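(* Let $K$ be a splitting field of $x^{m}-1$. Then the cyclotomic Temperley-Lieb algebra of type $D$, $\mathrm{CTL}(D)_{m,n}$, over $K$ is a cellular algebra with cell datum $(\Lambda_{m,n},M,C,i)$, where $\Lambda_{m,n}$, $M$, $C$ and $i$ are the explicit poset, indexing sets, basis elements and involution described in the context.
   Context: **Standing data.** $K$ is a field, $n\ge 4$ and $m\ge 1$ are integers, and $\delta_0,\dots,\delta_{m-1}\in K$ satisfy $\delta_i\delta_0=\delta_i$ for $1\le i\le m-1$. **$m$-decorated tangles.** An $m$-decorated tangle of type $n$ is a crossing-free diagram in a rectangle (up to isotopy fixing the frame) consisting of $n$ arcs joining in pairs $n$ vertices on the top edge and $n$ vertices on the bottom edge (each row numbered $1,\dots,n$ from the left), together with finitely many closed cycles. Each arc and closed cycle is assigned a pair $[r,s]$, i.e. it carries $r$ dots and $s$ blobs, with $0\le r\le m-1$, $s\ge 0$, and $s=0$ if the arc or cycle is not exposed to the left face of the frame (i.e. it is separated from the left face by another arc). An arc is horizontal, written $\{a<b\}$ ($a$ its left endpoint, $b$ its right endpoint), if it joins two vertices of the same edge; it is vertical, written $\{a,b\}$, if it joins top vertex $a$ to bottom vertex $b$. On a horizontal arc one distinguishes left dots and right dots (sitting at the left/right endpoint); in a tangle all dots on horizontal arcs are taken to be left dots. **Composition.** $G_1\diamond G_2$ is obtained by placing $G_1$ above $G_2$ and identifying the bottom vertices of $G_1$ with the top vertices of $G_2$; dots and blobs are collected by the rules: blobs and dots interchange freely; blobs move freely between arcs sharing an endpoint and their numbers add;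 a left dot of a horizontal arc equals $m-1$ right dots of it and vice versa; a dot may be moved through a common endpoint $v$ of two arcs, becoming a left (resp. right) dot of a horizontal arc if $v$ is its left (resp. right) endpoint; a dot on a vertical arc may sit at either end of it; numbers of dots add and are reduced modulo $m$. The number of dots of a closed cycle formed in this process is the number obtained when all its dots are moved to be left dots at the leftmost vertex of the cycle. **Admissible diagrams.** An $m$-cyclotomic $D$-admissible diagram of type $n$ is an $m$-decorated tangle of type $n$ with at most one blob on each arc or closed cycle satisfying one of: (type I) it contains exactly one closed cycle, carrying one blob and no dots, there are no other blobs, and there is at least one horizontal arc; (type II) it contains no closed cycles and the total number of blobs is even. **The algebra.** $\mathrm{CTL}(D)_{m,n}$ has $K$-basis the $m$-cyclotomic $D$-admissible diagrams of type $n$; the product of two diagrams is $G_1\diamond G_2$ reduced by the relations: (1) a closed cycle with $[i,0]$ is removed and replaced by the scalar $\delta_i$ ($0\le i\le m-1$); (2) two blobs on the same arc or closed cycle cancel; (3) in the presence of a closed cycle with $[0,1]$, any other arc or closed cycle loses its blob (keeping its dots); (4) a closed cycle with $[i,1]$, $i\ge 1$, equals $\delta_i$ times a closed cycle with $[0,1]$. **Dangles.** An $m$-cyclotomic $D$-admissible dangle of type $(n,k)$ is a crossing-free half-diagram with vertices $1,\dots,n$, $k$ horizontal arcs, $n-2k$ vertical lines at the remaining vertices, and possibly closed cycles. Each horizontal arc and closed cycle carries at most $m-1$ dots, and vertical lines carry no dots. Only the leftmost vertical line and those outermost horizontal arcs (and closed cycles) lying to the left of the leftmost vertical line may carry a blob,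 at most one each. It must satisfy one of: (type I) there is exactly one closed cycle, carrying one blob and no dots, there are no other blobs, and there is at least one horizontal arc; (type II) there are no closed cycles, and the total number of blobs is even if $k\ne n/2$. $D^{+}(n,k)$ ($1\le k\le[n/2]$) and $D^{-}(n,k)$ ($0\le k\le [n/2]$) denote the sets of type I and type II dangles of type $(n,k)$. For $k=n/2$, $D_1^-(n,\frac n2)$ and $D_2^-(n,\frac n2)$ are the subsets of $D^-(n,\frac n2)$ with an even, respectively odd, total number of blobs. **Tensor notation.** $G_{m,r}$ is the commutative algebra generated by $\mathcal T_1,\dots,\mathcal T_r$ with $\mathcal T_j^m=1$ (the group algebra of $(\mathbb Z/m\mathbb Z)^r$; $G_{m,0}=K$). For $v_1,v_2$ both in $D^+(n,k)$, or both in $D^-(n,k)$ with $k\neq n/2$, or both in the same $D^-_j(n,\frac n2)$, and $\omega=\mathcal T_1^{m_1}\cdots\mathcal T_{n-2k}^{m_{n-2k}}$ with $0\le m_j\le m-1$, $v_1\otimes v_2\otimes\omega$ denotes the admissible diagram with upper part $v_1$ and lower part $v_2$ (reflected), the vertical lines joined in order without crossings, the $j$-th vertical arc carrying $m_j$ dots. For type I, one of the two closed cycles is omitted; for type II, two blobs meeting on the leftmost vertical arc cancel. Extend linearly in $\omega\in G_{m,n-2k}$. **Cell datum.** Write $x^m-1=\prod_{j=1}^m(x-\xi_j)$ in $K[x]$. For $r\ge1$, $\Lambda(m,r)=\{(i_1,\dots,i_r): 1\le i_j\le m\}$ with $I\preceq J$ iff componentwise $\le$; $\Lambda(m,0)=\{\emptyset\}$.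 For $I=(i_1,\dots,i_r)$, $C_{1,1}^I=\prod_{j=1}^r\prod_{l=i_j+1}^m(\mathcal T_j-\xi_l)\in G_{m,r}$ (empty products are $1$). If $n$ is odd, $\Lambda_{m,n}$ is the set of symbols $(\tilde k,I)^+$ ($1\le\tilde k\le[\frac n2]$, $I\in\Lambda(m,n-2\tilde k)$) and $(k,J)^-$ ($0\le k\le[\frac n2]$, $J\in\Lambda(m,n-2k)$). If $n$ is even it is the set of $(\tilde k,I)^+$ ($1\le\tilde k\le\frac n2$), $(k,J)^-$ ($0\le k\le\frac n2-1$), with $I,J$ in the same respective sets, and two extra symbols $(\frac n2,\emptyset)^-_1,(\frac n2,\emptyset)^-_2$. The partial order $\leqq$ is: $(\tilde k,I)^+\leqq(k,J)^-$ always; $(\tilde k_1,I_1)^+\leqq(\tilde k_2,I_2)^+$ if $\tilde k_1>\tilde k_2$, or if $\tilde k_1=\tilde k_2$ and $I_1\preceq I_2$; $(k_1,J_1)^-\leqq(k_2,J_2)^-$ if $k_1>k_2$, or if $k_1=k_2$ and $J_1\preceq J_2$; and, for $n$ even, $(\tilde k,I)^+\leqq(\frac n2,\emptyset)^-_j\leqq(k,J)^-$ for $j=1,2$ (with the two symbols $(\frac n2,\emptyset)^-_1,(\frac n2,\emptyset)^-_2$ incomparable to each other). $M((\tilde k,I)^+)=\{(v,I): v\in D^+(n,\tilde k)\}$, $M((k,J)^-)=\{(v,J):v\in D^-(n,k)\}$, $M((\frac n2,\emptyset)^-_j)=\{(v,\emptyset): v\in D^-_j(n,\frac n2)\}$.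 For $\lambda\in\Lambda_{m,n}$ with second entry $I$ (possibly $\emptyset$), $C^{\lambda}_{(v_1,I),(v_2,I)}=v_1\otimes v_2\otimes C^I_{1,1}$. The map $i$ is the $K$-linear map sending each diagram to its top-bottom inversion. **Cellular algebra (Graham–Lehrer).** An associative $K$-algebra $A$ is cellular with cell datum $(\Lambda,M,C,i)$ if: (C1) $\Lambda$ is a finite poset, each $M(\lambda)$ is a finite set, and the $C^\lambda_{S,T}$ ($\lambda\in\Lambda$, $S,T\in M(\lambda)$) form a $K$-basis of $A$; (C2) $i$ is a $K$-linear anti-automorphism with $i^2=\mathrm{id}$ and $i(C^\lambda_{S,T})=C^\lambda_{T,S}$; (C3) for $a\in A$, $aC^\lambda_{S,T}=\sum_{U\in M(\lambda)}r_a(U,S)C^\lambda_{U,T}+r'$ where $r'$ is a linear combination of basis elements with upper index strictly smaller than $\lambda$, and $r_a(U,S)\in K$ does not depend on $T$. *)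

theory Defs
  imports
    "HOL-Library.Poly_Mapping"
    "HOL-Library.Multiset"
    "HOL-Computational_Algebra.Polynomial"
begin

section \<open>Cellular algebras\<close>

text \<open>
  The algebra lives on a subspace \<open>A\<close> of a vector space, because the algebras of interest
  depend on natural-number parameters.
\<close>

locale associative_algebra = vector_space scale
  for scale :: "'k::field \<Rightarrow> 'a::ab_group_add \<Rightarrow> 'a" +
  fixes A :: "'a set" and mult :: "'a \<Rightarrow> 'a \<Rightarrow> 'a"
  assumes subspace_carrier: "subspace A"
    and mult_closed: "x \<in> A \<Longrightarrow> y \<in> A \<Longrightarrow> mult x y \<in> A"
    and mult_add_left: "x \<in> A \<Longrightarrow> y \<in> A \<Longrightarrow> z \<in> A \<Longrightarrow> mult (x + y) z = mult x z + mult y z"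
    and mult_add_right: "x \<in> A \<Longrightarrow> y \<in> A \<Longrightarrow> z \<in> A \<Longrightarrow> mult x (y + z) = mult x y + mult x z"
    and mult_scale_left: "x \<in> A \<Longrightarrow> y \<in> A \<Longrightarrow> mult (scale c x) y = scale c (mult x y)"
    and mult_scale_right: "x \<in> A \<Longrightarrow> y \<in> A \<Longrightarrow> mult x (scale c y) = scale c (mult x y)"
    and mult_assoc: "x \<in> A \<Longrightarrow> y \<in> A \<Longrightarrow> z \<in> A \<Longrightarrow> mult (mult x y) z = mult x (mult y z)"
    and unit_exists: "\<exists>e\<in>A. \<forall>x\<in>A. mult e x = x \<and> mult x e = x"

locale cellular_algebra = associative_algebra scale A mult
  for scale :: "'k::field \<Rightarrow> 'a::ab_group_add \<Rightarrow> 'a" and A mult +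
  fixes \<Lambda> :: "'l set" and le :: "'l \<Rightarrow> 'l \<Rightarrow> bool"
    and M :: "'l \<Rightarrow> 's set" and C :: "'l \<Rightarrow> 's \<Rightarrow> 's \<Rightarrow> 'a" and inv :: "'a \<Rightarrow> 'a"
  assumes
    \<comment> \<open>(C1)\<close>
        finite_poset: "finite \<Lambda>"
    and poset: "partial_order_on \<Lambda> {(l, l'). l \<in> \<Lambda> \<and> l' \<in> \<Lambda> \<and> le l l'}"
    and finite_M: "l \<in> \<Lambda> \<Longrightarrow> finite (M l)"
    and basis_inj: "inj_on (\<lambda>(l, S, T). C l S T) (SIGMA l:\<Lambda>. M l \<times> M l)"
    and basis_independent: "independent ((\<lambda>(l, S, T). C l S T) ` (SIGMA l:\<Lambda>. M l \<times> M l))"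
    and basis_span: "span ((\<lambda>(l, S, T). C l S T) ` (SIGMA l:\<Lambda>. M l \<times> M l)) = A"
    \<comment> \<open>(C2)\<close>
    and inv_closed: "x \<in> A \<Longrightarrow> inv x \<in> A"
    and inv_add: "x \<in> A \<Longrightarrow> y \<in> A \<Longrightarrow> inv (x + y) = inv x + inv y"
    and inv_scale: "x \<in> A \<Longrightarrow> inv (scale c x) = scale c (inv x)"
    and inv_mult: "x \<in> A \<Longrightarrow> y \<in> A \<Longrightarrow> inv (mult x y) = mult (inv y) (inv x)"
    and inv_inv: "x \<in> A \<Longrightarrow> inv (inv x) = x"
    and inv_C: "l \<in> \<Lambda> \<Longrightarrow> S \<in> M l \<Longrightarrow> T \<in> M l \<Longrightarrow> inv (C l S T) = C l T S"
    \<comment> \<open>(C3)\<close>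
    and mult_C: "a \<in> A \<Longrightarrow> l \<in> \<Lambda> \<Longrightarrow>
      \<exists>r :: 's \<Rightarrow> 's \<Rightarrow> 'k. \<forall>S\<in>M l. \<forall>T\<in>M l.
        mult a (C l S T) - (\<Sum>U\<in>M l. scale (r U S) (C l U T))
          \<in> span {C l' U V | l' U V. l' \<in> \<Lambda> \<and> le l' l \<and> l' \<noteq> l \<and> U \<in> M l' \<and> V \<in> M l'}"


section \<open>Decorated tangles\<close>

text \<open>
  A crossing-free diagram is recorded, up to isotopy, by the pairs of vertices its arcs join.
  A decorated arc consists of its set of end vertices, its number of dots and its number of blobs.
  Of a closed cycle only the pair (dots, blobs) is kept; its position plays no role in the
  relations below, and a cycle with a blob must lie in the region next to the left face.
\<close>

datatype 'v arc = Arc (ends: "'v set") (dots: nat) (blobs: nat)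

datatype 'v diagram = Diagram (arcs: "'v arc set") (cycles: "(nat \<times> nat) multiset")

text \<open>
  Vertices are pairs (row, position). A tangle has row \<open>0\<close> on top and row \<open>1\<close> at the bottom, with
  positions \<open>1, \<dots>, n\<close> in each row.
\<close>

type_synonym vertex = "nat \<times> nat"
type_synonym tangle = "vertex diagram"

definition vertices :: "nat \<Rightarrow> vertex set" where
  "vertices n = {0, 1} \<times> {1..n}"

definition horizontal :: "vertex arc \<Rightarrow> bool" where
  "horizontal a \<longleftrightarrow> (\<exists>r. \<forall>v\<in>ends a. fst v = r)"

text \<open>
  Position on the frame, read clockwise from the left face: the top row from left to right and
  then the bottom row from right to left.
\<close>

definition frame_pos :: "nat \<Rightarrow> vertex \<Rightarrow> nat" where
  "frame_pos n v = (if fst v = 0 then snd v else 2 * n + 1 - snd v)"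

definition lo :: "('v \<Rightarrow> nat) \<Rightarrow> 'v arc \<Rightarrow> nat" where
  "lo pos a = Min (pos ` ends a)"

definition hi :: "('v \<Rightarrow> nat) \<Rightarrow> 'v arc \<Rightarrow> nat" where
  "hi pos a = Max (pos ` ends a)"

definition crosses :: "('v \<Rightarrow> nat) \<Rightarrow> 'v arc \<Rightarrow> 'v arc \<Rightarrow> bool" where
  "crosses pos a b \<longleftrightarrow> lo pos a < lo pos b \<and> lo pos b < hi pos a \<and> hi pos a < hi pos b"

text \<open>
  As the frame positions start and end at the left face, \<open>encloses (frame_pos n) b a\<close> says that
  \<open>b\<close> separates \<open>a\<close> from the left face.
\<close>

definition encloses :: "('v \<Rightarrow> nat) \<Rightarrow> 'v arc \<Rightarrow> 'v arc \<Rightarrow> bool" where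
  "encloses pos b a \<longleftrightarrow> lo pos b < lo pos a \<and> hi pos a < hi pos b"

definition exposed :: "nat \<Rightarrow> tangle \<Rightarrow> vertex arc \<Rightarrow> bool" where
  "exposed n G a \<longleftrightarrow> \<not> (\<exists>b\<in>arcs G. encloses (frame_pos n) b a)"

text \<open>The dots of a horizontal arc are left dots.\<close>

definition decorated_tangle :: "nat \<Rightarrow> nat \<Rightarrow> tangle \<Rightarrow> bool" where
  "decorated_tangle m n G \<longleftrightarrow>
     (\<forall>a\<in>arcs G. ends a \<subseteq> vertices n \<and> card (ends a) = 2) \<and>
     (\<forall>v\<in>vertices n. \<exists>!a. a \<in> arcs G \<and> v \<in> ends a) \<and>
     (\<forall>a\<in>arcs G. \<forall>b\<in>arcs G. \<not> crosses (frame_pos n) a b) \<and>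
     (\<forall>a\<in>arcs G. dots a < m \<and> (\<not> exposed n G a \<longrightarrow> blobs a = 0)) \<and>
     (\<forall>(r, s)\<in>#cycles G. r < m)"

definition type_I :: "tangle \<Rightarrow> bool" where
  "type_I G \<longleftrightarrow> cycles G = {#(0, 1)#} \<and> (\<forall>a\<in>arcs G. blobs a = 0) \<and> (\<exists>a\<in>arcs G. horizontal a)"

definition type_II :: "tangle \<Rightarrow> bool" where
  "type_II G \<longleftrightarrow> cycles G = {#} \<and> even (\<Sum>a\<in>arcs G. blobs a)"

definition admissible :: "nat \<Rightarrow> nat \<Rightarrow> tangle \<Rightarrow> bool" where
  "admissible m n G \<longleftrightarrow> decorated_tangle m n G \<and>
     (\<forall>a\<in>arcs G. blobs a \<le> 1) \<and> (\<forall>(r, s)\<in>#cycles G. s \<le> 1) \<and> (type_I G \<or> type_II G)"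


section \<open>Composition\<close>

text \<open>
  When \<open>G1\<close> is stacked on \<open>G2\<close>, the rows are \<open>0, 1, 2\<close>, row \<open>1\<close> being the common one. A piece is an
  arc tagged with the tangle it comes from (\<open>0\<close> for \<open>G1\<close>, \<open>1\<close> for \<open>G2\<close>); the tag is needed since
  both tangles may have an arc with the same ends in row \<open>1\<close>.
\<close>

type_synonym piece = "nat \<times> vertex arc"

definition stack :: "tangle \<Rightarrow> tangle \<Rightarrow> piece set" where
  "stack G1 G2 = {0} \<times> arcs G1 \<union> {1} \<times> arcs G2"

definition points :: "piece \<Rightarrow> vertex set" where
  "points p = (\<lambda>(r, i). (fst p + r, i)) ` ends (snd p)"

definition strands :: "piece set \<Rightarrow> piece set set" where
  "strands P = P // ({(p, q). p \<in> P \<and> q \<in> P \<and> points p \<inter> points q \<noteq> {}}\<^sup>+)"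

definition free_ends :: "piece set \<Rightarrow> vertex set" where
  "free_ends S = {v \<in> \<Union>(points ` S). fst v \<noteq> 1}"

text \<open>
  A site \<open>(p, v)\<close> is the end \<open>v\<close> of the piece \<open>p\<close>. The relation \<open>slides m S s c t\<close> says that one dot
  at \<open>s\<close> amounts to \<open>c\<close> dots at \<open>t\<close>.
\<close>

inductive slides :: "nat \<Rightarrow> piece set \<Rightarrow> piece \<times> vertex \<Rightarrow> nat \<Rightarrow> piece \<times> vertex \<Rightarrow> bool"
  for m :: nat and S :: "piece set" where
  stay: "p \<in> S \<Longrightarrow> v \<in> points p \<Longrightarrow> slides m S (p, v) 1 (p, v)"
| common_end: "slides m S s c (p, v) \<Longrightarrow> q \<in> S \<Longrightarrow> v \<in> points q \<Longrightarrow> slides m S s c (q, v)"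
| along_vertical: "slides m S s c (p, v) \<Longrightarrow> points p = {v, w} \<Longrightarrow> fst v \<noteq> fst w \<Longrightarrow>
    slides m S s c (p, w)"
| along_horizontal: "slides m S s c (p, v) \<Longrightarrow> points p = {v, w} \<Longrightarrow> fst v = fst w \<Longrightarrow> v \<noteq> w \<Longrightarrow>
    slides m S s ((m - 1) * c) (p, w)"

text \<open>
  The point at which dots are collected, namely the leftmost point in the topmost row: the left
  endpoint of a horizontal arc, the top endpoint of a vertical arc, and the leftmost vertex of a
  closed cycle formed in a composition, all of whose vertices lie in row \<open>1\<close>.
\<close>

definition base_point :: "vertex set \<Rightarrow> vertex" where
  "base_point V = (let r = Min (fst ` V) in (r, Min {i. (r, i) \<in> V}))"

definition strand_base :: "piece set \<Rightarrow> vertex" where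
  "strand_base S = base_point (if free_ends S = {} then \<Union>(points ` S) else free_ends S)"

text \<open>For a strand of two tangles, all \<open>c\<close> eligible for the choice below agree modulo \<open>m\<close>.\<close>

definition strand_dots :: "nat \<Rightarrow> piece set \<Rightarrow> nat" where
  "strand_dots m S =
     (\<Sum>p\<in>S. (SOME c. \<exists>q. slides m S (p, base_point (points p)) c (q, strand_base S)) * dots (snd p))
       mod m"

definition strand_blobs :: "piece set \<Rightarrow> nat" where
  "strand_blobs S = (\<Sum>p\<in>S. blobs (snd p))"

definition compose :: "nat \<Rightarrow> tangle \<Rightarrow> tangle \<Rightarrow> tangle" where
  "compose m G1 G2 = Diagram
     {Arc ((\<lambda>(r, i). (r div 2, i)) ` free_ends S) (strand_dots m S) (strand_blobs S) | S.
        S \<in> strands (stack G1 G2) \<and> free_ends S \<noteq> {}}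
     (cycles G1 + cycles G2 +
      image_mset (\<lambda>S. (strand_dots m S, strand_blobs S))
        (mset_set {S \<in> strands (stack G1 G2). free_ends S = {}}))"


section \<open>The algebra\<close>

text \<open>The relations, as reduction steps on tangles with a scalar coefficient.\<close>

inductive reduces :: "nat \<Rightarrow> (nat \<Rightarrow> 'k::field) \<Rightarrow> 'k \<times> tangle \<Rightarrow> 'k \<times> tangle \<Rightarrow> bool"
  for m :: nat and \<delta> :: "nat \<Rightarrow> 'k" where
  remove_cycle: "i < m \<Longrightarrow>
    reduces m \<delta> (c, Diagram A (add_mset (i, 0) Z)) (c * \<delta> i, Diagram A Z)"
| cancel_blobs_arc: "Arc e r (s + 2) \<notin> A \<Longrightarrow>
    reduces m \<delta> (c, Diagram (insert (Arc e r (s + 2)) A) Z) (c, Diagram (insert (Arc e r s) A) Z)"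
| cancel_blobs_cycle:
    "reduces m \<delta> (c, Diagram A (add_mset (r, s + 2) Z)) (c, Diagram A (add_mset (r, s) Z))"
| lose_blob_arc: "(0, 1) \<in># Z \<Longrightarrow> Arc e r (s + 1) \<notin> A \<Longrightarrow>
    reduces m \<delta> (c, Diagram (insert (Arc e r (s + 1)) A) Z) (c, Diagram (insert (Arc e r s) A) Z)"
| lose_blob_cycle: "(0, 1) \<in># Z \<Longrightarrow>
    reduces m \<delta> (c, Diagram A (add_mset (r, s + 1) Z)) (c, Diagram A (add_mset (r, s) Z))"
| lose_dots_cycle: "1 \<le> i \<Longrightarrow> i < m \<Longrightarrow>
    reduces m \<delta> (c, Diagram A (add_mset (i, 1) Z)) (c * \<delta> i, Diagram A (add_mset (0, 1) Z))"

definition scale_pm :: "'k::field \<Rightarrow> ('b \<Rightarrow>\<^sub>0 'k) \<Rightarrow> ('b \<Rightarrow>\<^sub>0 'k)" where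
  "scale_pm c f = Poly_Mapping.map (\<lambda>x. c * x) f"

definition CTL :: "nat \<Rightarrow> nat \<Rightarrow> (tangle \<Rightarrow>\<^sub>0 'k::field) set" where
  "CTL m n = {f. \<forall>G\<in>Poly_Mapping.keys f. admissible m n G}"

definition diagram_mult ::
    "nat \<Rightarrow> nat \<Rightarrow> (nat \<Rightarrow> 'k::field) \<Rightarrow> tangle \<Rightarrow> tangle \<Rightarrow> (tangle \<Rightarrow>\<^sub>0 'k)" where
  "diagram_mult m n \<delta> G1 G2 =
     (THE x. \<exists>c G. (reduces m \<delta>)\<^sup>*\<^sup>* (1, compose m G1 G2) (c, G) \<and> admissible m n G \<and>
        x = Poly_Mapping.single G c)"

definition CTL_mult ::
    "nat \<Rightarrow> nat \<Rightarrow> (nat \<Rightarrow> 'k::field) \<Rightarrow> (tangle \<Rightarrow>\<^sub>0 'k) \<Rightarrow> (tangle \<Rightarrow>\<^sub>0 'k) \<Rightarrow> (tangle \<Rightarrow>\<^sub>0 'k)" where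
  "CTL_mult m n \<delta> f g =
     (\<Sum>G1\<in>Poly_Mapping.keys f. \<Sum>G2\<in>Poly_Mapping.keys g.
        scale_pm (Poly_Mapping.lookup f G1 * Poly_Mapping.lookup g G2) (diagram_mult m n \<delta> G1 G2))"

definition flip :: "tangle \<Rightarrow> tangle" where
  "flip G = Diagram ((\<lambda>a. Arc ((\<lambda>(r, i). (1 - r, i)) ` ends a) (dots a) (blobs a)) ` arcs G) (cycles G)"

definition CTL_inv :: "(tangle \<Rightarrow>\<^sub>0 'k::field) \<Rightarrow> (tangle \<Rightarrow>\<^sub>0 'k)" where
  "CTL_inv f =
     (\<Sum>G\<in>Poly_Mapping.keys f. Poly_Mapping.single (flip G) (Poly_Mapping.lookup f G))"


section \<open>Dangles\<close>

text \<open>A dangle has vertices \<open>1, \<dots>, n\<close>; a vertical line at \<open>v\<close> is an arc with \<open>{v}\<close> as its set of ends.\<close>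

type_synonym dangle = "nat diagram"

definition is_line :: "'v arc \<Rightarrow> bool" where
  "is_line a \<longleftrightarrow> card (ends a) = 1"

text \<open>
  The leftmost vertical line, and the outermost horizontal arcs to the left of it. If there are no
  vertical lines these are all outermost arcs.
\<close>

definition blob_position :: "dangle \<Rightarrow> nat arc \<Rightarrow> bool" where
  "blob_position v a \<longleftrightarrow>
     \<not> (\<exists>b\<in>arcs v. encloses id b a) \<and> \<not> (\<exists>b\<in>arcs v. is_line b \<and> lo id b < lo id a)"

definition decorated_dangle :: "nat \<Rightarrow> nat \<Rightarrow> nat \<Rightarrow> dangle \<Rightarrow> bool" where
  "decorated_dangle m n k v \<longleftrightarrow>
     (\<forall>a\<in>arcs v. ends a \<subseteq> {1..n} \<and> card (ends a) \<in> {1, 2}) \<and>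
     (\<forall>i\<in>{1..n}. \<exists>!a. a \<in> arcs v \<and> i \<in> ends a) \<and>
     card {a \<in> arcs v. \<not> is_line a} = k \<and>
     (\<forall>a\<in>arcs v. \<forall>b\<in>arcs v. \<not> crosses id a b \<and> (is_line a \<longrightarrow> \<not> encloses id b a)) \<and>
     (\<forall>a\<in>arcs v. dots a < m \<and> (is_line a \<longrightarrow> dots a = 0)) \<and>
     (\<forall>a\<in>arcs v. blobs a \<le> 1 \<and> (\<not> blob_position v a \<longrightarrow> blobs a = 0)) \<and>
     (\<forall>(r, s)\<in>#cycles v. r < m \<and> s \<le> 1)"

definition Dplus :: "nat \<Rightarrow> nat \<Rightarrow> nat \<Rightarrow> dangle set" where
  "Dplus m n k = {v. decorated_dangle m n k v \<and> cycles v = {#(0, 1)#} \<and>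
     (\<forall>a\<in>arcs v. blobs a = 0) \<and> (\<exists>a\<in>arcs v. \<not> is_line a)}"

definition Dminus :: "nat \<Rightarrow> nat \<Rightarrow> nat \<Rightarrow> dangle set" where
  "Dminus m n k = {v. decorated_dangle m n k v \<and> cycles v = {#} \<and>
     (2 * k \<noteq> n \<longrightarrow> even (\<Sum>a\<in>arcs v. blobs a))}"

definition Dminus_half :: "nat \<Rightarrow> nat \<Rightarrow> nat \<Rightarrow> dangle set" where
  "Dminus_half m n j =
     {v \<in> Dminus m n (n div 2).
        if j = 1 then even (\<Sum>a\<in>arcs v. blobs a) else odd (\<Sum>a\<in>arcs v. blobs a)}"


section \<open>Tensor notation\<close>

definition lines :: "dangle \<Rightarrow> nat list" where
  "lines v = sorted_list_of_set {i. \<exists>a\<in>arcs v. ends a = {i}}"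

text \<open>
  The diagram with upper part \<open>v1\<close>, lower part \<open>v2\<close> and \<open>e j mod m\<close> dots on the \<open>j\<close>-th vertical arc,
  counted from \<open>0\<close>. Of the two closed cycles of a pair of type I dangles, the one of \<open>v1\<close> is kept.
\<close>

definition glue :: "nat \<Rightarrow> dangle \<Rightarrow> dangle \<Rightarrow> (nat \<Rightarrow>\<^sub>0 nat) \<Rightarrow> tangle" where
  "glue m v1 v2 e = Diagram
     ({Arc (Pair 0 ` ends a) (dots a) (blobs a) | a. a \<in> arcs v1 \<and> \<not> is_line a} \<union>
      {Arc (Pair 1 ` ends a) (dots a) (blobs a) | a. a \<in> arcs v2 \<and> \<not> is_line a} \<union>
      {Arc {(0, lines v1 ! j), (1, lines v2 ! j)} (Poly_Mapping.lookup e j mod m)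
           ((blobs a + blobs b) mod 2) | j a b.
         j < length (lines v1) \<and> a \<in> arcs v1 \<and> ends a = {lines v1 ! j} \<and>
         b \<in> arcs v2 \<and> ends b = {lines v2 ! j}})
     (cycles v1)"

text \<open>
  An element of the group algebra \<open>G\<^bsub>m,r\<^esub>\<close> is represented by a polynomial over \<open>K\<close> in the
  generators. As \<open>tensor\<close> reduces all exponents modulo \<open>m\<close>, it depends only on the class of the
  polynomial modulo \<open>T\<^sub>j\<^sup>m = 1\<close>. The variable \<open>gen j\<close> stands for the generator
  with index \<open>j + 1\<close>.
\<close>

type_synonym 'k gpoly = "(nat \<Rightarrow>\<^sub>0 nat) \<Rightarrow>\<^sub>0 'k"

definition gen :: "nat \<Rightarrow> 'k::field gpoly" where
  "gen j = Poly_Mapping.single (Poly_Mapping.single j 1) 1"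

definition const :: "'k::field \<Rightarrow> 'k gpoly" where
  "const c = Poly_Mapping.single 0 c"

definition tensor :: "nat \<Rightarrow> dangle \<Rightarrow> dangle \<Rightarrow> 'k::field gpoly \<Rightarrow> (tangle \<Rightarrow>\<^sub>0 'k)" where
  "tensor m v1 v2 w =
     (\<Sum>e\<in>Poly_Mapping.keys w. Poly_Mapping.single (glue m v1 v2 e) (Poly_Mapping.lookup w e))"


section \<open>The cell datum\<close>

definition multi_indices :: "nat \<Rightarrow> nat \<Rightarrow> nat list set" where
  "multi_indices m r = {I. length I = r \<and> set I \<subseteq> {1..m}}"

text \<open>The list entry \<open>I ! j\<close> is the component of \<open>I\<close> with index \<open>j + 1\<close>, matching \<open>gen j\<close>.\<close>

definition C11 :: "nat \<Rightarrow> (nat \<Rightarrow> 'k::field) \<Rightarrow> nat list \<Rightarrow> 'k gpoly" where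
  "C11 m \<xi> I = (\<Prod>j<length I. \<Prod>l\<in>{I ! j + 1..m}. gen j - const (\<xi> l))"

text \<open>\<open>Plus k I\<close>, \<open>Minus k I\<close> and \<open>Half j\<close> are the symbols \<open>(k, I)\<^sup>+\<close>, \<open>(k, I)\<^sup>-\<close> and \<open>(n/2, {})\<^sub>j\<^sup>-\<close>.\<close>

datatype label = Plus nat "nat list" | Minus nat "nat list" | Half nat

definition labels :: "nat \<Rightarrow> nat \<Rightarrow> label set" where
  "labels m n =
     {Plus k I | k I. 1 \<le> k \<and> k \<le> n div 2 \<and> I \<in> multi_indices m (n - 2 * k)} \<union>
     (if odd n
      then {Minus k J | k J. k \<le> n div 2 \<and> J \<in> multi_indices m (n - 2 * k)}
      else {Minus k J | k J. k \<le> n div 2 - 1 \<and> J \<in> multi_indices m (n - 2 * k)} \<union> {Half 1, Half 2})"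

fun label_le :: "label \<Rightarrow> label \<Rightarrow> bool" where
  "label_le (Plus k1 I1) (Plus k2 I2) \<longleftrightarrow> k1 > k2 \<or> k1 = k2 \<and> list_all2 (\<le>) I1 I2"
| "label_le (Minus k1 J1) (Minus k2 J2) \<longleftrightarrow> k1 > k2 \<or> k1 = k2 \<and> list_all2 (\<le>) J1 J2"
| "label_le (Half i) (Half j) \<longleftrightarrow> i = j"
| "label_le (Plus _ _) (Minus _ _) \<longleftrightarrow> True"
| "label_le (Plus _ _) (Half _) \<longleftrightarrow> True"
| "label_le (Half _) (Minus _ _) \<longleftrightarrow> True"
| "label_le _ _ \<longleftrightarrow> False"

fun cell_index :: "nat \<Rightarrow> nat \<Rightarrow> label \<Rightarrow> (dangle \<times> nat list) set" where
  "cell_index m n (Plus k I) = {(v, I) | v. v \<in> Dplus m n k}"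
| "cell_index m n (Minus k J) = {(v, J) | v. v \<in> Dminus m n k}"
| "cell_index m n (Half j) = {(v, []) | v. v \<in> Dminus_half m n j}"

fun label_index :: "label \<Rightarrow> nat list" where
  "label_index (Plus k I) = I"
| "label_index (Minus k J) = J"
| "label_index (Half j) = []"

definition cell_basis ::
    "nat \<Rightarrow> (nat \<Rightarrow> 'k::field) \<Rightarrow> label \<Rightarrow> dangle \<times> nat list \<Rightarrow> dangle \<times> nat list \<Rightarrow> (tangle \<Rightarrow>\<^sub>0 'k)"
  where
  "cell_basis m \<xi> l S T = tensor m (fst S) (fst T) (C11 m \<xi> (label_index l))"

end

theory Submission
  imports Defs
begin

text \<open>
  The theorem rests on three facts: composition of tangles is associative, reduction by the relations
  is confluent, and left multiplication by a diagram changes only the upper half of a diagram.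

  \<^item> Composition. A strand of a stack of tangles is a connected component of its pieces, that is, a
    minimal nonempty set of pieces that is closed under sharing a vertex. Let \<open>U\<close> be the vertex set
    of a set of pieces closed under sharing a vertex, and give a vertex \<open>v\<close> the sign \<open>dir U v\<close>,
    which is \<open>1\<close> or \<open>- 1\<close> according to the parity of the number of points of \<open>U\<close> to the left
    of \<open>v\<close> in its row. Arcs do not cross, so an even number of points of \<open>U\<close> lies between the two
    ends of a piece, and the sign changes along horizontal arcs and is constant along vertical arcs.
    One dot at the left end of a horizontal arc amounts to \<open>m - 1\<close>, that is to \<open>- 1\<close> modulo \<open>m\<close>,
    dots at its right end. Hence the number of dots of a strand is the sum of the dots of its pieces,
    each multiplied by a sign (\<open>strand_dots_weight\<close>); no path along the strand is involved. The same
    parity count, with \<open>U\<close> taken from one strand and \<open>v\<close> from another one (\<open>colour_constant\<close>),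
    shows that composed arcs do not cross and that blobs stay exposed. The signed sum is defined for
    stacks of any height, and composing two adjacent layers does not change it (\<open>merge_layers\<close>);
    this gives associativity. Inversion of a stack preserves the signs, so it reverses products.

  \<^item> Reduction. Each step of the relations preserves the fully reduced tangle and the product of the
    scalar with an explicit value of the multiset of cycles (\<open>reduces_invariant\<close>); the equation
    \<open>\<delta> i * \<delta> 0 = \<delta> i\<close> enters when a cycle with dots meets a second cycle with a blob. Hence the
    product of two diagrams is a scalar times one diagram (\<open>diagram_mult_eq\<close>), and the algebra
    inherits associativity from composition.

  \<^item> Cells. Every diagram is glued from two dangles of the same kind (\<open>Adm_glue\<close>), in one way only
    (\<open>glue_injective\<close>). For a diagram \<open>G\<close> and a dangle \<open>v1\<close>, the product of \<open>G\<close> with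
    \<open>glue m v1 v2 e\<close> either has more horizontal arcs or is \<open>glue m v1' v2 (d + e)\<close>, where \<open>v1'\<close>,
    \<open>d\<close> and the closed cycles do not depend on \<open>v2\<close> and \<open>e\<close> (\<open>tangle_action\<close>). In the group algebra
    a generator maps \<open>C\<^sub>I\<close> to a multiple of \<open>C\<^sub>I\<close> plus \<open>C\<^sub>J\<close>, where \<open>J\<close> is \<open>I\<close> with one
    entry lowered by one (\<open>gen_C11\<close>), so the monomial \<open>d\<close> acts on \<open>C\<^sub>I\<close> by a scalar modulo lower
    indices (\<open>monomial_action\<close>). Products in which a closed cycle with a blob appears lie in the type I
    cells, which are below all others. This is the third axiom (\<open>cell_action\<close>). The cell elements
    span, since \<open>C\<^sub>I = 1\<close> for \<open>I = (m, \<dots>, m)\<close>, and there are at most as many of them as diagrams, so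
    they form a basis (\<open>spanning_family_basis\<close>).
\<close>

abbreviation "lookup \<equiv> Poly_Mapping.lookup"
abbreviation "keys \<equiv> Poly_Mapping.keys"
abbreviation "single \<equiv> Poly_Mapping.single"

section \<open>Strands as minimal closed sets\<close>

text \<open>
  Strands are studied through this closure property, which avoids paths of pieces.
\<close>

definition share_closed :: "piece set \<Rightarrow> piece set \<Rightarrow> bool" where
  "share_closed P X \<longleftrightarrow> (\<forall>p\<in>X. \<forall>q\<in>P. points p \<inter> points q \<noteq> {} \<longrightarrow> q \<in> X)"

lemma share_closedD:
  "share_closed P X \<Longrightarrow> p \<in> X \<Longrightarrow> q \<in> P \<Longrightarrow> v \<in> points p \<Longrightarrow> v \<in> points q \<Longrightarrow> q \<in> X"
  unfolding share_closed_def by blast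

text \<open>
  A minimal nonempty closed set is the class of any of its members, because the pieces reachable
  from one piece form a nonempty closed subset of it.
\<close>

lemma strands_iff:
  assumes ne: "\<And>p. p \<in> P \<Longrightarrow> points p \<noteq> {}"
  shows "X \<in> strands P \<longleftrightarrow> X \<noteq> {} \<and> X \<subseteq> P \<and> share_closed P X \<and>
    (\<forall>Y. Y \<subseteq> X \<longrightarrow> Y \<noteq> {} \<longrightarrow> share_closed P Y \<longrightarrow> Y = X)"
proof -
  define R where "R = {(p, q). p \<in> P \<and> q \<in> P \<and> points p \<inter> points q \<noteq> {}}"
  have R_sym: "sym R" unfolding R_def sym_def by auto
  have sub: "R\<^sup>+ \<subseteq> P \<times> P" by (rule trancl_subset_Sigma) (auto simp: R_def)
  have refl: "(p, p) \<in> R\<^sup>+" if "p \<in> P" for p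
    using ne[OF that] that by (auto simp: R_def)
  have E: "equiv P (R\<^sup>+)"
    by (rule equivI) (use sub refl sym_trancl[OF R_sym] in \<open>auto simp: refl_on_def\<close>)
  have closed_step: "q \<in> Y" if "share_closed P Y" "p \<in> Y" "(p, q) \<in> R\<^sup>+" for Y p q
    using that(3,2)
    by (induction rule: trancl_induct) (use that(1) in \<open>auto simp: R_def share_closed_def\<close>)
  have class_closed: "share_closed P (R\<^sup>+ `` {p})" if "p \<in> P" for p
    unfolding share_closed_def
  proof (intro ballI impI)
    fix q r assume q: "q \<in> R\<^sup>+ `` {p}" and r: "r \<in> P" and "points q \<inter> points r \<noteq> {}"
    hence "(q, r) \<in> R" using sub by (auto simp: R_def)
    thus "r \<in> R\<^sup>+ `` {p}" using q by (auto intro: trancl_into_trancl)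
  qed
  have st: "strands P = P // (R\<^sup>+)" unfolding strands_def R_def ..
  show ?thesis
  proof
    assume "X \<in> strands P"
    then obtain p where p: "p \<in> P" "X = R\<^sup>+ `` {p}" by (auto simp: st quotient_def)
    have min: "Y = X" if Y: "Y \<subseteq> X" "Y \<noteq> {}" "share_closed P Y" for Y
    proof -
      obtain q where q: "q \<in> Y" using Y by auto
      hence "(p, q) \<in> R\<^sup>+" using Y p by auto
      hence "(q, p) \<in> R\<^sup>+" using sym_trancl[OF R_sym] by (auto dest: symD)
      hence pY: "p \<in> Y" using closed_step[of Y q p] Y q by simp
      have "X \<subseteq> Y"
      proof
        fix x assume "x \<in> X"
        thus "x \<in> Y" using closed_step[of Y p x] Y p pY by simp
      qed
      thus ?thesis using Y by auto
    qed
    have "p \<in> X" using p(2) refl[OF p(1)] by simp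
    moreover have "X \<subseteq> P" using p(2) sub by blast
    moreover have "share_closed P X" using class_closed[OF p(1)] p(2) by simp
    ultimately show "X \<noteq> {} \<and> X \<subseteq> P \<and> share_closed P X \<and>
      (\<forall>Y. Y \<subseteq> X \<longrightarrow> Y \<noteq> {} \<longrightarrow> share_closed P Y \<longrightarrow> Y = X)"
      using min by blast
  next
    assume X: "X \<noteq> {} \<and> X \<subseteq> P \<and> share_closed P X \<and>
      (\<forall>Y. Y \<subseteq> X \<longrightarrow> Y \<noteq> {} \<longrightarrow> share_closed P Y \<longrightarrow> Y = X)"
    then obtain p where p: "p \<in> X" by auto
    have "R\<^sup>+ `` {p} \<subseteq> X"
    proof
      fix q assume "q \<in> R\<^sup>+ `` {p}"
      thus "q \<in> X" using closed_step[of X p q] X p by simp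
    qed
    moreover have "p \<in> R\<^sup>+ `` {p}" using refl[of p] X p by blast
    ultimately have "R\<^sup>+ `` {p} = X" using X class_closed p by blast
    thus "X \<in> strands P" using X p unfolding st quotient_def by blast
  qed
qed

lemma strands_cover:
  assumes "\<And>p. p \<in> P \<Longrightarrow> points p \<noteq> {}"
  shows "\<Union>(strands P) = P"
proof -
  define R where "R = {(p, q). p \<in> P \<and> q \<in> P \<and> points p \<inter> points q \<noteq> {}}"
  have sub: "R\<^sup>+ \<subseteq> P \<times> P" by (rule trancl_subset_Sigma) (auto simp: R_def)
  have refl: "(p, p) \<in> R\<^sup>+" if "p \<in> P" for p
    using assms[OF that] that by (auto simp: R_def)
  show ?thesis unfolding strands_def R_def[symmetric] quotient_def using sub refl by blast
qed

locale pieces =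
  fixes P :: "piece set"
  assumes points_ne: "p \<in> P \<Longrightarrow> points p \<noteq> {}"
begin

lemma strandD:
  assumes "X \<in> strands P"
  shows "X \<noteq> {}" "X \<subseteq> P" "share_closed P X"
  using assms strands_iff[of P] points_ne by auto

lemma strand_minimal:
  assumes "X \<in> strands P" "Y \<subseteq> X" "Y \<noteq> {}" "share_closed P Y"
  shows "Y = X"
  using assms strands_iff[of P] points_ne by auto

lemma strand_exists: "p \<in> P \<Longrightarrow> \<exists>X\<in>strands P. p \<in> X"
  using strands_cover[of P] points_ne by blast

lemma strand_closed: "X \<in> strands P \<Longrightarrow> p \<in> X \<Longrightarrow> q \<in> P \<Longrightarrow> v \<in> points p \<Longrightarrow> v \<in> points q \<Longrightarrow> q \<in> X"
  using share_closedD strandD(3) by blast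

lemma strand_unique:
  assumes X: "X \<in> strands P" and Y: "Y \<in> strands P" and p: "p \<in> X" "p \<in> Y"
  shows "X = Y"
proof -
  have c: "share_closed P (X \<inter> Y)" using strandD(3)[OF X] strandD(3)[OF Y] unfolding share_closed_def by blast
  have "X \<inter> Y = X" by (rule strand_minimal[OF X _ _ c]) (use p in auto)
  moreover have "X \<inter> Y = Y" by (rule strand_minimal[OF Y _ _ c]) (use p in auto)
  ultimately show ?thesis by simp
qed

lemma strand_unique_point:
  assumes X: "X \<in> strands P" and Y: "Y \<in> strands P" and p: "p \<in> X" "q \<in> Y" "v \<in> points p" "v \<in> points q"
  shows "X = Y"
proof -
  have "q \<in> X" using strand_closed[OF X p(1) _ p(3,4)] strandD(2)[OF Y] p by auto
  thus ?thesis using strand_unique X Y p by blast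
qed

lemma strandI:
  assumes "X \<subseteq> P" "X \<noteq> {}" "share_closed P X"
    and "\<And>Y. Y \<subseteq> X \<Longrightarrow> Y \<noteq> {} \<Longrightarrow> share_closed P Y \<Longrightarrow> X \<subseteq> Y"
  shows "X \<in> strands P"
  using assms strands_iff[of P X] points_ne by blast

text \<open>
  Connectedness as an induction principle: the pieces of the strand with property \<open>Q\<close>
  form a nonempty closed subset.
\<close>

lemma strand_induct:
  assumes X: "X \<in> strands P" and p: "p \<in> X" "Q p"
    and step: "\<And>p q v. p \<in> X \<Longrightarrow> q \<in> X \<Longrightarrow> Q p \<Longrightarrow> v \<in> points p \<Longrightarrow> v \<in> points q \<Longrightarrow> Q q"
    and q: "q \<in> X"
  shows "Q q"
proof -
  have "share_closed P {q \<in> X. Q q}"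
    unfolding share_closed_def using strand_closed[OF X] step by blast
  moreover have "{q \<in> X. Q q} \<noteq> {}" using p by blast
  ultimately have "{q \<in> X. Q q} = X" by (intro strand_minimal[OF X]) auto
  thus ?thesis using q by auto
qed

text \<open>
  Distinct strands are disjoint, so a family of strands that covers all pieces leaves no room for
  another one. Compositions are computed explicitly with this rule.
\<close>

lemma strands_eqI:
  assumes "\<X> \<subseteq> strands P" "P \<subseteq> \<Union>\<X>"
  shows "strands P = \<X>"
proof -
  have "X \<in> \<X>" if X: "X \<in> strands P" for X
  proof -
    obtain p where p: "p \<in> X" using strandD(1)[OF X] by auto
    then obtain Y where Y: "Y \<in> \<X>" "p \<in> Y" using strandD(2)[OF X] assms by blast
    thus ?thesis using strand_unique[OF X _ p] assms by auto
  qed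
  thus ?thesis using assms by auto
qed

lemma strand_pairI:
  assumes pq: "p \<in> P" "q \<in> P" "v \<in> points p" "v \<in> points q"
    and only: "\<And>r w. r \<in> P \<Longrightarrow> w \<in> points r \<Longrightarrow> w \<in> points p \<or> w \<in> points q \<Longrightarrow> r = p \<or> r = q"
  shows "{p, q} \<in> strands P"
proof (rule strandI)
  show "share_closed P {p, q}" unfolding share_closed_def using only by blast
next
  fix Y assume Y: "Y \<subseteq> {p, q}" "Y \<noteq> {}" "share_closed P Y"
  thus "{p, q} \<subseteq> Y" using share_closedD[OF Y(3) _ _ pq(3,4)] share_closedD[OF Y(3) _ _ pq(4,3)] pq by auto
qed (use pq in auto)

lemma strand_singleI:
  assumes "p \<in> P" "\<And>r w. r \<in> P \<Longrightarrow> w \<in> points r \<Longrightarrow> w \<in> points p \<Longrightarrow> r = p"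
  shows "{p} \<in> strands P"
proof -
  obtain v where "v \<in> points p" using points_ne[OF assms(1)] by auto
  thus ?thesis using strand_pairI[of p p v] assms by auto
qed

end

text \<open>
  A relabelling of the pieces that respects sharing of vertices transports strands. It is used for
  inversion and for changing blob numbers.
\<close>

lemma strands_image:
  assumes P: "pieces P" and inj: "inj_on f P"
    and sh: "\<And>p q. p \<in> P \<Longrightarrow> q \<in> P \<Longrightarrow> points (f p) \<inter> points (f q) \<noteq> {} \<longleftrightarrow> points p \<inter> points q \<noteq> {}"
  shows "strands (f ` P) = (`) f ` strands P"
proof -
  interpret P: pieces P by fact
  interpret Q: pieces "f ` P"
  proof
    fix q assume "q \<in> f ` P"
    then obtain p where "p \<in> P" "q = f p" by auto
    thus "points q \<noteq> {}" using sh[of p p] P.points_ne[of p] by auto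
  qed
  have subimg: "\<exists>Z. Z \<subseteq> X \<and> Y = f ` Z" if "Y \<subseteq> f ` X" for X Y
    using that by (meson subset_imageE)
  have closed: "share_closed (f ` P) (f ` Z) \<longleftrightarrow> share_closed P Z" if Z: "Z \<subseteq> P" for Z
  proof -
    have mem: "f q \<in> f ` Z \<longleftrightarrow> q \<in> Z" if "q \<in> P" for q
      using inj_on_image_mem_iff[OF inj that Z] .
    have "share_closed (f ` P) (f ` Z) \<longleftrightarrow>
        (\<forall>p\<in>Z. \<forall>q\<in>P. points (f p) \<inter> points (f q) \<noteq> {} \<longrightarrow> q \<in> Z)"
      unfolding share_closed_def by (simp only: ball_simps, intro ball_cong refl, simp only: mem)
    also have "\<dots> \<longleftrightarrow> share_closed P Z"
      unfolding share_closed_def by (intro ball_cong refl imp_cong sh) (use Z in auto)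
    finally show ?thesis .
  qed
  show ?thesis
  proof (rule Q.strands_eqI)
    show "f ` P \<subseteq> \<Union> ((`) f ` strands P)" using P.strand_exists by blast
    show "(`) f ` strands P \<subseteq> strands (f ` P)"
    proof
      fix X' assume "X' \<in> (`) f ` strands P"
      then obtain X where X: "X \<in> strands P" "X' = f ` X" by auto
      note D = P.strandD[OF X(1)]
      show "X' \<in> strands (f ` P)" unfolding X(2)
      proof (rule Q.strandI)
        show "share_closed (f ` P) (f ` X)" using closed D by auto
        fix Y assume Y: "Y \<subseteq> f ` X" "Y \<noteq> {}" "share_closed (f ` P) Y"
        then obtain Z where Z: "Z \<subseteq> X" "Y = f ` Z" using subimg by blast
        hence "share_closed P Z" using closed Y D by auto
        hence "Z = X" using P.strand_minimal[OF X(1) Z(1)] Z Y by auto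
        thus "f ` X \<subseteq> Y" using Z by auto
      qed (use D in auto)
    qed
  qed
qed

lemma finite_strands: "finite P \<Longrightarrow> finite (strands P)"
  unfolding strands_def by (rule finite_quotient, assumption, rule trancl_subset_Sigma) auto

section \<open>Parity in planar matchings\<close>

text \<open>The part of \<open>decorated_tangle\<close> that concerns the shape alone.\<close>

definition planar_matching :: "nat \<Rightarrow> vertex arc set \<Rightarrow> bool" where
  "planar_matching n A \<longleftrightarrow>
     (\<forall>a\<in>A. ends a \<subseteq> vertices n \<and> card (ends a) = 2) \<and>
     (\<forall>v\<in>vertices n. \<exists>!a. a \<in> A \<and> v \<in> ends a) \<and>
     (\<forall>a\<in>A. \<forall>b\<in>A. \<not> crosses (frame_pos n) a b)"

lemma decorated_planar: "decorated_tangle m n G \<Longrightarrow> planar_matching n (arcs G)"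
  unfolding decorated_tangle_def planar_matching_def by blast

lemma vertices_iff: "(r, i) \<in> vertices n \<longleftrightarrow> (r = 0 \<or> r = 1) \<and> 1 \<le> i \<and> i \<le> n"
  by (auto simp: vertices_def)

lemma finite_vertices [simp]: "finite (vertices n)"
  by (simp add: vertices_def)

lemma frame_pos_inj: "inj_on (frame_pos n) (vertices n)"
  by (auto simp: inj_on_def frame_pos_def vertices_def)

lemma lo_hi_pair:
  assumes "ends a = {v, w}" "pos v < pos w"
  shows "lo pos a = pos v" "hi pos a = pos w"
  using assms by (auto simp: lo_def hi_def)

text \<open>
  Only the parity of this number matters: it decides on which side of the arcs through
  \<open>U\<close> the point \<open>v\<close> lies.
\<close>

definition left_count :: "vertex set \<Rightarrow> vertex \<Rightarrow> nat" where
  "left_count U v = card {u \<in> U. fst u = fst v \<and> snd u < snd v}"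

definition dir :: "vertex set \<Rightarrow> vertex \<Rightarrow> int" where
  "dir U v = (- 1) ^ left_count U v"

lemma dir_square [simp]: "dir U v * dir U v = 1"
  by (simp add: dir_def flip: power_mult_distrib)

lemma dir_cases: "dir U v = 1 \<or> dir U v = - 1"
  unfolding dir_def by (cases "even (left_count U v)") auto

lemma dir_eq_iff: "dir U v = dir U' v' \<longleftrightarrow> even (left_count U v + left_count U' v')"
  unfolding dir_def by (simp add: minus_one_power_iff)

lemma dir_neg_iff: "dir U v = - dir U' v' \<longleftrightarrow> odd (left_count U v + left_count U' v')"
  unfolding dir_def by (simp add: minus_one_power_iff)

lemma left_count_parity_row:
  assumes U: "finite U" and row: "fst v = fst w" and lt: "snd v < snd w"
  shows "left_count U w = left_count U v + (if v \<in> U then 1 else 0) +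
    card {u \<in> U. fst u = fst v \<and> snd v < snd u \<and> snd u < snd w}"
proof -
  let ?L = "{u \<in> U. fst u = fst v \<and> snd u < snd v}" and ?M = "U \<inter> {v}"
    and ?R = "{u \<in> U. fst u = fst v \<and> snd v < snd u \<and> snd u < snd w}"
  have "{u \<in> U. fst u = fst w \<and> snd u < snd w} = (?L \<union> ?M) \<union> ?R"
    using row lt by (auto simp: prod_eq_iff)
  moreover have "card ((?L \<union> ?M) \<union> ?R) = card (?L \<union> ?M) + card ?R"
    by (rule card_Un_disjoint) (use U in auto)
  moreover have "card (?L \<union> ?M) = card ?L + card ?M"
    by (rule card_Un_disjoint) (use U in auto)
  moreover have "card ?M = (if v \<in> U then 1 else 0)" by auto
  ultimately show ?thesis by (simp add: left_count_def)
qed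

text \<open>
  Read along the frame, the points of \<open>U\<close> split into those before \<open>v\<close>,
  those between \<open>v\<close> and \<open>w\<close>, and those after \<open>w\<close>. As
  \<open>w\<close> lies in the bottom row, which is read from right to left, the points after
  \<open>w\<close> are those to its left.
\<close>

lemma left_count_parity_col:
  assumes U: "U \<subseteq> vertices n" and row: "fst v = 0" "fst w = 1"
    and that: "snd v \<le> n" "snd w \<le> n" "1 \<le> snd w"
  shows "card U = left_count U v + (if v \<in> U then 1 else 0) + left_count U w + (if w \<in> U then 1 else 0) +
    card {u \<in> U. frame_pos n v < frame_pos n u \<and> frame_pos n u < frame_pos n w}"
proof -
  have fin: "finite U" using U finite_subset finite_vertices by blast
  let ?L = "{u \<in> U. fst u = fst v \<and> snd u < snd v}" and ?M = "U \<inter> {v}"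
    and ?L' = "{u \<in> U. fst u = fst w \<and> snd u < snd w}" and ?M' = "U \<inter> {w}"
    and ?R = "{u \<in> U. frame_pos n v < frame_pos n u \<and> frame_pos n u < frame_pos n w}"
  have "U = (((?L \<union> ?M) \<union> ?L') \<union> ?M') \<union> ?R"
  proof
    show "U \<subseteq> (((?L \<union> ?M) \<union> ?L') \<union> ?M') \<union> ?R"
    proof
      fix u assume u: "u \<in> U"
      hence "u \<in> vertices n" using U by auto
      hence c: "fst u = 0 \<or> fst u = 1" "1 \<le> snd u" "snd u \<le> n" by (auto simp: vertices_def)
      show "u \<in> (((?L \<union> ?M) \<union> ?L') \<union> ?M') \<union> ?R"
      proof (cases "fst u = 0")
        case True
        hence "snd u < snd v \<or> u = v \<or> snd v < snd u" using row by (metis linorder_neqE_nat prod_eqI)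
        thus ?thesis using True c row u that by (auto simp: frame_pos_def)
      next
        case False
        hence "snd u < snd w \<or> u = w \<or> snd w < snd u" using row c by (metis linorder_neqE_nat prod_eqI)
        thus ?thesis using False c row u that by (auto simp: frame_pos_def)
      qed
    qed
  qed auto
  moreover have "card ((((?L \<union> ?M) \<union> ?L') \<union> ?M') \<union> ?R) = card (((?L \<union> ?M) \<union> ?L') \<union> ?M') + card ?R"
    by (rule card_Un_disjoint) (use fin row that in \<open>auto simp: frame_pos_def split: if_splits\<close>)
  moreover have "card (((?L \<union> ?M) \<union> ?L') \<union> ?M') = card ((?L \<union> ?M) \<union> ?L') + card ?M'"
    by (rule card_Un_disjoint) (use fin row in auto)
  moreover have "card ((?L \<union> ?M) \<union> ?L') = card (?L \<union> ?M) + card ?L'"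
    by (rule card_Un_disjoint) (use fin row in auto)
  moreover have "card (?L \<union> ?M) = card ?L + card ?M"
    by (rule card_Un_disjoint) (use fin in auto)
  moreover have "card ?M = (if v \<in> U then 1 else 0)" "card ?M' = (if w \<in> U then 1 else 0)" by auto
  ultimately show ?thesis by (simp add: left_count_def)
qed

locale planar =
  fixes n :: nat and A :: "vertex arc set"
  assumes planar: "planar_matching n A"
begin

abbreviation "pos \<equiv> frame_pos n"

lemma ends_sub: "a \<in> A \<Longrightarrow> ends a \<subseteq> vertices n"
  using planar unfolding planar_matching_def by blast

lemma ends_card: "a \<in> A \<Longrightarrow> card (ends a) = 2"
  using planar unfolding planar_matching_def by blast

lemma arc_exists: "v \<in> vertices n \<Longrightarrow> \<exists>a\<in>A. v \<in> ends a"
  using planar unfolding planar_matching_def by blast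

lemma arc_unique:
  assumes "a \<in> A" "b \<in> A" "v \<in> ends a" "v \<in> ends b"
  shows "a = b"
proof -
  have "v \<in> vertices n" using ends_sub assms by blast
  hence "\<exists>!a. a \<in> A \<and> v \<in> ends a" using planar unfolding planar_matching_def by simp
  then obtain c where "\<forall>y. y \<in> A \<and> v \<in> ends y \<longrightarrow> y = c" by (elim ex1E)
  thus ?thesis using assms by metis
qed

lemma not_crosses: "a \<in> A \<Longrightarrow> b \<in> A \<Longrightarrow> \<not> crosses pos a b"
  using planar unfolding planar_matching_def by blast

lemma inj_ends: "inj_on ends A"
proof (rule inj_onI)
  fix a b assume "a \<in> A" "b \<in> A" "ends a = ends b"
  moreover have "ends a \<noteq> {}" using ends_card[OF \<open>a \<in> A\<close>] by auto
  ultimately show "a = b" using arc_unique by blast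
qed

lemma finite_arcs: "finite A"
  by (rule finite_imageD[OF _ inj_ends], rule finite_subset[of _ "Pow (vertices n)"]) (use ends_sub in auto)

lemma arc_pair:
  assumes "a \<in> A"
  obtains v w where "ends a = {v, w}" "pos v < pos w" "lo pos a = pos v" "hi pos a = pos w"
    "v \<in> vertices n" "w \<in> vertices n"
proof -
  obtain v w where vw: "ends a = {v, w}" "v \<noteq> w" using ends_card[OF assms] by (auto simp: card_2_iff)
  hence V: "v \<in> vertices n" "w \<in> vertices n" using ends_sub[OF assms] by auto
  hence "pos v \<noteq> pos w" using vw frame_pos_inj[of n] by (auto simp: inj_on_def)
  then consider "pos v < pos w" | "pos w < pos v" by linarith
  thus ?thesis
  proof cases
    case 1 thus ?thesis using that[of v w] vw V lo_hi_pair[of a v w pos] by auto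
  next
    case 2 thus ?thesis using that[of w v] vw V lo_hi_pair[of a w v pos] by (auto simp: insert_commute)
  qed
qed

lemma union_even:
  assumes "B \<subseteq> A"
  shows "even (card (\<Union>(ends ` B)))"
proof -
  have "card (\<Union>(ends ` B)) = (\<Sum>b\<in>B. card (ends b))"
  proof (rule card_UN_disjoint)
    show "finite B" using assms finite_arcs finite_subset by blast
    show "\<forall>i\<in>B. finite (ends i)"
      using finite_subset[OF ends_sub finite_vertices] subsetD[OF assms] by simp
    show "\<forall>i\<in>B. \<forall>j\<in>B. i \<noteq> j \<longrightarrow> ends i \<inter> ends j = {}"
      using arc_unique subsetD[OF assms] by (metis disjoint_iff)
  qed
  also have "\<dots> = (\<Sum>b\<in>B. 2)" by (rule sum.cong) (use assms ends_card in auto)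
  finally show ?thesis by simp
qed

lemma pos_eqD: "u \<in> vertices n \<Longrightarrow> v \<in> vertices n \<Longrightarrow> pos u = pos v \<Longrightarrow> u = v"
  using frame_pos_inj by (auto simp: inj_on_def)

lemma pos_eq_iff: "u \<in> vertices n \<Longrightarrow> v \<in> vertices n \<Longrightarrow> pos u = pos v \<longleftrightarrow> u = v"
  using pos_eqD by blast

text \<open>
  The points with \<open>Q\<close> are then all ends of some of the arcs of \<open>B\<close>.
\<close>

lemma even_closed:
  assumes B: "B \<subseteq> A" and Q: "\<And>b u u'. b \<in> B \<Longrightarrow> u \<in> ends b \<Longrightarrow> u' \<in> ends b \<Longrightarrow> Q u \<Longrightarrow> Q u'"
  shows "even (card {u \<in> \<Union>(ends ` B). Q u})"
proof -
  have "{u \<in> \<Union>(ends ` B). Q u} = \<Union>(ends ` {b \<in> B. \<forall>u\<in>ends b. Q u})" using Q by blast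
  moreover have "{b \<in> B. \<forall>u\<in>ends b. Q u} \<subseteq> A" using B by blast
  ultimately show ?thesis using union_even by simp
qed

lemma end_pos: "a \<in> A \<Longrightarrow> u \<in> ends a \<Longrightarrow> (pos u = lo pos a \<or> pos u = hi pos a) \<and> lo pos a < hi pos a"
  using arc_pair[of a] by (metis insertE singletonD)

text \<open>
  Two intervals with distinct end points that do not cross are disjoint or nested.
\<close>

lemma arcs_apart:
  assumes a: "a \<in> A" and b: "b \<in> A" "a \<noteq> b"
  shows "hi pos a < lo pos b \<or> hi pos b < lo pos a \<or> encloses pos a b \<or> encloses pos b a"
proof -
  obtain v w where vw: "ends a = {v, w}" "pos v < pos w" "lo pos a = pos v" "hi pos a = pos w"
    "v \<in> vertices n" "w \<in> vertices n" using arc_pair[OF a] by metis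
  obtain x y where xy: "ends b = {x, y}" "pos x < pos y" "lo pos b = pos x" "hi pos b = pos y"
    "x \<in> vertices n" "y \<in> vertices n" using arc_pair[OF b(1)] by metis
  have "x \<notin> ends a" "y \<notin> ends a"
    using arc_unique[OF a b(1), of x] arc_unique[OF a b(1), of y] b(2) xy by auto
  hence "pos x \<noteq> pos v" "pos x \<noteq> pos w" "pos y \<noteq> pos v" "pos y \<noteq> pos w"
    using pos_eq_iff[OF xy(5) vw(5)] pos_eq_iff[OF xy(5) vw(6)]
      pos_eq_iff[OF xy(6) vw(5)] pos_eq_iff[OF xy(6) vw(6)] vw(1) by blast+
  moreover have "\<not> crosses pos a b" "\<not> crosses pos b a" using not_crosses a b by auto
  ultimately show ?thesis using vw xy unfolding crosses_def encloses_def by linarith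
qed

text \<open>
  Any other arc is disjoint from \<open>a\<close> or nested with it, so an arc of \<open>B\<close>
  has both or none of its ends between the ends of \<open>a\<close>.
\<close>

lemma even_between:
  assumes B: "B \<subseteq> A" and a: "a \<in> A"
  shows "even (card {u \<in> \<Union>(ends ` B). lo pos a < pos u \<and> pos u < hi pos a})"
proof (rule even_closed[OF B])
  fix b u u' assume b: "b \<in> B" "u \<in> ends b" "u' \<in> ends b" and u: "lo pos a < pos u \<and> pos u < hi pos a"
  have bA: "b \<in> A" using b(1) B by auto
  note e = end_pos[OF bA b(2)] end_pos[OF bA b(3)]
  have "a \<noteq> b" using e(1) u by auto
  thus "lo pos a < pos u' \<and> pos u' < hi pos a"
    using arcs_apart[OF a bA] e u unfolding encloses_def by linarith
qed

text \<open>
  As \<open>a\<close> is not enclosed, no arc has one end before \<open>a\<close> and the other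
  one after it.
\<close>

lemma even_before:
  assumes B: "B \<subseteq> A" and a: "a \<in> A - B" and ex: "\<And>b. b \<in> A \<Longrightarrow> \<not> encloses pos b a"
  shows "even (card {u \<in> \<Union>(ends ` B). pos u < lo pos a})"
proof (rule even_closed[OF B])
  fix b u u' assume b: "b \<in> B" "u \<in> ends b" "u' \<in> ends b" and u: "pos u < lo pos a"
  have bA: "b \<in> A" and ne: "a \<noteq> b" using b(1) B a by auto
  show "pos u' < lo pos a"
    using arcs_apart[OF _ bA ne] a ex[OF bA] end_pos[OF bA b(2)] end_pos[OF bA b(3)] u
    unfolding encloses_def by auto
qed

text \<open>
  The parity of \<open>left_count\<close> behaves along every arc like an orientation: it changes
  along the horizontal arcs of \<open>B\<close> and along no other arc. All later statements on
  signs and regions come from this one.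
\<close>

lemma left_count_ends:
  assumes B: "B \<subseteq> A" and a: "a \<in> A" and vw: "ends a = {v, w}" "v \<noteq> w"
  shows "even (left_count (\<Union>(ends ` B)) v + left_count (\<Union>(ends ` B)) w) \<longleftrightarrow> a \<notin> B \<or> fst v \<noteq> fst w"
proof -
  let ?U = "\<Union>(ends ` B)"
  have U: "?U \<subseteq> vertices n" using B ends_sub by blast
  have fin: "finite ?U" using U finite_subset finite_vertices by blast
  have mem: "v \<in> ?U \<longleftrightarrow> a \<in> B" "w \<in> ?U \<longleftrightarrow> a \<in> B" using arc_unique[OF a] B vw by blast+
  have V: "v \<in> vertices n" "w \<in> vertices n" using vw ends_sub[OF a] by auto
  have bet: "even (card {u \<in> ?U. pos v < pos u \<and> pos u < pos w})"
    if "ends a = {v, w}" "pos v < pos w" for v w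
    using even_between[OF B a] lo_hi_pair[OF that] by simp
  have row: ?thesis if vw: "ends a = {v, w}" and V: "v \<in> vertices n" "w \<in> vertices n"
    and mem: "v \<in> ?U \<longleftrightarrow> a \<in> B" and fs: "fst v = fst w" and lt: "snd v < snd w" for v w
  proof -
    have E: "{u \<in> ?U. fst u = fst v \<and> snd v < snd u \<and> snd u < snd w} =
      {u \<in> ?U. min (pos v) (pos w) < pos u \<and> pos u < max (pos v) (pos w)}"
    proof (intro set_eqI)
      fix u
      have "u \<in> vertices n" if "u \<in> ?U" using U that by blast
      thus "u \<in> {u \<in> ?U. fst u = fst v \<and> snd v < snd u \<and> snd u < snd w} \<longleftrightarrow>
        u \<in> {u \<in> ?U. min (pos v) (pos w) < pos u \<and> pos u < max (pos v) (pos w)}"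
        using V fs lt by (cases "u \<in> ?U"; cases u; cases v; cases w)
          (auto simp: frame_pos_def vertices_iff min_def max_def split: if_splits simp del: UN_iff)
    qed
    have "even (card {u \<in> ?U. min (pos v) (pos w) < pos u \<and> pos u < max (pos v) (pos w)})"
    proof (cases "pos v < pos w")
      case True thus ?thesis using bet[OF vw True] by simp
    next
      case False
      hence "pos w < pos v" using V fs lt by (auto simp: frame_pos_def vertices_def split: if_splits)
      thus ?thesis using bet[of w v] vw by (simp add: insert_commute min_def max_def)
    qed
    hence ev: "even (card {u \<in> ?U. fst u = fst v \<and> snd v < snd u \<and> snd u < snd w})" using E by simp
    have "left_count ?U w = left_count ?U v + (if a \<in> B then 1 else 0) +
      card {u \<in> ?U. fst u = fst v \<and> snd v < snd u \<and> snd u < snd w}"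
      using left_count_parity_row[OF fin fs lt] mem by simp
    hence "even (left_count ?U v + left_count ?U w) \<longleftrightarrow> a \<notin> B \<or> fst v \<noteq> fst w" using ev fs by auto
    thus ?thesis using vw \<open>ends a = {v, w}\<close> assms(3) fs
      by (metis add.commute doubleton_eq_iff)
  qed
  have col: ?thesis if vw: "ends a = {v, w}" and V: "v \<in> vertices n" "w \<in> vertices n"
    and mem: "v \<in> ?U \<longleftrightarrow> a \<in> B" "w \<in> ?U \<longleftrightarrow> a \<in> B" and fs: "fst v = 0" "fst w = 1" for v w
  proof -
    have lt: "pos v < pos w" using V fs by (auto simp: frame_pos_def vertices_def)
    have "card ?U = left_count ?U v + (if a \<in> B then 1 else 0) + left_count ?U w + (if a \<in> B then 1 else 0) +
      card {u \<in> ?U. frame_pos n v < frame_pos n u \<and> frame_pos n u < frame_pos n w}"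
      using left_count_parity_col[OF U fs] V mem fs by (auto simp: vertices_def)
    hence "even (left_count ?U v + left_count ?U w)"
      using bet[OF vw lt] union_even[OF B] by (auto split: if_splits)
    thus ?thesis using vw fs assms(3)
      by (metis add.commute doubleton_eq_iff zero_neq_one)
  qed
  consider "fst v = fst w" "snd v < snd w" | "fst v = fst w" "snd w < snd v" | "fst v = 0" "fst w = 1" | "fst v = 1" "fst w = 0"
  proof -
    have "snd v < snd w \<or> snd w < snd v \<or> fst v \<noteq> fst w"
      using vw(2) by (metis linorder_neqE_nat prod_eqI)
    moreover have "fst v = 0 \<or> fst v = 1" "fst w = 0 \<or> fst w = 1" using V by (auto simp: vertices_def)
    ultimately show thesis using that by argo
  qed
  thus ?thesis
  proof cases
    case 1 thus ?thesis using row[of v w] vw V mem by blast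
  next
    case 2 thus ?thesis using row[of w v] vw V mem by (simp add: insert_commute)
  next
    case 3 thus ?thesis using col[of v w] vw V mem by blast
  next
    case 4 thus ?thesis using col[of w v] vw V mem by (simp add: insert_commute)
  qed
qed

text \<open>
  Exposed arcs lie in the region next to the left face, whose points have even count.
\<close>

lemma left_count_exposed:
  assumes B: "B \<subseteq> A" and a: "a \<in> A - B" and ex: "\<And>b. b \<in> A \<Longrightarrow> \<not> encloses pos b a" and v: "v \<in> ends a"
  shows "even (left_count (\<Union>(ends ` B)) v)"
proof -
  let ?U = "\<Union>(ends ` B)"
  have aA: "a \<in> A" using a by auto
  obtain x y where xy: "ends a = {x, y}" "pos x < pos y" "lo pos a = pos x" "hi pos a = pos y"
    "x \<in> vertices n" "y \<in> vertices n" using arc_pair[OF aA] by metis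
  have U: "?U \<subseteq> vertices n" using B ends_sub by blast
  have fin: "finite ?U" using U finite_subset finite_vertices by blast
  have notU: "x \<notin> ?U" "y \<notin> ?U" using arc_unique[OF aA, of _ x] arc_unique[OF aA, of _ y] B xy a by blast+
  have x: "even (card {u \<in> ?U. pos u < pos x})" using even_before[OF B a ex] xy by simp
  have m: "even (card {u \<in> ?U. pos x < pos u \<and> pos u < pos y})" using even_between[OF B aA] xy by simp
  have E: "?U = ({u \<in> ?U. pos u < pos x} \<union> {u \<in> ?U. pos x < pos u \<and> pos u < pos y}) \<union> {u \<in> ?U. pos y < pos u}"
  proof (intro equalityI subsetI)
    fix u assume u: "u \<in> ?U"
    hence "u \<in> vertices n" "u \<noteq> x" "u \<noteq> y" using U notU by blast+
    hence "pos u \<noteq> pos x" "pos u \<noteq> pos y" using pos_eq_iff xy(5,6) by blast+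
    thus "u \<in> ({u \<in> ?U. pos u < pos x} \<union> {u \<in> ?U. pos x < pos u \<and> pos u < pos y}) \<union> {u \<in> ?U. pos y < pos u}"
      using u by (auto simp del: UN_iff)
  qed blast
  have F: "card (({u \<in> ?U. pos u < pos x} \<union> {u \<in> ?U. pos x < pos u \<and> pos u < pos y}) \<union> {u \<in> ?U. pos y < pos u})
    = card {u \<in> ?U. pos u < pos x} + card {u \<in> ?U. pos x < pos u \<and> pos u < pos y} + card {u \<in> ?U. pos y < pos u}"
  proof -
    have "card (({u \<in> S. f u < a} \<union> {u \<in> S. a < f u \<and> f u < b}) \<union> {u \<in> S. b < f u})
      = card {u \<in> S. f u < a} + card {u \<in> S. a < f u \<and> f u < b} + card {u \<in> S. b < f u}"
      if "finite S" "a < b" for S :: "vertex set" and f :: "vertex \<Rightarrow> nat" and a b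
      using that by (subst card_Un_disjoint; (subst card_Un_disjoint)?; auto)
    thus ?thesis using fin xy(2) by blast
  qed
  have "card ?U = card {u \<in> ?U. pos u < pos x} + card {u \<in> ?U. pos x < pos u \<and> pos u < pos y} + card {u \<in> ?U. pos y < pos u}"
    by (rule trans[OF arg_cong[OF E, of card] F])
  hence y: "even (card {u \<in> ?U. pos y < pos u})" using x m union_even[OF B] by presburger
  have one: "even (left_count ?U x) \<or> even (left_count ?U y)"
  proof (cases "fst x = 0")
    case True
    have "{u \<in> ?U. fst u = fst x \<and> snd u < snd x} = {u \<in> ?U. pos u < pos x}"
    proof (intro Collect_cong conj_cong refl)
      fix u assume "u \<in> ?U"
      hence "u \<in> vertices n" using U by blast
      thus "(fst u = fst x \<and> snd u < snd x) = (pos u < pos x)"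
        using True xy(5) by (cases u; cases x) (auto simp: frame_pos_def vertices_iff)
    qed
    thus ?thesis using x by (simp add: left_count_def)
  next
    case False
    hence "fst y = 1" using xy(2,5,6) by (cases x; cases y) (auto simp: frame_pos_def vertices_iff split: if_splits)
    hence "{u \<in> ?U. fst u = fst y \<and> snd u < snd y} = {u \<in> ?U. pos y < pos u}"
    proof (intro Collect_cong conj_cong refl)
      fix u assume "u \<in> ?U"
      hence "u \<in> vertices n" using U by blast
      thus "(fst u = fst y \<and> snd u < snd y) = (pos y < pos u)"
        using \<open>fst y = 1\<close> xy(6) by (cases u; cases y) (auto simp: frame_pos_def vertices_iff)
    qed
    thus ?thesis using y by (simp add: left_count_def)
  qed
  have "x \<noteq> y" using xy by auto
  hence "even (left_count ?U x + left_count ?U y)" using left_count_ends[OF B aA xy(1)] a by auto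
  thus ?thesis using one v xy by auto
qed

end

section \<open>Strands of a stack of layers\<close>

text \<open>
  Stacks of arbitrary height are needed for associativity, where three tangles are stacked at
  once.
\<close>

definition layers :: "nat \<Rightarrow> (nat \<Rightarrow> vertex arc set) \<Rightarrow> piece set" where
  "layers L A = (SIGMA t:{..<L}. A t)"

definition shift :: "nat \<Rightarrow> vertex \<Rightarrow> vertex" where
  "shift t v = (t + fst v, snd v)"

definition pts :: "piece set \<Rightarrow> vertex set" where
  "pts X = \<Union>(points ` X)"

definition boundary :: "nat \<Rightarrow> piece set \<Rightarrow> vertex set" where
  "boundary L X = {v \<in> pts X. fst v = 0 \<or> fst v = L}"

text \<open>
  Modulo \<open>m\<close> this is the number of dots of the strand; the sign says whether a dot
  moved from the base point of the piece to that of the strand is counted as \<open>1\<close> or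
  as \<open>m - 1\<close>.
\<close>

definition strand_weight :: "piece set \<Rightarrow> int" where
  "strand_weight X = (\<Sum>p\<in>X. dir (pts X) (base_point (points p)) * int (dots (snd p)))"

lemma points_shift: "points (t, a) = shift t ` ends a"
  by (simp add: points_def shift_def case_prod_unfold)

lemma inj_shift: "inj (shift t)"
  by (auto simp: inj_def shift_def prod_eq_iff)

lemma fst_shift [simp]: "fst (shift t v) = t + fst v" and snd_shift [simp]: "snd (shift t v) = snd v"
  by (simp_all add: shift_def)

lemma stack_layers: "stack G1 G2 = layers 2 (\<lambda>t. if t = 0 then arcs G1 else arcs G2)"
proof -
  have "{..<2} = {0, 1::nat}" by auto
  moreover have "Sigma {0, 1::nat} B = {0} \<times> B 0 \<union> {1} \<times> B 1" for B :: "nat \<Rightarrow> vertex arc set" by blast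
  ultimately show ?thesis by (simp add: stack_def layers_def)
qed

lemma base_point_props:
  assumes "finite V" "V \<noteq> {}"
  shows base_point_in: "base_point V \<in> V"
    and base_point_row: "\<And>u. u \<in> V \<Longrightarrow> fst (base_point V) \<le> fst u"
    and base_point_left: "\<And>u. u \<in> V \<Longrightarrow> fst u = fst (base_point V) \<Longrightarrow> snd (base_point V) \<le> snd u"
proof -
  define r where "r = Min (fst ` V)"
  define i where "i = Min {i. (r, i) \<in> V}"
  have b: "base_point V = (r, i)" by (simp add: base_point_def r_def i_def Let_def)
  have "r \<in> fst ` V" unfolding r_def by (rule Min_in) (use assms in auto)
  hence ne: "{i. (r, i) \<in> V} \<noteq> {}" by force
  have fin: "finite {i. (r, i) \<in> V}"
    by (rule finite_subset[of _ "snd ` V"]) (use assms in force)+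
  show "base_point V \<in> V" using Min_in[OF fin ne] by (simp add: b i_def)
  show "fst (base_point V) \<le> fst u" if "u \<in> V" for u
    using that assms by (simp add: b r_def)
  show "snd (base_point V) \<le> snd u" if "u \<in> V" "fst u = fst (base_point V)" for u
    using that fin by (cases u) (auto simp: b i_def intro: Min_le)
qed

lemma dir_leftmost:
  assumes "\<And>u. u \<in> U \<Longrightarrow> fst u = fst v \<Longrightarrow> snd v \<le> snd u"
  shows "dir U v = 1"
proof -
  have e: "{u \<in> U. fst u = fst v \<and> snd u < snd v} = {}" using assms by fastforce
  show ?thesis unfolding dir_def left_count_def e by simp
qed

locale layered =
  fixes n L :: nat and A :: "nat \<Rightarrow> vertex arc set"
  assumes planar_layer: "t < L \<Longrightarrow> planar_matching n (A t)"
begin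

abbreviation P :: "piece set" where "P \<equiv> layers L A"

abbreviation open_strands :: "piece set set" where "open_strands \<equiv> {X \<in> strands P. boundary L X \<noteq> {}}"

abbreviation loops :: "piece set set" where "loops \<equiv> {X \<in> strands P. boundary L X = {}}"

lemma piece_iff: "p \<in> P \<longleftrightarrow> fst p < L \<and> snd p \<in> A (fst p)"
  by (cases p) (auto simp: layers_def)

lemma planar_at: "t < L \<Longrightarrow> planar n (A t)"
  using planar_layer by (simp add: planar_def)

lemma finite_P: "finite P"
  unfolding layers_def by (rule finite_SigmaI) (simp_all add: planar.finite_arcs[OF planar_at])

lemma points_pair:
  assumes "p \<in> P"
  obtains v w where "points p = {v, w}" "v \<noteq> w"
proof -
  have "card (ends (snd p)) = 2" using planar.ends_card[OF planar_at] assms by (auto simp: piece_iff)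
  hence "card (points p) = 2"
    by (cases p) (simp add: points_shift card_image inj_on_subset[OF inj_shift])
  thus ?thesis using that by (auto simp: card_2_iff)
qed

lemma points_card:
  assumes "p \<in> P"
  shows "card (points p) = 2"
proof -
  obtain v w where "points p = {v, w}" "v \<noteq> w" using points_pair[OF assms] .
  thus ?thesis by simp
qed

lemma finite_points: "p \<in> P \<Longrightarrow> finite (points p)"
  using points_card[of p] by (intro card_ge_0_finite) simp

sublocale pieces P
proof
  fix p assume "p \<in> P"
  thus "points p \<noteq> {}" using points_card[of p] by auto
qed

lemma points_rows:
  assumes "p \<in> P" "v \<in> points p"
  shows "(fst v = fst p \<or> fst v = Suc (fst p)) \<and> 1 \<le> snd v \<and> snd v \<le> n"
proof -
  obtain t a where p: "p = (t, a)" by (cases p)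
  obtain u where u: "u \<in> ends a" "v = shift t u" using assms by (auto simp: p points_shift)
  have "ends a \<subseteq> vertices n"
    using planar.ends_sub[OF planar_at, of t a] assms by (simp add: piece_iff p)
  hence "u \<in> vertices n" using u by auto
  thus ?thesis using u p by (auto simp: shift_def vertices_def)
qed

lemma piece_at:
  assumes "t < L" "fst v = t \<or> fst v = Suc t" "1 \<le> snd v" "snd v \<le> n"
  obtains a where "(t, a) \<in> P" "v \<in> points (t, a)"
proof -
  have "(fst v - t, snd v) \<in> vertices n" using assms by (auto simp: vertices_def)
  then obtain a where a: "a \<in> A t" "(fst v - t, snd v) \<in> ends a"
    using planar.arc_exists[OF planar_at[OF assms(1)]] by blast
  have "v = shift t (fst v - t, snd v)" using assms by (auto simp: shift_def prod_eq_iff)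
  thus ?thesis using that[of a] a assms by (auto simp: points_shift piece_iff)
qed

lemma piece_unique:
  assumes "p \<in> P" "q \<in> P" "fst p = fst q" "v \<in> points p" "v \<in> points q"
  shows "p = q"
proof -
  obtain t a b where pq: "p = (t, a)" "q = (t, b)" using assms by (cases p; cases q) auto
  obtain u u' where u: "u \<in> ends a" "v = shift t u" "u' \<in> ends b" "v = shift t u'"
    using assms by (auto simp: pq points_shift)
  hence "u = u'" using inj_shift by (metis injD)
  thus ?thesis using planar.arc_unique[OF planar_at, of t a b u] assms u pq by (auto simp: piece_iff)
qed

lemma finite_sub: "X \<subseteq> P \<Longrightarrow> finite X"
  using finite_subset[OF _ finite_P] .

lemma finite_pts: "X \<subseteq> P \<Longrightarrow> finite (pts X)"
  unfolding pts_def by (rule finite_UN_I[OF finite_sub]) (auto intro: finite_points)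

text \<open>
  In a closed set the points of the rows bounding a layer are covered by the pieces of that layer,
  since the layer is a perfect matching of these points.
\<close>

lemma pts_layer:
  assumes X: "X \<subseteq> P" "share_closed P X" and t: "t < L"
    and v: "v \<in> pts X" "fst v = t \<or> fst v = Suc t"
  obtains a where "(t, a) \<in> X" "v \<in> points (t, a)"
proof -
  obtain p where p: "p \<in> X" "v \<in> points p" using v by (auto simp: pts_def)
  hence "1 \<le> snd v" "snd v \<le> n" using points_rows[of p v] X by auto
  then obtain a where a: "(t, a) \<in> P" "v \<in> points (t, a)" using piece_at[OF t v(2)] by blast
  thus ?thesis using that share_closedD[OF X(2) p(1) a(1) p(2) a(2)] by blast
qed

lemma left_count_layer:
  assumes X: "X \<subseteq> P" "share_closed P X" and t: "t < L" and v: "v \<in> vertices n"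
  shows "left_count (pts X) (shift t v) = left_count (\<Union>(ends ` {a. (t, a) \<in> X})) v"
proof -
  let ?U = "\<Union>(ends ` {a. (t, a) \<in> X})"
  have v01: "fst v = 0 \<or> fst v = 1" using v by (auto simp: vertices_def)
  have "{u \<in> pts X. fst u = fst (shift t v) \<and> snd u < snd (shift t v)} =
    shift t ` {u \<in> ?U. fst u = fst v \<and> snd u < snd v}" (is "?l = shift t ` ?r")
  proof (intro equalityI subsetI)
    fix u assume u: "u \<in> ?l"
    hence u': "u \<in> pts X" "fst u = t \<or> fst u = Suc t" using v01 by auto
    obtain a where a: "(t, a) \<in> X" "u \<in> points (t, a)" using pts_layer[OF X t u'] by blast
    then obtain w where w: "w \<in> ends a" "u = shift t w" by (auto simp: points_shift)
    hence "w \<in> ?r" using a u by auto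
    thus "u \<in> shift t ` ?r" using w by blast
  next
    fix u assume "u \<in> shift t ` ?r"
    then obtain w a where w: "u = shift t w" "w \<in> ends a" "(t, a) \<in> X" "fst w = fst v" "snd w < snd v" by auto
    hence "u \<in> points (t, a)" by (auto simp: points_shift)
    thus "u \<in> ?l" using w by (auto simp: pts_def)
  qed
  thus ?thesis unfolding left_count_def by (simp add: card_image inj_on_subset[OF inj_shift])
qed

lemma left_count_piece:
  assumes X: "X \<subseteq> P" "share_closed P X" and p: "p \<in> P" "points p = {v, w}" "v \<noteq> w"
  shows "even (left_count (pts X) v + left_count (pts X) w) \<longleftrightarrow> p \<notin> X \<or> fst v \<noteq> fst w"
proof -
  obtain t a where pt: "p = (t, a)" by (cases p)
  have t: "t < L" "a \<in> A t" using p by (auto simp: pt piece_iff)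
  interpret planar n "A t" using planar_at t by auto
  have im: "shift t ` ends a = {v, w}" using p by (simp add: pt points_shift)
  then obtain v' where v': "v' \<in> ends a" "v = shift t v'" by blast
  obtain w' where w': "w' \<in> ends a" "w = shift t w'" using im by blast
  have "v' \<noteq> w'" using v' w' p by auto
  hence e: "ends a = {v', w'}" using ends_card[OF t(2)] v' w' by (auto simp: card_2_iff)
  have V: "v' \<in> vertices n" "w' \<in> vertices n" using ends_sub[OF t(2)] v' w' by auto
  have B: "{a. (t, a) \<in> X} \<subseteq> A t" using X by (auto simp: piece_iff)
  show ?thesis
    using left_count_ends[OF B t(2) e \<open>v' \<noteq> w'\<close>] left_count_layer[OF X t(1)] V v' w' pt by auto
qed

lemma left_count_exposed_piece:
  assumes X: "X \<subseteq> P" "share_closed P X" and p: "(t, a) \<in> P" "(t, a) \<notin> X" "v \<in> points (t, a)"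
    and ex: "\<And>b. b \<in> A t \<Longrightarrow> \<not> encloses (frame_pos n) b a"
  shows "even (left_count (pts X) v)"
proof -
  have t: "t < L" "a \<in> A t" using p by (auto simp: piece_iff)
  interpret planar n "A t" using planar_at t by auto
  obtain v' where v': "v' \<in> ends a" "v = shift t v'" using p by (auto simp: points_shift)
  have V: "v' \<in> vertices n" using ends_sub[OF t(2)] v' by auto
  have B: "{a. (t, a) \<in> X} \<subseteq> A t" using X by (auto simp: piece_iff)
  have "even (left_count (\<Union>(ends ` {a. (t, a) \<in> X})) v')"
    by (rule left_count_exposed[OF B _ ex v'(1)]) (use p t in auto)
  thus ?thesis using left_count_layer[OF X t(1) V] v' by simp
qed

lemma dir_piece:
  assumes X: "X \<subseteq> P" "share_closed P X" and p: "p \<in> X" "points p = {v, w}" "v \<noteq> w"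
  shows "dir (pts X) v = (if fst v = fst w then - dir (pts X) w else dir (pts X) w)"
  using left_count_piece[OF X _ p(2,3)] p X by (auto simp: dir_eq_iff dir_neg_iff)

text \<open>
  The rule for passing along a piece determines the function on a connected strand up to a global
  sign.
\<close>

lemma orientation_unique:
  fixes f g :: "vertex \<Rightarrow> int"
  assumes X: "X \<in> strands P"
    and f: "\<And>p v w. p \<in> X \<Longrightarrow> points p = {v, w} \<Longrightarrow> v \<noteq> w \<Longrightarrow> f v = (if fst v = fst w then - f w else f w)"
    and g: "\<And>p v w. p \<in> X \<Longrightarrow> points p = {v, w} \<Longrightarrow> v \<noteq> w \<Longrightarrow> g v = (if fst v = fst w then - g w else g w)"
    and v: "v \<in> pts X" and w: "w \<in> pts X"
  shows "f v * g v = f w * g w"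
proof -
  obtain p q where p: "p \<in> X" "v \<in> points p" and q: "q \<in> X" "w \<in> points q" using v w by (auto simp: pts_def)
  have one: "f x * g x = f y * g y" if h: "p \<in> X" "x \<in> points p" "y \<in> points p" for p x y
  proof (cases "x = y")
    case False
    obtain a b where "points p = {a, b}" "a \<noteq> b" using points_pair[OF subsetD[OF strandD(2)[OF X] h(1)]] .
    hence "points p = {x, y}" using h False by auto
    thus ?thesis using f[OF h(1) _ False] g[OF h(1) _ False] by auto
  qed simp
  have "\<forall>x\<in>points q. f x * g x = f v * g v"
  proof (rule strand_induct[OF X p(1), of "\<lambda>q. \<forall>x\<in>points q. f x * g x = f v * g v"])
    show "\<forall>x\<in>points p. f x * g x = f v * g v" using one[OF p(1) _ p(2)] by blast
  next
    fix r q u assume "r \<in> X" "q \<in> X" "\<forall>x\<in>points r. f x * g x = f v * g v" "u \<in> points r" "u \<in> points q"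
    thus "\<forall>x\<in>points q. f x * g x = f v * g v" using one[of q _ u] by auto
  qed (rule q(1))
  thus ?thesis using q by simp
qed

text \<open>
  Any function that obeys the orientation rule on a strand is a multiple of \<open>dir\<close>.
  This compares the signs taken in a part of a stack with those taken in the whole stack.
\<close>

lemma dir_substrand:
  assumes X: "X \<in> strands P"
    and g: "\<And>p v w. p \<in> X \<Longrightarrow> points p = {v, w} \<Longrightarrow> v \<noteq> w \<Longrightarrow> g v = (if fst v = fst w then - g w else g w)"
    and b: "b \<in> pts X" "dir (pts X) b = 1" and v: "v \<in> pts X"
  shows "g v = g b * dir (pts X) v"
proof -
  have d: "dir (pts X) v = (if fst v = fst w then - dir (pts X) w else dir (pts X) w)"
    if "p \<in> X" "points p = {v, w}" "v \<noteq> w" for p v w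
    using dir_piece[OF strandD(2,3)[OF X] that] .
  have "dir (pts X) v * g v = dir (pts X) b * g b"
    by (rule orientation_unique[OF X d g v b(1)])
  thus ?thesis using b(2) dir_cases[of "pts X" v] by auto
qed

text \<open>
  Each sliding rule multiplies the coefficient by \<open>1\<close> or, along a horizontal arc, by
  \<open>m - 1\<close>, which is \<open>- 1\<close> modulo \<open>m\<close>. These are the changes
  of \<open>dir\<close> along the piece, so all coefficients for the same two sites agree modulo
  \<open>m\<close>.
\<close>

lemma slides_dir:
  assumes X: "X \<in> strands P" and m: "m \<ge> 1"
  shows "slides m X s c t \<Longrightarrow> fst t \<in> X \<and> snd t \<in> points (fst t) \<and>
    int m dvd int c - dir (pts X) (snd s) * dir (pts X) (snd t)"
proof (induction rule: slides.induct)
  case (stay p v)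
  have "int 1 - dir (pts X) v * dir (pts X) v = 0" by simp
  thus ?case using stay by (simp only: fst_conv snd_conv dvd_0_right simp_thms)
next
  case (common_end s c p v q)
  thus ?case by simp
next
  case (along_vertical s c p v w)
  hence "v \<noteq> w" by auto
  thus ?case using along_vertical dir_piece[OF strandD(2,3)[OF X], of p v w] by auto
next
  case (along_horizontal s c p v w)
  hence d: "dir (pts X) v = - dir (pts X) w" using dir_piece[OF strandD(2,3)[OF X], of p v w] by auto
  have "int ((m - 1) * c) - dir (pts X) (snd s) * dir (pts X) w =
    int m * int c - (int c - dir (pts X) (snd s) * dir (pts X) v)"
    using m d by (simp add: of_nat_diff algebra_simps)
  thus ?case using along_horizontal by (auto intro: dvd_diff)
qed

lemma slides_exist:
  assumes X: "X \<in> strands P" and p: "p \<in> X" "v \<in> points p" and q: "q \<in> X" "w \<in> points q"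
  shows "\<exists>c. slides m X (p, v) c (q, w)"
proof -
  have other: "\<exists>c. slides m X s c (q, w)" if h: "slides m X s c (q, v)" "q \<in> X" "v \<in> points q" "w \<in> points q" for s c q v w
  proof (cases "v = w")
    case True thus ?thesis using h(1) by blast
  next
    case False
    obtain a b where "points q = {a, b}" "a \<noteq> b" using points_pair[OF subsetD[OF strandD(2)[OF X] h(2)]] .
    hence "points q = {v, w}" using h False by auto
    thus ?thesis using along_vertical[OF h(1)] along_horizontal[OF h(1)] False by blast
  qed
  have "\<forall>w\<in>points q. \<exists>c. slides m X (p, v) c (q, w)"
  proof (rule strand_induct[OF X p(1), of "\<lambda>q. \<forall>w\<in>points q. \<exists>c. slides m X (p, v) c (q, w)"])
    show "\<forall>w\<in>points p. \<exists>c. slides m X (p, v) c (p, w)" using other[OF stay[OF p]] p by blast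
  next
    fix r q u assume "r \<in> X" "q \<in> X" "\<forall>w\<in>points r. \<exists>c. slides m X (p, v) c (r, w)" "u \<in> points r" "u \<in> points q"
    then obtain c where "slides m X (p, v) c (q, u)" using common_end by blast
    thus "\<forall>w\<in>points q. \<exists>c. slides m X (p, v) c (q, w)"
      using other \<open>q \<in> X\<close> \<open>u \<in> points q\<close> by blast
  qed (use q in auto)
  thus ?thesis using q by blast
qed

lemma finite_boundary: "X \<subseteq> P \<Longrightarrow> finite (boundary L X)"
  using finite_pts unfolding boundary_def by simp

text \<open>
  A connected graph with \<open>e\<close> edges has at most \<open>e + 1\<close> vertices: a new
  piece of a growing connected part adds at most one point.
\<close>

lemma card_pts_le:
  assumes X: "X \<in> strands P"
  shows "card (pts X) \<le> card X + 1"
proof -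
  note D = strandD[OF X]
  define F where "F = {Y. Y \<subseteq> X \<and> Y \<noteq> {} \<and> card (pts Y) \<le> card Y + 1}"
  have finX: "finite X" using finite_sub D by auto
  hence finF: "finite F" unfolding F_def by (auto intro: finite_subset[of _ "Pow X"])
  obtain p where p: "p \<in> X" using D by auto
  hence "{p} \<in> F" using points_card[of p] D by (auto simp: F_def pts_def)
  then obtain Y where Y: "Y \<in> F" "\<And>Z. Z \<in> F \<Longrightarrow> Y \<subseteq> Z \<Longrightarrow> Y = Z"
    using finite_has_maximal[OF finF] by auto
  have "Y = X"
  proof (rule strand_minimal[OF X])
    show "Y \<subseteq> X" "Y \<noteq> {}" using Y by (auto simp: F_def)
    show "share_closed P Y"
      unfolding share_closed_def
    proof (intro ballI impI)
      fix p q assume pq: "p \<in> Y" "q \<in> P" "points p \<inter> points q \<noteq> {}"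
      hence qX: "q \<in> X" using D(3) \<open>Y \<subseteq> X\<close> unfolding share_closed_def by blast
      show "q \<in> Y"
      proof (rule ccontr)
        assume q: "q \<notin> Y"
        obtain v where v: "v \<in> points p" "v \<in> points q" using pq by auto
        obtain a b where ab: "points q = {a, b}" using points_pair[OF pq(2)] .
        have finY: "finite Y" "finite (pts Y)" using \<open>Y \<subseteq> X\<close> finX finite_subset finite_pts D by blast+
        have "v \<in> pts Y" "pts (insert q Y) = {a, b} \<union> pts Y" "v = a \<or> v = b"
          using v ab pq(1) by (auto simp: pts_def)
        then obtain w where w: "pts (insert q Y) \<subseteq> insert w (pts Y)"
          by (metis Un_insert_left insert_absorb insert_commute order_refl sup_bot_left)
        have "card (pts (insert q Y)) \<le> card (insert w (pts Y))" using card_mono[OF _ w] finY by auto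
        also have "\<dots> \<le> card (pts Y) + 1" using finY by (simp add: card_insert_if)
        finally have "insert q Y \<in> F" using Y(1) q finY qX by (auto simp: F_def)
        thus False using Y(2)[of "insert q Y"] q by auto
      qed
    qed
  qed
  thus ?thesis using Y by (auto simp: F_def)
qed

text \<open>
  A point in an inner row is an end of one piece of the layer above and of one piece of the layer
  below.
\<close>

lemma degree:
  assumes X: "X \<in> strands P" and v: "v \<in> pts X" and L: "L \<ge> 1"
  shows "card {p \<in> X. v \<in> points p} = (if fst v = 0 \<or> fst v = L then 1 else 2)"
proof -
  note D = strandD[OF X]
  obtain p0 where p0: "p0 \<in> X" "v \<in> points p0" using v by (auto simp: pts_def)
  have r: "fst v \<le> L" using points_rows[of p0 v] subsetD[OF D(2) p0(1)] p0(2) by (auto simp: piece_iff)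
  have lay: "\<exists>a. {p \<in> X. v \<in> points p \<and> fst p = t} = {(t, a)}" if h: "t < L" "fst v = t \<or> fst v = Suc t" for t
  proof -
    obtain a where a: "(t, a) \<in> X" "v \<in> points (t, a)" using pts_layer[OF D(2,3) h(1) v h(2)] .
    have uniq: "p = (t, a)" if "p \<in> X" "v \<in> points p" "fst p = t" for p
      by (rule piece_unique[of p "(t, a)" v]) (use a that D in auto)
    have "{p \<in> X. v \<in> points p \<and> fst p = t} = {(t, a)}"
    proof (intro set_eqI iffI)
      fix p assume "p \<in> {p \<in> X. v \<in> points p \<and> fst p = t}"
      hence "p = (t, a)" by (intro uniq) simp_all
      thus "p \<in> {(t, a)}" by simp
    qed (use a in simp)
    thus ?thesis by blast
  qed
  have rows: "fst v = fst p \<or> fst v = Suc (fst p)" "fst p < L" if "p \<in> X" "v \<in> points p" for p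
    using points_rows[of p v] subsetD[OF D(2) that(1)] that(2) by (auto simp: piece_iff)
  consider "fst v = 0" | "fst v = L" "L \<noteq> 0" | "0 < fst v" "fst v < L" using r by linarith
  thus ?thesis
  proof cases
    case 1
    hence "{p \<in> X. v \<in> points p} = {p \<in> X. v \<in> points p \<and> fst p = 0}" using rows by fastforce
    hence "\<exists>a. {p \<in> X. v \<in> points p} = {(0, a)}" using lay[of 0] 1 L by simp
    thus ?thesis using 1 by (elim exE) simp
  next
    case 2
    hence "{p \<in> X. v \<in> points p} = {p \<in> X. v \<in> points p \<and> fst p = L - 1}" using rows by fastforce
    hence "\<exists>a. {p \<in> X. v \<in> points p} = {(L - 1, a)}" using lay[of "L - 1"] 2 by simp
    thus ?thesis using 2 by (elim exE) simp
  next
    case 3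
    hence e: "{p \<in> X. v \<in> points p} = {p \<in> X. v \<in> points p \<and> fst p = fst v} \<union> {p \<in> X. v \<in> points p \<and> fst p = fst v - 1}"
      using rows by fastforce
    obtain a where a: "{p \<in> X. v \<in> points p \<and> fst p = fst v} = {(fst v, a)}"
      using lay[of "fst v"] 3 by blast
    have "\<exists>b. {p \<in> X. v \<in> points p \<and> fst p = fst v - 1} = {(fst v - 1, b)}"
      using lay[of "fst v - 1"] 3 by simp
    then obtain b where b: "{p \<in> X. v \<in> points p \<and> fst p = fst v - 1} = {(fst v - 1, b)}" ..
    have "fst v - 1 \<noteq> fst v" using 3 by linarith
    thus ?thesis unfolding e a b using 3 by (simp add: card_insert_if)
  qed
qed

text \<open>
  Counting ends of pieces, the number of points is the number of pieces plus half the size of the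
  boundary. By \<open>card_pts_le\<close> the boundary has at most two points, and its size is
  even.
\<close>

lemma boundary_card:
  assumes X: "X \<in> strands P" and L: "L \<ge> 1"
  shows "boundary L X = {} \<or> card (boundary L X) = 2"
proof -
  note D = strandD[OF X]
  have fin: "finite X" "finite (pts X)" using finite_sub finite_pts D by auto
  have "(\<Sum>p\<in>X. card (points p)) = (\<Sum>p\<in>X. 2)"
    by (rule sum.cong[OF refl]) (rule points_card[OF subsetD[OF D(2)]])
  hence "2 * card X = (\<Sum>p\<in>X. card (points p))" by simp
  also have "\<dots> = (\<Sum>p\<in>X. card {v \<in> pts X. v \<in> points p})"
    by (rule sum.cong) (auto simp: pts_def intro!: arg_cong[where f = card])
  also have "\<dots> = (\<Sum>v\<in>pts X. card {p \<in> X. v \<in> points p})"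
    using sum.swap_restrict[OF fin, of "\<lambda>_ _. 1::nat" "\<lambda>p v. v \<in> points p"] by (simp only: card_eq_sum)
  also have "\<dots> = (\<Sum>v\<in>pts X. if fst v = 0 \<or> fst v = L then 1 else 2)"
    by (rule sum.cong) (use degree[OF X _ L] in auto)
  also have "\<dots> + card (boundary L X) = 2 * card (pts X)"
  proof -
    have "card (boundary L X) = (\<Sum>v\<in>pts X. if fst v = 0 \<or> fst v = L then 1 else 0)"
      using fin by (simp add: boundary_def sum.If_cases Int_def)
    hence "(\<Sum>v\<in>pts X. if fst v = 0 \<or> fst v = L then 1 else 2) + card (boundary L X) =
      (\<Sum>v\<in>pts X. (if fst v = 0 \<or> fst v = L then 1 else 2) + (if fst v = 0 \<or> fst v = L then 1 else 0))"
      by (simp only: sum.distrib)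
    also have "\<dots> = (\<Sum>v\<in>pts X. 2)" by (rule sum.cong) auto
    finally show ?thesis by simp
  qed
  finally have "2 * card X + card (boundary L X) = 2 * card (pts X)" .
  hence "card (boundary L X) = 0 \<or> card (boundary L X) = 2" using card_pts_le[OF X] by presburger
  thus ?thesis using finite_boundary D by auto
qed

end

section \<open>Composition by signed sums\<close>

definition outer :: "vertex \<Rightarrow> vertex" where
  "outer v = (if fst v = 0 then 0 else 1, snd v)"

definition strand_arc :: "nat \<Rightarrow> nat \<Rightarrow> piece set \<Rightarrow> vertex arc" where
  "strand_arc m L X = Arc (outer ` boundary L X) (nat (strand_weight X mod int m)) (strand_blobs X)"

abbreviation strand_cycle :: "nat \<Rightarrow> piece set \<Rightarrow> nat \<times> nat" where
  "strand_cycle m \<equiv> \<lambda>X. (nat (strand_weight X mod int m), strand_blobs X)"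

text \<open>Composition with the signed sum in place of the sliding of dots.\<close>

definition compose_layers :: "nat \<Rightarrow> nat \<Rightarrow> (nat \<Rightarrow> vertex arc set) \<Rightarrow> (nat \<times> nat) multiset \<Rightarrow> tangle" where
  "compose_layers m L A Z = Diagram
     (strand_arc m L ` {X \<in> strands (layers L A). boundary L X \<noteq> {}})
     (Z + image_mset (strand_cycle m)
       (mset_set {X \<in> strands (layers L A). boundary L X = {}}))"

lemma card_pair:
  assumes "x \<noteq> y"
  shows "card {u \<in> {x, y}. Q u} = of_bool (Q x) + of_bool (Q y)"
proof -
  have "{u \<in> {x, y}. Q u} = (if Q x then {x} else {}) \<union> (if Q y then {y} else {})" by auto
  thus ?thesis using assms by simp
qed

lemma left_count_pair:
  assumes "v \<in> vertices n" "v' \<in> vertices n" "w \<in> vertices n" "w \<noteq> v" "w \<noteq> v'"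
    and lt: "frame_pos n v < frame_pos n v'"
  shows "odd (left_count {v, v'} w) \<longleftrightarrow> frame_pos n v < frame_pos n w \<and> frame_pos n w < frame_pos n v'"
proof -
  have "v \<noteq> v'" using lt by blast
  hence c: "odd (left_count {v, v'} w) \<longleftrightarrow>
    (fst v = fst w \<and> snd v < snd w) \<noteq> (fst v' = fst w \<and> snd v' < snd w)"
    using card_pair[of v v' "\<lambda>u. fst u = fst w \<and> snd u < snd w"] by (auto simp: left_count_def)
  have p: "frame_pos n w \<noteq> frame_pos n v" "frame_pos n w \<noteq> frame_pos n v'"
    using assms(1-5) inj_onD[OF frame_pos_inj] by blast+
  have x: "fst x = fst w \<and> snd x < snd w \<longleftrightarrow>
    (if fst w = 0 then frame_pos n x < frame_pos n w else frame_pos n w < frame_pos n x)"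
    if "x \<in> vertices n" for x
    using that assms(3) by (cases x; cases w) (auto simp: vertices_iff frame_pos_def)
  show ?thesis unfolding c x[OF assms(1)] x[OF assms(2)] using p lt by (simp split: if_splits) linarith+
qed

context layered
begin

lemma pts_rows: "X \<subseteq> P \<Longrightarrow> v \<in> pts X \<Longrightarrow> fst v \<le> L \<and> 1 \<le> snd v \<and> snd v \<le> n"
proof -
  assume "X \<subseteq> P" "v \<in> pts X"
  then obtain p where p: "p \<in> P" "v \<in> points p" by (auto simp: pts_def)
  thus ?thesis using points_rows[OF p] by (auto simp: piece_iff)
qed

lemma pts_strand_unique:
  assumes "X \<in> strands P" "Y \<in> strands P" "v \<in> pts X" "v \<in> pts Y"
  shows "X = Y"
proof -
  obtain p q where "p \<in> X" "v \<in> points p" "q \<in> Y" "v \<in> points q" using assms by (auto simp: pts_def)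
  thus ?thesis using strand_unique_point[OF assms(1,2)] by simp
qed

lemma strand_through:
  assumes "fst v \<le> L" "1 \<le> snd v" "snd v \<le> n" "L \<ge> 1"
  obtains X where "X \<in> strands P" "v \<in> pts X"
proof -
  define t where "t = (if fst v = 0 then 0 else fst v - 1)"
  have t: "t < L" "fst v = t \<or> fst v = Suc t" using assms by (auto simp: t_def)
  obtain a where a: "(t, a) \<in> P" "v \<in> points (t, a)" using piece_at[OF t assms(2,3)] .
  then obtain X where "X \<in> strands P" "(t, a) \<in> X" using strand_exists by blast
  thus ?thesis using that[of X] a by (auto simp: pts_def)
qed

text \<open>
  A strand stays on one side of every other strand: the parity of the number of points of
  \<open>X\<close> to the left is constant along \<open>Y\<close>, as no piece of \<open>Y\<close>
  belongs to \<open>X\<close>.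
\<close>

lemma colour_constant:
  assumes X: "X \<in> strands P" and Y: "Y \<in> strands P" and ne: "X \<noteq> Y" and y: "y \<in> pts Y" "y' \<in> pts Y"
  shows "even (left_count (pts X) y + left_count (pts X) y')"
proof -
  obtain p q where p: "p \<in> Y" "y \<in> points p" and q: "q \<in> Y" "y' \<in> points q" using y by (auto simp: pts_def)
  have one: "even (left_count (pts X) u + left_count (pts X) u')" if h: "p \<in> Y" "u \<in> points p" "u' \<in> points p" for p u u'
  proof (cases "u = u'")
    case False
    have pP: "p \<in> P" using strandD(2)[OF Y] h(1) ..
    obtain a b where "points p = {a, b}" "a \<noteq> b" using points_pair[OF pP] .
    hence "points p = {u, u'}" using h False by auto
    moreover have "p \<notin> X" using strand_unique[OF X Y] h(1) ne by metis
    ultimately show ?thesis using left_count_piece[OF strandD(2,3)[OF X] pP _ False] by simp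
  qed simp
  have "\<forall>u\<in>points q. even (left_count (pts X) y + left_count (pts X) u)"
  proof (rule strand_induct[OF Y p(1), of "\<lambda>q. \<forall>u\<in>points q. even (left_count (pts X) y + left_count (pts X) u)"])
    show "\<forall>u\<in>points p. even (left_count (pts X) y + left_count (pts X) u)" using one[OF p] by simp
  next
    fix r q v assume "r \<in> Y" "q \<in> Y" "\<forall>u\<in>points r. even (left_count (pts X) y + left_count (pts X) u)" "v \<in> points r" "v \<in> points q"
    thus "\<forall>u\<in>points q. even (left_count (pts X) y + left_count (pts X) u)" using one[of q v]
      by (metis even_add)
  qed (rule q(1))
  thus ?thesis using q by simp
qed

lemma outer_inj: "inj_on outer {v. fst v = 0 \<or> fst v = L}"
  by (auto simp: inj_on_def outer_def prod_eq_iff split: if_splits)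

lemma outer_inj_boundary: "inj_on outer (boundary L X)"
  by (rule inj_on_subset[OF outer_inj]) (auto simp: boundary_def)

lemma outer_vertices:
  assumes "X \<subseteq> P" "v \<in> boundary L X"
  shows "outer v \<in> vertices n"
  using pts_rows[OF assms(1), of v] assms(2) by (auto simp: outer_def vertices_def boundary_def)

lemma left_count_outer:
  assumes X: "X \<subseteq> P" and v: "fst v = 0 \<or> fst v = L"
  shows "left_count (outer ` boundary L X) (outer v) = left_count (pts X) v"
proof -
  have "{u \<in> outer ` boundary L X. fst u = fst (outer v) \<and> snd u < snd (outer v)} =
    outer ` {u \<in> pts X. fst u = fst v \<and> snd u < snd v}" (is "?l = outer ` ?r")
  proof (intro equalityI subsetI)
    fix u assume "u \<in> ?l"
    then obtain x where x: "x \<in> boundary L X" "u = outer x" "fst (outer x) = fst (outer v)" "snd x < snd v"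
      by (force simp: outer_def)
    moreover have "fst x = fst v" using x(1,3) v by (auto simp: outer_def boundary_def split: if_splits)
    ultimately have "x \<in> ?r" by (simp add: boundary_def)
    thus "u \<in> outer ` ?r" using x(2) by blast
  next
    fix u assume "u \<in> outer ` ?r"
    then obtain x where x: "x \<in> pts X" "fst x = fst v" "snd x < snd v" "u = outer x" by blast
    hence "x \<in> boundary L X" using v by (simp add: boundary_def)
    hence "u \<in> outer ` boundary L X" using x(4) by blast
    moreover have "fst u = fst (outer v)" "snd u < snd (outer v)" using x by (simp_all add: outer_def)
    ultimately show "u \<in> ?l" by simp
  qed
  moreover have "inj_on outer ?r" by (auto simp: inj_on_def outer_def prod_eq_iff)
  ultimately show ?thesis by (simp add: left_count_def card_image)
qed

lemma strand_arc_same: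
  assumes X: "X \<in> strands P" and Y: "Y \<in> strands P" and v: "v \<in> ends (strand_arc m L X)" "v \<in> ends (strand_arc m L Y)"
  shows "X = Y"
proof -
  obtain x y where xy: "x \<in> boundary L X" "v = outer x" "y \<in> boundary L Y" "v = outer y"
    using v by (auto simp: strand_arc_def)
  hence "x = y" using inj_onD[OF outer_inj, of x y] by (simp add: boundary_def)
  thus ?thesis using pts_strand_unique[OF X Y, of x] xy by (simp add: boundary_def)
qed

lemma strand_arc_ends:
  assumes X: "X \<in> strands P" "boundary L X \<noteq> {}" and L: "L \<ge> 1"
  shows "ends (strand_arc m L X) \<subseteq> vertices n" "card (ends (strand_arc m L X)) = 2"
proof -
  note D = strandD(2)[OF X(1)]
  show "ends (strand_arc m L X) \<subseteq> vertices n" using outer_vertices[OF D] by (auto simp: strand_arc_def)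
  show "card (ends (strand_arc m L X)) = 2"
    using boundary_card[OF X(1) L] X(2) outer_inj_boundary by (simp add: strand_arc_def card_image)
qed

text \<open>
  The parity of \<open>left_count\<close> with respect to \<open>X\<close>, computed from the two
  boundary points of \<open>X\<close> alone, tells whether a boundary point lies between them on
  the frame.
\<close>

lemma strand_arc_inside:
  assumes X: "X \<in> strands P" "boundary L X \<noteq> {}" and Y: "Y \<in> strands P" and ne: "X \<noteq> Y" and L: "L \<ge> 1"
    and y: "y \<in> boundary L Y"
  shows "odd (left_count (pts X) y) \<longleftrightarrow> lo (frame_pos n) (strand_arc m L X) < frame_pos n (outer y)
    \<and> frame_pos n (outer y) < hi (frame_pos n) (strand_arc m L X)"
proof -
  let ?a = "strand_arc m L X"
  have e: "ends ?a \<subseteq> vertices n" "card (ends ?a) = 2" using strand_arc_ends[OF X L] by auto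
  obtain v w where vw: "ends ?a = {v, w}" "v \<noteq> w" using e(2) by (auto simp: card_2_iff)
  have V: "v \<in> vertices n" "w \<in> vertices n" using e vw by auto
  have "frame_pos n v \<noteq> frame_pos n w" using frame_pos_inj[of n] V vw(2) by (auto simp: inj_on_def)
  then obtain v w where vw: "ends ?a = {v, w}" "frame_pos n v < frame_pos n w" "v \<in> vertices n" "w \<in> vertices n"
  proof (cases "frame_pos n v < frame_pos n w")
    case True thus ?thesis using that[OF vw(1) _ V] by simp
  next
    case False
    hence "frame_pos n w < frame_pos n v" using \<open>frame_pos n v \<noteq> frame_pos n w\<close> by simp
    thus ?thesis using that[of w v] vw(1) V by (simp add: insert_commute)
  qed
  have yv: "outer y \<in> vertices n" using outer_vertices[OF strandD(2)[OF Y] y] .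
  have "outer y \<in> ends (strand_arc m L Y)" using y by (simp add: strand_arc_def)
  hence "outer y \<notin> ends ?a" using strand_arc_same[OF X(1) Y] ne by metis
  hence "outer y \<noteq> v" "outer y \<noteq> w" using vw by auto
  note c = left_count_pair[OF vw(3,4) yv this vw(2)]
  have "left_count (pts X) y = left_count (ends ?a) (outer y)"
    using left_count_outer[OF strandD(2)[OF X(1)], of y] y by (simp add: strand_arc_def boundary_def)
  thus ?thesis using c lo_hi_pair[OF vw(1,2)] vw(1) by simp
qed

text \<open>
  By \<open>colour_constant\<close> both ends of \<open>Y\<close> have the same parity with
  respect to \<open>X\<close>, so they lie both between the ends of \<open>X\<close> or both
  outside.
\<close>

lemma strand_arc_not_crosses:
  assumes X: "X \<in> strands P" "boundary L X \<noteq> {}" and Y: "Y \<in> strands P" "boundary L Y \<noteq> {}" and L: "L \<ge> 1"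
  shows "\<not> crosses (frame_pos n) (strand_arc m L X) (strand_arc m L Y)"
proof
  assume c: "crosses (frame_pos n) (strand_arc m L X) (strand_arc m L Y)"
  hence ne: "X \<noteq> Y" by (auto simp: crosses_def)
  let ?b = "strand_arc m L Y"
  have e: "ends ?b \<subseteq> vertices n" "card (ends ?b) = 2" using strand_arc_ends[OF Y L] by auto
  have fin: "finite (frame_pos n ` ends ?b)" "frame_pos n ` ends ?b \<noteq> {}" using finite_subset[OF e(1)] e(2) by auto
  obtain u where u: "u \<in> ends ?b" "lo (frame_pos n) ?b = frame_pos n u" using Min_in[OF fin] by (auto simp: lo_def)
  obtain u' where u': "u' \<in> ends ?b" "hi (frame_pos n) ?b = frame_pos n u'" using Max_in[OF fin] by (auto simp: hi_def)
  obtain y where y: "y \<in> boundary L Y" "u = outer y" using u by (auto simp: strand_arc_def)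
  obtain y' where y': "y' \<in> boundary L Y" "u' = outer y'" using u' by (auto simp: strand_arc_def)
  have "odd (left_count (pts X) y)"
    using strand_arc_inside[OF X Y(1) ne L y(1), of m] c u(2) y(2) by (simp add: crosses_def)
  moreover have "even (left_count (pts X) y')"
    using strand_arc_inside[OF X Y(1) ne L y'(1), of m] c u'(2) y'(2) by (simp add: crosses_def)
  moreover have "even (left_count (pts X) y + left_count (pts X) y')"
    using colour_constant[OF X(1) Y(1) ne] y(1) y'(1) by (simp add: boundary_def)
  ultimately show False by simp
qed

text \<open>
  An enclosed strand has odd parity with respect to the enclosing one, and the points of exposed
  pieces have even parity. This keeps blobs exposed under composition.
\<close>

lemma strand_arc_enclosed:
  assumes X: "X \<in> strands P" "boundary L X \<noteq> {}" and Y: "Y \<in> strands P" "boundary L Y \<noteq> {}" and L: "L \<ge> 1"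
    and enc: "encloses (frame_pos n) (strand_arc m L X) (strand_arc m L Y)" and p: "(t, a) \<in> Y"
  shows "\<exists>b\<in>A t. encloses (frame_pos n) b a"
proof (rule ccontr)
  assume ex: "\<not> (\<exists>b\<in>A t. encloses (frame_pos n) b a)"
  have ne: "X \<noteq> Y" using enc by (auto simp: encloses_def)
  let ?b = "strand_arc m L Y"
  have e: "ends ?b \<subseteq> vertices n" "card (ends ?b) = 2" using strand_arc_ends[OF Y L] by auto
  have fin: "finite (frame_pos n ` ends ?b)" "frame_pos n ` ends ?b \<noteq> {}" using finite_subset[OF e(1)] e(2) by auto
  obtain u where u: "u \<in> ends ?b" "lo (frame_pos n) ?b = frame_pos n u" using Min_in[OF fin] by (auto simp: lo_def)
  have "lo (frame_pos n) ?b \<le> hi (frame_pos n) ?b" unfolding lo_def hi_def using fin by (simp add: Min_le_iff)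
  hence "frame_pos n u < hi (frame_pos n) (strand_arc m L X)" using enc u(2) by (simp add: encloses_def)
  obtain y where y: "y \<in> boundary L Y" "u = outer y" using u by (auto simp: strand_arc_def)
  have odd: "odd (left_count (pts X) y)"
    using strand_arc_inside[OF X Y(1) ne L y(1), of m] enc u(2) y(2) \<open>frame_pos n u < _\<close> by (simp add: encloses_def)
  have pP: "(t, a) \<in> P" using strandD(2)[OF Y(1)] p ..
  have "(t, a) \<notin> X" using strand_unique[OF X(1) Y(1) _ p] ne by metis
  moreover obtain v where v: "v \<in> points (t, a)" using points_ne[OF pP] by auto
  ultimately have "even (left_count (pts X) v)"
    using left_count_exposed_piece[OF strandD(2,3)[OF X(1)] pP _ v] ex by simp
  moreover have "v \<in> pts Y" using v p by (auto simp: pts_def)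
  ultimately show False using colour_constant[OF X(1) Y(1) ne, of y v] odd y(1) by (simp add: boundary_def)
qed

lemma planar_compose_layers:
  assumes L: "L \<ge> 1"
  shows "planar_matching n (arcs (compose_layers m L A Z))"
  unfolding planar_matching_def
proof (intro conjI ballI)
  fix a assume "a \<in> arcs (compose_layers m L A Z)"
  then obtain X where X: "X \<in> strands P" "boundary L X \<noteq> {}" "a = strand_arc m L X"
    by (auto simp: compose_layers_def)
  show "ends a \<subseteq> vertices n" "card (ends a) = 2" using strand_arc_ends[OF X(1,2) L] X(3) by simp_all
  fix b assume "b \<in> arcs (compose_layers m L A Z)"
  then obtain Y where Y: "Y \<in> strands P" "boundary L Y \<noteq> {}" "b = strand_arc m L Y"
    by (auto simp: compose_layers_def)
  show "\<not> crosses (frame_pos n) a b" using strand_arc_not_crosses[OF X(1,2) Y(1,2) L] X(3) Y(3) by simp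
next
  fix v assume v: "v \<in> vertices n"
  define v' where "v' = (if fst v = 0 then 0 else L, snd v)"
  have "fst v' \<le> L" "1 \<le> snd v'" "snd v' \<le> n" using v by (auto simp: v'_def vertices_def)
  then obtain X where X: "X \<in> strands P" "v' \<in> pts X" using strand_through L by metis
  have b: "v' \<in> boundary L X" using X by (simp add: boundary_def v'_def)
  have o: "outer v' = v" using L v by (auto simp: v'_def outer_def vertices_def prod_eq_iff)
  have in_arc: "v \<in> ends (strand_arc m L X)" using b o by (force simp: strand_arc_def)
  show "\<exists>!a. a \<in> arcs (compose_layers m L A Z) \<and> v \<in> ends a"
  proof (rule ex1I[of _ "strand_arc m L X"])
    show "strand_arc m L X \<in> arcs (compose_layers m L A Z) \<and> v \<in> ends (strand_arc m L X)"
      using in_arc X(1) b by (auto simp: compose_layers_def)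
  next
    fix a assume a: "a \<in> arcs (compose_layers m L A Z) \<and> v \<in> ends a"
    then obtain Y where Y: "Y \<in> strands P" "a = strand_arc m L Y" by (auto simp: compose_layers_def)
    thus "a = strand_arc m L X" using strand_arc_same[OF Y(1) X(1), of v m] a in_arc by simp
  qed
qed

lemma base_dir:
  assumes X: "X \<subseteq> P" "share_closed P X" and p: "p \<in> X" and v: "v \<in> points p"
    and left: "\<And>u. u \<in> points p \<Longrightarrow> fst u = fst v \<Longrightarrow> snd v \<le> snd u"
  shows "dir (pts X) (base_point (points p)) = dir (pts X) v"
proof (cases "base_point (points p) = v")
  case False
  have pP: "p \<in> P" using X p by blast
  note fp = finite_points[OF pP] points_ne[OF pP]
  note b = base_point_in[OF fp] base_point_left[OF fp]
  have pair: "Q = {c, v}" if "card Q = 2" "c \<in> Q" "v \<in> Q" "c \<noteq> v" for Q :: "vertex set" and c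
    using that by (auto simp: card_2_iff)
  have e: "points p = {base_point (points p), v}" using pair[OF points_card[OF pP] b(1) v False] .
  have "fst (base_point (points p)) \<noteq> fst v"
    using left[OF b(1)] b(2)[OF v] False by (auto simp: prod_eq_iff)
  thus ?thesis using dir_piece[OF X p e False] by simp
qed simp

end

context layered
begin

text \<open>
  The coefficients chosen in \<open>strand_dots\<close> are congruent to the signs: the strand
  base is leftmost in its row, so its sign is \<open>1\<close>.
\<close>

lemma strand_dots_weight:
  assumes L: "L = 2" and X: "X \<in> strands P" and m: "m \<ge> 1"
  shows "int (strand_dots m X) = strand_weight X mod int m"
proof -
  note D = strandD[OF X]
  obtain p0 where p0: "p0 \<in> X" using D(1) by blast
  hence "points p0 \<noteq> {}" using points_ne D(2) by blast
  hence fin: "finite (pts X)" "pts X \<noteq> {}" using finite_pts[OF D(2)] p0 unfolding pts_def by blast+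
  have fe: "free_ends X = boundary L X"
  proof -
    have "fst v \<noteq> 1 \<longleftrightarrow> fst v = 0 \<or> fst v = 2" if "v \<in> pts X" for v
      using pts_rows[OF D(2) that] L by auto
    thus ?thesis by (auto simp: free_ends_def boundary_def pts_def L)
  qed
  have base: "strand_base X \<in> pts X \<and> dir (pts X) (strand_base X) = 1"
  proof (cases "free_ends X = {}")
    case True
    hence e: "strand_base X = base_point (pts X)" by (simp add: strand_base_def pts_def)
    show ?thesis unfolding e using base_point_in[OF fin] base_point_left[OF fin] by (auto intro!: dir_leftmost)
  next
    case False
    hence e: "strand_base X = base_point (free_ends X)" by (simp add: strand_base_def)
    have sub: "free_ends X \<subseteq> pts X" by (auto simp: free_ends_def pts_def)
    have fin': "finite (free_ends X)" "free_ends X \<noteq> {}" using finite_subset[OF sub] fin False by auto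
    have b: "base_point (free_ends X) \<in> free_ends X" using base_point_in[OF fin'] .
    have "snd (base_point (free_ends X)) \<le> snd u" if "u \<in> pts X" "fst u = fst (base_point (free_ends X))" for u
    proof -
      have "u \<in> free_ends X" using that b by (auto simp: free_ends_def pts_def)
      thus ?thesis using base_point_left[OF fin'] that by simp
    qed
    thus ?thesis unfolding e using b sub by (auto intro!: dir_leftmost)
  qed
  then obtain q0 where q0: "q0 \<in> X" "strand_base X \<in> points q0" by (auto simp: pts_def)
  let ?c = "\<lambda>p. SOME c. \<exists>q. slides m X (p, base_point (points p)) c (q, strand_base X)"
  have c: "int m dvd int (?c p) - dir (pts X) (base_point (points p))" if p: "p \<in> X" for p
  proof -
    have pP: "p \<in> P" using D(2) p ..
    have "base_point (points p) \<in> points p" using base_point_in[OF finite_points[OF pP] points_ne[OF pP]] .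
    hence "\<exists>c q. slides m X (p, base_point (points p)) c (q, strand_base X)"
      using slides_exist[OF X p _ q0] by blast
    hence "\<exists>q. slides m X (p, base_point (points p)) (?c p) (q, strand_base X)"
      by (rule someI_ex)
    then obtain q where "slides m X (p, base_point (points p)) (?c p) (q, strand_base X)" ..
    from slides_dir[OF X m this] show ?thesis using base by simp
  qed
  have "int m dvd (\<Sum>p\<in>X. (int (?c p) - dir (pts X) (base_point (points p))) * int (dots (snd p)))"
    by (rule dvd_sum) (use c in simp)
  also have "\<dots> = int (\<Sum>p\<in>X. ?c p * dots (snd p)) - strand_weight X"
    by (simp add: strand_weight_def sum_subtractf left_diff_distrib)
  finally have "int (\<Sum>p\<in>X. ?c p * dots (snd p)) mod int m = strand_weight X mod int m"
    by (simp add: mod_eq_dvd_iff)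
  thus ?thesis unfolding strand_dots_def by (simp only: zmod_int)
qed

end

abbreviation two_layers :: "tangle \<Rightarrow> tangle \<Rightarrow> nat \<Rightarrow> vertex arc set" where
  "two_layers G1 G2 \<equiv> \<lambda>t. if t = 0 then arcs G1 else arcs G2"

lemma compose_two_layers:
  assumes "planar_matching n (arcs G1)" "planar_matching n (arcs G2)" and m: "m \<ge> 1"
  shows "compose m G1 G2 = compose_layers m 2 (two_layers G1 G2) (cycles G1 + cycles G2)"
proof -
  interpret layered n 2 "two_layers G1 G2" by standard (use assms in simp)
  have w: "strand_dots m X = nat (strand_weight X mod int m)" if "X \<in> strands P" for X
    using strand_dots_weight[OF refl that m] by simp
  have fe: "free_ends X = boundary 2 X" if "X \<in> strands P" for X
  proof -
    have "fst v \<noteq> 1 \<longleftrightarrow> fst v = 0 \<or> fst v = 2" if v: "v \<in> pts X" for v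
      using pts_rows[OF strandD(2)[OF \<open>X \<in> strands P\<close>] v] by auto
    thus ?thesis by (auto simp: free_ends_def boundary_def pts_def)
  qed
  have out: "(\<lambda>(r, i). (r div 2, i)) ` free_ends X = outer ` boundary 2 X" if "X \<in> strands P" for X
    unfolding fe[OF that] by (rule image_cong) (auto simp: outer_def boundary_def)
  have arc: "Arc ((\<lambda>(r, i). (r div 2, i)) ` free_ends X) (strand_dots m X) (strand_blobs X) = strand_arc m 2 X"
    if "X \<in> strands P" for X using w[OF that] out[OF that] by (simp add: strand_arc_def)
  show ?thesis
    unfolding compose_def compose_layers_def stack_layers diagram.inject
  proof (intro conjI)
    show "{Arc ((\<lambda>(r, i). (r div 2, i)) ` free_ends S) (strand_dots m S) (strand_blobs S) |S.
       S \<in> strands P \<and> free_ends S \<noteq> {}} = strand_arc m 2 ` {X \<in> strands P. boundary 2 X \<noteq> {}}"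
    proof (intro set_eqI iffI)
      fix a assume "a \<in> {Arc ((\<lambda>(r, i). (r div 2, i)) ` free_ends S) (strand_dots m S) (strand_blobs S) |S.
       S \<in> strands P \<and> free_ends S \<noteq> {}}"
      then obtain S where S: "S \<in> strands P" "free_ends S \<noteq> {}"
        "a = Arc ((\<lambda>(r, i). (r div 2, i)) ` free_ends S) (strand_dots m S) (strand_blobs S)" by blast
      thus "a \<in> strand_arc m 2 ` {X \<in> strands P. boundary 2 X \<noteq> {}}"
        unfolding S(3) arc[OF S(1)] using S(1,2) fe[OF S(1)] by (intro imageI) simp
    next
      fix a assume "a \<in> strand_arc m 2 ` {X \<in> strands P. boundary 2 X \<noteq> {}}"
      then obtain S where S: "S \<in> strands P" "boundary 2 S \<noteq> {}" "a = strand_arc m 2 S" by blast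
      thus "a \<in> {Arc ((\<lambda>(r, i). (r div 2, i)) ` free_ends S) (strand_dots m S) (strand_blobs S) |S.
       S \<in> strands P \<and> free_ends S \<noteq> {}}"
        unfolding S(3) arc[OF S(1), symmetric] using fe[OF S(1)] by blast
    qed
    have "{S \<in> strands P. free_ends S = {}} = {S \<in> strands P. boundary 2 S = {}}"
      by (intro Collect_cong conj_cong refl) (simp add: fe)
    thus "cycles G1 + cycles G2 +
      image_mset (\<lambda>S. (strand_dots m S, strand_blobs S)) (mset_set {S \<in> strands P. free_ends S = {}}) =
      cycles G1 + cycles G2 +
      image_mset (\<lambda>S. (nat (strand_weight S mod int m), strand_blobs S)) (mset_set {S \<in> strands P. boundary 2 S = {}})"
      using w finite_strands[OF finite_P] by (auto intro!: image_mset_cong)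
  qed
qed

section \<open>Top-bottom inversion\<close>

definition flip_vertex :: "vertex \<Rightarrow> vertex" where
  "flip_vertex v = (1 - fst v, snd v)"

definition flip_arc :: "vertex arc \<Rightarrow> vertex arc" where
  "flip_arc a = Arc (flip_vertex ` ends a) (dots a) (blobs a)"

definition flip_row :: "nat \<Rightarrow> vertex \<Rightarrow> vertex" where
  "flip_row L v = (L - fst v, snd v)"

definition flip_piece :: "nat \<Rightarrow> piece \<Rightarrow> piece" where
  "flip_piece L p = (L - 1 - fst p, flip_arc (snd p))"

lemma flip_eq: "flip G = Diagram (flip_arc ` arcs G) (cycles G)"
  by (simp add: flip_def flip_arc_def[abs_def] flip_vertex_def[abs_def] case_prod_unfold)

lemma flip_arc_simps [simp]:
  "ends (flip_arc a) = flip_vertex ` ends a" "dots (flip_arc a) = dots a" "blobs (flip_arc a) = blobs a"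
  by (simp_all add: flip_arc_def)

lemma arcs_flip [simp]: "arcs (flip G) = flip_arc ` arcs G" and cycles_flip [simp]: "cycles (flip G) = cycles G"
  by (simp_all add: flip_eq)

lemma flip_vertex_in: "v \<in> vertices n \<Longrightarrow> flip_vertex v \<in> vertices n"
  by (auto simp: vertices_def flip_vertex_def)

lemma flip_vertex_flip: "v \<in> vertices n \<Longrightarrow> flip_vertex (flip_vertex v) = v"
  by (auto simp: vertices_def flip_vertex_def)

lemma frame_pos_flip: "v \<in> vertices n \<Longrightarrow> frame_pos n (flip_vertex v) = 2 * n + 1 - frame_pos n v"
  by (auto simp: vertices_def flip_vertex_def frame_pos_def)

lemma frame_pos_bound: "v \<in> vertices n \<Longrightarrow> 1 \<le> frame_pos n v \<and> frame_pos n v \<le> 2 * n"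
  by (auto simp: vertices_def frame_pos_def)

lemma flip_vertex_inj: "inj_on flip_vertex (vertices n)"
  by (rule inj_on_inverseI[of _ flip_vertex]) (rule flip_vertex_flip)

lemma filter_image: "(\<And>x. x \<in> S \<Longrightarrow> R (f x) \<longleftrightarrow> R' x) \<Longrightarrow> {y \<in> f ` S. R y} = f ` {x \<in> S. R' x}"
  by auto

context planar
begin

lemma flip_arc_flip: "a \<in> A \<Longrightarrow> flip_arc (flip_arc a) = a"
proof -
  assume a: "a \<in> A"
  have "flip_vertex ` flip_vertex ` ends a = (\<lambda>v. v) ` ends a"
    unfolding image_image by (rule image_cong[OF refl]) (rule flip_vertex_flip[OF subsetD[OF ends_sub[OF a]]])
  thus ?thesis by (cases a) (simp add: flip_arc_def)
qed

lemma flip_arc_inj: "inj_on flip_arc A"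
  by (rule inj_on_inverseI[of _ flip_arc]) (rule flip_arc_flip)

lemma lo_hi_flip:
  assumes "a \<in> A"
  shows "lo pos (flip_arc a) = 2 * n + 1 - hi pos a" "hi pos (flip_arc a) = 2 * n + 1 - lo pos a"
    "lo pos a \<le> 2 * n" "hi pos a \<le> 2 * n"
proof -
  obtain v w where vw: "ends a = {v, w}" "pos v < pos w" "lo pos a = pos v" "hi pos a = pos w"
    "v \<in> vertices n" "w \<in> vertices n" using arc_pair[OF assms] .
  have e: "ends (flip_arc a) = {flip_vertex w, flip_vertex v}" using vw(1) by auto
  have "pos (flip_vertex w) < pos (flip_vertex v)"
    using vw frame_pos_flip frame_pos_bound[OF vw(5)] frame_pos_bound[OF vw(6)] by simp
  from lo_hi_pair[OF e this] show "lo pos (flip_arc a) = 2 * n + 1 - hi pos a" "hi pos (flip_arc a) = 2 * n + 1 - lo pos a"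
    using vw frame_pos_flip by simp_all
  show "lo pos a \<le> 2 * n" "hi pos a \<le> 2 * n" using vw frame_pos_bound by simp_all
qed

lemma encloses_flip: "a \<in> A \<Longrightarrow> b \<in> A \<Longrightarrow> encloses pos (flip_arc b) (flip_arc a) \<longleftrightarrow> encloses pos b a"
  using lo_hi_flip[of a] lo_hi_flip[of b] unfolding encloses_def by linarith

lemma crosses_flip: "a \<in> A \<Longrightarrow> b \<in> A \<Longrightarrow> crosses pos (flip_arc a) (flip_arc b) \<longleftrightarrow> crosses pos b a"
  using lo_hi_flip[of a] lo_hi_flip[of b] unfolding crosses_def by linarith

lemma planar_flip: "planar_matching n (flip_arc ` A)"
  unfolding planar_matching_def
proof (intro conjI ballI)
  fix a' assume "a' \<in> flip_arc ` A"
  then obtain a where a: "a \<in> A" "a' = flip_arc a" by blast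
  show "ends a' \<subseteq> vertices n" using ends_sub[OF a(1)] flip_vertex_in a(2) by auto
  show "card (ends a') = 2"
    using ends_card[OF a(1)] a(2) inj_on_subset[OF flip_vertex_inj ends_sub[OF a(1)]] by (simp add: card_image)
  fix b' assume "b' \<in> flip_arc ` A"
  then obtain b where b: "b \<in> A" "b' = flip_arc b" by blast
  show "\<not> crosses pos a' b'" using crosses_flip[OF a(1) b(1)] not_crosses[OF b(1) a(1)] a(2) b(2) by simp
next
  fix v assume v: "v \<in> vertices n"
  obtain a where a: "a \<in> A" "flip_vertex v \<in> ends a" using arc_exists[OF flip_vertex_in[OF v]] by blast
  have va: "v \<in> flip_vertex ` ends a" using flip_vertex_flip[OF v] a(2) by (metis imageI)
  show "\<exists>!a. a \<in> flip_arc ` A \<and> v \<in> ends a"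
  proof (rule ex1I[of _ "flip_arc a"])
    show "flip_arc a \<in> flip_arc ` A \<and> v \<in> ends (flip_arc a)" using a va by simp
    fix b' assume b': "b' \<in> flip_arc ` A \<and> v \<in> ends b'"
    then obtain b where b: "b \<in> A" "b' = flip_arc b" by blast
    then obtain w where w: "w \<in> ends b" "v = flip_vertex w" using b' by auto
    have "w \<in> vertices n" using ends_sub[OF b(1)] w(1) ..
    hence "flip_vertex v = w" using w(2) flip_vertex_flip by simp
    hence "a = b" using arc_unique[OF a(1) b(1) a(2)] w(1) by simp
    thus "b' = flip_arc a" using b(2) by simp
  qed
qed

end

lemma flip_flip: "planar_matching n (arcs G) \<Longrightarrow> flip (flip G) = G"
proof -
  assume "planar_matching n (arcs G)"
  then interpret planar n "arcs G" by (simp add: planar_def)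
  have "flip_arc ` flip_arc ` arcs G = (\<lambda>a. a) ` arcs G"
    unfolding image_image by (rule image_cong[OF refl]) (rule flip_arc_flip)
  thus ?thesis by (cases G) (simp add: flip_eq)
qed

lemma left_count_flip_row:
  assumes "\<And>u. u \<in> U \<Longrightarrow> fst u \<le> L" "fst v \<le> L"
  shows "left_count (flip_row L ` U) (flip_row L v) = left_count U v"
proof -
  have "{u \<in> flip_row L ` U. fst u = fst (flip_row L v) \<and> snd u < snd (flip_row L v)} =
    flip_row L ` {u \<in> U. fst u = fst v \<and> snd u < snd v}" (is "?l = flip_row L ` ?r")
  proof (intro equalityI subsetI)
    fix u assume "u \<in> ?l"
    then obtain x where x: "x \<in> U" "u = flip_row L x" "L - fst x = L - fst v" "snd x < snd v"
      by (auto simp: flip_row_def)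
    hence "fst x = fst v" using assms(1)[OF x(1)] assms(2) by linarith
    thus "u \<in> flip_row L ` ?r" using x by blast
  next
    fix u assume "u \<in> flip_row L ` ?r"
    then obtain x where x: "x \<in> U" "u = flip_row L x" "fst x = fst v" "snd x < snd v" by blast
    have "u \<in> flip_row L ` U" using x by blast
    moreover have "fst u = fst (flip_row L v)" "snd u < snd (flip_row L v)" using x by (simp_all add: flip_row_def)
    ultimately show "u \<in> ?l" by simp
  qed
  moreover have "inj_on (flip_row L) ?r" by (auto simp: inj_on_def flip_row_def prod_eq_iff)
  ultimately show ?thesis by (simp add: left_count_def card_image)
qed

context layered
begin

lemma points_flip:
  assumes "p \<in> P"
  shows "points (flip_piece L p) = flip_row L ` points p"
proof -
  have t: "fst p < L" "snd p \<in> A (fst p)" using assms by (auto simp: piece_iff)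
  have V: "fst v = 0 \<or> fst v = 1" if "v \<in> ends (snd p)" for v
    using planar.ends_sub[OF planar_at[OF t(1)] t(2)] that by (auto simp: vertices_def)
  have p: "points p = shift (fst p) ` ends (snd p)" using points_shift[of "fst p" "snd p"] by simp
  show ?thesis unfolding p flip_piece_def points_shift flip_arc_simps image_image
  proof (rule image_cong[OF refl])
    fix v assume "v \<in> ends (snd p)"
    from V[OF this] show "shift (L - 1 - fst p) (flip_vertex v) = flip_row L (shift (fst p) v)"
      using t(1) by (auto simp: shift_def flip_vertex_def flip_row_def)
  qed
qed

lemma layers_flip: "layers L (\<lambda>t. flip_arc ` A (L - 1 - t)) = flip_piece L ` P"
proof (intro equalityI subsetI)
  fix p assume "p \<in> layers L (\<lambda>t. flip_arc ` A (L - 1 - t))"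
  then obtain t a where p: "p = (t, flip_arc a)" "t < L" "a \<in> A (L - 1 - t)" by (auto simp: layers_def)
  hence "(L - 1 - t, a) \<in> P" by (auto simp: piece_iff)
  moreover have "p = flip_piece L (L - 1 - t, a)" using p by (simp add: flip_piece_def)
  ultimately show "p \<in> flip_piece L ` P" by blast
next
  fix p assume "p \<in> flip_piece L ` P"
  then obtain q where q: "q \<in> P" "p = flip_piece L q" by blast
  hence "fst q < L" "snd q \<in> A (fst q)" by (simp_all add: piece_iff)
  thus "p \<in> layers L (\<lambda>t. flip_arc ` A (L - 1 - t))" using q(2) by (simp add: flip_piece_def layers_def)
qed

lemma flip_piece_inj: "inj_on (flip_piece L) P"
proof (rule inj_onI)
  fix p q assume h: "p \<in> P" "q \<in> P" "flip_piece L p = flip_piece L q"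
  have t: "fst p < L" "fst q < L" "snd p \<in> A (fst p)" "snd q \<in> A (fst q)" using h by (simp_all add: piece_iff)
  hence e: "fst p = fst q" using h(3) by (simp add: flip_piece_def) arith
  have "flip_arc (snd p) = flip_arc (snd q)" using h(3) by (simp add: flip_piece_def)
  hence "snd p = snd q" using inj_onD[OF planar.flip_arc_inj[OF planar_at[OF t(1)]]] t(3,4) e by simp
  thus "p = q" using e by (simp add: prod_eq_iff)
qed

lemma flip_row_inj: "inj_on (flip_row L) {v. fst v \<le> L}"
  by (auto simp: inj_on_def flip_row_def prod_eq_iff)

lemma pts_flip: "X \<subseteq> P \<Longrightarrow> pts (flip_piece L ` X) = flip_row L ` pts X"
  unfolding pts_def image_image image_UN
  by (rule SUP_cong[OF refl]) (rule points_flip, rule subsetD)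

lemma strands_flip: "strands (flip_piece L ` P) = (`) (flip_piece L) ` strands P"
proof (rule strands_image)
  show "pieces P" ..
  show "inj_on (flip_piece L) P" by (rule flip_piece_inj)
  fix p q assume pq: "p \<in> P" "q \<in> P"
  have "points p \<subseteq> {v. fst v \<le> L}" "points q \<subseteq> {v. fst v \<le> L}"
    using points_rows[OF pq(1)] points_rows[OF pq(2)] pq piece_iff by fastforce+
  hence "flip_row L ` points p \<inter> flip_row L ` points q = flip_row L ` (points p \<inter> points q)"
    using inj_on_image_Int[OF flip_row_inj] by metis
  thus "points (flip_piece L p) \<inter> points (flip_piece L q) \<noteq> {} \<longleftrightarrow> points p \<inter> points q \<noteq> {}"
    using points_flip pq by simp
qed

lemma strand_weight_flip:
  assumes X: "X \<in> strands P"
  shows "strand_weight (flip_piece L ` X) = strand_weight X"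
proof -
  note D = strandD[OF X]
  have "strand_weight (flip_piece L ` X) =
    (\<Sum>p\<in>X. dir (pts (flip_piece L ` X)) (base_point (points (flip_piece L p))) * int (dots (snd (flip_piece L p))))"
    unfolding strand_weight_def by (subst sum.reindex[OF inj_on_subset[OF flip_piece_inj D(2)]]) (simp only: o_def)
  also have "\<dots> = strand_weight X"
    unfolding strand_weight_def
  proof (rule sum.cong[OF refl])
    fix p assume p: "p \<in> X"
    hence pP: "p \<in> P" using D(2) by blast
    define b where "b = base_point (points (flip_piece L p))"
    have fin: "finite (flip_row L ` points p)" "flip_row L ` points p \<noteq> {}"
      using finite_points[OF pP] points_ne[OF pP] by simp_all
    have b: "b \<in> flip_row L ` points p" "\<And>u. u \<in> flip_row L ` points p \<Longrightarrow> fst u = fst b \<Longrightarrow> snd b \<le> snd u"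
      unfolding b_def points_flip[OF pP] using base_point_in[OF fin] base_point_left[OF fin] by blast+
    then obtain v where v: "v \<in> points p" "b = flip_row L v" by blast
    have rows: "fst u \<le> L" if "u \<in> pts X" for u using pts_rows[OF D(2) that] by simp
    have vX: "v \<in> pts X" using v(1) p unfolding pts_def by blast
    have "dir (pts (flip_piece L ` X)) b = dir (pts X) v"
      unfolding pts_flip[OF D(2)] v(2) dir_def using left_count_flip_row[OF rows rows[OF vX]] by simp
    moreover have "dir (pts X) (base_point (points p)) = dir (pts X) v"
    proof (rule base_dir[OF D(2,3) p v(1)])
      fix u assume u: "u \<in> points p" "fst u = fst v"
      have "flip_row L u \<in> flip_row L ` points p" using u(1) by blast
      moreover have "fst (flip_row L u) = fst b" using u(2) v(2) by (simp add: flip_row_def)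
      ultimately have "snd b \<le> snd (flip_row L u)" by (rule b(2))
      thus "snd v \<le> snd u" using v(2) by (simp add: flip_row_def)
    qed
    ultimately show "dir (pts (flip_piece L ` X)) (base_point (points (flip_piece L p))) * int (dots (snd (flip_piece L p)))
      = dir (pts X) (base_point (points p)) * int (dots (snd p))"
      unfolding b_def[symmetric] by (simp add: flip_piece_def)
  qed
  finally show ?thesis .
qed

lemma strand_blobs_flip:
  assumes X: "X \<subseteq> P"
  shows "strand_blobs (flip_piece L ` X) = strand_blobs X"
  unfolding strand_blobs_def by (subst sum.reindex[OF inj_on_subset[OF flip_piece_inj X]]) (simp add: o_def flip_piece_def)

lemma boundary_flip:
  assumes X: "X \<subseteq> P"
  shows "boundary L (flip_piece L ` X) = flip_row L ` boundary L X"
proof -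
  have r: "(fst (flip_row L v) = 0 \<or> fst (flip_row L v) = L) \<longleftrightarrow> (fst v = 0 \<or> fst v = L)" if "v \<in> pts X" for v
    using pts_rows[OF X that] by (auto simp: flip_row_def)
  show ?thesis unfolding boundary_def pts_flip[OF X]
  proof (intro equalityI subsetI)
    fix u assume "u \<in> {v \<in> flip_row L ` pts X. fst v = 0 \<or> fst v = L}"
    then obtain x where "x \<in> pts X" "u = flip_row L x" "fst u = 0 \<or> fst u = L" by blast
    thus "u \<in> flip_row L ` {v \<in> pts X. fst v = 0 \<or> fst v = L}" using r[of x] by blast
  next
    fix u assume "u \<in> flip_row L ` {v \<in> pts X. fst v = 0 \<or> fst v = L}"
    then obtain x where "x \<in> pts X" "u = flip_row L x" "fst x = 0 \<or> fst x = L" by blast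
    hence "u \<in> flip_row L ` pts X" "fst u = 0 \<or> fst u = L" using r[of x] by simp_all
    thus "u \<in> {v \<in> flip_row L ` pts X. fst v = 0 \<or> fst v = L}" by (intro CollectI conjI)
  qed
qed

lemma strand_arc_flip:
  assumes X: "X \<in> strands P" and L: "L \<ge> 1"
  shows "strand_arc m L (flip_piece L ` X) = flip_arc (strand_arc m L X)"
proof -
  note D = strandD(2)[OF X]
  have "outer ` flip_row L ` boundary L X = flip_vertex ` outer ` boundary L X"
    unfolding image_image
  proof (rule image_cong[OF refl])
    fix v assume "v \<in> boundary L X"
    hence "fst v = 0 \<or> fst v = L" by (simp add: boundary_def)
    thus "outer (flip_row L v) = flip_vertex (outer v)"
      using L by (auto simp: outer_def flip_row_def flip_vertex_def)
  qed
  thus ?thesis unfolding strand_arc_def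
    by (simp add: boundary_flip[OF D] strand_weight_flip[OF X] strand_blobs_flip[OF D] flip_arc_def)
qed

text \<open>
  Inversion keeps the left-to-right order in every row, hence all signs. It may move the base
  point of a vertical arc to the other end, where the sign is the same.
\<close>

lemma flip_compose_layers:
  assumes L: "L \<ge> 1"
  shows "compose_layers m L (\<lambda>t. flip_arc ` A (L - 1 - t)) Z = flip (compose_layers m L A Z)"
proof -
  let ?f = "(`) (flip_piece L)"
  have D: "X \<subseteq> P" if "X \<in> strands P" for X using strandD(2)[OF that] .
  have sel: "{X \<in> ?f ` strands P. Q (boundary L X = {})} = ?f ` {X \<in> strands P. Q (boundary L X = {})}" for Q
  proof -
    have "boundary L (?f X) = {} \<longleftrightarrow> boundary L X = {}" if "X \<in> strands P" for X
      using boundary_flip[OF D[OF that]] by simp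
    thus ?thesis by (intro filter_image) simp
  qed
  have inj: "inj_on ?f (strands P)"
    by (rule inj_on_subset[OF inj_on_image_Pow[OF flip_piece_inj]]) (use D in blast)
  have "strand_arc m L ` ?f ` open_strands =
    flip_arc ` strand_arc m L ` open_strands"
    unfolding image_image by (rule image_cong[OF refl]) (simp add: strand_arc_flip[OF _ L])
  moreover have "image_mset (strand_cycle m)
       (mset_set (?f ` loops)) =
     image_mset (strand_cycle m)
       (mset_set loops)"
  proof -
    have fin: "finite loops" using finite_strands[OF finite_P] by simp
    have "mset_set (?f ` loops) =
      image_mset ?f (mset_set loops)"
      by (rule image_mset_mset_set[symmetric]) (rule inj_on_subset[OF inj], blast)
    thus ?thesis
      using strand_weight_flip strand_blobs_flip[OF D] fin by (simp add: multiset.map_comp o_def) (rule image_mset_cong, simp)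
  qed
  ultimately show ?thesis
    unfolding compose_layers_def flip_eq layers_flip strands_flip
    using sel[of "\<lambda>x. x"] sel[of Not] by simp
qed

end

lemma compose_layers_cong:
  assumes "\<And>t. t < L \<Longrightarrow> A t = B t"
  shows "compose_layers m L A Z = compose_layers m L B Z"
proof -
  have "layers L A = layers L B" unfolding layers_def using assms by (intro Sigma_cong) auto
  thus ?thesis by (simp add: compose_layers_def)
qed

lemma flip_compose:
  assumes "planar_matching n (arcs G1)" "planar_matching n (arcs G2)" and m: "m \<ge> 1"
  shows "flip (compose m G1 G2) = compose m (flip G2) (flip G1)"
proof -
  interpret layered n 2 "two_layers G1 G2" by standard (use assms in simp)
  have f: "planar_matching n (arcs (flip G1))" "planar_matching n (arcs (flip G2))"
    using planar.planar_flip assms by (simp_all add: planar_def)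
  have "compose m (flip G2) (flip G1) = compose_layers m 2 (\<lambda>t. flip_arc ` two_layers G1 G2 (2 - 1 - t)) (cycles G1 + cycles G2)"
    unfolding compose_two_layers[OF f(2,1) m] cycles_flip add.commute[of "cycles G2"]
    by (rule compose_layers_cong) (auto simp: less_2_cases_iff)
  thus ?thesis using flip_compose_layers[of m "cycles G1 + cycles G2"] compose_two_layers[OF assms] by simp
qed

section \<open>Associativity of composition\<close>

text \<open>
  When the two upper layers of three are composed, the inner row 1 disappears. This map sends the
  rows 0, 1, 2 of the resulting stack to the rows 0, 2, 3 of the original one.
\<close>

definition fold_row :: "vertex \<Rightarrow> vertex" where
  "fold_row v = (if fst v = 0 then 0 else Suc (fst v), snd v)"

lemma points_piece: "points q = shift (fst q) ` ends (snd q)"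
  using points_shift[of "fst q" "snd q"] by simp

lemma fold_row_inj: "inj fold_row"
  by (rule injI) (simp add: fold_row_def prod_eq_iff split: if_splits)

lemma fst_fold_row_ne: "fst (fold_row v) \<noteq> 1"
  by (simp add: fold_row_def)

lemma fst_fold_row_eq: "fst (fold_row u) = fst (fold_row v) \<longleftrightarrow> fst u = fst v"
  by (simp add: fold_row_def)

lemma snd_fold_row [simp]: "snd (fold_row v) = snd v"
  by (simp add: fold_row_def)

lemma outer_fold_row: "outer (fold_row v) = outer v"
  by (simp add: fold_row_def outer_def)

lemma fold_row_outer: "fst v = 0 \<or> fst v = 2 \<Longrightarrow> fold_row (outer v) = v"
  by (cases v) (auto simp: fold_row_def outer_def)

lemma fold_row_shift: "fold_row (shift 1 v) = shift 2 v"
  by (simp add: fold_row_def shift_def)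

lemma sum_nested:
  assumes "finite I" "\<And>i. i \<in> I \<Longrightarrow> finite (E i)" "\<And>i j. i \<in> I \<Longrightarrow> j \<in> I \<Longrightarrow> i \<noteq> j \<Longrightarrow> E i \<inter> E j = {}"
  shows "sum f (\<Union>(E ` I)) = (\<Sum>i\<in>I. sum f (E i))"
  using sum.UNION_disjoint[of I E f] assms by simp

locale merge = layered n 3 A for n A +
  fixes m :: nat and Z :: "(nat \<times> nat) multiset"
  assumes m: "m \<ge> 1"
begin

sublocale I: layered n 2 A
  by standard (rule planar_layer, simp)

text \<open>
  The two upper layers are composed to \<open>C\<close>, and \<open>A'\<close> is the stack of
  \<open>C\<close> on the third layer. Each piece \<open>q\<close> of \<open>A'\<close> is
  expanded by \<open>E\<close> into the pieces of \<open>A\<close> that it is made of;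
  \<open>hidden\<close> are the closed cycles formed between the two upper layers.
\<close>

definition C :: "vertex arc set" where "C = arcs (compose_layers m 2 A Z)"

definition A' :: "nat \<Rightarrow> vertex arc set" where "A' t = (if t = 0 then C else A 2)"

sublocale J: layered n 2 A'
  by standard (use I.planar_compose_layers[of m Z] planar_layer[of 2] in \<open>auto simp: A'_def C_def\<close>)

definition opens :: "piece set set" where
  "opens = {X \<in> strands I.P. boundary 2 X \<noteq> {}}"

definition hidden :: "piece set set" where
  "hidden = {X \<in> strands I.P. boundary 2 X = {}}"

definition E :: "piece \<Rightarrow> piece set" where
  "E q = (if fst q = 0 then inv_into opens (strand_arc m 2) (snd q) else {(2, snd q)})"

definition \<Phi> :: "piece set \<Rightarrow> piece set" where "\<Phi> S = \<Union>(E ` S)"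

lemma C_eq: "C = strand_arc m 2 ` opens"
  by (simp add: C_def opens_def compose_layers_def)

lemma sub_I: "I.P \<subseteq> P"
  by (auto simp: layers_def)

lemma I_row2: "p \<in> P \<Longrightarrow> p \<notin> I.P \<Longrightarrow> fst p = 2"
proof -
  assume "p \<in> P" "p \<notin> I.P"
  hence "fst p < 3" "\<not> fst p < 2" by (auto simp only: piece_iff I.piece_iff)
  thus ?thesis by linarith
qed

lemma E_open: "q \<in> J.P \<Longrightarrow> fst q = 0 \<Longrightarrow> E q \<in> opens \<and> strand_arc m 2 (E q) = snd q"
proof -
  assume q: "q \<in> J.P" "fst q = 0"
  hence "snd q \<in> strand_arc m 2 ` opens" by (simp add: J.piece_iff A'_def flip: C_eq)
  thus ?thesis using q(2) by (simp add: E_def inv_into_into f_inv_into_f)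
qed

lemma E_top: "q \<in> J.P \<Longrightarrow> fst q \<noteq> 0 \<Longrightarrow> fst q = 1 \<and> E q = {(2, snd q)} \<and> (2, snd q) \<in> P"
  by (auto simp: J.piece_iff A'_def E_def piece_iff)

lemma opensD: "X \<in> opens \<Longrightarrow> X \<in> strands I.P"
  by (simp add: opens_def)

lemma strand_arc_inj: "inj_on (strand_arc m 2) opens"
proof (rule inj_onI)
  fix X Y assume h: "X \<in> opens" "Y \<in> opens" "strand_arc m 2 X = strand_arc m 2 Y"
  have "boundary 2 X \<noteq> {}" using h(1) by (simp add: opens_def)
  then obtain x where "x \<in> boundary 2 X" by blast
  then obtain v where "v \<in> ends (strand_arc m 2 X)" using imageI by (simp add: strand_arc_def) blast
  thus "X = Y" using I.strand_arc_same[OF opensD[OF h(1)] opensD[OF h(2)], of v m] h(3) by simp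
qed

lemma E_sub: "q \<in> J.P \<Longrightarrow> E q \<subseteq> P"
proof (cases "fst q = 0")
  case True
  assume "q \<in> J.P"
  hence "E q \<subseteq> I.P" using E_open[OF _ True] I.strandD(2)[OF opensD] by blast
  thus ?thesis using sub_I by blast
next
  case False
  assume "q \<in> J.P"
  thus ?thesis using E_top[OF _ False] by simp
qed

lemma E_ne: "q \<in> J.P \<Longrightarrow> E q \<noteq> {}"
proof (cases "fst q = 0")
  case True
  assume "q \<in> J.P"
  thus ?thesis using E_open[OF _ True] I.strandD(1)[OF opensD] by blast
next
  case False
  assume "q \<in> J.P"
  thus ?thesis using E_top[OF _ False] by simp
qed

lemma pts_mono_mem: "p \<in> X \<Longrightarrow> v \<in> points p \<Longrightarrow> v \<in> pts X"
  by (auto simp: pts_def)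

lemma points_E: "q \<in> J.P \<Longrightarrow> fold_row ` points q = {v \<in> pts (E q). fst v \<noteq> 1}"
proof (cases "fst q = 0")
  case True
  assume q: "q \<in> J.P"
  note e = E_open[OF q True]
  have "points q = shift 0 ` ends (snd q)" using points_piece[of q] True by simp
  also have "\<dots> = outer ` boundary 2 (E q)" using e by (simp add: strand_arc_def[of m 2 "E q", symmetric] shift_def)
     (metis arc.sel(1) strand_arc_def)
  finally have "fold_row ` points q = fold_row ` outer ` boundary 2 (E q)" by simp
  also have "\<dots> = (\<lambda>v. v) ` boundary 2 (E q)"
    unfolding image_image by (rule image_cong[OF refl]) (rule fold_row_outer, simp add: boundary_def)
  also have "\<dots> = {v \<in> pts (E q). fst v \<noteq> 1}"
  proof -
    have "fst v = 0 \<or> fst v = 2 \<longleftrightarrow> fst v \<noteq> 1" if "v \<in> pts (E q)" for v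
      using I.pts_rows[OF I.strandD(2)[OF opensD] that] e by auto
    thus ?thesis by (auto simp: boundary_def)
  qed
  finally show ?thesis .
next
  case False
  assume q: "q \<in> J.P"
  note e = E_top[OF q False]
  have "points q = shift 1 ` ends (snd q)" using points_piece[of q] e by simp
  hence "fold_row ` points q = shift 2 ` ends (snd q)" by (simp only: image_image fold_row_shift)
  also have "\<dots> = pts (E q)" using e by (simp add: pts_def points_shift)
  also have "\<dots> = {v \<in> pts (E q). fst v \<noteq> 1}"
  proof -
    have "fst v \<noteq> 1" if "v \<in> shift 2 ` ends (snd q)" for v using that by auto
    thus ?thesis using e by (auto simp: pts_def points_shift)
  qed
  finally show ?thesis .
qed

lemma E_share:
  assumes q: "q \<in> J.P" "q' \<in> J.P" and v: "v \<in> pts (E q)" "v \<in> pts (E q')"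
  shows "q = q' \<or> (\<exists>u. u \<in> points q \<and> u \<in> points q')"
proof (cases "fst v = 1")
  case True
  have z: "fst r = 0" if r: "r \<in> J.P" "v \<in> pts (E r)" for r
  proof (rule ccontr)
    assume "fst r \<noteq> 0"
    hence e: "E r = {(2, snd r)}" using E_top[OF r(1)] by simp
    show False using r(2) True unfolding e by (auto simp: pts_def points_shift)
  qed
  have f: "fst q = 0" "fst q' = 0" using z q v by simp_all
  have "E q = E q'"
    using I.pts_strand_unique[OF opensD opensD v] E_open[OF q(1) f(1)] E_open[OF q(2) f(2)] by simp
  hence "snd q = snd q'" using E_open[OF q(1) f(1)] E_open[OF q(2) f(2)] by simp
  thus ?thesis using f by (simp add: prod_eq_iff)
next
  case False
  hence "v \<in> fold_row ` points q" "v \<in> fold_row ` points q'" using points_E q v by simp_all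
  then obtain u u' where u: "u \<in> points q" "v = fold_row u" "u' \<in> points q'" "v = fold_row u'" by blast
  hence "u = u'" using injD[OF fold_row_inj] by metis
  thus ?thesis using u by blast
qed

lemma E_share_rev:
  assumes "q \<in> J.P" "u \<in> points q"
  shows "fold_row u \<in> pts (E q)"
  using points_E[OF assms(1)] assms(2) by blast

lemma E_disjoint:
  assumes "q \<in> J.P" "q' \<in> J.P" "p \<in> E q" "p \<in> E q'"
  shows "q = q'"
proof (cases "fst q = 0")
  case True
  have "fst q' = 0"
  proof (rule ccontr)
    assume "fst q' \<noteq> 0"
    hence "p = (2, snd q')" using E_top[OF assms(2)] assms(4) by simp
    moreover have "p \<in> I.P" using E_open[OF assms(1) True] I.strandD(2)[OF opensD] assms(3) by blast
    ultimately show False by (simp add: I.piece_iff)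
  qed
  hence e: "E q = E q'" using I.strand_unique[OF opensD opensD assms(3,4)] E_open assms True by simp
  have "strand_arc m 2 (E q) = snd q" "strand_arc m 2 (E q') = snd q'"
    using E_open[OF assms(1) True] E_open[OF assms(2) \<open>fst q' = 0\<close>] by simp_all
  hence "snd q = snd q'" unfolding e by (rule trans[OF sym])
  thus ?thesis using True \<open>fst q' = 0\<close> by (simp add: prod_eq_iff)
next
  case False
  have "fst q' \<noteq> 0"
  proof
    assume t: "fst q' = 0"
    have "p = (2, snd q)" using E_top[OF assms(1) False] assms(3) by simp
    moreover have "p \<in> I.P" using E_open[OF assms(2) t] I.strandD(2)[OF opensD] assms(4) by blast
    ultimately show False by (simp add: I.piece_iff)
  qed
  thus ?thesis using E_top[OF assms(1) False] E_top[OF assms(2)] assms(3,4) by (simp add: prod_eq_iff)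
qed

text \<open>
  The expansion of a piece of \<open>C\<close> is a strand of the two upper layers; it meets a
  closed set of the three layers in a closed set of the two upper layers.
\<close>

lemma E_closed:
  assumes Y: "Y \<subseteq> P" "share_closed P Y" and q: "q \<in> J.P" and p: "p \<in> E q" "p \<in> Y"
  shows "E q \<subseteq> Y"
proof (cases "fst q = 0")
  case True
  have X: "E q \<in> strands I.P" using E_open[OF q True] opensD by blast
  have "share_closed I.P (E q \<inter> Y)"
    using I.strandD(3)[OF X] Y(2) sub_I unfolding share_closed_def by blast
  hence "E q \<inter> Y = E q" using I.strand_minimal[OF X, of "E q \<inter> Y"] p by blast
  thus ?thesis by blast
next
  case False
  thus ?thesis using E_top[OF q False] p by simp
qed

lemma cover: "p \<in> P \<Longrightarrow> (\<exists>q\<in>J.P. p \<in> E q) \<or> (\<exists>X\<in>hidden. p \<in> X)"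
proof (cases "p \<in> I.P")
  case True
  then obtain X where X: "X \<in> strands I.P" "p \<in> X" using I.strand_exists by blast
  show ?thesis
  proof (cases "boundary 2 X = {}")
    case True
    thus ?thesis using X by (auto simp: hidden_def)
  next
    case False
    hence O: "X \<in> opens" using X by (simp add: opens_def)
    hence "(0, strand_arc m 2 X) \<in> J.P" by (simp add: J.piece_iff A'_def C_eq)
    moreover have "E (0, strand_arc m 2 X) = X" using O strand_arc_inj by (simp add: E_def)
    ultimately show ?thesis using X(2) by blast
  qed
next
  case False
  assume p: "p \<in> P"
  have t: "fst p = 2" using I_row2[OF p False] .
  have "(1, snd p) \<in> J.P" using p t by (simp add: J.piece_iff A'_def piece_iff)
  moreover have "p \<in> E (1, snd p)" using t by (simp add: E_def prod_eq_iff)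
  ultimately show ?thesis by blast
qed

lemma hidden_strand:
  assumes X: "X \<in> hidden"
  shows "X \<in> strands P" "boundary 3 X = {}"
proof -
  have S: "X \<in> strands I.P" and b: "boundary 2 X = {}" using X by (simp_all add: hidden_def)
  have row: "fst v = 1" if v: "v \<in> pts X" for v
  proof -
    have "v \<notin> boundary 2 X" using b by simp
    hence "fst v \<noteq> 0" "fst v \<noteq> 2" using v by (simp_all add: boundary_def)
    thus ?thesis using I.pts_rows[OF I.strandD(2)[OF S] v] by simp
  qed
  show "boundary 3 X = {}" using row by (auto simp: boundary_def)
  show "X \<in> strands P"
  proof (rule strandI)
    show "X \<subseteq> P" using I.strandD(2)[OF S] sub_I by blast
    show "X \<noteq> {}" using I.strandD(1)[OF S] .
    show "share_closed P X"
      unfolding share_closed_def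
    proof (intro ballI impI)
      fix p q assume h: "p \<in> X" "q \<in> P" "points p \<inter> points q \<noteq> {}"
      then obtain v where v: "v \<in> points p" "v \<in> points q" by blast
      have "fst v = 1" using row pts_mono_mem[OF h(1) v(1)] .
      hence "fst q \<noteq> 2" using points_rows[OF h(2) v(2)] by auto
      hence "q \<in> I.P" using I_row2[OF h(2)] by blast
      thus "q \<in> X" using I.strand_closed[OF S h(1) _ v] by simp
    qed
    fix Y assume Y: "Y \<subseteq> X" "Y \<noteq> {}" "share_closed P Y"
    hence "share_closed I.P Y" using sub_I unfolding share_closed_def by blast
    thus "X \<subseteq> Y" using I.strand_minimal[OF S Y(1,2)] by simp
  qed
qed

text \<open>
  A closed subset of the expansion of \<open>S\<close> contains with a piece the whole expansion
  \<open>E q\<close> around it, so it is the expansion of a closed subset of \<open>S\<close>.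
\<close>

lemma \<Phi>_strand:
  assumes S: "S \<in> strands J.P"
  shows "\<Phi> S \<in> strands P"
proof (rule strandI)
  note D = J.strandD[OF S]
  have SJ: "q \<in> J.P" if "q \<in> S" for q using D(2) that ..
  show "\<Phi> S \<subseteq> P" using E_sub[OF SJ] unfolding \<Phi>_def by blast
  show "\<Phi> S \<noteq> {}" using D(1) E_ne[OF SJ] unfolding \<Phi>_def by blast
  show "share_closed P (\<Phi> S)"
    unfolding share_closed_def
  proof (intro ballI impI)
    fix p p' assume h: "p \<in> \<Phi> S" "p' \<in> P" "points p \<inter> points p' \<noteq> {}"
    then obtain v where v: "v \<in> points p" "v \<in> points p'" by blast
    obtain q where q: "q \<in> S" "p \<in> E q" using h(1) by (auto simp: \<Phi>_def)
    have pP: "p \<in> P" using E_sub[OF SJ[OF q(1)]] q(2) ..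
    from cover[OF h(2)] show "p' \<in> \<Phi> S"
    proof
      assume "\<exists>q\<in>J.P. p' \<in> E q"
      then obtain q' where q': "q' \<in> J.P" "p' \<in> E q'" by blast
      have "q = q' \<or> (\<exists>u. u \<in> points q \<and> u \<in> points q')"
        using E_share[OF SJ[OF q(1)] q'(1) pts_mono_mem[OF q(2) v(1)] pts_mono_mem[OF q'(2) v(2)]] .
      hence "q' \<in> S" using J.strand_closed[OF S q(1) q'(1)] q(1) by blast
      thus ?thesis using q'(2) by (auto simp: \<Phi>_def)
    next
      assume "\<exists>X\<in>hidden. p' \<in> X"
      then obtain X where X: "X \<in> hidden" "p' \<in> X" by blast
      have "p \<in> X" using strand_closed[OF hidden_strand(1)[OF X(1)] X(2) pP v(2,1)] .
      have XI: "X \<in> strands I.P" "boundary 2 X = {}" using X(1) by (simp_all add: hidden_def)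
      have f: "fst q = 0"
      proof (rule ccontr)
        assume "fst q \<noteq> 0"
        hence "p = (2, snd q)" using E_top[OF SJ[OF q(1)]] q(2) by simp
        moreover have "p \<in> I.P" using \<open>p \<in> X\<close> I.strandD(2)[OF XI(1)] by blast
        ultimately show False by (simp add: I.piece_iff)
      qed
      note e = E_open[OF SJ[OF q(1)] f]
      have "E q = X" using I.strand_unique[OF opensD XI(1) q(2) \<open>p \<in> X\<close>] e by simp
      thus ?thesis using e XI(2) by (simp add: opens_def)
    qed
  qed
  fix Y assume Y: "Y \<subseteq> \<Phi> S" "Y \<noteq> {}" "share_closed P Y"
  have YP: "Y \<subseteq> P" using Y(1) \<open>\<Phi> S \<subseteq> P\<close> by blast
  define T where "T = {q \<in> S. E q \<subseteq> Y}"
  have "share_closed J.P T"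
    unfolding share_closed_def
  proof (intro ballI impI)
    fix q q' assume h: "q \<in> T" "q' \<in> J.P" "points q \<inter> points q' \<noteq> {}"
    have q: "q \<in> S" "E q \<subseteq> Y" using h(1) by (simp_all add: T_def)
    obtain u where u: "u \<in> points q" "u \<in> points q'" using h(3) by blast
    have q'S: "q' \<in> S" using J.strand_closed[OF S q(1) h(2) u] .
    obtain p where p: "p \<in> E q" "fold_row u \<in> points p" using E_share_rev[OF SJ[OF q(1)] u(1)] by (auto simp: pts_def)
    obtain p' where p': "p' \<in> E q'" "fold_row u \<in> points p'" using E_share_rev[OF h(2) u(2)] by (auto simp: pts_def)
    have "p' \<in> P" using E_sub[OF h(2)] p'(1) ..
    hence "p' \<in> Y" using share_closedD[OF Y(3) _ _ p(2) p'(2)] q(2) p(1) by blast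
    hence "E q' \<subseteq> Y" using E_closed[OF YP Y(3) h(2) p'(1)] by simp
    thus "q' \<in> T" using q'S by (simp add: T_def)
  qed
  moreover have "T \<noteq> {}"
  proof -
    obtain p where p: "p \<in> Y" using Y(2) by blast
    then obtain q where q: "q \<in> S" "p \<in> E q" using Y(1) by (auto simp: \<Phi>_def)
    hence "q \<in> T" using E_closed[OF YP Y(3) SJ[OF q(1)] q(2) p] by (simp add: T_def)
    thus ?thesis by blast
  qed
  ultimately have "T = S" using J.strand_minimal[OF S, of T] by (auto simp: T_def)
  thus "\<Phi> S \<subseteq> Y" unfolding \<Phi>_def T_def by blast
qed

lemma strands_P: "strands P = \<Phi> ` strands J.P \<union> hidden"
proof (rule strands_eqI)
  show "\<Phi> ` strands J.P \<union> hidden \<subseteq> strands P" using \<Phi>_strand hidden_strand(1) by blast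
  show "P \<subseteq> \<Union> (\<Phi> ` strands J.P \<union> hidden)"
  proof
    fix p assume "p \<in> P"
    from cover[OF this] show "p \<in> \<Union> (\<Phi> ` strands J.P \<union> hidden)"
    proof
      assume "\<exists>q\<in>J.P. p \<in> E q"
      then obtain q where q: "q \<in> J.P" "p \<in> E q" by blast
      then obtain S where "S \<in> strands J.P" "q \<in> S" using J.strand_exists by blast
      thus ?thesis using q(2) unfolding \<Phi>_def by blast
    qed blast
  qed
qed

lemma \<Phi>_inj: "inj_on \<Phi> (strands J.P)"
proof (rule inj_onI)
  fix S T assume h: "S \<in> strands J.P" "T \<in> strands J.P" "\<Phi> S = \<Phi> T"
  obtain q where q: "q \<in> S" using J.strandD(1)[OF h(1)] by blast
  have qJ: "q \<in> J.P" using J.strandD(2)[OF h(1)] q ..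
  obtain p where p: "p \<in> E q" using E_ne[OF qJ] by blast
  hence "p \<in> \<Phi> T" using q h(3) unfolding \<Phi>_def by blast
  then obtain q' where q': "q' \<in> T" "p \<in> E q'" unfolding \<Phi>_def by blast
  have "q = q'" using E_disjoint[OF qJ _ p q'(2)] J.strandD(2)[OF h(2)] q'(1) by blast
  thus "S = T" using J.strand_unique[OF h(1,2) q] q'(1) by simp
qed

lemma \<Phi>_not_hidden: "S \<in> strands J.P \<Longrightarrow> \<Phi> S \<notin> hidden"
proof
  assume S: "S \<in> strands J.P" and H: "\<Phi> S \<in> hidden"
  obtain q where q: "q \<in> S" using J.strandD(1)[OF S] by blast
  have qJ: "q \<in> J.P" using J.strandD(2)[OF S] q ..
  obtain p where p: "p \<in> E q" using E_ne[OF qJ] by blast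
  have X: "\<Phi> S \<in> strands I.P" "boundary 2 (\<Phi> S) = {}" using H by (simp_all add: hidden_def)
  have p\<Phi>: "p \<in> \<Phi> S" using p q unfolding \<Phi>_def by blast
  show False
  proof (cases "fst q = 0")
    case True
    note e = E_open[OF qJ True]
    have "E q = \<Phi> S" using I.strand_unique[OF opensD X(1) p p\<Phi>] e by simp
    thus False using e X(2) by (simp add: opens_def)
  next
    case False
    hence "p = (2, snd q)" using E_top[OF qJ] p by simp
    moreover have "p \<in> I.P" using p\<Phi> I.strandD(2)[OF X(1)] ..
    ultimately show False by (simp add: I.piece_iff)
  qed
qed

lemma pts_\<Phi>:
  assumes S: "S \<subseteq> J.P"
  shows "{v \<in> pts (\<Phi> S). fst v \<noteq> 1} = fold_row ` pts S"
proof -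
  have "{v \<in> pts (\<Phi> S). fst v \<noteq> 1} = (\<Union>q\<in>S. {v \<in> pts (E q). fst v \<noteq> 1})"
    unfolding pts_def \<Phi>_def by blast
  also have "\<dots> = (\<Union>q\<in>S. fold_row ` points q)"
    by (rule SUP_cong[OF refl]) (rule points_E[symmetric], rule subsetD[OF S])
  finally show ?thesis unfolding pts_def by blast
qed

lemma boundary_\<Phi>:
  assumes S: "S \<subseteq> J.P"
  shows "boundary 3 (\<Phi> S) = fold_row ` boundary 2 S"
proof -
  have "boundary 3 (\<Phi> S) = {v \<in> {v \<in> pts (\<Phi> S). fst v \<noteq> 1}. fst v = 0 \<or> fst v = 3}"
    by (auto simp: boundary_def)
  also have "\<dots> = {v \<in> fold_row ` pts S. fst v = 0 \<or> fst v = 3}" unfolding pts_\<Phi>[OF S] ..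
  also have "\<dots> = fold_row ` boundary 2 S"
    unfolding boundary_def by (rule filter_image) (simp add: fold_row_def)
  finally show ?thesis .
qed

text \<open>
  Expansion adds points in row 1 only, so the counts in the other rows are unchanged.
\<close>

lemma dir_\<Phi>:
  assumes S: "S \<subseteq> J.P"
  shows "dir (pts (\<Phi> S)) (fold_row v) = dir (pts S) v"
proof -
  have "{u \<in> pts (\<Phi> S). fst u = fst (fold_row v) \<and> snd u < snd (fold_row v)} =
    {u \<in> {v \<in> pts (\<Phi> S). fst v \<noteq> 1}. fst u = fst (fold_row v) \<and> snd u < snd (fold_row v)}"
    using fst_fold_row_ne[of v] by auto
  also have "\<dots> = fold_row ` {u \<in> pts S. fst u = fst v \<and> snd u < snd v}"
    unfolding pts_\<Phi>[OF S] by (rule filter_image) (simp add: fst_fold_row_eq)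
  finally show ?thesis
    by (simp add: dir_def left_count_def card_image inj_on_subset[OF fold_row_inj])
qed

text \<open>
  For a piece \<open>q\<close> of \<open>C\<close> the signs of the whole expansion restrict on
  \<open>E q\<close> to a function obeying the orientation rule. By \<open>dir_substrand\<close>
  they are the signs of \<open>E q\<close> up to the sign at one point, which is the sign of
  \<open>q\<close> in \<open>S\<close>.
\<close>

lemma weight_part:
  assumes S: "S \<in> strands J.P" and q: "q \<in> S"
  shows "int m dvd (\<Sum>p\<in>E q. dir (pts (\<Phi> S)) (base_point (points p)) * int (dots (snd p)))
    - dir (pts S) (base_point (points q)) * int (dots (snd q))"
proof -
  note D = strandD[OF \<Phi>_strand[OF S]]
  have qJ: "q \<in> J.P" using J.strandD(2)[OF S] q ..
  have E\<Phi>: "E q \<subseteq> \<Phi> S" using q unfolding \<Phi>_def by blast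
  define b where "b = base_point (points q)"
  note fq = J.finite_points[OF qJ] J.points_ne[OF qJ]
  have b: "b \<in> points q" "\<And>u. u \<in> points q \<Longrightarrow> fst u = fst b \<Longrightarrow> snd b \<le> snd u"
    unfolding b_def using base_point_in[OF fq] base_point_left[OF fq] by simp_all
  have left: "snd (fold_row b) \<le> snd u" if u: "u \<in> pts (E q)" "fst u = fst (fold_row b)" for u
  proof -
    have "u \<in> fold_row ` points q" using points_E[OF qJ] u fst_fold_row_ne by simp
    then obtain x where x: "x \<in> points q" "u = fold_row x" by blast
    thus ?thesis using b(2)[of x] u(2) by (simp add: fst_fold_row_eq)
  qed
  have bE: "fold_row b \<in> pts (E q)" using E_share_rev[OF qJ b(1)] .
  have d: "dir (pts (\<Phi> S)) (fold_row b) = dir (pts S) b" using dir_\<Phi>[OF J.strandD(2)[OF S]] .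
  show ?thesis
  proof (cases "fst q = 0")
    case True
    note e = E_open[OF qJ True]
    have X: "E q \<in> strands I.P" using e opensD by blast
    have "dir (pts (E q)) (fold_row b) = 1" by (rule dir_leftmost) (rule left)
    hence one: "dir (pts (E q)) (fold_row b) = 1" .
    have o: "dir (pts (\<Phi> S)) v = (if fst v = fst w then - dir (pts (\<Phi> S)) w else dir (pts (\<Phi> S)) w)"
      if "p \<in> E q" "points p = {v, w}" "v \<noteq> w" for p v w
      using dir_piece[OF D(2,3) subsetD[OF E\<Phi> that(1)] that(2,3)] .
    have or: "dir (pts (\<Phi> S)) v = dir (pts S) b * dir (pts (E q)) v" if "v \<in> pts (E q)" for v
      using I.dir_substrand[OF X o bE one that] d by simp
    have "(\<Sum>p\<in>E q. dir (pts (\<Phi> S)) (base_point (points p)) * int (dots (snd p))) =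
      (\<Sum>p\<in>E q. dir (pts S) b * (dir (pts (E q)) (base_point (points p)) * int (dots (snd p))))"
    proof (rule sum.cong[OF refl])
      fix p assume p: "p \<in> E q"
      have pP: "p \<in> P" using E_sub[OF qJ] p ..
      have "base_point (points p) \<in> pts (E q)"
        using pts_mono_mem[OF p base_point_in[OF finite_points[OF pP] points_ne[OF pP]]] .
      thus "dir (pts (\<Phi> S)) (base_point (points p)) * int (dots (snd p)) =
         dir (pts S) b * (dir (pts (E q)) (base_point (points p)) * int (dots (snd p)))" using or by simp
    qed
    hence s: "(\<Sum>p\<in>E q. dir (pts (\<Phi> S)) (base_point (points p)) * int (dots (snd p))) =
      dir (pts S) b * strand_weight (E q)" by (simp add: strand_weight_def sum_distrib_left)
    have "dots (snd q) = nat (strand_weight (E q) mod int m)" using e by (metis arc.sel(2) strand_arc_def)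
    hence "int (dots (snd q)) = strand_weight (E q) mod int m" using m by simp
    hence "int m dvd strand_weight (E q) - int (dots (snd q))" by (simp add: minus_mod_eq_mult_div)
    hence "int m dvd dir (pts S) b * (strand_weight (E q) - int (dots (snd q)))" by simp
    thus ?thesis unfolding s b_def[symmetric] by (simp add: right_diff_distrib)
  next
    case False
    note e = E_top[OF qJ False]
    have p: "(2, snd q) \<in> \<Phi> S" using E\<Phi> e by blast
    have pe: "pts (E q) = points (2, snd q)" using e by (simp add: pts_def)
    have "dir (pts (\<Phi> S)) (base_point (points (2, snd q))) = dir (pts (\<Phi> S)) (fold_row b)"
      by (rule base_dir[OF D(2,3) p]) (use bE left pe in auto)
    thus ?thesis using e d by (simp add: b_def)
  qed
qed

lemma finite_E: "q \<in> J.P \<Longrightarrow> finite (E q)"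
  using finite_subset[OF E_sub finite_P] .

lemma sum_\<Phi>:
  assumes S: "S \<in> strands J.P"
  shows "sum f (\<Phi> S) = (\<Sum>q\<in>S. sum f (E q))"
  unfolding \<Phi>_def
proof (rule sum_nested)
  have SJ: "q \<in> J.P" if "q \<in> S" for q using J.strandD(2)[OF S] that ..
  show "finite S" using J.finite_sub[OF J.strandD(2)[OF S]] .
  show "finite (E q)" if "q \<in> S" for q using finite_E[OF SJ[OF that]] .
  show "E q \<inter> E q' = {}" if "q \<in> S" "q' \<in> S" "q \<noteq> q'" for q q'
    using E_disjoint[OF SJ[OF that(1)] SJ[OF that(2)]] that(3) by blast
qed

lemma weight_\<Phi>:
  assumes S: "S \<in> strands J.P"
  shows "strand_weight (\<Phi> S) mod int m = strand_weight S mod int m"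
proof -
  have "int m dvd (\<Sum>q\<in>S. (\<Sum>p\<in>E q. dir (pts (\<Phi> S)) (base_point (points p)) * int (dots (snd p)))
    - dir (pts S) (base_point (points q)) * int (dots (snd q)))"
    by (rule dvd_sum) (rule weight_part[OF S])
  also have "\<dots> = strand_weight (\<Phi> S) - strand_weight S"
    unfolding sum_subtractf by (simp add: strand_weight_def sum_\<Phi>[OF S])
  finally show ?thesis by (simp add: mod_eq_dvd_iff)
qed

lemma blobs_\<Phi>:
  assumes S: "S \<in> strands J.P"
  shows "strand_blobs (\<Phi> S) = strand_blobs S"
  unfolding strand_blobs_def sum_\<Phi>[OF S]
proof (rule sum.cong[OF refl])
  fix q assume "q \<in> S"
  hence qJ: "q \<in> J.P" using J.strandD(2)[OF S] by blast
  show "(\<Sum>p\<in>E q. blobs (snd p)) = blobs (snd q)"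
  proof (cases "fst q = 0")
    case True
    hence "blobs (snd q) = strand_blobs (E q)" using E_open[OF qJ] by (metis arc.sel(3) strand_arc_def)
    thus ?thesis by (simp add: strand_blobs_def)
  next
    case False
    thus ?thesis using E_top[OF qJ] by simp
  qed
qed

lemma strand_arc_\<Phi>:
  assumes S: "S \<in> strands J.P"
  shows "strand_arc m 3 (\<Phi> S) = strand_arc m 2 S"
  unfolding strand_arc_def
  by (simp add: weight_\<Phi>[OF S] blobs_\<Phi>[OF S] boundary_\<Phi>[OF J.strandD(2)[OF S]] image_image outer_fold_row)

text \<open>
  The strands of the three layers are the expansions of the strands of \<open>A'\<close>, with the
  same ends, dots and blobs, together with the closed cycles that are already cycles of the first
  composition.
\<close>

lemma merge_layers:
  "compose_layers m 2 A' (cycles (compose_layers m 2 A Z) + Z') = compose_layers m 3 A (Z + Z')"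
proof -
  let ?f = "\<lambda>X. (nat (strand_weight X mod int m), strand_blobs X)"
  let ?OJ = "{S \<in> strands J.P. boundary 2 S \<noteq> {}}" and ?CJ = "{S \<in> strands J.P. boundary 2 S = {}}"
  have b: "boundary 3 (\<Phi> S) = {} \<longleftrightarrow> boundary 2 S = {}" if "S \<in> strands J.P" for S
    using boundary_\<Phi>[OF J.strandD(2)[OF that]] by simp
  have o: "{X \<in> strands P. boundary 3 X \<noteq> {}} = \<Phi> ` ?OJ"
    unfolding strands_P using b hidden_strand(2) by blast
  have c: "{X \<in> strands P. boundary 3 X = {}} = \<Phi> ` ?CJ \<union> hidden"
    unfolding strands_P using b hidden_strand(2) by blast
  have fin: "finite (\<Phi> ` ?CJ)" "finite hidden"
    using finite_strands[OF J.finite_P] finite_strands[OF I.finite_P] by (simp_all add: hidden_def)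
  have dis: "\<Phi> ` ?CJ \<inter> hidden = {}" using \<Phi>_not_hidden by blast
  have "mset_set (\<Phi> ` ?CJ) = image_mset \<Phi> (mset_set ?CJ)"
    by (rule image_mset_mset_set[symmetric]) (rule inj_on_subset[OF \<Phi>_inj], blast)
  moreover have "image_mset ?f (image_mset \<Phi> (mset_set ?CJ)) = image_mset ?f (mset_set ?CJ)"
    unfolding multiset.map_comp
    by (rule image_mset_cong) (use finite_strands[OF J.finite_P] in \<open>simp add: weight_\<Phi> blobs_\<Phi>\<close>)
  ultimately have cyc: "image_mset ?f (mset_set {X \<in> strands P. boundary 3 X = {}}) =
    image_mset ?f (mset_set ?CJ) + image_mset ?f (mset_set hidden)"
    unfolding c by (simp add: mset_set_Union[OF fin dis])
  have arcs: "strand_arc m 3 ` {X \<in> strands P. boundary 3 X \<noteq> {}} = strand_arc m 2 ` ?OJ"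
    unfolding o image_image by (rule image_cong[OF refl]) (simp add: strand_arc_\<Phi>)
  show ?thesis
    unfolding compose_layers_def[of m 2 A'] compose_layers_def[of m 3] cyc arcs
    by (simp add: compose_layers_def hidden_def add_ac)
qed

end

definition three_layers :: "tangle \<Rightarrow> tangle \<Rightarrow> tangle \<Rightarrow> nat \<Rightarrow> vertex arc set" where
  "three_layers G1 G2 G3 t = (if t = 0 then arcs G1 else if t = 1 then arcs G2 else arcs G3)"

lemma planar_compose:
  assumes "planar_matching n (arcs G1)" "planar_matching n (arcs G2)" "m \<ge> 1"
  shows "planar_matching n (arcs (compose m G1 G2))"
proof -
  interpret layered n 2 "two_layers G1 G2" by standard (use assms in simp)
  show ?thesis unfolding compose_two_layers[OF assms] by (rule planar_compose_layers) simp
qed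

lemma compose_three_layers:
  assumes G: "planar_matching n (arcs G1)" "planar_matching n (arcs G2)" "planar_matching n (arcs G3)" and m: "m \<ge> 1"
  shows "compose m (compose m G1 G2) G3 =
    compose_layers m 3 (three_layers G1 G2 G3) (cycles G1 + cycles G2 + cycles G3)"
proof -
  interpret merge n "three_layers G1 G2 G3" m "cycles G1 + cycles G2"
    by standard (use G m in \<open>simp_all add: three_layers_def\<close>)
  have c: "compose m G1 G2 = compose_layers m 2 (three_layers G1 G2 G3) (cycles G1 + cycles G2)"
    unfolding compose_two_layers[OF G(1,2) m] by (rule compose_layers_cong) (simp add: three_layers_def)
  have "compose m (compose m G1 G2) G3 =
    compose_layers m 2 (two_layers (compose m G1 G2) G3) (cycles (compose m G1 G2) + cycles G3)"
    by (rule compose_two_layers[OF planar_compose[OF G(1,2) m] G(3) m])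
  also have "\<dots> = compose_layers m 2 A' (cycles (compose m G1 G2) + cycles G3)"
    by (rule compose_layers_cong) (simp add: A'_def C_def c three_layers_def)
  finally show ?thesis unfolding c merge_layers .
qed

text \<open>
  Both sides equal the composition of the three-layer stack; for the right-hand side this follows
  from the left-hand one by inversion.
\<close>

theorem compose_assoc:
  assumes G: "planar_matching n (arcs G1)" "planar_matching n (arcs G2)" "planar_matching n (arcs G3)" and m: "m \<ge> 1"
  shows "compose m (compose m G1 G2) G3 = compose m G1 (compose m G2 G3)"
proof -
  have f: "planar_matching n (arcs (flip G))" if "planar_matching n (arcs G)" for G
    using planar.planar_flip that by (simp add: planar_def)
  interpret layered n 3 "three_layers G1 G2 G3" by standard (use G in \<open>simp add: three_layers_def\<close>)
  have "flip (compose m G1 (compose m G2 G3)) = compose m (compose m (flip G3) (flip G2)) (flip G1)"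
    by (simp only: flip_compose[OF G(1) planar_compose[OF G(2,3) m] m] flip_compose[OF G(2,3) m])
  also have "\<dots> = compose_layers m 3 (three_layers (flip G3) (flip G2) (flip G1)) (cycles G3 + cycles G2 + cycles G1)"
    using compose_three_layers[OF f[OF G(3)] f[OF G(2)] f[OF G(1)] m] by simp
  also have "\<dots> = compose_layers m 3 (\<lambda>t. flip_arc ` three_layers G1 G2 G3 (3 - 1 - t)) (cycles G1 + cycles G2 + cycles G3)"
  proof -
    have z: "cycles G3 + cycles G2 + cycles G1 = cycles G1 + cycles G2 + cycles G3" by (simp add: add_ac)
    show ?thesis unfolding z
      by (rule compose_layers_cong) (auto simp: three_layers_def less_Suc_eq numeral_3_eq_3)
  qed
  also have "\<dots> = flip (compose_layers m 3 (three_layers G1 G2 G3) (cycles G1 + cycles G2 + cycles G3))"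
    by (rule flip_compose_layers) simp
  finally have e: "flip (compose m G1 (compose m G2 G3)) = flip (compose m (compose m G1 G2) G3)"
    unfolding compose_three_layers[OF G m] .
  have x: "flip (flip (compose m G1 (compose m G2 G3))) = compose m G1 (compose m G2 G3)"
    by (rule flip_flip[OF planar_compose[OF G(1) planar_compose[OF G(2,3) m] m]])
  have y: "flip (flip (compose m (compose m G1 G2) G3)) = compose m (compose m G1 G2) G3"
    by (rule flip_flip[OF planar_compose[OF planar_compose[OF G(1,2) m] G(3) m]])
  show ?thesis using arg_cong[OF e, of flip] by (simp only: x y)
qed

section \<open>The identity tangle, blobs and horizontal arcs\<close>

definition vertical :: "nat \<Rightarrow> vertex arc" where
  "vertical i = Arc {(0, i), (1, i)} 0 0"

definition id_tangle :: "nat \<Rightarrow> tangle" where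
  "id_tangle n = Diagram (vertical ` {1..n}) {#}"

lemma vertical_inj: "inj vertical"
  by (rule injI) (auto simp: vertical_def doubleton_eq_iff)

lemma vertical_pos:
  assumes "1 \<le> i" "i \<le> n"
  shows "lo (frame_pos n) (vertical i) = i" "hi (frame_pos n) (vertical i) = 2 * n + 1 - i"
  using lo_hi_pair[of "vertical i" "(0, i)" "(1, i)" "frame_pos n"] assms
  by (simp_all add: vertical_def frame_pos_def)

lemma planar_id: "planar_matching n (arcs (id_tangle n))"
  unfolding planar_matching_def
proof (intro conjI ballI)
  fix a assume "a \<in> arcs (id_tangle n)"
  then obtain i where i: "1 \<le> i" "i \<le> n" "a = vertical i" by (auto simp: id_tangle_def)
  show "ends a \<subseteq> vertices n" "card (ends a) = 2" using i by (auto simp: vertical_def vertices_def)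
  fix b assume "b \<in> arcs (id_tangle n)"
  then obtain j where j: "1 \<le> j" "j \<le> n" "b = vertical j" by (auto simp: id_tangle_def)
  show "\<not> crosses (frame_pos n) a b" using vertical_pos[OF i(1,2)] vertical_pos[OF j(1,2)] i j
    by (simp add: crosses_def) arith
next
  fix v assume "v \<in> vertices n"
  then obtain r i where v: "v = (r, i)" "r = 0 \<or> r = 1" "1 \<le> i" "i \<le> n" by (cases v) (auto simp: vertices_iff)
  show "\<exists>!a. a \<in> arcs (id_tangle n) \<and> v \<in> ends a"
    by (rule ex1I[of _ "vertical i"]) (use v in \<open>auto simp: id_tangle_def vertical_def\<close>)
qed

lemma flip_id: "flip (id_tangle n) = id_tangle n"
proof -
  have "flip_arc (vertical i) = vertical i" for i
    by (simp add: flip_arc_def vertical_def flip_vertex_def insert_commute)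
  thus ?thesis by (simp add: flip_eq id_tangle_def image_image)
qed

lemma strand_arc_eqI:
  assumes "outer ` boundary L X = ends a" "strand_weight X = int (dots a)" "strand_blobs X = blobs a" "dots a < m"
  shows "strand_arc m L X = a"
  using assms by (cases a) (simp add: strand_arc_def)

text \<open>
  The strand through a piece \<open>a\<close> of \<open>G\<close> consists of \<open>a\<close> and
  of the vertical arcs of the identity above its top ends.
\<close>

lemma compose_id_left:
  assumes G: "planar_matching n (arcs G)" and d: "\<And>a. a \<in> arcs G \<Longrightarrow> dots a < m" and m: "m \<ge> 1"
  shows "compose m (id_tangle n) G = G"
proof -
  interpret layered n 2 "two_layers (id_tangle n) G" by standard (use G planar_id in simp)
  interpret G: planar n "arcs G" using G by (simp add: planar_def)
  define X where "X a = insert (1, a) ((\<lambda>i. (0::nat, vertical i)) ` {i. (0, i) \<in> ends a})" for a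
  have vin: "(0, vertical i) \<in> P \<longleftrightarrow> 1 \<le> i \<and> i \<le> n" for i
    using inj_image_mem_iff[OF vertical_inj, of i "{1..n}"] by (simp add: piece_iff id_tangle_def)
  have v0: "\<exists>i. p = (0, vertical i) \<and> 1 \<le> i \<and> i \<le> n" if "p \<in> P" "fst p = 0" for p
    using that by (cases p) (auto simp: piece_iff id_tangle_def)
  have a1: "(1, a) \<in> P \<longleftrightarrow> a \<in> arcs G" for a by (simp add: piece_iff)
  have p1: "snd p \<in> arcs G \<and> p = (1, snd p)" if "p \<in> P" "fst p \<noteq> 0" for p
    using that by (cases p) (auto simp: piece_iff)
  have pv: "points (0, vertical i) = {(0, i), (1, i)}" for i
    by (simp add: points_shift vertical_def shift_def)
  have pa: "v \<in> points (1, a) \<longleftrightarrow> fst v \<ge> 1 \<and> (fst v - 1, snd v) \<in> ends a" for v a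
    by (cases v) (force simp: points_shift shift_def image_iff)
  have strand: "X a \<in> strands P" if a: "a \<in> arcs G" for a
  proof (rule strandI)
    have sub: "(0, vertical i) \<in> P" if "(0, i) \<in> ends a" for i
      using G.ends_sub[OF a] that vin by (auto simp: vertices_iff)
    show "X a \<subseteq> P" using sub a a1 by (auto simp: X_def)
    show "X a \<noteq> {}" by (simp add: X_def)
    show "share_closed P (X a)"
      unfolding share_closed_def
    proof (intro ballI impI)
      fix p q assume h: "p \<in> X a" "q \<in> P" "points p \<inter> points q \<noteq> {}"
      then obtain v where v: "v \<in> points p" "v \<in> points q" by blast
      have pP: "p \<in> P" using \<open>X a \<subseteq> P\<close> h(1) ..
      show "q \<in> X a"
      proof (cases "fst p = fst q")
        case True
        thus ?thesis using piece_unique[OF pP h(2) True v] h(1) by simp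
      next
        case False
        show ?thesis
        proof (cases "fst q = 0")
          case True
          then obtain i where i: "q = (0, vertical i)" using v0[OF h(2)] by blast
          have "p = (1, a)" using h(1) False True by (auto simp: X_def)
          hence "(0, i) \<in> ends a" using v i pv pa by auto
          thus ?thesis using i by (simp add: X_def)
        next
          case q: False
          obtain b where b: "b \<in> arcs G" "q = (1, b)" using p1[OF h(2) q] by blast
          obtain i where i: "p = (0, vertical i)" "(0, i) \<in> ends a" using h(1) False b by (auto simp: X_def)
          hence "(0, i) \<in> ends b" using v b pv pa by auto
          hence "a = b" using G.arc_unique[OF a b(1) i(2)] by simp
          thus ?thesis using b by (simp add: X_def)
        qed
      qed
    qed
    fix Y assume Y: "Y \<subseteq> X a" "Y \<noteq> {}" "share_closed P Y"
    have aP: "(1, a) \<in> P" using a a1 by simp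
    have link: "(1, i) \<in> points (1, a)" "(1, i) \<in> points (0, vertical i)" if "(0, i) \<in> ends a" for i
      using that pa pv by simp_all
    obtain p where p: "p \<in> Y" using Y(2) by blast
    hence "p \<in> X a" using Y(1) by blast
    hence "(1, a) \<in> Y"
    proof (cases "p = (1, a)")
      case False
      then obtain i where i: "p = (0, vertical i)" "(0, i) \<in> ends a" using \<open>p \<in> X a\<close> by (auto simp: X_def)
      show ?thesis using share_closedD[OF Y(3) p aP _ link(1)[OF i(2)]] link(2)[OF i(2)] i(1) by simp
    qed (use p in simp)
    hence "(0, vertical i) \<in> Y" if "(0, i) \<in> ends a" for i
      using share_closedD[OF Y(3) _ sub[OF that] link[OF that]] by simp
    thus "X a \<subseteq> Y" using \<open>(1, a) \<in> Y\<close> by (auto simp: X_def)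
  qed
  have S: "strands P = X ` arcs G"
  proof (rule strands_eqI)
    show "X ` arcs G \<subseteq> strands P" using strand by blast
    show "P \<subseteq> \<Union> (X ` arcs G)"
    proof
      fix p assume p: "p \<in> P"
      show "p \<in> \<Union> (X ` arcs G)"
      proof (cases "fst p = 0")
        case True
        then obtain i where i: "p = (0, vertical i)" "1 \<le> i" "i \<le> n" using v0[OF p] by blast
        then obtain a where "a \<in> arcs G" "(0, i) \<in> ends a" using G.arc_exists[of "(0, i)"] by (auto simp: vertices_iff)
        thus ?thesis using i by (auto simp: X_def)
      next
        case False
        thus ?thesis using p1[OF p] by (auto simp: X_def)
      qed
    qed
  qed
  have pts: "pts (X a) = points (1, a) \<union> {v. fst v = 0 \<and> v \<in> ends a}" for a
  proof -
    have "pts (X a) = points (1, a) \<union> (\<Union>i\<in>{i. (0, i) \<in> ends a}. {(0, i), (1, i)})"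
      by (simp add: X_def pts_def pv)
    moreover have "v \<in> (\<Union>i\<in>{i. (0, i) \<in> ends a}. {(0, i), (1, i)}) \<longleftrightarrow>
      (0, snd v) \<in> ends a \<and> (fst v = 0 \<or> fst v = 1)" for v :: vertex
      by (cases v) auto
    moreover have "v \<in> points (1, a) \<or> ((0, snd v) \<in> ends a \<and> (fst v = 0 \<or> fst v = 1)) \<longleftrightarrow>
      v \<in> points (1, a) \<or> (fst v = 0 \<and> v \<in> ends a)" for v
      using pa[of v a] by (cases v) auto
    ultimately show ?thesis by (intro set_eqI) (simp only: Un_iff mem_Collect_eq)
  qed
  have bd: "outer ` boundary 2 (X a) = ends a" if a: "a \<in> arcs G" for a
  proof -
    have V: "fst v = 0 \<or> fst v = 1" if "v \<in> ends a" for v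
      using G.ends_sub[OF a] that by (auto simp: vertices_def)
    show ?thesis
    proof (intro equalityI subsetI)
      fix v assume "v \<in> outer ` boundary 2 (X a)"
      then obtain u where u: "u \<in> pts (X a)" "fst u = 0 \<or> fst u = 2" "v = outer u" by (auto simp: boundary_def)
      show "v \<in> ends a"
      proof (cases "fst u = 0")
        case True
        thus ?thesis using u pa[of u a] by (simp add: pts outer_def) (metis prod.collapse)
      next
        case False
        thus ?thesis using u pa[of u a] by (simp add: pts outer_def)
      qed
    next
      fix v assume v: "v \<in> ends a"
      show "v \<in> outer ` boundary 2 (X a)"
      proof (cases "fst v = 0")
        case True
        hence "v \<in> boundary 2 (X a)" "v = outer v" using v by (simp_all add: boundary_def pts outer_def prod_eq_iff)
        thus ?thesis by (metis imageI)
      next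
        case False
        hence "fst v = 1" using V[OF v] by simp
        hence "(2, snd v) \<in> boundary 2 (X a)" "v = outer (2, snd v)"
          using v pa[of "(2, snd v)" a] by (simp_all add: boundary_def pts outer_def prod_eq_iff) (metis prod.collapse)
        thus ?thesis by (metis imageI)
      qed
    qed
  qed
  have arc: "strand_arc m 2 (X a) = a" if a: "a \<in> arcs G" for a
  proof (rule strand_arc_eqI[OF bd[OF a]])
    have aP: "(1, a) \<in> P" using a a1 by simp
    have fin: "finite (X a)" using finite_sub strandD(2)[OF strand[OF a]] by blast
    note fp = finite_points[OF aP] points_ne[OF aP]
    have "dir (pts (X a)) (base_point (points (1, a))) = 1"
    proof (rule dir_leftmost)
      fix u assume u: "u \<in> pts (X a)" "fst u = fst (base_point (points (1, a)))"
      have "fst (base_point (points (1, a))) \<ge> 1" using base_point_in[OF fp] pa by blast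
      hence "u \<in> points (1, a)" using u by (auto simp: pts)
      thus "snd (base_point (points (1, a))) \<le> snd u" using base_point_left[OF fp] u(2) by simp
    qed
    moreover have mem: "(1, a) \<in> X a" by (simp add: X_def)
    note split = sum.remove[OF fin mem]
    moreover have z: "dots (snd p) = 0 \<and> blobs (snd p) = 0" if "p \<in> X a - {(1, a)}" for p
      using that by (auto simp: X_def vertical_def)
    ultimately show "strand_weight (X a) = int (dots a)" by (simp add: strand_weight_def split)
    show "strand_blobs (X a) = blobs a" using z by (simp add: strand_blobs_def split)
  qed (rule d[OF a])
  have ne: "boundary 2 (X a) \<noteq> {}" if "a \<in> arcs G" for a
  proof -
    have "ends a \<noteq> {}" using G.ends_card[OF that] by auto
    thus ?thesis using bd[OF that] by auto
  qed
  have e: "{Y \<in> X ` arcs G. boundary 2 Y = {}} = {}" "{Y \<in> X ` arcs G. boundary 2 Y \<noteq> {}} = X ` arcs G"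
    using ne by blast+
  have e3: "strand_arc m 2 ` X ` arcs G = arcs G" using arc by (simp add: image_image)
  show ?thesis
    unfolding compose_two_layers[OF planar_id G m] compose_layers_def S e e3
    by (simp add: id_tangle_def)
qed

lemma compose_id_right:
  assumes G: "planar_matching n (arcs G)" and d: "\<And>a. a \<in> arcs G \<Longrightarrow> dots a < m" and m: "m \<ge> 1"
  shows "compose m G (id_tangle n) = G"
proof -
  have f: "planar_matching n (arcs (flip G))" using planar.planar_flip G by (simp add: planar_def)
  have "flip (compose m G (id_tangle n)) = compose m (id_tangle n) (flip G)"
    using flip_compose[OF G planar_id m] flip_id by simp
  also have "\<dots> = flip G" by (rule compose_id_left[OF f _ m]) (use d in auto)
  finally have "flip (flip (compose m G (id_tangle n))) = flip (flip G)" by simp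
  thus ?thesis by (simp only: flip_flip[OF planar_compose[OF G planar_id m]] flip_flip[OF G])
qed

text \<open>
  If a blob on a composed arc were not exposed, then by \<open>strand_arc_enclosed\<close> the
  piece that carries it would be enclosed in its own layer.
\<close>

lemma decorated_compose:
  assumes G: "decorated_tangle m n G1" "decorated_tangle m n G2" and m: "m \<ge> 1"
  shows "decorated_tangle m n (compose m G1 G2)"
proof -
  note p = decorated_planar[OF G(1)] decorated_planar[OF G(2)]
  interpret layered n 2 "two_layers G1 G2" by standard (use p in simp)
  let ?C = "compose m G1 G2"
  have pc: "planar_matching n (arcs ?C)" using planar_compose[OF p m] .
  have lt: "nat (w mod int m) < m" for w using m by (simp add: nat_less_iff)
  have C: "?C = compose_layers m 2 (two_layers G1 G2) (cycles G1 + cycles G2)" using compose_two_layers[OF p m] .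
  have ex: "blobs a = 0" if a: "a \<in> arcs ?C" "\<not> exposed n ?C a" for a
  proof -
    obtain b where b: "b \<in> arcs ?C" "encloses (frame_pos n) b a" using a(2) by (auto simp: exposed_def)
    obtain X where X: "X \<in> strands P" "boundary 2 X \<noteq> {}" "a = strand_arc m 2 X"
      using a(1) by (auto simp: C compose_layers_def)
    obtain Y where Y: "Y \<in> strands P" "boundary 2 Y \<noteq> {}" "b = strand_arc m 2 Y"
      using b(1) by (auto simp: C compose_layers_def)
    have "blobs (snd p) = 0" if p: "p \<in> X" for p
    proof -
      have "\<exists>b\<in>two_layers G1 G2 (fst p). encloses (frame_pos n) b (snd p)"
        using strand_arc_enclosed[OF Y(1,2) X(1,2) _ , of m "fst p" "snd p"] b(2) X(3) Y(3) p by simp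
      moreover have "snd p \<in> two_layers G1 G2 (fst p)" using strandD(2)[OF X(1)] p piece_iff by blast
      ultimately show ?thesis using G unfolding decorated_tangle_def exposed_def by (cases "fst p = 0") auto
    qed
    thus ?thesis by (simp add: X(3) strand_arc_def strand_blobs_def)
  qed
  have "dots a < m" if "a \<in> arcs ?C" for a
    using that lt by (auto simp: C compose_layers_def strand_arc_def)
  moreover have "fst x < m" if "x \<in># cycles ?C" for x
  proof -
    have c: "\<forall>x\<in>#cycles G1. fst x < m" "\<forall>x\<in>#cycles G2. fst x < m" using G by (auto simp: decorated_tangle_def)
    show ?thesis using that c lt by (auto simp: C compose_layers_def)
  qed
  ultimately show ?thesis
    using pc ex unfolding decorated_tangle_def planar_matching_def by (auto simp: case_prod_beta)
qed

definition total_blobs :: "tangle \<Rightarrow> nat" where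
  "total_blobs G = (\<Sum>a\<in>arcs G. blobs a) + (\<Sum>x\<in>#cycles G. snd x)"

lemma total_blobs_compose:
  assumes p: "planar_matching n (arcs G1)" "planar_matching n (arcs G2)" and m: "m \<ge> 1"
  shows "total_blobs (compose m G1 G2) = total_blobs G1 + total_blobs G2"
proof -
  interpret layered n 2 "two_layers G1 G2" by standard (use p in simp)
  let ?O = "{X \<in> strands P. boundary 2 X \<noteq> {}}" and ?H = "{X \<in> strands P. boundary 2 X = {}}"
  have inj: "inj_on (strand_arc m 2) ?O"
  proof (rule inj_onI)
    fix X Y assume h: "X \<in> ?O" "Y \<in> ?O" "strand_arc m 2 X = strand_arc m 2 Y"
    then obtain x where "x \<in> boundary 2 X" by blast
    hence "outer x \<in> ends (strand_arc m 2 X)" by (simp add: strand_arc_def)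
    thus "X = Y" using strand_arc_same[of X Y "outer x" m] h by simp
  qed
  have fin: "finite (strands P)" using finite_strands[OF finite_P] .
  have "(\<Sum>a\<in>strand_arc m 2 ` ?O. blobs a) = (\<Sum>X\<in>?O. strand_blobs X)"
    unfolding sum.reindex[OF inj] by (simp add: strand_arc_def)
  moreover have "(\<Sum>x\<in>#image_mset (strand_cycle m) (mset_set ?H). snd x) =
    (\<Sum>X\<in>?H. strand_blobs X)"
    by (simp add: multiset.map_comp o_def sum_unfold_sum_mset)
  moreover have "(\<Sum>X\<in>?O. strand_blobs X) + (\<Sum>X\<in>?H. strand_blobs X) = (\<Sum>X\<in>strands P. strand_blobs X)"
    using sum.Int_Diff[OF fin, of strand_blobs "{X. boundary 2 X \<noteq> {}}"] by (simp add: Int_def set_diff_eq)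
  moreover have "(\<Sum>X\<in>strands P. strand_blobs X) = (\<Sum>p\<in>P. blobs (snd p))"
  proof -
    have "(\<Sum>p\<in>\<Union>((\<lambda>X. X) ` strands P). blobs (snd p)) = (\<Sum>X\<in>strands P. \<Sum>p\<in>X. blobs (snd p))"
    proof (rule sum_nested[OF fin])
      show "finite X" if "X \<in> strands P" for X using finite_sub strandD(2)[OF that] .
      show "X \<inter> Y = {}" if "X \<in> strands P" "Y \<in> strands P" "X \<noteq> Y" for X Y
        using strand_unique[OF that(1,2)] that(3) by (metis disjoint_iff)
    qed
    moreover have "\<Union>((\<lambda>X. X) ` strands P) = P" using strands_cover[of P] points_ne by simp
    ultimately show ?thesis by (simp add: strand_blobs_def)
  qed
  moreover have "(\<Sum>p\<in>P. blobs (snd p)) = (\<Sum>a\<in>arcs G1. blobs a) + (\<Sum>a\<in>arcs G2. blobs a)"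
  proof -
    have "P = (\<lambda>a. (0, a)) ` arcs G1 \<union> (\<lambda>a. (1, a)) ` arcs G2"
      unfolding stack_layers[symmetric] stack_def by auto
    moreover have "finite (arcs G1)" "finite (arcs G2)" using planar.finite_arcs p by (auto simp: planar_def)
    moreover have "(\<Sum>p\<in>(\<lambda>a. (0::nat, a)) ` arcs G1 \<union> (\<lambda>a. (1::nat, a)) ` arcs G2. blobs (snd p)) =
      (\<Sum>p\<in>(\<lambda>a. (0::nat, a)) ` arcs G1. blobs (snd p)) + (\<Sum>p\<in>(\<lambda>a. (1::nat, a)) ` arcs G2. blobs (snd p))"
      by (rule sum.union_disjoint) (use \<open>finite (arcs G1)\<close> \<open>finite (arcs G2)\<close> in auto)
    ultimately show ?thesis by (simp add: sum.reindex inj_on_def)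
  qed
  ultimately show ?thesis
    unfolding total_blobs_def compose_two_layers[OF p m] compose_layers_def by simp
qed

definition hor :: "nat \<Rightarrow> vertex arc set \<Rightarrow> vertex arc set" where
  "hor r A = {a \<in> A. \<forall>v\<in>ends a. fst v = r}"

text \<open>
  Both rows have \<open>n\<close> vertices, a horizontal arc uses two of them and a vertical arc
  uses one in each row.
\<close>

lemma (in planar) card_row:
  assumes r: "r = 0 \<or> r = 1"
  shows "n = 2 * card (hor r A) + card (A - hor 0 A - hor 1 A)"
proof -
  let ?row = "{v \<in> vertices n. fst v = r}"
  have fin: "finite A" by (rule finite_arcs)
  have "?row = Pair r ` {1..n}" using r by (auto simp: vertices_def)
  hence "card ?row = n" by (simp add: card_image inj_on_def)
  moreover have "?row = \<Union>((\<lambda>a. {v \<in> ends a. fst v = r}) ` A)" using arc_exists ends_sub by fastforce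
  moreover have "card (\<Union>((\<lambda>a. {v \<in> ends a. fst v = r}) ` A)) = (\<Sum>a\<in>A. card {v \<in> ends a. fst v = r})"
  proof (rule card_UN_disjoint[OF fin])
    show "\<forall>a\<in>A. finite {v \<in> ends a. fst v = r}" using finite_subset[OF ends_sub finite_vertices] by simp
    show "\<forall>a\<in>A. \<forall>b\<in>A. a \<noteq> b \<longrightarrow> {v \<in> ends a. fst v = r} \<inter> {v \<in> ends b. fst v = r} = {}"
    proof (intro ballI impI)
      fix a b assume "a \<in> A" "b \<in> A" "a \<noteq> b"
      hence "ends a \<inter> ends b = {}" using arc_unique by (metis disjoint_iff)
      thus "{v \<in> ends a. fst v = r} \<inter> {v \<in> ends b. fst v = r} = {}" by blast
    qed
  qed
  moreover have "card {v \<in> ends a. fst v = r} = (if a \<in> hor r A then 2 else if a \<in> A - hor 0 A - hor 1 A then 1 else 0)"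
    if a: "a \<in> A" for a
  proof -
    obtain x y where xy: "ends a = {x, y}" "x \<noteq> y" using ends_card[OF a] by (auto simp: card_2_iff)
    have "x \<in> vertices n" "y \<in> vertices n" using ends_sub[OF a] unfolding xy(1) by simp_all
    hence "fst x = 0 \<or> fst x = 1" "fst y = 0 \<or> fst y = 1" by (auto simp: vertices_def)
    moreover have "card {v \<in> {x, y}. fst v = r} = of_bool (fst x = r) + of_bool (fst y = r)"
      by (rule card_pair[OF xy(2)])
    moreover have "a \<in> hor s A \<longleftrightarrow> fst x = s \<and> fst y = s" for s using a xy(1) by (simp add: hor_def)
    ultimately show ?thesis using r a unfolding xy(1) by (elim disjE) simp_all
  qed
  moreover have "(\<Sum>a\<in>A. if a \<in> hor r A then 2 else if a \<in> A - hor 0 A - hor 1 A then 1 else 0) =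
    2 * card (hor r A) + card (A - hor 0 A - hor 1 A)"
  proof -
    have "(\<Sum>a\<in>A. if a \<in> hor r A then 2 else if a \<in> A - hor 0 A - hor 1 A then 1 else 0) =
      (\<Sum>a\<in>A. if a \<in> hor r A then 2 else 0) + (\<Sum>a\<in>A. if a \<in> A - hor 0 A - hor 1 A then 1 else (0::nat))"
      unfolding sum.distrib[symmetric] by (rule sum.cong) (use r in \<open>auto simp: hor_def\<close>)
    moreover have "A \<inter> hor r A = hor r A" by (auto simp: hor_def)
    moreover have "A \<inter> (A - hor 0 A - hor 1 A) = A - hor 0 A - hor 1 A" by blast
    ultimately show ?thesis using fin by (simp only: sum.If_cases Collect_mem_eq) simp
  qed
  ultimately show ?thesis by simp
qed

lemma (in planar) card_hor: "card (hor 0 A) = card (hor 1 A)"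
  using card_row[of 0] card_row[of 1] by simp

text \<open>
  A horizontal arc with both ends in an outer row of a stack of two meets no other piece.
\<close>

lemma (in layered) single_strand:
  assumes L: "L = 2" and a: "(t, a) \<in> P" "\<And>v. v \<in> ends a \<Longrightarrow> fst v = t" "dots a < m"
  shows "{(t, a)} \<in> strands P" "boundary L {(t, a)} \<noteq> {}" "strand_arc m 2 {(t, a)} = a"
proof -
  have "t < L" using a(1) piece_iff[of "(t, a)"] by simp
  hence t: "t = 0 \<or> t = 1" using L by linarith
  have row: "fst v = 2 * t" if "v \<in> points (t, a)" for v using that a(2) by (auto simp: points_shift)
  show X: "{(t, a)} \<in> strands P"
  proof (rule strand_singleI[OF a(1)])
    fix q v assume q: "q \<in> P" "v \<in> points q" "v \<in> points (t, a)"
    have "fst q < 2" using q(1) L piece_iff by blast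
    hence "fst q = t" using points_rows[OF q(1,2)] row[OF q(3)] t by auto
    thus "q = (t, a)" using piece_unique[OF q(1) a(1) _ q(2,3)] by simp
  qed
  have b: "boundary 2 {(t, a)} = points (t, a)" using row t by (auto simp: boundary_def pts_def)
  have out: "outer ` points (t, a) = ends a"
  proof -
    have "outer ` points (t, a) = (\<lambda>v. v) ` ends a"
      unfolding points_shift image_image by (rule image_cong[OF refl]) (use a(2) t in \<open>auto simp: outer_def prod_eq_iff\<close>)
    thus ?thesis by simp
  qed
  note fp = finite_points[OF a(1)] points_ne[OF a(1)]
  show "boundary L {(t, a)} \<noteq> {}" using b fp(2) L by simp
  show "strand_arc m 2 {(t, a)} = a"
  proof (rule strand_arc_eqI)
    have "dir (points (t, a)) (base_point (points (t, a))) = 1" by (rule dir_leftmost) (rule base_point_left[OF fp])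
    thus "strand_weight {(t, a)} = int (dots a)" by (simp add: strand_weight_def pts_def)
  qed (use a(3) b out in \<open>simp_all add: strand_blobs_def\<close>)
qed

lemma hor_compose_top:
  assumes p: "planar_matching n (arcs G1)" "planar_matching n (arcs G2)" and m: "m \<ge> 1"
    and a: "a \<in> hor 0 (arcs G1)" "dots a < m"
  shows "a \<in> hor 0 (arcs (compose m G1 G2))"
proof -
  interpret layered n 2 "two_layers G1 G2" by standard (use p in simp)
  have "(0, a) \<in> P" using a by (simp add: piece_iff hor_def)
  note X = single_strand[OF refl this _ a(2)]
  have "a \<in> arcs (compose m G1 G2)"
    unfolding compose_two_layers[OF p m] compose_layers_def using X a(1) by (force simp: hor_def)
  thus ?thesis using a(1) by (simp add: hor_def)
qed

lemma hor_flip: "planar_matching n A \<Longrightarrow> flip_arc ` hor 0 A = hor 1 (flip_arc ` A)" "planar_matching n A \<Longrightarrow> flip_arc ` hor 1 A = hor 0 (flip_arc ` A)"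
proof -
  assume "planar_matching n A"
  then interpret planar n A by (simp add: planar_def)
  have V: "fst v = 0 \<or> fst v = 1" if "a \<in> A" "v \<in> ends a" for a v
    using ends_sub[OF that(1)] that(2) by (auto simp: vertices_def)
  have "(\<forall>v\<in>ends (flip_arc a). fst v = 1) \<longleftrightarrow> (\<forall>v\<in>ends a. fst v = 0)"
    "(\<forall>v\<in>ends (flip_arc a). fst v = 0) \<longleftrightarrow> (\<forall>v\<in>ends a. fst v = 1)" if "a \<in> A" for a
    using V[OF that] by (force simp: flip_vertex_def)+
  thus "flip_arc ` hor 0 A = hor 1 (flip_arc ` A)" "flip_arc ` hor 1 A = hor 0 (flip_arc ` A)"
    unfolding hor_def by (intro filter_image[symmetric]; simp)+
qed

lemma hor_compose_bottom:
  assumes p: "planar_matching n (arcs G1)" "planar_matching n (arcs G2)" and m: "m \<ge> 1"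
    and a: "a \<in> hor 1 (arcs G2)" "dots a < m"
  shows "a \<in> hor 1 (arcs (compose m G1 G2))"
proof -
  have f: "planar_matching n (arcs (flip G1))" "planar_matching n (arcs (flip G2))"
    using planar.planar_flip p by (simp_all add: planar_def)
  have pc: "planar_matching n (arcs (compose m G1 G2))" using planar_compose[OF p m] .
  have "flip_arc a \<in> hor 0 (arcs (flip G2))" using hor_flip(2)[OF p(2)] a(1) by auto
  hence "flip_arc a \<in> hor 0 (arcs (compose m (flip G2) (flip G1)))"
    using hor_compose_top[OF f(2,1) m] a(2) by simp
  hence "flip_arc a \<in> flip_arc ` hor 1 (arcs (compose m G1 G2))"
    using flip_compose[OF p m] hor_flip(2)[OF pc] by (metis arcs_flip)
  then obtain b where b: "b \<in> hor 1 (arcs (compose m G1 G2))" "flip_arc a = flip_arc b" by blast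
  have "flip_arc (flip_arc a) = a" "flip_arc (flip_arc b) = b"
    using planar.flip_arc_flip p(2) pc a(1) b(1) by (auto simp: planar_def hor_def)
  thus ?thesis using b by metis
qed

section \<open>Reduction\<close>

definition reblob :: "(vertex arc \<Rightarrow> nat) \<Rightarrow> vertex arc \<Rightarrow> vertex arc" where
  "reblob h a = Arc (ends a) (dots a) (h a)"

lemma reblob_simps [simp]: "ends (reblob h a) = ends a" "dots (reblob h a) = dots a" "blobs (reblob h a) = h a"
  by (simp_all add: reblob_def)

lemma planar_reblob:
  assumes "planar_matching n A"
  shows "planar_matching n (reblob h ` A)"
proof -
  interpret planar n A using assms by (simp add: planar_def)
  have lohi: "lo pos (reblob h a) = lo pos a" "hi pos (reblob h a) = hi pos a" for a
    by (simp_all add: lo_def hi_def)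
  show ?thesis unfolding planar_matching_def
  proof (intro conjI ballI)
    fix a' assume "a' \<in> reblob h ` A"
    then obtain a where a: "a \<in> A" "a' = reblob h a" by blast
    show "ends a' \<subseteq> vertices n" "card (ends a') = 2" using a ends_sub ends_card by simp_all
    fix b' assume "b' \<in> reblob h ` A"
    then obtain b where b: "b \<in> A" "b' = reblob h b" by blast
    show "\<not> crosses pos a' b'" using not_crosses[OF a(1) b(1)] a(2) b(2) by (simp add: crosses_def lohi)
  next
    fix v assume "v \<in> vertices n"
    then obtain a where a: "a \<in> A" "v \<in> ends a" using arc_exists by blast
    show "\<exists>!a. a \<in> reblob h ` A \<and> v \<in> ends a"
    proof (rule ex1I[of _ "reblob h a"])
      show "reblob h a \<in> reblob h ` A \<and> v \<in> ends (reblob h a)" using a by simp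
      fix b' assume b': "b' \<in> reblob h ` A \<and> v \<in> ends b'"
      then obtain b where b: "b \<in> A" "b' = reblob h b" by blast
      hence "b = a" using arc_unique[OF b(1) a(1)] b' a(2) by simp
      thus "b' = reblob h a" using b by simp
    qed
  qed
qed

context layered
begin

definition reblobbed :: "(nat \<Rightarrow> vertex arc \<Rightarrow> nat) \<Rightarrow> piece \<Rightarrow> piece" where
  "reblobbed h p = (fst p, reblob (h (fst p)) (snd p))"

definition blob_sum :: "(nat \<Rightarrow> vertex arc \<Rightarrow> nat) \<Rightarrow> piece set \<Rightarrow> nat" where
  "blob_sum h X = (\<Sum>p\<in>X. h (fst p) (snd p))"

lemma points_reblobbed [simp]: "points (reblobbed h p) = points p"
  by (simp add: points_piece reblobbed_def)

lemma reblobbed_inj: "inj_on (reblobbed h) P"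
proof (rule inj_onI)
  fix p q assume h: "p \<in> P" "q \<in> P" "reblobbed h p = reblobbed h q"
  hence f: "fst p = fst q" by (simp add: reblobbed_def)
  have "points p = points q" using h(3) points_reblobbed by metis
  moreover obtain v where "v \<in> points p" using points_ne[OF h(1)] by blast
  ultimately show "p = q" using piece_unique[OF h(1,2) f] by simp
qed

lemma layers_reblob: "layers L (\<lambda>t. reblob (h t) ` A t) = reblobbed h ` P"
proof (intro equalityI subsetI)
  fix p assume "p \<in> layers L (\<lambda>t. reblob (h t) ` A t)"
  then obtain t a where p: "p = (t, reblob (h t) a)" "t < L" "a \<in> A t" by (auto simp: layers_def)
  hence "p = reblobbed h (t, a)" "(t, a) \<in> P" by (simp_all add: reblobbed_def piece_iff)
  thus "p \<in> reblobbed h ` P" by (rule image_eqI)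
next
  fix p assume "p \<in> reblobbed h ` P"
  then obtain q where q: "q \<in> P" "p = reblobbed h q" by blast
  hence "fst q < L" "snd q \<in> A (fst q)" by (simp_all add: piece_iff)
  thus "p \<in> layers L (\<lambda>t. reblob (h t) ` A t)" using q(2) by (simp add: reblobbed_def layers_def)
qed

text \<open>
  The strands and their dots are determined by the ends and dots of the pieces, so changing blob
  numbers changes only the sums of blobs over the strands.
\<close>

lemma compose_reblob:
  "compose_layers m L (\<lambda>t. reblob (h t) ` A t) Z = Diagram
    ((\<lambda>X. Arc (outer ` boundary L X) (nat (strand_weight X mod int m)) (blob_sum h X)) `
      open_strands)
    (Z + image_mset (\<lambda>X. (nat (strand_weight X mod int m), blob_sum h X))
      (mset_set loops))"
proof -
  let ?f = "(`) (reblobbed h)"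
  have D: "X \<subseteq> P" if "X \<in> strands P" for X using strandD(2)[OF that] .
  have pts: "pts (?f X) = pts X" for X by (simp add: pts_def)
  have bd: "boundary L (?f X) = boundary L X" for X by (simp add: boundary_def pts)
  have w: "strand_weight (?f X) = strand_weight X" if "X \<in> strands P" for X
    unfolding strand_weight_def pts
    by (subst sum.reindex[OF inj_on_subset[OF reblobbed_inj D[OF that]]]) (simp add: reblobbed_def points_piece)
  have b: "strand_blobs (?f X) = blob_sum h X" if "X \<in> strands P" for X
    unfolding strand_blobs_def blob_sum_def
    by (subst sum.reindex[OF inj_on_subset[OF reblobbed_inj D[OF that]]]) (simp add: reblobbed_def)
  have st: "strands (reblobbed h ` P) = ?f ` strands P"
    by (rule strands_image) (simp_all add: reblobbed_inj pieces_axioms)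
  have inj: "inj_on ?f (strands P)"
    by (rule inj_on_subset[OF inj_on_image_Pow[OF reblobbed_inj]]) (use D in blast)
  have o: "{X \<in> ?f ` strands P. boundary L X \<noteq> {}} = ?f ` open_strands"
    and c: "{X \<in> ?f ` strands P. boundary L X = {}} = ?f ` loops"
    by (rule filter_image, simp add: bd)+
  have arcs: "strand_arc m L ` ?f ` open_strands =
    (\<lambda>X. Arc (outer ` boundary L X) (nat (strand_weight X mod int m)) (blob_sum h X)) `
      open_strands"
    unfolding image_image by (rule image_cong[OF refl]) (simp add: strand_arc_def bd w b)
  have "mset_set (?f ` loops) =
      image_mset ?f (mset_set loops)"
    by (rule image_mset_mset_set[symmetric]) (rule inj_on_subset[OF inj], blast)
  moreover have "image_mset (strand_cycle m)
      (image_mset ?f (mset_set loops)) =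
    image_mset (\<lambda>X. (nat (strand_weight X mod int m), blob_sum h X))
      (mset_set loops)"
    unfolding multiset.map_comp
    by (rule image_mset_cong) (use finite_strands[OF finite_P] in \<open>simp add: w b\<close>)
  ultimately show ?thesis unfolding compose_layers_def layers_reblob st o c arcs by simp
qed

end

definition odd_cycles :: "(nat \<times> nat) multiset \<Rightarrow> nat" where
  "odd_cycles Z = size (filter_mset (\<lambda>x. odd (snd x)) Z)"

definition cycle_weight :: "(nat \<Rightarrow> 'k::field) \<Rightarrow> nat \<times> nat \<Rightarrow> 'k" where
  "cycle_weight \<delta> x = (if fst x = 0 \<and> odd (snd x) then 1 else \<delta> (fst x))"

text \<open>
  The scalar that a multiset of cycles contributes. A cycle with \<open>[i, 0]\<close> contributes
  \<open>\<delta> i\<close>, and so does a cycle with \<open>[i, 1]\<close> for \<open>i \<ge>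
  1\<close>, which leaves a cycle with \<open>[0, 1]\<close>; of several cycles with a blob one
  survives, and each other one loses its blob and contributes a factor \<open>\<delta> 0\<close>.
\<close>

definition cycle_value :: "(nat \<Rightarrow> 'k::field) \<Rightarrow> (nat \<times> nat) multiset \<Rightarrow> 'k" where
  "cycle_value \<delta> Z = (\<Prod>x\<in>#Z. cycle_weight \<delta> x) * \<delta> 0 ^ (odd_cycles Z - 1)"

definition reduced_blobs :: "tangle \<Rightarrow> vertex arc \<Rightarrow> nat" where
  "reduced_blobs G a = (if odd_cycles (cycles G) = 0 then blobs a mod 2 else 0)"

text \<open>
  The normal form: as soon as one cycle has an odd number of blobs, it absorbs all other blobs.
\<close>

definition reduced :: "tangle \<Rightarrow> tangle" where
  "reduced G = Diagram (reblob (reduced_blobs G) ` arcs G)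
     (if odd_cycles (cycles G) = 0 then {#} else {#(0, 1)#})"

lemma odd_cycles_simps [simp]:
  "odd_cycles {#} = 0"
  "odd_cycles (add_mset x Z) = (if odd (snd x) then Suc (odd_cycles Z) else odd_cycles Z)"
  "odd_cycles (Z + W) = odd_cycles Z + odd_cycles W"
  by (simp_all add: odd_cycles_def)

lemma odd_cycles_pos: "odd_cycles Z > 0 \<longleftrightarrow> (\<exists>x\<in>#Z. odd (snd x))"
proof -
  have "odd_cycles Z = 0 \<longleftrightarrow> (\<forall>x\<in>#Z. \<not> odd (snd x))"
    unfolding odd_cycles_def size_eq_0_iff_empty filter_mset_eq_conv by simp
  thus ?thesis by auto
qed

lemma cycle_value_even:
  assumes "odd_cycles Z = 0"
  shows "cycle_value \<delta> (Z + W) = (\<Prod>x\<in>#Z. \<delta> (fst x)) * cycle_value \<delta> W"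
proof -
  have "\<forall>x\<in>#Z. even (snd x)" using assms odd_cycles_pos[of Z] by auto
  hence "image_mset (cycle_weight \<delta>) Z = image_mset (\<lambda>x. \<delta> (fst x)) Z"
    by (intro image_mset_cong) (simp add: cycle_weight_def)
  thus ?thesis using assms by (simp add: cycle_value_def)
qed

lemma cycle_value_parity:
  assumes "image_mset (\<lambda>x. (fst x, snd x mod 2)) Z = image_mset (\<lambda>x. (fst x, snd x mod 2)) W"
  shows "cycle_value \<delta> Z = cycle_value \<delta> W" "odd_cycles Z = odd_cycles W"
proof -
  have w: "cycle_weight \<delta> = cycle_weight \<delta> \<circ> (\<lambda>x. (fst x, snd x mod 2))"
    by (rule ext) (simp add: cycle_weight_def)
  have "image_mset (cycle_weight \<delta>) Z = image_mset (cycle_weight \<delta>) W"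
    using assms by (subst (1 2) w) (simp only: multiset.map_comp[symmetric])
  moreover have o: "odd_cycles V = odd_cycles (image_mset (\<lambda>x. (fst x, snd x mod 2)) V)" for V
    by (induction V) auto
  have "odd_cycles Z = odd_cycles W" using assms o[of Z] o[of W] by simp
  ultimately show "cycle_value \<delta> Z = cycle_value \<delta> W" "odd_cycles Z = odd_cycles W"
    by (simp_all add: cycle_value_def)
qed

locale parameters =
  fixes m n :: nat and \<delta> :: "nat \<Rightarrow> 'k::field"
  assumes m: "m \<ge> 1"
    and absorb: "\<And>i. 1 \<le> i \<Longrightarrow> i \<le> m - 1 \<Longrightarrow> \<delta> i * \<delta> 0 = \<delta> i"
begin

text \<open>
  In the presence of a cycle with a blob a further cycle contributes \<open>\<delta> i\<close>
  whether or not it has a blob. For a blob and \<open>i \<ge> 1\<close> the formula yields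
  \<open>\<delta> i * \<delta> 0\<close>, which is \<open>\<delta> i\<close> by
  \<open>absorb\<close>.
\<close>

lemma cycle_value_add_odd:
  assumes "odd_cycles Z > 0" "fst x < m"
  shows "cycle_value \<delta> (add_mset x Z) = cycle_value \<delta> Z * \<delta> (fst x)"
proof (cases "even (snd x)")
  case True
  thus ?thesis by (simp add: cycle_value_def cycle_weight_def)
next
  case False
  obtain k where k: "odd_cycles Z = Suc k" using assms(1) by (cases "odd_cycles Z") auto
  show ?thesis
  proof (cases "fst x = 0")
    case True
    thus ?thesis using False k by (simp add: cycle_value_def cycle_weight_def)
  next
    case ne: False
    hence "\<delta> (fst x) * \<delta> 0 = \<delta> (fst x)" using absorb[of "fst x"] assms(2) by simp
    thus ?thesis using False ne k by (auto simp: cycle_value_def cycle_weight_def)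
  qed
qed

lemma cycle_value_plus_odd:
  assumes "odd_cycles Z > 0" "\<forall>x\<in>#W. fst x < m"
  shows "cycle_value \<delta> (Z + W) = cycle_value \<delta> Z * (\<Prod>x\<in>#W. \<delta> (fst x))"
  using assms(2)
proof (induction W)
  case (add x W)
  have "odd_cycles (Z + W) > 0" using assms(1) by simp
  from cycle_value_add_odd[OF this, of x] add show ?case by (simp add: mult_ac)
qed simp

lemma cycle_value_odd_delta:
  assumes "\<forall>x\<in>#Z. fst x < m" "odd_cycles Z > 0"
  shows "cycle_value \<delta> Z * \<delta> 0 = (\<Prod>x\<in>#Z. \<delta> (fst x))"
proof -
  obtain x where x: "x \<in># Z" "odd (snd x)" using assms(2) odd_cycles_pos by blast
  define W where "W = Z - {#x#}"
  have Z: "Z = {#x#} + W" using x(1) by (simp add: W_def)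
  have xm: "fst x < m" using assms(1) x(1) by blast
  have "cycle_value \<delta> {#x#} * \<delta> 0 = \<delta> (fst x)"
    using x(2) absorb[of "fst x"] xm by (auto simp: cycle_value_def cycle_weight_def)
  moreover have "cycle_value \<delta> Z = cycle_value \<delta> {#x#} * (\<Prod>x\<in>#W. \<delta> (fst x))"
    unfolding Z by (rule cycle_value_plus_odd) (use x assms(1) Z in auto)
  ultimately show ?thesis using Z by (simp add: mult_ac)
qed

text \<open>
  The normal form and the scalar times the value of the cycles are invariants of every relation.
  As the value is \<open>1\<close> on admissible diagrams, they determine the result of any
  complete reduction.
\<close>

lemma reduces_invariant:
  assumes "reduces m \<delta> (c, D) (c', D')" and "\<forall>x\<in>#cycles D. fst x < m" "finite (arcs D)"
  shows "reduced D' = reduced D \<and> c' * cycle_value \<delta> (cycles D') = c * cycle_value \<delta> (cycles D) \<and>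
    (\<forall>x\<in>#cycles D'. fst x < m) \<and> finite (arcs D')"
  using assms
proof (cases rule: reduces.cases)
  case (remove_cycle i A Z)
  thus ?thesis using assms
    by (simp add: reduced_def reduced_blobs_def[abs_def] cycle_value_def cycle_weight_def mult_ac)
next
  case (cancel_blobs_arc e r s A Z)
  thus ?thesis using assms
    by (auto simp: reduced_def reduced_blobs_def[abs_def] reblob_def)
next
  case (cancel_blobs_cycle A r s Z)
  thus ?thesis using assms
    by (simp add: reduced_def reduced_blobs_def[abs_def] cycle_value_def cycle_weight_def)
next
  case (lose_blob_arc Z e r s A)
  hence "odd_cycles Z > 0" using odd_cycles_pos[of Z] by force
  thus ?thesis using assms lose_blob_arc
    by (auto simp: reduced_def reduced_blobs_def[abs_def] reblob_def)
next
  case (lose_blob_cycle Z A r s)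
  hence o: "odd_cycles Z > 0" using odd_cycles_pos[of Z] by force
  have "r < m" using assms(2) lose_blob_cycle by simp
  hence "cycle_value \<delta> (add_mset (r, s + 1) Z) = cycle_value \<delta> (add_mset (r, s) Z)"
    using cycle_value_add_odd[OF o, of "(r, s + 1)"] cycle_value_add_odd[OF o, of "(r, s)"] by simp
  thus ?thesis using assms lose_blob_cycle o
    by (simp add: reduced_def reduced_blobs_def[abs_def])
next
  case (lose_dots_cycle i A Z)
  thus ?thesis using assms m
    by (simp add: reduced_def reduced_blobs_def[abs_def] cycle_value_def cycle_weight_def mult_ac)
qed

lemma reduces_star_invariant:
  assumes "(reduces m \<delta>)\<^sup>*\<^sup>* (c, D) (c', D')" and "\<forall>x\<in>#cycles D. fst x < m" "finite (arcs D)"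
  shows "reduced D' = reduced D \<and> c' * cycle_value \<delta> (cycles D') = c * cycle_value \<delta> (cycles D)"
proof -
  have "reduced (snd x) = reduced D \<and> fst x * cycle_value \<delta> (cycles (snd x)) = c * cycle_value \<delta> (cycles D) \<and>
    (\<forall>y\<in>#cycles (snd x). fst y < m) \<and> finite (arcs (snd x))"
    if "(reduces m \<delta>)\<^sup>*\<^sup>* (c, D) x" for x
    using that
  proof (induction rule: rtranclp_induct)
    case base
    thus ?case using assms by simp
  next
    case (step y z)
    have r: "reduces m \<delta> (fst y, snd y) (fst z, snd z)" using step.hyps(2) by simp
    show ?case using reduces_invariant[OF r] step.IH by simp
  qed
  from this[OF assms(1)] show ?thesis by simp
qed

text \<open>
  Every step chosen in \<open>reduces_step\<close> decreases this number, which proves that a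
  normal form is reached.
\<close>

definition reduction_size :: "tangle \<Rightarrow> nat" where
  "reduction_size D = (\<Sum>a\<in>arcs D. blobs a) + (\<Sum>x\<in>#cycles D. fst x + snd x + 1)"

lemma sum_blobs_insert: "finite A \<Longrightarrow> (\<Sum>a\<in>insert b A. blobs a) \<le> blobs b + (\<Sum>a\<in>A. blobs a)"
  by (simp add: sum.insert_if)

lemma reduces_step:
  assumes "\<forall>x\<in>#cycles D. fst x < m" "finite (arcs D)" "reduced D \<noteq> D"
  shows "\<exists>c' D'. reduces m \<delta> (c, D) (c', D') \<and> reduction_size D' < reduction_size D"
proof -
  obtain A0 Z0 where D: "D = Diagram A0 Z0" by (cases D)
  have fin: "finite A0" using assms(2) D by simp
  have arc: ?thesis if a: "a \<in> A0" "blobs a = s + t" "t > 0"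
    and red: "\<And>A. Arc (ends a) (dots a) (s + t) \<notin> A \<Longrightarrow>
      reduces m \<delta> (c, Diagram (insert (Arc (ends a) (dots a) (s + t)) A) Z0) (c, Diagram (insert (Arc (ends a) (dots a) s) A) Z0)" for a s t
  proof -
    have e: "Arc (ends a) (dots a) (s + t) = a" using a(2) by (cases a) simp
    have "A0 = insert a (A0 - {a})" using a(1) by blast
    hence "reduces m \<delta> (c, D) (c, Diagram (insert (Arc (ends a) (dots a) s) (A0 - {a})) Z0)"
      using red[of "A0 - {a}"] unfolding e D by simp
    moreover have "(\<Sum>b\<in>insert (Arc (ends a) (dots a) s) (A0 - {a}). blobs b) < (\<Sum>b\<in>A0. blobs b)"
      using sum_blobs_insert[of "A0 - {a}" "Arc (ends a) (dots a) s"] fin sum.remove[OF fin a(1), of blobs] a(2,3) by simp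
    ultimately show ?thesis
      by (intro exI[of _ c] exI[of _ "Diagram (insert (Arc (ends a) (dots a) s) (A0 - {a})) Z0"])
        (simp add: reduction_size_def D)
  qed
  have cyc: ?thesis if "x \<in># Z0" "reduces m \<delta> (c, Diagram A0 (add_mset x (Z0 - {#x#}))) (c', Diagram A0 W)"
    "(\<Sum>y\<in>#W. fst y + snd y + 1) < (\<Sum>y\<in>#add_mset x (Z0 - {#x#}). fst y + snd y + 1)" for x c' W
    using that by (intro exI[of _ c'] exI[of _ "Diagram A0 W"]) (simp add: D reduction_size_def)
  show ?thesis
  proof (rule ccontr)
    assume no: "\<not> ?thesis"
    have b1: "\<not> blobs a \<ge> 2" if a: "a \<in> A0" for a
    proof
      assume ge: "blobs a \<ge> 2"
      show False by (rule notE[OF no], rule arc[OF a, of "blobs a - 2" 2]) (use ge cancel_blobs_arc in simp_all)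
    qed
    have s1: "\<not> snd x \<ge> 2" if x: "x \<in># Z0" for x
    proof
      assume "snd x \<ge> 2"
      then obtain r s where rs: "(r, s + 2) \<in># Z0" using x by (metis add.commute le_Suc_ex prod.collapse)
      show False by (rule notE[OF no], rule cyc[OF rs cancel_blobs_cycle]) simp
    qed
    have m: "fst x < m" if "x \<in># Z0" for x using assms(1) D that by simp
    have s0: "snd x \<noteq> 0" if x: "x \<in># Z0" for x
    proof
      assume "snd x = 0"
      hence i: "(fst x, 0) \<in># Z0" using x by (metis prod.collapse)
      show False by (rule notE[OF no], rule cyc[OF i remove_cycle[OF m[OF x]]]) simp
    qed
    have one: "snd x = 1" if "x \<in># Z0" for x using s0[OF that] s1[OF that] by linarith
    have r0: "\<not> fst x \<ge> 1" if x: "x \<in># Z0" for x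
    proof
      assume i: "fst x \<ge> 1"
      have z: "(fst x, 1) \<in># Z0" using x one[OF x] by (metis prod.collapse)
      show False by (rule notE[OF no], rule cyc[OF z lose_dots_cycle[OF i m[OF x]]]) (use i in simp)
    qed
    have z: "x = (0, 1)" if "x \<in># Z0" for x using one[OF that] r0[OF that] by (simp add: prod_eq_iff)
    show False
    proof (cases "Z0 = {#}")
      case True
      have "reblob (reduced_blobs D) a = a" if "a \<in> A0" for a
        using b1 that True D by (cases a) (force simp: reblob_def reduced_blobs_def)
      thus False using assms(3) True D by (simp add: reduced_def)
    next
      case False
      then obtain x W where xW: "Z0 = add_mset x W" by (meson multiset_cases)
      hence Z0: "Z0 = add_mset (0, 1) W" using z[of x] by simp
      have W: "W = {#}"
      proof (rule ccontr)
        assume "W \<noteq> {#}"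
        then obtain y W' where yW: "W = add_mset y W'" by (meson multiset_cases)
        hence W: "W = add_mset (0, 1) W'" using z[of y] Z0 by simp
        have "reduces m \<delta> (c, Diagram A0 (add_mset (0, 0 + 1) W)) (c, Diagram A0 (add_mset (0, 0) W))"
          by (rule lose_blob_cycle) (simp add: W)
        thus False using Z0
          by - (rule notE[OF no], intro exI[of _ c] exI[of _ "Diagram A0 (add_mset (0, 0) W)"], simp add: D reduction_size_def)
      qed
      have "blobs a \<noteq> 1" if a: "a \<in> A0" for a
      proof
        assume "blobs a = 1"
        thus False using Z0 lose_blob_arc[of Z0] by - (rule notE[OF no], rule arc[OF a, of 0 1], simp_all)
      qed
      hence b0: "blobs a = 0" if "a \<in> A0" for a using b1[OF that] that by (metis One_nat_def less_2_cases not_less)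
      hence "reblob (reduced_blobs D) a = a" if "a \<in> A0" for a
        using b0[OF that] Z0 D by (cases a) (simp add: reblob_def reduced_blobs_def)
      thus False using assms(3) Z0 W D by (simp add: reduced_def)
    qed
  qed
qed

lemma reduces_to_reduced:
  assumes "\<forall>x\<in>#cycles D. fst x < m" "finite (arcs D)"
  shows "\<exists>c'. (reduces m \<delta>)\<^sup>*\<^sup>* (c, D) (c', reduced D)"
  using assms
proof (induction "reduction_size D" arbitrary: c D rule: less_induct)
  case less
  show ?case
  proof (cases "reduced D = D")
    case True
    thus ?thesis by (intro exI[of _ c]) simp
  next
    case False
    obtain c1 D1 where s: "reduces m \<delta> (c, D) (c1, D1)" "reduction_size D1 < reduction_size D"
      using reduces_step[OF less.prems False] by blast
    note inv = reduces_invariant[OF s(1) less.prems]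
    obtain c' where "(reduces m \<delta>)\<^sup>*\<^sup>* (c1, D1) (c', reduced D1)"
      using less.hyps[OF s(2)] inv by blast
    thus ?thesis using s(1) inv by (metis converse_rtranclp_into_rtranclp)
  qed
qed

lemma admissible_reduced:
  assumes "admissible m n G"
  shows "reduced G = G" "cycle_value \<delta> (cycles G) = 1"
proof -
  have b: "blobs a \<le> 1" if "a \<in> arcs G" for a using assms that by (simp add: admissible_def)
  have r: "reblob (reduced_blobs G) ` arcs G = arcs G" if "\<And>a. a \<in> arcs G \<Longrightarrow> reduced_blobs G a = blobs a"
  proof -
    have "reblob (reduced_blobs G) a = a" if "a \<in> arcs G" for a
      using \<open>\<And>a. a \<in> arcs G \<Longrightarrow> reduced_blobs G a = blobs a\<close>[OF that] by (cases a) (simp add: reblob_def)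
    thus ?thesis by simp
  qed
  consider "type_I G" | "type_II G" using assms by (auto simp: admissible_def)
  hence "reduced G = G \<and> cycle_value \<delta> (cycles G) = 1"
  proof cases
    case 1
    hence c: "cycles G = {#(0, 1)#}" "\<And>a. a \<in> arcs G \<Longrightarrow> reduced_blobs G a = blobs a"
      by (simp_all add: type_I_def reduced_blobs_def)
    thus ?thesis using r by (cases G) (simp add: reduced_def cycle_value_def cycle_weight_def)
  next
    case 2
    hence c: "cycles G = {#}" by (simp add: type_II_def)
    hence "\<And>a. a \<in> arcs G \<Longrightarrow> reduced_blobs G a = blobs a" using b by (simp add: reduced_blobs_def) force
    thus ?thesis using r c by (cases G) (simp add: reduced_def cycle_value_def)
  qed
  thus "reduced G = G" "cycle_value \<delta> (cycles G) = 1" by simp_all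
qed

text \<open>
  Reducing the factors first does not change the reduced product. If neither factor has an odd
  cycle, only the parities of blobs are changed, and composition adds blobs. Otherwise the product
  has an odd cycle, all blobs disappear, and every cycle formed contributes
  \<open>\<delta>\<close> of its dots.
\<close>

lemma reduced_compose:
  assumes G: "decorated_tangle m n G1" "decorated_tangle m n G2"
  shows "reduced (compose m (reduced G1) (reduced G2)) = reduced (compose m G1 G2)" (is ?r)
    and "cycle_value \<delta> (cycles G1) * cycle_value \<delta> (cycles G2) *
      cycle_value \<delta> (cycles (compose m (reduced G1) (reduced G2))) =
      cycle_value \<delta> (cycles (compose m G1 G2))" (is ?v)
proof -
  note p = decorated_planar[OF G(1)] decorated_planar[OF G(2)]
  interpret layered n 2 "two_layers G1 G2" by standard (use p in simp)
  define Z1 Z2 where "Z1 = cycles G1" and "Z2 = cycles G2"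
  define h where "h t = (if t = (0::nat) then reduced_blobs G1 else reduced_blobs G2)" for t
  define R1 R2 where "R1 = cycles (reduced G1)" and "R2 = cycles (reduced G2)"
  define CL where "CL = mset_set {X \<in> strands P. boundary 2 X = {}}"
  define OP where "OP = {X \<in> strands P. boundary 2 X \<noteq> {}}"
  define W where "W X = nat (strand_weight X mod int m)" for X
  define N where "N = image_mset (\<lambda>X. (W X, strand_blobs X)) CL"
  define N' where "N' = image_mset (\<lambda>X. (W X, blob_sum h X)) CL"
  have C: "compose m G1 G2 = Diagram ((\<lambda>X. Arc (outer ` boundary 2 X) (W X) (strand_blobs X)) ` OP) (Z1 + Z2 + N)"
    unfolding compose_two_layers[OF p m] compose_layers_def strand_arc_def[abs_def]
    by (simp add: Z1_def Z2_def N_def CL_def OP_def W_def)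
  have C': "compose m (reduced G1) (reduced G2) =
    Diagram ((\<lambda>X. Arc (outer ` boundary 2 X) (W X) (blob_sum h X)) ` OP) (R1 + R2 + N')"
  proof -
    have pr: "planar_matching n (arcs (reduced G1))" "planar_matching n (arcs (reduced G2))"
      using planar_reblob p by (simp_all add: reduced_def)
    have "compose m (reduced G1) (reduced G2) =
      compose_layers m 2 (\<lambda>t. reblob (h t) ` two_layers G1 G2 t) (R1 + R2)"
      unfolding compose_two_layers[OF pr m] R1_def R2_def
      by (rule compose_layers_cong) (simp add: reduced_def h_def)
    thus ?thesis unfolding compose_reblob by (simp add: N'_def CL_def OP_def W_def)
  qed
  have lt: "W X < m" for X using m by (simp add: W_def nat_less_iff)
  have NN: "\<forall>x\<in>#N. fst x < m" "\<forall>x\<in>#N'. fst x < m" using lt by (auto simp: N_def N'_def)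
  have ZZ: "\<forall>x\<in>#Z1. fst x < m" "\<forall>x\<in>#Z2. fst x < m" using G by (auto simp: Z1_def Z2_def decorated_tangle_def)
  have fN: "image_mset fst N = image_mset fst N'" by (simp add: N_def N'_def multiset.map_comp o_def)
  let ?\<Delta> = "\<lambda>Z. \<Prod>x\<in>#Z. \<delta> (fst x)"
  have dN: "?\<Delta> N = ?\<Delta> N'"
  proof -
    have "?\<Delta> V = (\<Prod>x\<in>#image_mset fst V. \<delta> x)" for V :: "(nat \<times> nat) multiset"
      by (simp add: multiset.map_comp o_def)
    thus ?thesis using fN by simp
  qed
  have R: "R1 = (if odd_cycles Z1 = 0 then {#} else {#(0, 1)#})" "R2 = (if odd_cycles Z2 = 0 then {#} else {#(0, 1)#})"
    by (simp_all add: R1_def R2_def reduced_def Z1_def Z2_def)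
  have v1: "cycle_value \<delta> {#(0, 1)#} = 1" by (simp add: cycle_value_def cycle_weight_def)
  have red: "reduced (Diagram ((\<lambda>X. Arc (outer ` boundary 2 X) (W X) (b X)) ` OP) Z) =
    Diagram ((\<lambda>X. Arc (outer ` boundary 2 X) (W X) (if odd_cycles Z = 0 then b X mod 2 else 0)) ` OP)
      (if odd_cycles Z = 0 then {#} else {#(0, 1)#})" for b Z
    by (simp add: reduced_def image_image reblob_def reduced_blobs_def cong: if_cong)
  have "?r \<and> ?v"
  proof (cases "odd_cycles Z1 = 0 \<and> odd_cycles Z2 = 0")
    case True
    have par: "blob_sum h X mod 2 = strand_blobs X mod 2" for X
    proof -
      have "blob_sum h X mod 2 = (\<Sum>p\<in>X. blobs (snd p) mod 2) mod 2"
        unfolding blob_sum_def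
        by (rule arg_cong[where f = "\<lambda>s. s mod 2"], rule sum.cong[OF refl])
          (use True in \<open>simp add: h_def reduced_blobs_def Z1_def Z2_def\<close>)
      thus ?thesis by (simp add: strand_blobs_def mod_sum_eq)
    qed
    have "image_mset (\<lambda>x. (fst x, snd x mod 2)) N' = image_mset (\<lambda>x. (fst x, snd x mod 2)) N"
      unfolding N_def N'_def multiset.map_comp by (rule image_mset_cong) (simp add: par)
    note cp = cycle_value_parity(1)[OF this, of \<delta>] cycle_value_parity(2)[OF this]
    have o: "odd_cycles (R1 + R2 + N') = odd_cycles (Z1 + Z2 + N)" using R True cp(2) by simp
    have ?r unfolding C C' red o by (simp add: par cong: if_cong)
    moreover have ?v
    proof -
      have e: "cycle_value \<delta> Z1 = ?\<Delta> Z1" "cycle_value \<delta> Z2 = ?\<Delta> Z2"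
        using cycle_value_even[of Z1 \<delta> "{#}"] cycle_value_even[of Z2 \<delta> "{#}"] True by (simp_all add: cycle_value_def)
      have "cycle_value \<delta> (Z1 + Z2 + N) = ?\<Delta> Z1 * (?\<Delta> Z2 * cycle_value \<delta> N)"
        using cycle_value_even[of Z1 \<delta> "Z2 + N"] cycle_value_even[of Z2 \<delta> N] True by (simp add: add.assoc)
      thus ?thesis using R True cp(1) e unfolding C C' Z1_def[symmetric] Z2_def[symmetric] by (simp add: mult.assoc)
    qed
    ultimately show ?thesis ..
  next
    case False
    have o: "odd_cycles (Z1 + Z2 + N) \<noteq> 0" "odd_cycles (R1 + R2 + N') \<noteq> 0" using R False by auto
    have ?r unfolding C C' red by (simp only: if_not_P[OF o(1)] if_not_P[OF o(2)])
    moreover have ?v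
    proof -
      have val: "cycle_value \<delta> (Z + V) = cycle_value \<delta> Z * ?\<Delta> V"
        if "odd_cycles Z \<noteq> 0" "\<forall>x\<in>#V. fst x < m" for Z V
        using cycle_value_plus_odd[of Z V] that by simp
      have even: "cycle_value \<delta> Z = ?\<Delta> Z" if "odd_cycles Z = 0" for Z
        using cycle_value_even[OF that, of \<delta> "{#}"] by (simp add: cycle_value_def)
      consider "odd_cycles Z1 \<noteq> 0" "odd_cycles Z2 = 0" | "odd_cycles Z1 = 0" "odd_cycles Z2 \<noteq> 0"
        | "odd_cycles Z1 \<noteq> 0" "odd_cycles Z2 \<noteq> 0"
        using False by (cases "odd_cycles Z1 = 0"; cases "odd_cycles Z2 = 0") simp_all
      hence "cycle_value \<delta> Z1 * cycle_value \<delta> Z2 * cycle_value \<delta> (R1 + R2 + N') = cycle_value \<delta> (Z1 + Z2 + N)"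
      proof cases
        case 1
        have "cycle_value \<delta> (R1 + R2 + N') = ?\<Delta> N'" using R 1 val[of "{#(0, 1)#}" N'] NN v1 by simp
        moreover have "cycle_value \<delta> (Z1 + (Z2 + N)) = cycle_value \<delta> Z1 * ?\<Delta> (Z2 + N)"
          by (rule val) (use 1 ZZ NN in auto)
        ultimately show ?thesis using even[OF 1(2)] dN by (simp add: add.assoc mult.assoc)
      next
        case 2
        have "cycle_value \<delta> (R1 + R2 + N') = ?\<Delta> N'" using R 2 val[of "{#(0, 1)#}" N'] NN v1 by simp
        moreover have "cycle_value \<delta> (Z2 + (Z1 + N)) = cycle_value \<delta> Z2 * ?\<Delta> (Z1 + N)"
          by (rule val) (use 2 ZZ NN in auto)
        ultimately show ?thesis using even[OF 2(1)] dN by (simp add: add_ac mult_ac)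
      next
        case 3
        have "cycle_value \<delta> (R1 + (R2 + N')) = cycle_value \<delta> R1 * ?\<Delta> (R2 + N')"
          by (rule val) (use 3 R NN m in auto)
        hence "cycle_value \<delta> (R1 + R2 + N') = \<delta> 0 * ?\<Delta> N'" using R 3 v1 by (simp add: add.assoc)
        moreover have "cycle_value \<delta> (Z1 + (Z2 + N)) = cycle_value \<delta> Z1 * ?\<Delta> (Z2 + N)"
          by (rule val) (use 3 ZZ NN in auto)
        moreover have "cycle_value \<delta> Z2 * \<delta> 0 = ?\<Delta> Z2" using cycle_value_odd_delta[OF ZZ(2)] 3 by simp
        hence "?\<Delta> (Z2 + N) = cycle_value \<delta> Z2 * \<delta> 0 * ?\<Delta> N" by simp
        ultimately show ?thesis using dN by (auto simp: add.assoc mult.assoc)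
      qed
      thus ?thesis unfolding C C' Z1_def[symmetric] Z2_def[symmetric] by simp
    qed
    ultimately show ?thesis ..
  qed
  thus ?r ?v by simp_all
qed

end

section \<open>The algebra of diagrams\<close>

lemma lookup_scale_pm [simp]: "lookup (scale_pm c f) x = c * lookup f x"
  by (simp add: scale_pm_def Poly_Mapping.map.rep_eq when_def)

lemma vector_space_scale_pm: "vector_space (scale_pm :: 'k::field \<Rightarrow> ('b \<Rightarrow>\<^sub>0 'k) \<Rightarrow> ('b \<Rightarrow>\<^sub>0 'k))"
  by standard (auto intro!: poly_mapping_eqI simp: lookup_add algebra_simps)

global_interpretation pm: vector_space scale_pm
  by (rule vector_space_scale_pm)

lemma scale_single: "scale_pm c (single x d) = single x (c * d)"
  by (rule poly_mapping_eqI) (simp add: lookup_single when_def)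

lemma pm_expand:
  assumes "finite S" "keys f \<subseteq> S"
  shows "f = (\<Sum>x\<in>S. single x (lookup f x))"
proof (rule poly_mapping_eqI)
  fix y
  have "lookup (\<Sum>x\<in>S. single x (lookup f x)) y =
    (\<Sum>x\<in>S. if x = y then lookup f x else 0)"
    by (simp add: lookup_sum lookup_single when_def)
  also have "\<dots> = lookup f y"
    using assms by (auto simp: sum.delta' in_keys_iff)
  finally show "lookup f y = lookup (\<Sum>x\<in>S. single x (lookup f x)) y" by simp
qed

lemma type_flip:
  assumes p: "planar_matching n (arcs G)"
  shows "type_I (flip G) \<longleftrightarrow> type_I G" "type_II (flip G) \<longleftrightarrow> type_II G"
proof -
  interpret planar n "arcs G" using p by (simp add: planar_def)
  have "horizontal (flip_arc a) \<longleftrightarrow> horizontal a" if a: "a \<in> arcs G" for a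
  proof -
    obtain x y where xy: "ends a = {x, y}" "x \<noteq> y" using ends_card[OF a] by (auto simp: card_2_iff)
    have "x \<in> vertices n" "y \<in> vertices n" using ends_sub[OF a] unfolding xy(1) by simp_all
    hence r: "fst x = 0 \<or> fst x = 1" "fst y = 0 \<or> fst y = 1" by (auto simp: vertices_def)
    have "horizontal a \<longleftrightarrow> fst x = fst y" "horizontal (flip_arc a) \<longleftrightarrow> 1 - fst x = 1 - fst y"
      by (auto simp: horizontal_def xy(1) flip_vertex_def)
    thus ?thesis using r by auto
  qed
  thus "type_I (flip G) \<longleftrightarrow> type_I G" by (simp add: type_I_def)
  show "type_II (flip G) \<longleftrightarrow> type_II G"
    by (simp add: type_II_def sum.reindex[OF flip_arc_inj])
qed

lemma decorated_flip:
  assumes G: "decorated_tangle m n G"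
  shows "decorated_tangle m n (flip G)"
proof -
  have p: "planar_matching n (arcs G)" using decorated_planar[OF G] .
  interpret planar n "arcs G" using p by (simp add: planar_def)
  have f: "planar_matching n (arcs (flip G))" using planar_flip by simp
  have "exposed n (flip G) (flip_arc a) \<longleftrightarrow> exposed n G a" if "a \<in> arcs G" for a
    using encloses_flip[OF that] by (simp add: exposed_def)
  hence "\<forall>a\<in>arcs (flip G). dots a < m \<and> (\<not> exposed n (flip G) a \<longrightarrow> blobs a = 0)"
    using G by (simp add: decorated_tangle_def)
  thus ?thesis using f G unfolding decorated_tangle_def planar_matching_def by simp
qed

lemma admissible_flip: "admissible m n G \<Longrightarrow> admissible m n (flip G)"
  using decorated_flip type_flip[OF decorated_planar] unfolding admissible_def by auto

lemma reduced_flip: "reduced (flip G) = flip (reduced G)"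
proof -
  have "reblob (reduced_blobs (flip G)) (flip_arc a) = flip_arc (reblob (reduced_blobs G) a)" for a
    by (simp add: reblob_def flip_arc_def reduced_blobs_def)
  thus ?thesis by (simp add: reduced_def flip_eq image_image)
qed

lemma planar_reduced: "planar_matching n (arcs G) \<Longrightarrow> planar_matching n (arcs (reduced G))"
  by (simp add: reduced_def planar_reblob)

lemma hor_horizontal: "a \<in> hor r A \<Longrightarrow> horizontal a"
  by (auto simp: hor_def horizontal_def)

lemma (in planar) horizontal_hor: "a \<in> A \<Longrightarrow> horizontal a \<Longrightarrow> a \<in> hor 0 A \<or> a \<in> hor 1 A"
proof -
  assume a: "a \<in> A" "horizontal a"
  then obtain r where r: "\<forall>v\<in>ends a. fst v = r" by (auto simp: horizontal_def)
  have "ends a \<noteq> {}" using ends_card[OF a(1)] by auto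
  then obtain v where "v \<in> ends a" by blast
  moreover have "v \<in> vertices n" using ends_sub[OF a(1)] \<open>v \<in> ends a\<close> ..
  ultimately have "r = 0 \<or> r = 1" using r by (auto simp: vertices_def)
  thus ?thesis using a(1) r by (auto simp: hor_def)
qed

lemma (in planar) hor_nonempty: "hor 0 A \<noteq> {} \<longleftrightarrow> hor 1 A \<noteq> {}"
proof -
  have "finite (hor r A)" for r by (rule finite_subset[OF _ finite_arcs]) (auto simp: hor_def)
  thus ?thesis using card_hor card_0_eq[of "hor 0 A"] card_0_eq[of "hor 1 A"] by metis
qed

lemma decorated_reduced:
  assumes G: "decorated_tangle m n G" and m: "m \<ge> 1"
  shows "decorated_tangle m n (reduced G)"
proof -
  have p: "planar_matching n (arcs (reduced G))" using planar_reduced[OF decorated_planar[OF G]] .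
  have lohi: "lo pos (reblob h a) = lo pos a" "hi pos (reblob h a) = hi pos a" for h a pos
    by (simp_all add: lo_def hi_def)
  have "exposed n (reduced G) (reblob h a) \<longleftrightarrow> exposed n G a" for h a
    by (simp add: exposed_def reduced_def encloses_def lohi)
  hence "\<forall>a\<in>arcs (reduced G). dots a < m \<and> (\<not> exposed n (reduced G) a \<longrightarrow> blobs a = 0)"
    using G by (auto simp: decorated_tangle_def reduced_def reduced_blobs_def)
  moreover have "\<forall>(r, s)\<in>#cycles (reduced G). r < m" using m by (simp add: reduced_def)
  ultimately show ?thesis using p unfolding decorated_tangle_def planar_matching_def by blast
qed

lemma admissible_decorated: "admissible m n G \<Longrightarrow> decorated_tangle m n G"
  by (simp add: admissible_def)

lemma even_total_admissible:
  assumes "admissible m n G" "odd_cycles (cycles G) = 0"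
  shows "even (total_blobs G)"
  using assms by (auto simp: admissible_def type_I_def type_II_def total_blobs_def)

lemma even_sum_mset: "(\<forall>x\<in>#Z. even (f x)) \<Longrightarrow> even (\<Sum>x\<in>#Z. f x :: nat)"
  by (induction Z) auto

context parameters
begin

lemma hor_compose_nonempty:
  assumes p: "planar_matching n (arcs G1)" "planar_matching n (arcs G2)" and d: "\<And>a. a \<in> arcs G1 \<Longrightarrow> dots a < m"
    and h: "hor 1 (arcs G1) \<noteq> {}"
  shows "\<exists>a\<in>arcs (compose m G1 G2). horizontal a"
proof -
  obtain a where a: "a \<in> hor 0 (arcs G1)"
    using h planar.hor_nonempty[of n "arcs G1"] p(1) by (auto simp: planar_def)
  hence "a \<in> hor 0 (arcs (compose m G1 G2))" using hor_compose_top[OF p m a] d by (simp add: hor_def)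
  thus ?thesis using hor_horizontal by (auto simp: hor_def)
qed

text \<open>
  A cycle with a blob is inherited from a type I factor, which has horizontal arcs, or is formed
  at the joint, which needs horizontal arcs there. So a reduced product with such a cycle is of
  type I.
\<close>

lemma odd_cycle_horizontal:
  assumes G: "admissible m n G1" "admissible m n G2"
    and o: "odd_cycles (cycles (compose m G1 G2)) > 0"
  shows "\<exists>a\<in>arcs (compose m G1 G2). horizontal a"
proof -
  note dec = admissible_decorated[OF G(1)] admissible_decorated[OF G(2)]
  note p = decorated_planar[OF dec(1)] decorated_planar[OF dec(2)]
  have d: "dots a < m" if "a \<in> arcs G1 \<or> a \<in> arcs G2" for a using dec that by (auto simp: decorated_tangle_def)
  interpret layered n 2 "two_layers G1 G2" by standard (use p in simp)
  interpret G1: planar n "arcs G1" using p(1) by (simp add: planar_def)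
  interpret G2: planar n "arcs G2" using p(2) by (simp add: planar_def)
  have hor1: "hor 1 (arcs G) \<noteq> {}" if "admissible m n G" "odd_cycles (cycles G) > 0" "planar n (arcs G)" for G
  proof -
    have "type_I G" using that(1,2) by (auto simp: admissible_def type_II_def)
    then obtain a where "a \<in> arcs G" "horizontal a" by (auto simp: type_I_def)
    hence "hor 0 (arcs G) \<noteq> {} \<or> hor 1 (arcs G) \<noteq> {}" using planar.horizontal_hor[OF that(3)] by blast
    thus ?thesis using planar.hor_nonempty[OF that(3)] by blast
  qed
  have fromG1: ?thesis if "hor 1 (arcs G1) \<noteq> {}" using hor_compose_nonempty[OF p _ that] d by blast
  let ?N = "image_mset (strand_cycle m) (mset_set {X \<in> strands P. boundary 2 X = {}})"
  have "odd_cycles (cycles G1) > 0 \<or> odd_cycles (cycles G2) > 0 \<or> odd_cycles ?N > 0"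
    using o unfolding compose_two_layers[OF p m] compose_layers_def by simp
  thus ?thesis
  proof (elim disjE)
    assume "odd_cycles (cycles G1) > 0"
    thus ?thesis using fromG1 hor1[OF G(1) _ G1.planar_axioms] by blast
  next
    assume "odd_cycles (cycles G2) > 0"
    then obtain a where a: "a \<in> hor 1 (arcs G2)" using hor1[OF G(2) _ G2.planar_axioms] by blast
    hence "a \<in> hor 1 (arcs (compose m G1 G2))" using hor_compose_bottom[OF p m a] d by (simp add: hor_def)
    thus ?thesis using hor_horizontal by (auto simp: hor_def)
  next
    assume "odd_cycles ?N > 0"
    then obtain x where "x \<in># ?N" using odd_cycles_pos by blast
    then obtain X where X: "X \<in> strands P" "boundary 2 X = {}"
      using finite_strands[OF finite_P] by auto
    note D = strandD[OF X(1)]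
    have row: "fst v = 1" if v: "v \<in> pts X" for v
    proof -
      have "v \<notin> boundary 2 X" using X(2) by simp
      thus ?thesis using pts_rows[OF D(2) v] v by (auto simp: boundary_def)
    qed
    obtain p where pX: "p \<in> X" using D(1) by blast
    hence "points p \<noteq> {}" using points_ne D(2) by blast
    then obtain v where v: "v \<in> pts X" using pX by (auto simp: pts_def)
    obtain a where a: "(0, a) \<in> X" "v \<in> points (0, a)"
      using pts_layer[OF D(2,3) _ v, of 0] row[OF v] by auto
    have "a \<in> arcs G1" using D(2) a(1) piece_iff[of "(0, a)"] by auto
    moreover have "fst u = 1" if "u \<in> ends a" for u
    proof -
      have "shift 0 u \<in> points (0, a)" using that by (simp add: points_shift)
      hence "shift 0 u \<in> pts X" using a(1) by (auto simp: pts_def)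
      from row[OF this] show ?thesis by simp
    qed
    ultimately have "a \<in> hor 1 (arcs G1)" by (simp add: hor_def)
    thus ?thesis using fromG1 by blast
  qed
qed

text \<open>
  In type II the number of blobs stays even: composition adds the total numbers of blobs, and
  reduction changes them by even numbers.
\<close>

lemma admissible_reduced_compose:
  assumes G: "admissible m n G1" "admissible m n G2"
  shows "admissible m n (reduced (compose m G1 G2))"
proof -
  note dec = admissible_decorated[OF G(1)] admissible_decorated[OF G(2)]
  note p = decorated_planar[OF dec(1)] decorated_planar[OF dec(2)]
  let ?C = "compose m G1 G2"
  have dC: "decorated_tangle m n ?C" using decorated_compose[OF dec m] .
  interpret C: planar n "arcs ?C" using decorated_planar[OF dC] by (simp add: planar_def)
  have dR: "decorated_tangle m n (reduced ?C)" using decorated_reduced[OF dC m] .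
  have b: "\<forall>a\<in>arcs (reduced ?C). blobs a \<le> 1" by (auto simp: reduced_def reduced_blobs_def)
  have c: "\<forall>(r, s)\<in>#cycles (reduced ?C). s \<le> 1" by (simp add: reduced_def)
  have "type_I (reduced ?C) \<or> type_II (reduced ?C)"
  proof (cases "odd_cycles (cycles ?C) = 0")
    case True
    have "odd_cycles (cycles G1) = 0" "odd_cycles (cycles G2) = 0"
      using True unfolding compose_two_layers[OF p m] compose_layers_def by simp_all
    hence "even (total_blobs ?C)"
      using even_total_admissible G unfolding total_blobs_compose[OF p m] by simp
    moreover have "even (\<Sum>x\<in>#cycles ?C. snd x)"
      by (rule even_sum_mset) (use True odd_cycles_pos[of "cycles ?C"] in auto)
    ultimately have e: "even (\<Sum>a\<in>arcs ?C. blobs a)" by (simp add: total_blobs_def)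
    have inj: "inj_on (reblob h) (arcs ?C)" for h
    proof (rule inj_onI)
      fix a b assume "a \<in> arcs ?C" "b \<in> arcs ?C" "reblob h a = reblob h b"
      thus "a = b" using inj_onD[OF C.inj_ends] by (simp add: reblob_def)
    qed
    have "(\<Sum>a\<in>arcs (reduced ?C). blobs a) = (\<Sum>a\<in>arcs ?C. blobs a mod 2)"
      using True by (simp add: reduced_def sum.reindex[OF inj] reduced_blobs_def)
    moreover have "even (\<Sum>a\<in>arcs ?C. blobs a mod 2)" using e
      by (simp add: even_iff_mod_2_eq_zero mod_sum_eq)
    ultimately show ?thesis using True by (simp add: type_II_def reduced_def)
  next
    case False
    then obtain a where "a \<in> arcs ?C" "horizontal a" using odd_cycle_horizontal[OF G] by auto
    hence "\<exists>a\<in>arcs (reduced ?C). horizontal a" by (auto simp: reduced_def horizontal_def)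
    thus ?thesis using False by (auto simp: type_I_def reduced_def reduced_blobs_def)
  qed
  thus ?thesis using dR b c by (simp add: admissible_def)
qed

abbreviation prod_tangle :: "tangle \<Rightarrow> tangle \<Rightarrow> tangle" where
  "prod_tangle G1 G2 \<equiv> reduced (compose m G1 G2)"

abbreviation prod_coeff :: "tangle \<Rightarrow> tangle \<Rightarrow> 'k" where
  "prod_coeff G1 G2 \<equiv> cycle_value \<delta> (cycles (compose m G1 G2))"

text \<open>
  Existence comes from \<open>reduces_to_reduced\<close>, uniqueness from the invariants.
\<close>

lemma diagram_mult_eq:
  assumes G: "admissible m n G1" "admissible m n G2"
  shows "diagram_mult m n \<delta> G1 G2 = single (prod_tangle G1 G2) (prod_coeff G1 G2)"
proof -
  let ?C = "compose m G1 G2"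
  have dC: "decorated_tangle m n ?C"
    using decorated_compose[OF _ _ m] admissible_decorated G by blast
  have good: "\<forall>x\<in>#cycles ?C. fst x < m" "finite (arcs ?C)"
    using dC planar.finite_arcs[of n] decorated_planar[OF dC] by (auto simp: decorated_tangle_def planar_def)
  have adm: "admissible m n (reduced ?C)" using admissible_reduced_compose[OF G] .
  have uniq: "G = reduced ?C \<and> c = prod_coeff G1 G2"
    if "(reduces m \<delta>)\<^sup>*\<^sup>* (1, ?C) (c, G)" "admissible m n G" for c G
    using reduces_star_invariant[OF that(1) good] admissible_reduced[OF that(2)] by simp
  obtain c where c: "(reduces m \<delta>)\<^sup>*\<^sup>* (1, ?C) (c, reduced ?C)" using reduces_to_reduced[OF good] by blast
  have "c = prod_coeff G1 G2" using uniq[OF c adm] by simp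
  thus ?thesis unfolding diagram_mult_def
    by (intro the_equality) (use c adm uniq in blast)+
qed

text \<open>
  Both bracketings reduce the composition of three tangles; the scalars agree as the value of the
  cycles of that composition.
\<close>

lemma prod_assoc:
  assumes G: "admissible m n G1" "admissible m n G2" "admissible m n G3"
  shows "prod_tangle (prod_tangle G1 G2) G3 = prod_tangle G1 (prod_tangle G2 G3)"
    and "prod_coeff G1 G2 * prod_coeff (prod_tangle G1 G2) G3 = prod_coeff G2 G3 * prod_coeff G1 (prod_tangle G2 G3)"
proof -
  have d: "decorated_tangle m n G1" "decorated_tangle m n G2" "decorated_tangle m n G3"
    using admissible_decorated G by blast+
  have d12: "decorated_tangle m n (compose m G1 G2)" "decorated_tangle m n (compose m G2 G3)"
    using decorated_compose[OF _ _ m] d by blast+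
  note p = decorated_planar[OF d(1)] decorated_planar[OF d(2)] decorated_planar[OF d(3)]
  note a = compose_assoc[OF p m]
  show "prod_tangle (prod_tangle G1 G2) G3 = prod_tangle G1 (prod_tangle G2 G3)"
    using reduced_compose(1)[OF d12(1) d(3)] reduced_compose(1)[OF d(1) d12(2)] a
      admissible_reduced(1)[OF G(1)] admissible_reduced(1)[OF G(3)] by simp
  show "prod_coeff G1 G2 * prod_coeff (prod_tangle G1 G2) G3 = prod_coeff G2 G3 * prod_coeff G1 (prod_tangle G2 G3)"
    using reduced_compose(2)[OF d12(1) d(3)] reduced_compose(2)[OF d(1) d12(2)] a
      admissible_reduced[OF G(1)] admissible_reduced[OF G(3)] by simp
qed

lemma admissible_dots: "admissible m n G \<Longrightarrow> a \<in> arcs G \<Longrightarrow> dots a < m"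
  by (auto simp: admissible_def decorated_tangle_def)

lemma prod_id:
  assumes G: "admissible m n G"
  shows "prod_tangle (id_tangle n) G = G" "prod_coeff (id_tangle n) G = 1"
    "prod_tangle G (id_tangle n) = G" "prod_coeff G (id_tangle n) = 1"
proof -
  have p: "planar_matching n (arcs G)" using decorated_planar admissible_decorated G by blast
  show "prod_tangle (id_tangle n) G = G" "prod_coeff (id_tangle n) G = 1"
    "prod_tangle G (id_tangle n) = G" "prod_coeff G (id_tangle n) = 1"
    using compose_id_left[OF p admissible_dots[OF G] m] compose_id_right[OF p admissible_dots[OF G] m]
      admissible_reduced[OF G] by simp_all
qed

lemma admissible_id: "admissible m n (id_tangle n)"
proof -
  have z: "blobs a = 0" "dots a = 0" if "a \<in> arcs (id_tangle n)" for a
    using that by (auto simp: id_tangle_def vertical_def)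
  have "decorated_tangle m n (id_tangle n)"
    using planar_id[of n] z m unfolding decorated_tangle_def planar_matching_def
    by (simp add: id_tangle_def)
  moreover have "type_II (id_tangle n)" using z by (simp add: type_II_def) (simp add: id_tangle_def)
  ultimately show ?thesis using z by (simp add: admissible_def) (simp add: id_tangle_def)
qed

lemma prod_flip:
  assumes G: "admissible m n G1" "admissible m n G2"
  shows "flip (prod_tangle G1 G2) = prod_tangle (flip G2) (flip G1)"
    "prod_coeff G1 G2 = prod_coeff (flip G2) (flip G1)"
proof -
  have p: "planar_matching n (arcs G1)" "planar_matching n (arcs G2)"
    using decorated_planar admissible_decorated G by blast+
  show "flip (prod_tangle G1 G2) = prod_tangle (flip G2) (flip G1)"
    using flip_compose[OF p m] by (simp flip: reduced_flip)
  show "prod_coeff G1 G2 = prod_coeff (flip G2) (flip G1)"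
    using flip_compose[OF p m] by (metis cycles_flip)
qed

definition Adm :: "tangle set" where "Adm = {G. admissible m n G}"

lemma finite_Adm: "finite Adm"
proof -
  let ?arcs = "(\<lambda>(e, r, s). Arc e r s) ` (Pow (vertices n) \<times> {..<m} \<times> {..1})"
  let ?all = "(\<lambda>(A, Z). Diagram A Z) ` (Pow ?arcs \<times> {{#}, {#(0, 1)#}})"
  have "G \<in> ?all" if G: "admissible m n G" for G
  proof -
    have "a \<in> ?arcs" if "a \<in> arcs G" for a
    proof -
      have "ends a \<subseteq> vertices n" "dots a < m" "blobs a \<le> 1"
        using G that by (auto simp: admissible_def decorated_tangle_def)
      thus ?thesis by (cases a) (auto intro!: image_eqI[of _ _ "(ends a, dots a, blobs a)"])
    qed
    moreover have "cycles G \<in> {{#}, {#(0, 1)#}}" using G by (auto simp: admissible_def type_I_def type_II_def)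
    ultimately show ?thesis by (cases G) (auto intro!: image_eqI[of _ _ "(arcs G, cycles G)"])
  qed
  hence "Adm \<subseteq> ?all" by (auto simp: Adm_def)
  thus ?thesis by (rule finite_subset) simp
qed

abbreviation A where "A \<equiv> (CTL m n :: (tangle \<Rightarrow>\<^sub>0 'k) set)"
abbreviation mult where "mult \<equiv> CTL_mult m n \<delta>"

definition E :: "tangle \<Rightarrow> (tangle \<Rightarrow>\<^sub>0 'k)" where "E G = single G 1"

lemma A_iff: "f \<in> A \<longleftrightarrow> keys f \<subseteq> Adm"
  by (auto simp: CTL_def Adm_def)

lemma subspace_A: "pm.subspace A"
proof (rule pm.subspaceI)
  show "0 \<in> A" by (simp add: A_iff)
  show "f + g \<in> A" if "f \<in> A" "g \<in> A" for f g
    using that Poly_Mapping.keys_add[of f g] unfolding A_iff by blast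
  show "scale_pm c f \<in> A" if "f \<in> A" for c f
    using that unfolding A_iff by (auto simp: in_keys_iff)
qed

lemma A_expand: "f \<in> A \<Longrightarrow> f = (\<Sum>G\<in>Adm. scale_pm (lookup f G) (E G))"
  using pm_expand[OF finite_Adm, of f] by (simp add: A_iff E_def scale_single)

lemma E_in: "G \<in> Adm \<Longrightarrow> E G \<in> A"
  by (simp add: A_iff E_def)

lemma mult_Adm:
  assumes "f \<in> A" "g \<in> A"
  shows "mult f g = (\<Sum>G1\<in>Adm. \<Sum>G2\<in>Adm. scale_pm (lookup f G1 * lookup g G2)
    (diagram_mult m n \<delta> G1 G2))"
proof -
  let ?t = "\<lambda>G1 G2. scale_pm (lookup f G1 * lookup g G2) (diagram_mult m n \<delta> G1 G2)"
  have k: "keys f \<subseteq> Adm" "keys g \<subseteq> Adm" using assms by (simp_all add: A_iff)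
  have "mult f g = (\<Sum>G1\<in>keys f. \<Sum>G2\<in>Adm. ?t G1 G2)"
    unfolding CTL_mult_def
    by (rule sum.cong[OF refl], rule sum.mono_neutral_left[OF finite_Adm k(2)]) (simp add: in_keys_iff)
  also have "\<dots> = (\<Sum>G1\<in>Adm. \<Sum>G2\<in>Adm. ?t G1 G2)"
    by (rule sum.mono_neutral_left[OF finite_Adm k(1)]) (simp add: in_keys_iff)
  finally show ?thesis .
qed

lemma diagram_mult_E: "G1 \<in> Adm \<Longrightarrow> G2 \<in> Adm \<Longrightarrow>
    diagram_mult m n \<delta> G1 G2 = scale_pm (prod_coeff G1 G2) (E (prod_tangle G1 G2))"
  using diagram_mult_eq by (simp add: Adm_def E_def scale_single)

lemma prod_Adm: "G1 \<in> Adm \<Longrightarrow> G2 \<in> Adm \<Longrightarrow> prod_tangle G1 G2 \<in> Adm"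
  using admissible_reduced_compose by (simp add: Adm_def)

lemma mult_closed: "f \<in> A \<Longrightarrow> g \<in> A \<Longrightarrow> mult f g \<in> A"
  unfolding mult_Adm
  by (intro pm.subspace_sum[OF subspace_A] pm.subspace_scale[OF subspace_A])
    (simp add: diagram_mult_E E_in prod_Adm pm.subspace_scale[OF subspace_A])

lemma mult_add_left: "f \<in> A \<Longrightarrow> f' \<in> A \<Longrightarrow> g \<in> A \<Longrightarrow> mult (f + f') g = mult f g + mult f' g"
  using pm.subspace_add[OF subspace_A]
  by (simp add: mult_Adm lookup_add pm.scale_left_distrib distrib_right sum.distrib)

lemma mult_add_right: "f \<in> A \<Longrightarrow> f' \<in> A \<Longrightarrow> g \<in> A \<Longrightarrow> mult g (f + f') = mult g f + mult g f'"
  using pm.subspace_add[OF subspace_A]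
  by (simp add: mult_Adm lookup_add pm.scale_left_distrib distrib_left sum.distrib)

lemma mult_scale_left: "f \<in> A \<Longrightarrow> g \<in> A \<Longrightarrow> mult (scale_pm c f) g = scale_pm c (mult f g)"
  using pm.subspace_scale[OF subspace_A]
  by (simp add: mult_Adm pm.scale_sum_right mult.assoc)

lemma mult_scale_right: "f \<in> A \<Longrightarrow> g \<in> A \<Longrightarrow> mult f (scale_pm c g) = scale_pm c (mult f g)"
  using pm.subspace_scale[OF subspace_A]
  by (simp add: mult_Adm pm.scale_sum_right mult_ac)

lemma zero_A: "0 \<in> A"
  by (simp add: A_iff)

lemma mult_E: 
  assumes "G1 \<in> Adm" "G2 \<in> Adm"
  shows "mult (E G1) (E G2) = scale_pm (prod_coeff G1 G2) (E (prod_tangle G1 G2))"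
proof -
  have "mult (E G1) (E G2) = diagram_mult m n \<delta> G1 G2"
    unfolding CTL_mult_def by (simp add: E_def)
  thus ?thesis using diagram_mult_E[OF assms] by simp
qed

lemma mult_assoc_E:
  assumes G: "G1 \<in> Adm" "G2 \<in> Adm" "G3 \<in> Adm"
  shows "mult (mult (E G1) (E G2)) (E G3) = mult (E G1) (mult (E G2) (E G3))"
proof -
  have a: "admissible m n G1" "admissible m n G2" "admissible m n G3" using G by (simp_all add: Adm_def)
  show ?thesis
    using prod_assoc[OF a] G
    by (simp add: mult_E mult_scale_left mult_scale_right E_in prod_Adm)
qed

text \<open>Identities between linear maps are checked on diagrams.\<close>

lemma linear_extension:
  assumes f: "f \<in> A" and E: "\<And>G. G \<in> Adm \<Longrightarrow> F (E G) = H (E G)"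
    and F: "\<And>x y. x \<in> A \<Longrightarrow> y \<in> A \<Longrightarrow> F (x + y) = F x + F y" "\<And>c x. x \<in> A \<Longrightarrow> F (scale_pm c x) = scale_pm c (F x)"
    and H: "\<And>x y. x \<in> A \<Longrightarrow> y \<in> A \<Longrightarrow> H (x + y) = H x + H y" "\<And>c x. x \<in> A \<Longrightarrow> H (scale_pm c x) = scale_pm c (H x)"
  shows "F f = H f"
proof -
  define x where "x G = scale_pm (lookup f G) (E G)" for G
  have x: "x G \<in> A" if "G \<in> Adm" for G unfolding x_def using E_in[OF that] pm.subspace_scale[OF subspace_A] by simp
  have fx: "f = (\<Sum>G\<in>Adm. x G)" unfolding x_def by (rule A_expand[OF f])
  have xFH: "F (x G) = H (x G)" if "G \<in> Adm" for G unfolding x_def using F(2) H(2) E E_in that by simp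
  have "F (\<Sum>G\<in>S. x G) = H (\<Sum>G\<in>S. x G) \<and> (\<Sum>G\<in>S. x G) \<in> A" if "finite S" "S \<subseteq> Adm" for S
    using that
  proof (induction S rule: finite_induct)
    case empty
    show ?case using F(2)[OF zero_A, of 0] H(2)[OF zero_A, of 0] zero_A by simp
  next
    case (insert G S)
    thus ?case using x[of G] xFH[of G] F(1) H(1) pm.subspace_add[OF subspace_A] by simp
  qed
  from this[OF finite_Adm] show ?thesis unfolding fx by simp
qed

lemma mult_assoc:
  assumes "f \<in> A" "g \<in> A" "h \<in> A"
  shows "mult (mult f g) h = mult f (mult g h)"
proof -
  have 1: "mult (mult (E G1) (E G2)) h = mult (E G1) (mult (E G2) h)" if "G1 \<in> Adm" "G2 \<in> Adm" for G1 G2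
    by (rule linear_extension[OF assms(3)])
      (use that mult_assoc_E in \<open>simp_all add: mult_add_right mult_scale_right E_in mult_closed\<close>)
  have 2: "mult (mult (E G1) g) h = mult (E G1) (mult g h)" if "G1 \<in> Adm" for G1
    by (rule linear_extension[OF assms(2)])
      (use that 1 assms(3) in \<open>simp_all add: mult_add_right mult_add_left mult_scale_right mult_scale_left E_in mult_closed\<close>)
  show ?thesis
    by (rule linear_extension[OF assms(1)])
      (use 2 assms(2,3) in \<open>simp_all add: mult_add_right mult_add_left mult_scale_right mult_scale_left E_in mult_closed\<close>)
qed

lemma mult_unit:
  assumes "f \<in> A"
  shows "mult (E (id_tangle n)) f = f" "mult f (E (id_tangle n)) = f"
proof -
  have id: "id_tangle n \<in> Adm" using admissible_id by (simp add: Adm_def)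
  show "mult (E (id_tangle n)) f = f"
    by (rule linear_extension[OF assms, where H = "\<lambda>x. x"])
      (use id prod_id in \<open>simp_all add: mult_E Adm_def mult_add_right mult_scale_right E_in\<close>)
  show "mult f (E (id_tangle n)) = f"
    by (rule linear_extension[OF assms, where H = "\<lambda>x. x" and F = "\<lambda>x. mult x (E (id_tangle n))"])
      (use id prod_id in \<open>simp_all add: mult_E Adm_def mult_add_left mult_scale_left E_in\<close>)
qed

lemma associative: "associative_algebra scale_pm A mult"
proof
  show "\<exists>e\<in>A. \<forall>x\<in>A. mult e x = x \<and> mult x e = x"
    using mult_unit E_in[of "id_tangle n"] admissible_id by (intro bexI[of _ "E (id_tangle n)"]) (simp_all add: Adm_def)
qed (simp_all add: subspace_A mult_closed mult_add_left mult_add_right mult_scale_left mult_scale_right mult_assoc)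

abbreviation inv :: "(tangle \<Rightarrow>\<^sub>0 'k) \<Rightarrow> (tangle \<Rightarrow>\<^sub>0 'k)" where "inv \<equiv> CTL_inv"

lemma inv_Adm: "f \<in> A \<Longrightarrow> inv f = (\<Sum>G\<in>Adm. scale_pm (lookup f G) (E (flip G)))"
  unfolding CTL_inv_def E_def scale_single
  by (rule sum.mono_neutral_cong_left) (use finite_Adm A_iff in \<open>auto simp: in_keys_iff\<close>)

lemma flip_Adm: "G \<in> Adm \<Longrightarrow> flip G \<in> Adm"
  using admissible_flip by (simp add: Adm_def)

lemma inv_closed: "f \<in> A \<Longrightarrow> inv f \<in> A"
  unfolding inv_Adm
  by (intro pm.subspace_sum[OF subspace_A] pm.subspace_scale[OF subspace_A] E_in flip_Adm)

lemma inv_add: "f \<in> A \<Longrightarrow> g \<in> A \<Longrightarrow> inv (f + g) = inv f + inv g"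
  using pm.subspace_add[OF subspace_A] by (simp add: inv_Adm lookup_add pm.scale_left_distrib sum.distrib)

lemma inv_scale: "f \<in> A \<Longrightarrow> inv (scale_pm c f) = scale_pm c (inv f)"
  using pm.subspace_scale[OF subspace_A] by (simp add: inv_Adm pm.scale_sum_right)

lemma inv_E: "inv (E G) = E (flip G)"
  by (simp add: CTL_inv_def E_def)

lemma inv_mult:
  assumes "f \<in> A" "g \<in> A"
  shows "inv (mult f g) = mult (inv g) (inv f)"
proof -
  have E: "inv (mult (E G1) (E G2)) = mult (inv (E G2)) (inv (E G1))" if "G1 \<in> Adm" "G2 \<in> Adm" for G1 G2
    using that prod_flip[of G1 G2] by (simp add: mult_E inv_E inv_scale E_in prod_Adm flip_Adm) (simp add: Adm_def)
  have 1: "inv (mult (E G1) g) = mult (inv g) (inv (E G1))" if "G1 \<in> Adm" for G1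
    by (rule linear_extension[OF assms(2), where F = "\<lambda>g. inv (mult (E G1) g)" and H = "\<lambda>g. mult (inv g) (inv (E G1))"])
      (use that E in \<open>simp_all add: mult_add_right mult_add_left mult_scale_right mult_scale_left E_in mult_closed inv_add inv_scale inv_closed\<close>)
  show ?thesis
    by (rule linear_extension[OF assms(1), where F = "\<lambda>f. inv (mult f g)" and H = "\<lambda>f. mult (inv g) (inv f)"])
      (use assms(2) 1 in \<open>simp_all add: mult_add_right mult_add_left mult_scale_right mult_scale_left E_in mult_closed inv_add inv_scale inv_closed\<close>)
qed

lemma inv_inv:
  assumes "f \<in> A"
  shows "inv (inv f) = f"
proof (rule linear_extension[OF assms, where F = "\<lambda>f. inv (inv f)" and H = "\<lambda>f. f"])
  fix G assume "G \<in> Adm"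
  hence "flip (flip G) = G"
    using flip_flip[OF decorated_planar[OF admissible_decorated]] by (simp add: Adm_def)
  thus "inv (inv (E G)) = E G" by (simp add: inv_E)
qed (simp_all add: inv_add inv_scale inv_closed)

end

section \<open>Gluing dangles\<close>

definition nonlines :: "dangle \<Rightarrow> nat arc set" where
  "nonlines v = {a \<in> arcs v. \<not> is_line a}"

definition up :: "nat \<Rightarrow> nat arc \<Rightarrow> vertex arc" where
  "up r a = Arc (Pair r ` ends a) (dots a) (blobs a)"

definition line_blobs :: "dangle \<Rightarrow> nat \<Rightarrow> nat" where
  "line_blobs v j = blobs (THE a. a \<in> arcs v \<and> ends a = {lines v ! j})"

text \<open>
  The \<open>j\<close>-th vertical arc of a glued diagram, with the blob numbers of the lines
  given by \<open>line_blobs\<close>; this turns the set comprehension in \<open>glue\<close> into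
  an image.
\<close>

definition vertical_arc :: "nat \<Rightarrow> dangle \<Rightarrow> dangle \<Rightarrow> (nat \<Rightarrow>\<^sub>0 nat) \<Rightarrow> nat \<Rightarrow> vertex arc" where
  "vertical_arc m v1 v2 e j = Arc {(0, lines v1 ! j), (1, lines v2 ! j)} (lookup e j mod m)
     ((line_blobs v1 j + line_blobs v2 j) mod 2)"

lemma up_simps [simp]: "ends (up r a) = Pair r ` ends a" "dots (up r a) = dots a" "blobs (up r a) = blobs a"
  by (simp_all add: up_def)

lemma up_inj: "inj (up r)"
proof (rule injI)
  fix a b assume h: "up r a = up r b"
  hence "Pair r ` ends a = Pair r ` ends b" by (simp add: up_def)
  hence "ends a = ends b" by (simp add: inj_image_eq_iff inj_on_def)
  thus "a = b" using h by (cases a; cases b) (simp add: up_def)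
qed

lemma card_1_2_cases:
  fixes A :: "nat set"
  assumes "card A \<in> {1, 2}"
  obtains i where "A = {i}" | i j where "A = {i, j}" "i < j"
proof (cases "card A = 1")
  case True
  thus ?thesis using that(1) by (auto simp: card_1_singleton_iff)
next
  case False
  then obtain i j where ij: "A = {i, j}" "i \<noteq> j" using assms by (auto simp: card_2_iff)
  thus ?thesis using that(2)[of i j] that(2)[of j i] by (cases "i < j") (simp_all add: insert_commute)
qed

locale dangle =
  fixes m n k :: nat and v :: dangle
  assumes dangle: "decorated_dangle m n k v"
begin

lemma ends_sub: "a \<in> arcs v \<Longrightarrow> ends a \<subseteq> {1..n}" and ends_card: "a \<in> arcs v \<Longrightarrow> card (ends a) \<in> {1, 2}"
  using dangle unfolding decorated_dangle_def by blast+

lemma card_nonlines: "card (nonlines v) = k"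
  using dangle unfolding decorated_dangle_def nonlines_def by blast

lemma not_crosses: "a \<in> arcs v \<Longrightarrow> b \<in> arcs v \<Longrightarrow> \<not> crosses id a b"
  and line_not_enclosed: "a \<in> arcs v \<Longrightarrow> b \<in> arcs v \<Longrightarrow> is_line a \<Longrightarrow> \<not> encloses id b a"
  using dangle unfolding decorated_dangle_def by blast+

lemma dots_less: "a \<in> arcs v \<Longrightarrow> dots a < m" and line_dots: "a \<in> arcs v \<Longrightarrow> is_line a \<Longrightarrow> dots a = 0"
  and blobs_le: "a \<in> arcs v \<Longrightarrow> blobs a \<le> 1"
  and blobs_position: "a \<in> arcs v \<Longrightarrow> \<not> blob_position v a \<Longrightarrow> blobs a = 0"
  using dangle unfolding decorated_dangle_def by blast+

lemma arc_ex1: "i \<in> {1..n} \<Longrightarrow> \<exists>!a. a \<in> arcs v \<and> i \<in> ends a"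
  using dangle unfolding decorated_dangle_def by simp

lemma arc_exists: "i \<in> {1..n} \<Longrightarrow> \<exists>a\<in>arcs v. i \<in> ends a"
  using arc_ex1 by blast

lemma arc_unique:
  assumes "a \<in> arcs v" "b \<in> arcs v" "i \<in> ends a" "i \<in> ends b"
  shows "a = b"
proof -
  have "i \<in> {1..n}" using ends_sub assms by blast
  from arc_ex1[OF this] show ?thesis using assms by metis
qed

lemma inj_ends: "inj_on ends (arcs v)"
proof (rule inj_onI)
  fix a b assume h: "a \<in> arcs v" "b \<in> arcs v" "ends a = ends b"
  then obtain i where "i \<in> ends a" using ends_card[OF h(1)] by fastforce
  thus "a = b" using arc_unique h by simp
qed

lemma finite_arcs: "finite (arcs v)"
  by (rule finite_imageD[OF _ inj_ends], rule finite_subset[of _ "Pow {1..n}"]) (use ends_sub in auto)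

lemma finite_nonlines: "finite (nonlines v)"
  using finite_arcs by (simp add: nonlines_def)

lemma line_iff: "is_line a \<longleftrightarrow> (\<exists>i. ends a = {i})"
  by (simp add: is_line_def card_1_singleton_iff)

lemma nonline_pair:
  assumes "a \<in> nonlines v"
  obtains i j where "ends a = {i, j}" "i < j" "lo id a = i" "hi id a = j" "1 \<le> i" "j \<le> n"
proof -
  have a: "a \<in> arcs v" "\<not> is_line a" using assms by (simp_all add: nonlines_def)
  show ?thesis
  proof (cases rule: card_1_2_cases[OF ends_card[OF a(1)]])
    case (1 i)
    thus ?thesis using a(2) line_iff by blast
  next
    case (2 i j)
    thus ?thesis using that[of i j] lo_hi_pair[of a i j id] ends_sub[OF a(1)] by simp
  qed
qed

definition line_positions :: "nat set" where
  "line_positions = {i. \<exists>a\<in>arcs v. ends a = {i}}"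

lemma line_positions_sub: "line_positions \<subseteq> {1..n}"
  using ends_sub by (auto simp: line_positions_def)

lemma finite_line_positions: "finite line_positions"
  using line_positions_sub finite_subset by blast

lemma lines_eq: "lines v = sorted_list_of_set line_positions"
  by (simp add: lines_def line_positions_def)

lemma set_lines: "set (lines v) = line_positions" and sorted_lines: "sorted_wrt (<) (lines v)"
  and distinct_lines: "distinct (lines v)" and length_lines_card: "length (lines v) = card line_positions"
  using finite_line_positions by (simp_all add: lines_eq strict_sorted_list_of_set)

lemma nonline_union: "{1..n} = \<Union>(ends ` nonlines v) \<union> line_positions" "\<Union>(ends ` nonlines v) \<inter> line_positions = {}"
proof -
  show "{1..n} = \<Union>(ends ` nonlines v) \<union> line_positions"
  proof (intro equalityI subsetI)
    fix i assume "i \<in> {1..n}"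
    then obtain a where a: "a \<in> arcs v" "i \<in> ends a" using arc_exists by blast
    show "i \<in> \<Union>(ends ` nonlines v) \<union> line_positions"
    proof (cases "is_line a")
      case True
      then obtain i' where i': "ends a = {i'}" using line_iff[of a] by blast
      hence "ends a = {i}" using a(2) by simp
      thus ?thesis using a(1) by (auto simp: line_positions_def)
    next
      case False
      thus ?thesis using a by (auto simp: nonlines_def)
    qed
  next
    fix i assume "i \<in> \<Union>(ends ` nonlines v) \<union> line_positions"
    thus "i \<in> {1..n}" using ends_sub line_positions_sub by (fastforce simp: nonlines_def)
  qed
  show "\<Union>(ends ` nonlines v) \<inter> line_positions = {}"
  proof (rule ccontr)
    assume "\<Union>(ends ` nonlines v) \<inter> line_positions \<noteq> {}"
    then obtain i a b where h: "a \<in> nonlines v" "i \<in> ends a" "b \<in> arcs v" "ends b = {i}"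
      by (auto simp: line_positions_def)
    hence "a = b" using arc_unique[of a b i] by (simp add: nonlines_def)
    thus False using h line_iff by (auto simp: nonlines_def)
  qed
qed

lemma length_lines: "n = 2 * k + length (lines v)"
proof -
  have "card (\<Union>(ends ` nonlines v)) = (\<Sum>a\<in>nonlines v. card (ends a))"
  proof (rule card_UN_disjoint[OF finite_nonlines])
    show "\<forall>a\<in>nonlines v. finite (ends a)" using ends_sub finite_subset by (fastforce simp: nonlines_def)
    show "\<forall>a\<in>nonlines v. \<forall>b\<in>nonlines v. a \<noteq> b \<longrightarrow> ends a \<inter> ends b = {}"
      using arc_unique by (fastforce simp: nonlines_def)
  qed
  also have "\<dots> = (\<Sum>a\<in>nonlines v. 2)"
    by (rule sum.cong[OF refl]) (use ends_card in \<open>auto simp: nonlines_def is_line_def\<close>)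
  finally have c: "card (\<Union>(ends ` nonlines v)) = 2 * k" using card_nonlines by simp
  have "card {1..n} = card (\<Union>(ends ` nonlines v)) + card line_positions"
    unfolding nonline_union(1)
    by (rule card_Un_disjoint[OF _ finite_line_positions nonline_union(2)])
      (use nonline_union(1) finite_subset[of _ "{1..n}"] in blast)
  thus ?thesis using c length_lines_card by simp
qed

lemma line_arc:
  assumes "j < length (lines v)"
  obtains a where "a \<in> arcs v" "ends a = {lines v ! j}" "line_blobs v j = blobs a" "is_line a"
proof -
  have "lines v ! j \<in> line_positions" using assms set_lines nth_mem by blast
  then obtain a where a: "a \<in> arcs v" "ends a = {lines v ! j}" by (auto simp: line_positions_def)
  have "(THE a. a \<in> arcs v \<and> ends a = {lines v ! j}) = a"
    by (rule the_equality) (use a arc_unique in auto)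
  thus ?thesis using that[OF a] a line_iff[of a] by (simp add: line_blobs_def)
qed

lemma lines_bound: "j < length (lines v) \<Longrightarrow> 1 \<le> lines v ! j \<and> lines v ! j \<le> n"
  using set_lines line_positions_sub nth_mem by (metis atLeastAtMost_iff subsetD)

lemma lines_less: "i < j \<Longrightarrow> j < length (lines v) \<Longrightarrow> lines v ! i < lines v ! j"
  using sorted_lines by (simp add: sorted_wrt_iff_nth_less)

lemma lines_inj: "i < length (lines v) \<Longrightarrow> j < length (lines v) \<Longrightarrow> lines v ! i = lines v ! j \<Longrightarrow> i = j"
  using distinct_lines nth_eq_iff_index_eq by blast

text \<open>Only the leftmost line is a blob position.\<close>

lemma line_blobs_zero:
  assumes "0 < j" "j < length (lines v)"
  shows "line_blobs v j = 0"
proof -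
  obtain a where a: "a \<in> arcs v" "ends a = {lines v ! j}" "line_blobs v j = blobs a" using line_arc[OF assms(2)] .
  have "0 < length (lines v)" using assms by linarith
  then obtain b where b: "b \<in> arcs v" "ends b = {lines v ! 0}" "line_blobs v 0 = blobs b" "is_line b" using line_arc by blast
  have "lo id b < lo id a" using lines_less[OF assms] a b by (simp add: lo_def)
  hence "\<not> blob_position v a" using b unfolding blob_position_def by blast
  thus ?thesis using blobs_position a by simp
qed

lemma line_blobs_le: "j < length (lines v) \<Longrightarrow> line_blobs v j \<le> 1"
  using line_arc blobs_le by metis

lemma nonline_line_left:
  assumes "a \<in> nonlines v" "blobs a \<noteq> 0" "j < length (lines v)"
  shows "lo id a < lines v ! j"
proof -
  have a: "a \<in> arcs v" using assms(1) by (simp add: nonlines_def)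
  obtain b where b: "b \<in> arcs v" "ends b = {lines v ! j}" "is_line b" using line_arc[OF assms(3)] by metis
  have "blob_position v a" using blobs_position[OF a] assms(2) by blast
  hence "\<not> lo id b < lo id a" using b unfolding blob_position_def by blast
  hence le: "lo id a \<le> lines v ! j" using b by (simp add: lo_def)
  obtain x y where xy: "ends a = {x, y}" "lo id a = x" using nonline_pair[OF assms(1)] by metis
  have "x \<noteq> lines v ! j"
  proof
    assume "x = lines v ! j"
    hence "a = b" using arc_unique[OF a b(1)] xy b by simp
    thus False using assms(1) b by (simp add: nonlines_def)
  qed
  thus ?thesis using le xy by simp
qed

lemma line_not_inside:
  assumes "a \<in> nonlines v" "j < length (lines v)"
  shows "\<not> (lo id a < lines v ! j \<and> lines v ! j < hi id a)"
proof -
  obtain b where b: "b \<in> arcs v" "ends b = {lines v ! j}" "is_line b" using line_arc[OF assms(2)] by metis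
  have "\<not> encloses id a b" using line_not_enclosed[OF b(1) _ b(3), of a] assms by (simp add: nonlines_def)
  thus ?thesis using b by (simp add: encloses_def lo_def hi_def)
qed

lemma nonline_not_enclosed:
  assumes "a \<in> nonlines v" "b \<in> nonlines v" "blobs a \<noteq> 0"
  shows "\<not> encloses id b a"
  using blobs_position[of a] assms unfolding nonlines_def blob_position_def by blast

lemma up_lo_hi:
  assumes "a \<in> nonlines v"
  shows "lo (frame_pos n) (up 0 a) = lo id a" "hi (frame_pos n) (up 0 a) = hi id a"
    "lo (frame_pos n) (up 1 a) = 2 * n + 1 - hi id a" "hi (frame_pos n) (up 1 a) = 2 * n + 1 - lo id a"
    "1 \<le> lo id a" "lo id a < hi id a" "hi id a \<le> n"
proof -
  obtain i j where ij: "ends a = {i, j}" "i < j" "lo id a = i" "hi id a = j" "1 \<le> i" "j \<le> n"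
    using nonline_pair[OF assms] .
  show "lo (frame_pos n) (up 0 a) = lo id a" "hi (frame_pos n) (up 0 a) = hi id a"
    using lo_hi_pair[of "up 0 a" "(0, i)" "(0, j)" "frame_pos n"] ij by (simp_all add: frame_pos_def)
  show "lo (frame_pos n) (up 1 a) = 2 * n + 1 - hi id a" "hi (frame_pos n) (up 1 a) = 2 * n + 1 - lo id a"
    using lo_hi_pair[of "up 1 a" "(1, j)" "(1, i)" "frame_pos n"] ij by (simp_all add: frame_pos_def insert_commute)
  show "1 \<le> lo id a" "lo id a < hi id a" "hi id a \<le> n" using ij by simp_all
qed

lemma nonline_not_crosses: "a \<in> nonlines v \<Longrightarrow> b \<in> nonlines v \<Longrightarrow> \<not> crosses id a b"
  using not_crosses by (simp add: nonlines_def)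

lemma sum_blobs: "(\<Sum>a\<in>arcs v. blobs a) = (\<Sum>a\<in>nonlines v. blobs a) + (if lines v = [] then 0 else line_blobs v 0)"
proof -
  have "(\<Sum>a\<in>arcs v. blobs a) = (\<Sum>a\<in>nonlines v. blobs a) + (\<Sum>a\<in>arcs v - nonlines v. blobs a)"
    using sum.subset_diff[of "nonlines v" "arcs v" blobs] finite_arcs by (simp add: nonlines_def)
  moreover have "(\<Sum>a\<in>arcs v - nonlines v. blobs a) = (if lines v = [] then 0 else line_blobs v 0)"
  proof (cases "lines v = []")
    case True
    hence "line_positions = {}" using set_lines by simp
    moreover have "is_line a \<Longrightarrow> a \<in> arcs v \<Longrightarrow> \<exists>i. i \<in> line_positions" for a
      using line_iff[of a] unfolding line_positions_def by blast
    ultimately have e: "arcs v - nonlines v = {}" unfolding nonlines_def by blast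
    show ?thesis unfolding e using True by simp
  next
    case False
    hence l: "0 < length (lines v)" by simp
    obtain b where b: "b \<in> arcs v" "ends b = {lines v ! 0}" "line_blobs v 0 = blobs b" "is_line b" using line_arc[OF l] .
    have bm: "b \<in> arcs v - nonlines v" using b by (simp add: nonlines_def)
    have "blobs a = 0" if a: "a \<in> arcs v - nonlines v - {b}" for a
    proof -
      have "a \<in> arcs v" "is_line a" "a \<noteq> b" using a by (auto simp: nonlines_def)
      then obtain i where i: "ends a = {i}" using line_iff[of a] by blast
      hence "i \<in> set (lines v)" using \<open>a \<in> arcs v\<close> unfolding set_lines line_positions_def by blast
      then obtain j where j: "j < length (lines v)" "lines v ! j = i" by (auto simp: in_set_conv_nth)
      have "j \<noteq> 0"
      proof
        assume "j = 0"
        hence "a = b" using inj_onD[OF inj_ends, of a b] \<open>a \<in> arcs v\<close> b i j by simp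
        thus False using \<open>a \<noteq> b\<close> by simp
      qed
      obtain c where c: "c \<in> arcs v" "ends c = {lines v ! j}" "line_blobs v j = blobs c" using line_arc[OF j(1)] .
      have "c = a" using inj_onD[OF inj_ends, of c a] c i j \<open>a \<in> arcs v\<close> by simp
      thus ?thesis using line_blobs_zero[of j] \<open>j \<noteq> 0\<close> j c by simp
    qed
    hence "(\<Sum>a\<in>arcs v - nonlines v. blobs a) = blobs b"
      using sum.remove[of "arcs v - nonlines v" b blobs] finite_arcs bm by simp
    thus ?thesis using False b by simp
  qed
  ultimately show ?thesis by simp
qed

end

text \<open>
  The lines are at the positions left free by the horizontal arcs, and only the leftmost one may
  carry a blob, so the parity of the total number of blobs decides about that blob.
\<close>

lemma dangle_eqI:
  assumes "dangle m n k v" "dangle m n k' v'" and non: "nonlines v = nonlines v'" and cyc: "cycles v = cycles v'"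
    and par: "even (\<Sum>a\<in>arcs v. blobs a) \<longleftrightarrow> even (\<Sum>a\<in>arcs v'. blobs a)"
  shows "v = v'"
proof -
  interpret v: dangle m n k v by fact
  interpret v': dangle m n k' v' by fact
  have "v.line_positions = {1..n} - \<Union>(ends ` nonlines v)" unfolding v.nonline_union(1) using v.nonline_union(2) by blast
  moreover have "v'.line_positions = {1..n} - \<Union>(ends ` nonlines v')" unfolding v'.nonline_union(1) using v'.nonline_union(2) by blast
  ultimately have L: "lines v = lines v'" using non v.lines_eq v'.lines_eq by simp
  have b: "line_blobs v j = line_blobs v' j" if j: "j < length (lines v)" for j
  proof (cases "j = 0")
    case True
    hence "lines v \<noteq> []" using j by auto
    hence "even (line_blobs v 0) \<longleftrightarrow> even (line_blobs v' 0)"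
      using par unfolding v.sum_blobs v'.sum_blobs non L by (simp split: if_splits) argo
    moreover have "line_blobs v 0 \<le> 1" "line_blobs v' 0 \<le> 1"
      using v.line_blobs_le[of 0] v'.line_blobs_le[of 0] j True L by simp_all
    ultimately show ?thesis using True by (metis One_nat_def le_Suc_eq le_zero_eq odd_one even_zero)
  next
    case False
    thus ?thesis using v.line_blobs_zero[of j] v'.line_blobs_zero[of j] j L by simp
  qed
  have sub: "arcs w \<subseteq> arcs w'" if w: "dangle m n l w" "dangle m n l' w'" and nl: "nonlines w = nonlines w'" and ll: "lines w = lines w'"
    and bl: "\<And>j. j < length (lines w) \<Longrightarrow> line_blobs w j = line_blobs w' j" for w w' l l'
  proof
    interpret w: dangle m n l w by fact
    interpret w': dangle m n l' w' by fact
    fix a assume a: "a \<in> arcs w"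
    show "a \<in> arcs w'"
    proof (cases "is_line a")
      case False
      hence "a \<in> nonlines w'" using a nl by (auto simp: nonlines_def)
      thus ?thesis by (simp add: nonlines_def)
    next
      case True
      then obtain i where i: "ends a = {i}" using w.line_iff[of a] by blast
      hence "i \<in> set (lines w)" using a unfolding w.set_lines w.line_positions_def by blast
      then obtain j where j: "j < length (lines w)" "lines w ! j = i" by (auto simp: in_set_conv_nth)
      obtain c where c: "c \<in> arcs w" "ends c = {lines w ! j}" "line_blobs w j = blobs c" "is_line c" using w.line_arc[OF j(1)] .
      have ca: "c = a" using inj_onD[OF w.inj_ends, of c a] c i j a by simp
      obtain c' where c': "c' \<in> arcs w'" "ends c' = {lines w' ! j}" "line_blobs w' j = blobs c'" "is_line c'"
        using w'.line_arc[of j] j ll by metis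
      have "c' = c"
        using c c' bl[OF j(1)] w.line_dots[OF c(1,4)] w'.line_dots[OF c'(1,4)] ll
        by (cases c; cases c') simp
      thus ?thesis using c' ca by simp
    qed
  qed
  have "arcs v = arcs v'"
    using sub[OF assms(1,2) non L b] sub[OF assms(2,1) non[symmetric] L[symmetric]] b L by simp
  thus ?thesis using cyc by (cases v; cases v') simp
qed

locale dangle_pair = v1: dangle m n k v1 + v2: dangle m n k v2 for m n k v1 v2
begin

lemma length_eq: "length (lines v1) = length (lines v2)"
  using v1.length_lines v2.length_lines by linarith

lemma glue_arcs: "arcs (glue m v1 v2 e) = up 0 ` nonlines v1 \<union> up 1 ` nonlines v2 \<union>
    vertical_arc m v1 v2 e ` {..<length (lines v1)}"
proof -
  have "{Arc {(0, lines v1 ! j), (1, lines v2 ! j)} (lookup e j mod m)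
           ((blobs a + blobs b) mod 2) | j a b.
         j < length (lines v1) \<and> a \<in> arcs v1 \<and> ends a = {lines v1 ! j} \<and>
         b \<in> arcs v2 \<and> ends b = {lines v2 ! j}} = vertical_arc m v1 v2 e ` {..<length (lines v1)}" (is "?l = ?r")
  proof (intro equalityI subsetI)
    fix x assume "x \<in> ?l"
    then obtain j a b where h: "x = Arc {(0, lines v1 ! j), (1, lines v2 ! j)} (lookup e j mod m)
           ((blobs a + blobs b) mod 2)" "j < length (lines v1)" "a \<in> arcs v1" "ends a = {lines v1 ! j}"
         "b \<in> arcs v2" "ends b = {lines v2 ! j}" by blast
    obtain a' where a': "a' \<in> arcs v1" "ends a' = {lines v1 ! j}" "line_blobs v1 j = blobs a'" using v1.line_arc[OF h(2)] .
    obtain b' where b': "b' \<in> arcs v2" "ends b' = {lines v2 ! j}" "line_blobs v2 j = blobs b'"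
      using v2.line_arc[of j] h(2) length_eq by metis
    have "a' = a" "b' = b" using inj_onD[OF v1.inj_ends, of a' a] inj_onD[OF v2.inj_ends, of b' b] h a' b' by simp_all
    thus "x \<in> ?r" using h a' b' by (intro image_eqI[of _ _ j]) (simp_all add: vertical_arc_def)
  next
    fix x assume "x \<in> ?r"
    then obtain j where j: "j < length (lines v1)" "x = vertical_arc m v1 v2 e j" by blast
    obtain a where a: "a \<in> arcs v1" "ends a = {lines v1 ! j}" "line_blobs v1 j = blobs a" using v1.line_arc[OF j(1)] .
    obtain b where b: "b \<in> arcs v2" "ends b = {lines v2 ! j}" "line_blobs v2 j = blobs b"
      using v2.line_arc[of j] j length_eq by metis
    show "x \<in> ?l" unfolding mem_Collect_eq
      by (intro exI[of _ j] exI[of _ a] exI[of _ b]) (use j a b in \<open>simp add: vertical_arc_def\<close>)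
  qed
  thus ?thesis unfolding glue_def up_def[abs_def] nonlines_def by (auto simp: image_def)
qed

lemma vertical_lo_hi:
  assumes "j < length (lines v1)"
  shows "lo (frame_pos n) (vertical_arc m v1 v2 e j) = lines v1 ! j"
    "hi (frame_pos n) (vertical_arc m v1 v2 e j) = 2 * n + 1 - lines v2 ! j"
    "1 \<le> lines v1 ! j" "lines v1 ! j \<le> n" "1 \<le> lines v2 ! j" "lines v2 ! j \<le> n"
proof -
  show b: "1 \<le> lines v1 ! j" "lines v1 ! j \<le> n" "1 \<le> lines v2 ! j" "lines v2 ! j \<le> n"
    using v1.lines_bound[OF assms] v2.lines_bound[of j] assms length_eq by simp_all
  show "lo (frame_pos n) (vertical_arc m v1 v2 e j) = lines v1 ! j"
    "hi (frame_pos n) (vertical_arc m v1 v2 e j) = 2 * n + 1 - lines v2 ! j"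
    using lo_hi_pair[of "vertical_arc m v1 v2 e j" "(0, lines v1 ! j)" "(1, lines v2 ! j)" "frame_pos n"] b
    by (simp_all add: vertical_arc_def frame_pos_def)
qed

lemma glue_cases:
  assumes "a \<in> arcs (glue m v1 v2 e)"
  obtains (top) x where "x \<in> nonlines v1" "a = up 0 x" | (bottom) x where "x \<in> nonlines v2" "a = up 1 x"
    | (vert) j where "j < length (lines v1)" "a = vertical_arc m v1 v2 e j"
  using assms unfolding glue_arcs by blast

lemma lines_mono: "j < length (lines v1) \<Longrightarrow> j' < length (lines v1) \<Longrightarrow> lines v1 ! j < lines v1 ! j' \<longleftrightarrow> j < j'"
   "j < length (lines v1) \<Longrightarrow> j' < length (lines v1) \<Longrightarrow> lines v2 ! j < lines v2 ! j' \<longleftrightarrow> j < j'"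
  using v1.lines_less[of j j'] v1.lines_less[of j' j] v2.lines_less[of j j'] v2.lines_less[of j' j] length_eq
  by (metis linorder_neqE_nat not_less_iff_gr_or_eq)+

lemma glue_not_crosses:
  assumes a: "a \<in> arcs (glue m v1 v2 e)" and b: "b \<in> arcs (glue m v1 v2 e)"
  shows "\<not> crosses (frame_pos n) a b"
using a proof (cases rule: glue_cases)
  case (top x)
  note X = v1.up_lo_hi[OF top(1)]
  show ?thesis
    using b
  proof (cases rule: glue_cases)
    case (top y)
    thus ?thesis using v1.up_lo_hi[OF top(1)] X v1.nonline_not_crosses[OF \<open>x \<in> nonlines v1\<close> top(1)] \<open>a = up 0 x\<close>
      by (simp add: crosses_def)
  next
    case (bottom y)
    thus ?thesis using v2.up_lo_hi[OF bottom(1)] X unfolding crosses_def \<open>a = up 0 x\<close> bottom(2) by linarith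
  next
    case (vert j)
    thus ?thesis using vertical_lo_hi(1,2)[OF vert(1), of e] vertical_lo_hi(3-6)[OF vert(1)] X \<open>a = up 0 x\<close> v1.line_not_inside[OF \<open>x \<in> nonlines v1\<close> vert(1)]
      by (auto simp: crosses_def)
  qed
next
  case (bottom x)
  note X = v2.up_lo_hi[OF bottom(1)]
  show ?thesis
    using b
  proof (cases rule: glue_cases)
    case (top y)
    thus ?thesis using v1.up_lo_hi[OF top(1)] X unfolding crosses_def \<open>a = up 1 x\<close> top(2) by linarith
  next
    case (bottom y)
    note Y = v2.up_lo_hi[OF bottom(1)]
    have "\<not> crosses id y x" using v2.nonline_not_crosses[OF bottom(1) \<open>x \<in> nonlines v2\<close>] .
    thus ?thesis unfolding crosses_def \<open>a = up 1 x\<close> bottom(2) using X Y by linarith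
  next
    case (vert j)
    thus ?thesis using vertical_lo_hi(1,2)[OF vert(1), of e] vertical_lo_hi(3-6)[OF vert(1)] X unfolding crosses_def \<open>a = up 1 x\<close> vert(2) by linarith
  qed
next
  case (vert j)
  note X = vertical_lo_hi(1,2)[OF vert(1), of e] vertical_lo_hi(3-6)[OF vert(1)]
  show ?thesis
    using b
  proof (cases rule: glue_cases)
    case (top y)
    thus ?thesis using v1.up_lo_hi[OF top(1)] X unfolding crosses_def \<open>a = vertical_arc m v1 v2 e j\<close> top(2) by linarith
  next
    case (bottom y)
    have "\<not> (lo id y < lines v2 ! j \<and> lines v2 ! j < hi id y)"
      using v2.line_not_inside[OF bottom(1), of j] vert(1) length_eq by simp
    thus ?thesis using v2.up_lo_hi[OF bottom(1)] X unfolding crosses_def \<open>a = vertical_arc m v1 v2 e j\<close> bottom(2) by linarith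
  next
    case (vert j')
    show ?thesis
      using X vertical_lo_hi(1,2)[OF vert(1), of e] vertical_lo_hi(3-6)[OF vert(1)] lines_mono[OF \<open>j < length (lines v1)\<close> vert(1)]
        lines_mono[OF vert(1) \<open>j < length (lines v1)\<close>]
      unfolding crosses_def \<open>a = vertical_arc m v1 v2 e j\<close> vert(2) by linarith
  qed
qed

text \<open>
  Inversion exchanges the two halves. What holds for the top vertices of all glued diagrams thus
  holds for the bottom vertices as well.
\<close>

lemma glue_swap: "arcs (glue m v2 v1 e) = flip_arc ` arcs (glue m v1 v2 e)"
proof -
  interpret s: dangle_pair m n k v2 v1 by unfold_locales
  have "flip_arc (up 0 x) = up 1 x" "flip_arc (up 1 x) = up 0 x" for x
    by (simp_all add: flip_arc_def up_def image_image flip_vertex_def)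
  moreover have "flip_arc (vertical_arc m v1 v2 e j) = vertical_arc m v2 v1 e j" for j
    by (simp add: flip_arc_def vertical_arc_def flip_vertex_def insert_commute add.commute)
  ultimately show ?thesis
    unfolding glue_arcs s.glue_arcs image_Un image_image length_eq by (simp only: ac_simps)
qed

lemma glue_top_vertex:
  assumes i: "i \<in> {1..n}"
  shows "\<exists>!a. a \<in> arcs (glue m v1 v2 e) \<and> (0, i) \<in> ends a"
proof -
  have vend: "(0, i) \<in> ends (vertical_arc m v1 v2 e j) \<longleftrightarrow> i = lines v1 ! j" for j by (auto simp: vertical_arc_def)
  have upend: "(0, i) \<in> ends (up r x) \<longleftrightarrow> r = 0 \<and> i \<in> ends x" for r x by auto
  show ?thesis
  proof (cases "i \<in> v1.line_positions")
    case L: True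
    then obtain j where j: "j < length (lines v1)" "lines v1 ! j = i"
      using v1.set_lines by (metis in_set_conv_nth)
    show ?thesis
    proof (rule ex1I[of _ "vertical_arc m v1 v2 e j"])
      show "vertical_arc m v1 v2 e j \<in> arcs (glue m v1 v2 e) \<and> (0, i) \<in> ends (vertical_arc m v1 v2 e j)"
        using j vend by (auto simp: glue_arcs)
      fix a assume a: "a \<in> arcs (glue m v1 v2 e) \<and> (0, i) \<in> ends a"
      from conjunct1[OF a] show "a = vertical_arc m v1 v2 e j"
      proof (cases rule: glue_cases)
        case (top x)
        hence "i \<in> ends x" using a upend by simp
        thus ?thesis using top(1) L v1.nonline_union(2) by blast
      next
        case (vert j')
        hence "lines v1 ! j' = i" using a vend by simp
        hence "j' = j" using v1.lines_inj[OF vert(1) j(1)] j(2) by simp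
        thus ?thesis using vert(2) by simp
      qed (use a upend in simp)
    qed
  next
    case L: False
    have "i \<in> \<Union>(ends ` nonlines v1) \<union> v1.line_positions" unfolding v1.nonline_union(1)[symmetric] by (rule i)
    then obtain x where x: "x \<in> nonlines v1" "i \<in> ends x" using L by blast
    show ?thesis
    proof (rule ex1I[of _ "up 0 x"])
      show "up 0 x \<in> arcs (glue m v1 v2 e) \<and> (0, i) \<in> ends (up 0 x)" using x by (auto simp: glue_arcs)
      fix a assume a: "a \<in> arcs (glue m v1 v2 e) \<and> (0, i) \<in> ends a"
      from conjunct1[OF a] show "a = up 0 x"
      proof (cases rule: glue_cases)
        case (top y)
        hence "i \<in> ends y" using a upend by simp
        hence "y = x" using v1.arc_unique[of y x i] top(1) x by (simp add: nonlines_def)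
        thus ?thesis using top by simp
      next
        case (vert j)
        hence "lines v1 ! j = i" using a vend by simp
        thus ?thesis using L v1.set_lines nth_mem vert(1) by metis
      qed (use a upend in simp)
    qed
  qed
qed

lemma glue_ends:
  assumes a: "a \<in> arcs (glue m v1 v2 e)"
  shows "ends a \<subseteq> vertices n" "card (ends a) = 2"
proof -
  have both: "ends a \<subseteq> vertices n \<and> card (ends a) = 2"
    using a
  proof (cases rule: glue_cases)
    case (top x)
    hence "ends x \<subseteq> {1..n}" using v1.ends_sub by (simp add: nonlines_def)
    moreover have "card (ends x) = 2" using v1.ends_card top by (auto simp: nonlines_def is_line_def)
    ultimately show "ends a \<subseteq> vertices n \<and> card (ends a) = 2" using top by (auto simp: vertices_def card_image inj_on_def)
  next
    case (bottom x)
    hence "ends x \<subseteq> {1..n}" using v2.ends_sub by (simp add: nonlines_def)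
    moreover have "card (ends x) = 2" using v2.ends_card bottom by (auto simp: nonlines_def is_line_def)
    ultimately show "ends a \<subseteq> vertices n \<and> card (ends a) = 2" using bottom by (auto simp: vertices_def card_image inj_on_def)
  next
    case (vert j)
    thus ?thesis
      using vertical_lo_hi(1,2)[OF vert(1), of e] vertical_lo_hi(3-6)[OF vert(1)] by (simp add: vertical_arc_def vertices_iff)
  qed
  thus "ends a \<subseteq> vertices n" "card (ends a) = 2" by simp_all
qed

lemma glue_planar: "planar_matching n (arcs (glue m v1 v2 e))"
  unfolding planar_matching_def
proof (intro conjI ballI)
  fix u assume "u \<in> vertices n"
  then obtain r i where u: "u = (r, i)" "r = 0 \<or> r = 1" "i \<in> {1..n}" by (cases u) (auto simp: vertices_iff)
  show "\<exists>!a. a \<in> arcs (glue m v1 v2 e) \<and> u \<in> ends a"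
  proof (cases "r = 0")
    case False
    interpret s: dangle_pair m n k v2 v1 by unfold_locales
    have inv: "flip_arc (flip_arc a) = a" "(0, i) \<in> ends (flip_arc a) \<longleftrightarrow> (1, i) \<in> ends a"
      if a: "a \<in> arcs (glue m v1 v2 e)" for a
    proof -
      have V: "v \<in> vertices n" if "v \<in> ends a" for v using glue_ends(1)[OF a] that by blast
      have "flip_vertex ` flip_vertex ` ends a = (\<lambda>v. v) ` ends a"
        unfolding image_image by (rule image_cong[OF refl]) (rule flip_vertex_flip[OF V])
      thus "flip_arc (flip_arc a) = a" by (cases a) (simp add: flip_arc_def)
      show "(0, i) \<in> ends (flip_arc a) \<longleftrightarrow> (1, i) \<in> ends a"
        using V by (force simp: flip_vertex_def vertices_def image_iff)
    qed
    have ex1: "\<exists>!c. c \<in> flip_arc ` arcs (glue m v1 v2 e) \<and> (0, i) \<in> ends c"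
      using s.glue_top_vertex[OF u(3), of e] unfolding glue_swap .
    obtain c where c: "c \<in> flip_arc ` arcs (glue m v1 v2 e)" "(0, i) \<in> ends c"
      and uniq: "\<forall>c'. c' \<in> flip_arc ` arcs (glue m v1 v2 e) \<and> (0, i) \<in> ends c' \<longrightarrow> c' = c"
      by (rule ex1E[OF ex1], elim conjE, rule that)
    obtain a where a: "a \<in> arcs (glue m v1 v2 e)" "c = flip_arc a" using c(1) by (elim imageE) simp
    show ?thesis
    proof (rule ex1I[of _ a])
      show "a \<in> arcs (glue m v1 v2 e) \<and> u \<in> ends a" using a c(2) inv(2)[OF a(1)] u(1,2) False by simp
      fix a' assume a': "a' \<in> arcs (glue m v1 v2 e) \<and> u \<in> ends a'"
      hence "flip_arc a' = flip_arc a" using spec[OF uniq, of "flip_arc a'"] inv(2)[of a'] u(1,2) False a(2) by simp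
      thus "a' = a" using inv(1) a(1) a' by metis
    qed
  qed (use glue_top_vertex[OF u(3)] u(1) in simp)
qed (use glue_ends glue_not_crosses in blast)+

text \<open>
  A blob of a dangle lies on the leftmost line or on an outermost arc to the left of it, so no arc
  of the glued diagram passes between it and the left face.
\<close>

lemma glue_exposed:
  assumes a: "a \<in> arcs (glue m v1 v2 e)" and b: "b \<in> arcs (glue m v1 v2 e)" and bl: "blobs a \<noteq> 0"
  shows "\<not> encloses (frame_pos n) b a"
using a proof (cases rule: glue_cases)
  case (top x)
  note X = v1.up_lo_hi[OF top(1)]
  have x: "blobs x \<noteq> 0" using bl top by simp
  show ?thesis
    using b
  proof (cases rule: glue_cases)
    case (top y)
    have "\<not> encloses id y x" using v1.nonline_not_enclosed[OF \<open>x \<in> nonlines v1\<close> top(1) x] .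
    thus ?thesis using v1.up_lo_hi[OF top(1)] X unfolding encloses_def \<open>a = up 0 x\<close> top(2) by linarith
  next
    case (bottom y)
    thus ?thesis using v2.up_lo_hi[OF bottom(1)] X unfolding encloses_def \<open>a = up 0 x\<close> bottom(2) by linarith
  next
    case (vert j)
    thus ?thesis using vertical_lo_hi(1,2)[OF vert(1), of e] vertical_lo_hi(3-6)[OF vert(1)] X v1.nonline_line_left[OF \<open>x \<in> nonlines v1\<close> x vert(1)]
      unfolding encloses_def \<open>a = up 0 x\<close> vert(2) by linarith
  qed
next
  case (bottom x)
  note X = v2.up_lo_hi[OF bottom(1)]
  have x: "blobs x \<noteq> 0" using bl bottom by simp
  show ?thesis
    using b
  proof (cases rule: glue_cases)
    case (top y)
    thus ?thesis using v1.up_lo_hi[OF top(1)] X unfolding encloses_def \<open>a = up 1 x\<close> top(2) by linarith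
  next
    case (bottom y)
    have "\<not> encloses id y x" using v2.nonline_not_enclosed[OF \<open>x \<in> nonlines v2\<close> bottom(1) x] .
    thus ?thesis using v2.up_lo_hi[OF bottom(1)] X unfolding encloses_def \<open>a = up 1 x\<close> bottom(2) by linarith
  next
    case (vert j)
    hence "lo id x < lines v2 ! j" using v2.nonline_line_left[OF \<open>x \<in> nonlines v2\<close> x, of j] length_eq by simp
    thus ?thesis using vertical_lo_hi(1,2)[OF vert(1), of e] vertical_lo_hi(3-6)[OF vert(1)] X
      unfolding encloses_def \<open>a = up 1 x\<close> vert(2) by linarith
  qed
next
  case (vert j)
  note X = vertical_lo_hi(1,2)[OF vert(1), of e] vertical_lo_hi(3-6)[OF vert(1)]
  have j0: "j = 0"
  proof (rule ccontr)
    assume "j \<noteq> 0"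
    hence "line_blobs v1 j = 0" "line_blobs v2 j = 0"
      using v1.line_blobs_zero[of j] v2.line_blobs_zero[of j] vert(1) length_eq by simp_all
    thus False using bl vert(2) by (simp add: vertical_arc_def)
  qed
  show ?thesis
    using b
  proof (cases rule: glue_cases)
    case (top y)
    thus ?thesis using v1.up_lo_hi[OF top(1)] X unfolding encloses_def \<open>a = vertical_arc m v1 v2 e j\<close> top(2) by linarith
  next
    case (bottom y)
    thus ?thesis using v2.up_lo_hi[OF bottom(1)] X unfolding encloses_def \<open>a = vertical_arc m v1 v2 e j\<close> bottom(2) by linarith
  next
    case (vert j')
    have "\<not> lines v1 ! j' < lines v1 ! j" using lines_mono(1)[OF vert(1) \<open>j < length (lines v1)\<close>] j0 by simp
    thus ?thesis using X vertical_lo_hi(1,2)[OF vert(1), of e] vertical_lo_hi(3-6)[OF vert(1)]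
      unfolding encloses_def \<open>a = vertical_arc m v1 v2 e j\<close> vert(2) by linarith
  qed
qed

lemma glue_decorated:
  assumes m: "m \<ge> 1" and c: "\<forall>(r, s)\<in>#cycles v1. r < m"
  shows "decorated_tangle m n (glue m v1 v2 e)"
proof -
  have "dots a < m" if "a \<in> arcs (glue m v1 v2 e)" for a
    using that by (cases rule: glue_cases)
      (use v1.dots_less v2.dots_less m in \<open>simp_all add: nonlines_def vertical_arc_def\<close>)
  moreover have "blobs a = 0" if "a \<in> arcs (glue m v1 v2 e)" "\<not> exposed n (glue m v1 v2 e) a" for a
    using that glue_exposed unfolding exposed_def by blast
  moreover have "\<forall>(r, s)\<in>#cycles (glue m v1 v2 e). r < m" using c by (simp add: glue_def)
  ultimately show ?thesis using glue_planar[of e] unfolding decorated_tangle_def planar_matching_def by blast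
qed

lemma glue_blobs_le: "a \<in> arcs (glue m v1 v2 e) \<Longrightarrow> blobs a \<le> 1"
  by (erule glue_cases) (use v1.blobs_le v2.blobs_le in \<open>simp_all add: nonlines_def vertical_arc_def\<close>)

lemma vertical_inj: "inj_on (vertical_arc m v1 v2 e) {..<length (lines v1)}"
  by (rule inj_onI) (use v1.lines_inj in \<open>auto simp: vertical_arc_def doubleton_eq_iff\<close>)

text \<open>
  Two blobs meeting on the leftmost vertical arc cancel, which changes the number by two.
\<close>

lemma glue_parity: "even (\<Sum>a\<in>arcs (glue m v1 v2 e). blobs a) \<longleftrightarrow>
    even ((\<Sum>a\<in>arcs v1. blobs a) + (\<Sum>a\<in>arcs v2. blobs a))"
proof -
  have d1: "up 0 ` nonlines v1 \<inter> up 1 ` nonlines v2 = {}"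
  proof (rule ccontr)
    assume "up 0 ` nonlines v1 \<inter> up 1 ` nonlines v2 \<noteq> {}"
    then obtain x y where h: "x \<in> nonlines v1" "up 0 x = up 1 y" by blast
    obtain i j where "ends x = {i, j}" using v1.nonline_pair[OF h(1)] by metis
    hence "(0, i) \<in> ends (up 0 x)" by simp
    thus False unfolding h(2) by auto
  qed
  have d2: "(up 0 ` nonlines v1 \<union> up 1 ` nonlines v2) \<inter> vertical_arc m v1 v2 e ` {..<length (lines v1)} = {}"
  proof (rule ccontr)
    assume "\<not> ?thesis"
    then obtain r x j where h: "up r x = vertical_arc m v1 v2 e j" by blast
    have "(0, lines v1 ! j) \<in> ends (up r x)" "(1, lines v2 ! j) \<in> ends (up r x)"
      unfolding h by (simp_all add: vertical_arc_def)
    thus False by auto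
  qed
  have vb: "(\<Sum>a\<in>vertical_arc m v1 v2 e ` {..<length (lines v1)}. blobs a) =
    (\<Sum>j<length (lines v1). (line_blobs v1 j + line_blobs v2 j) mod 2)"
    unfolding sum.reindex[OF vertical_inj] by (simp add: vertical_arc_def)
  have "(\<Sum>a\<in>arcs (glue m v1 v2 e). blobs a) = (\<Sum>a\<in>nonlines v1. blobs a) + (\<Sum>a\<in>nonlines v2. blobs a) +
    (\<Sum>j<length (lines v1). (line_blobs v1 j + line_blobs v2 j) mod 2)"
    unfolding glue_arcs
    by (subst sum.union_disjoint[OF _ _ d2], simp add: v1.finite_nonlines v2.finite_nonlines, simp,
      subst sum.union_disjoint[OF _ _ d1], simp add: v1.finite_nonlines, simp add: v2.finite_nonlines)
      (simp add: sum.reindex inj_on_subset[OF up_inj] vb)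
  also have "(\<Sum>j<length (lines v1). (line_blobs v1 j + line_blobs v2 j) mod 2) =
    (if lines v1 = [] then 0 else (line_blobs v1 0 + line_blobs v2 0) mod 2)"
  proof (cases "lines v1 = []")
    case False
    hence "{..<length (lines v1)} = insert 0 {1..<length (lines v1)}" by auto
    moreover have "(\<Sum>j\<in>{1..<length (lines v1)}. (line_blobs v1 j + line_blobs v2 j) mod 2) = 0"
      using v1.line_blobs_zero v2.line_blobs_zero length_eq by simp
    ultimately show ?thesis using False by simp
  qed simp
  finally show ?thesis unfolding v1.sum_blobs v2.sum_blobs using length_eq by auto
qed

lemma hor_glue: "hor 0 (arcs (glue m v1 v2 e)) = up 0 ` nonlines v1" "hor 1 (arcs (glue m v1 v2 e)) = up 1 ` nonlines v2"
proof -
  have ne: "ends x \<noteq> {}" if "x \<in> nonlines v1 \<or> x \<in> nonlines v2" for x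
    using that v1.ends_card[of x] v2.ends_card[of x] by (auto simp: nonlines_def)
  have t: "hor r (up r ` B) = up r ` B" for r B by (auto simp: hor_def)
  have t': "hor r (up r' ` B) = {}" if "r \<noteq> r'" "\<And>x. x \<in> B \<Longrightarrow> ends x \<noteq> {}" for r r' B
    using that by (fastforce simp: hor_def)
  have v: "hor r (vertical_arc m v1 v2 e ` J) = {}" for r J by (auto simp: hor_def vertical_arc_def)
  have u: "hor r (B \<union> B') = hor r B \<union> hor r B'" for r B B' by (auto simp: hor_def)
  show "hor 0 (arcs (glue m v1 v2 e)) = up 0 ` nonlines v1" "hor 1 (arcs (glue m v1 v2 e)) = up 1 ` nonlines v2"
    using ne by (simp_all add: glue_arcs u t v t')
qed

end

section \<open>Cutting a tangle into dangles\<close>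

definition down :: "vertex arc \<Rightarrow> nat arc" where
  "down a = Arc (snd ` ends a) (dots a) (blobs a)"

definition top_lines :: "vertex arc set \<Rightarrow> nat set" where
  "top_lines A = {i. \<exists>j. \<exists>a\<in>A. ends a = {(0, i), (1, j)}}"

definition half_line :: "nat \<Rightarrow> vertex arc set \<Rightarrow> nat \<Rightarrow> nat arc" where
  "half_line b A i = Arc {i} 0 (if i = Min (top_lines A) then b else 0)"

text \<open>
  The upper half of \<open>G\<close>. A blob on the leftmost vertical arc can be given to either
  half, so the number of blobs of the leftmost line is a parameter \<open>b\<close>.
\<close>

definition half :: "nat \<Rightarrow> tangle \<Rightarrow> dangle" where
  "half b G = Diagram (down ` hor 0 (arcs G) \<union> half_line b (arcs G) ` top_lines (arcs G)) (cycles G)"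

lemma down_simps [simp]: "ends (down a) = snd ` ends a" "dots (down a) = dots a" "blobs (down a) = blobs a"
  by (simp_all add: down_def)

lemma half_line_simps [simp]: "ends (half_line b A i) = {i}" "dots (half_line b A i) = 0"
  "blobs (half_line b A i) = (if i = Min (top_lines A) then b else 0)"
  by (simp_all add: half_line_def)

lemma finite_pm: "\<exists>e :: nat \<Rightarrow>\<^sub>0 nat. (\<forall>j<r. lookup e j = d j) \<and> keys e \<subseteq> {..<r}"
proof -
  let ?e = "\<Sum>i<r. single i (d i)"
  have l: "lookup ?e j = (if j < r then d j else 0)" for j
    by (simp add: lookup_sum lookup_single when_def)
  hence "keys ?e \<subseteq> {..<r}" by (auto simp: in_keys_iff split: if_splits)
  thus ?thesis using l by (intro exI[of _ ?e]) simp
qed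

lemma sorted_list_of_set_image_mono:
  fixes f :: "nat \<Rightarrow> nat"
  assumes fin: "finite S" and mono: "\<And>x y. x \<in> S \<Longrightarrow> y \<in> S \<Longrightarrow> x < y \<Longrightarrow> f x < f y"
  shows "sorted_list_of_set (f ` S) = map f (sorted_list_of_set S)"
proof -
  let ?l = "sorted_list_of_set S"
  have s: "set ?l = S" using fin by simp
  have "sorted_wrt (<) ?l" by simp
  hence "sorted_wrt (<) (map f ?l)"
    unfolding sorted_wrt_map by (rule sorted_wrt_mono_rel[rotated]) (use mono s in auto)
  hence "sorted (map f ?l)" "distinct (map f ?l)" by (simp_all add: strict_sorted_iff)
  hence "sorted_list_of_set (set (map f ?l)) = map f ?l" by (rule sorted_list_of_set.idem_if_sorted_distinct)
  thus ?thesis using s by simp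
qed

lemma vertices_row: "v \<in> vertices n \<Longrightarrow> fst v = 0 \<or> fst v = 1"
  by (auto simp: vertices_def)

context planar
begin

lemma vertical_ends:
  assumes "a \<in> A" "a \<notin> hor 0 A" "a \<notin> hor 1 A"
  obtains i j where "ends a = {(0, i), (1, j)}"
proof -
  obtain x y where xy: "ends a = {x, y}" "x \<in> vertices n" "y \<in> vertices n" using arc_pair[OF assms(1)] by metis
  note vertices_row[OF xy(2)] vertices_row[OF xy(3)]
  then consider "fst x = 0" "fst y = 0" | "fst x = 1" "fst y = 1" | "fst x = 0" "fst y = 1" | "fst x = 1" "fst y = 0" by metis
  thus ?thesis
  proof cases
    case 1 thus ?thesis using assms xy by (simp add: hor_def)
  next
    case 2 thus ?thesis using assms xy by (simp add: hor_def)
  next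
    case 3
    hence "x = (0, snd x)" "y = (1, snd y)" by (simp_all add: prod_eq_iff)
    thus ?thesis using that xy(1) by metis
  next
    case 4
    hence "x = (1, snd x)" "y = (0, snd y)" by (simp_all add: prod_eq_iff)
    thus ?thesis using that xy(1) by (metis insert_commute)
  qed
qed

lemma vertical_range:
  assumes "a \<in> A" "ends a = {(0, i), (1, j)}"
  shows "1 \<le> i" "i \<le> n" "1 \<le> j" "j \<le> n" "lo pos a = i" "hi pos a = 2 * n + 1 - j"
proof -
  show r: "1 \<le> i" "i \<le> n" "1 \<le> j" "j \<le> n" using ends_sub[OF assms(1)] unfolding assms(2) by (simp_all add: vertices_iff)
  show "lo pos a = i" "hi pos a = 2 * n + 1 - j"
    using lo_hi_pair[OF assms(2), of pos] r by (simp_all add: frame_pos_def)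
qed

lemma hor_down:
  assumes "a \<in> hor 0 A"
  obtains i j where "ends a = {(0, i), (0, j)}" "ends (down a) = {i, j}" "i < j" "1 \<le> i" "j \<le> n"
    "lo pos a = i" "hi pos a = j" "lo id (down a) = i" "hi id (down a) = j"
proof -
  have a: "a \<in> A" "\<And>v. v \<in> ends a \<Longrightarrow> fst v = 0" using assms by (simp_all add: hor_def)
  obtain x y where xy: "ends a = {x, y}" "pos x < pos y" "lo pos a = pos x" "hi pos a = pos y"
    "x \<in> vertices n" "y \<in> vertices n" using arc_pair[OF a(1)] .
  have e: "x = (0, snd x)" "y = (0, snd y)" using a(2)[of x] a(2)[of y] xy(1) by (simp_all add: prod_eq_iff)
  have p: "pos x = snd x" "pos y = snd y" using e by (metis frame_pos_def fst_conv)+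
  have d: "ends (down a) = {snd x, snd y}" using xy(1) by simp
  have r: "1 \<le> snd x" "snd y \<le> n" using xy(5,6) by (auto simp: vertices_def)
  have l: "lo id (down a) = snd x" "hi id (down a) = snd y" using lo_hi_pair[OF d, of id] xy(2) p by simp_all
  show ?thesis by (rule that[of "snd x" "snd y"]) (use xy p e d r l in simp_all)
qed

lemma down_lo_hi:
  assumes "a \<in> hor 0 A"
  shows "lo id (down a) = lo pos a" "hi id (down a) = hi pos a" "lo pos a < hi pos a" "hi pos a \<le> n"
proof -
  obtain i j where ij: "ends a = {(0, i), (0, j)}" "ends (down a) = {i, j}" "i < j" "1 \<le> i" "j \<le> n"
    "lo pos a = i" "hi pos a = j" "lo id (down a) = i" "hi id (down a) = j" using hor_down[OF assms] .
  show "lo id (down a) = lo pos a" "hi id (down a) = hi pos a" "lo pos a < hi pos a" "hi pos a \<le> n"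
    using ij by simp_all
qed

lemma down_inj: "inj_on down (hor 0 A)"
proof (rule inj_onI)
  fix a b assume h: "a \<in> hor 0 A" "b \<in> hor 0 A" "down a = down b"
  have "Pair 0 ` snd ` ends x = ends x" if "x \<in> hor 0 A" for x
  proof -
    have "Pair 0 ` snd ` ends x = (\<lambda>v. v) ` ends x"
      unfolding image_image by (rule image_cong[OF refl]) (use that in \<open>simp add: hor_def prod_eq_iff\<close>)
    thus ?thesis by simp
  qed
  moreover have "snd ` ends a = snd ` ends b" using h(3) by (simp add: down_def)
  ultimately have "ends a = ends b" using h by metis
  thus "a = b" using h(3) by (cases a; cases b) (simp add: down_def)
qed

lemma up_down: "a \<in> hor 0 A \<Longrightarrow> up 0 (down a) = a"
proof -
  assume "a \<in> hor 0 A"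
  hence "Pair 0 ` snd ` ends a = (\<lambda>v. v) ` ends a"
    unfolding image_image by (intro image_cong[OF refl]) (simp add: hor_def prod_eq_iff)
  thus ?thesis by (cases a) (simp add: up_def down_def)
qed

lemma up_down_flip: "a \<in> hor 1 A \<Longrightarrow> up 1 (down (flip_arc a)) = a"
proof -
  assume "a \<in> hor 1 A"
  hence "Pair 1 ` snd ` flip_vertex ` ends a = (\<lambda>v. v) ` ends a"
    unfolding image_image by (intro image_cong[OF refl]) (simp add: hor_def prod_eq_iff flip_vertex_def)
  thus ?thesis by (cases a) (simp add: up_def down_def flip_arc_def)
qed

lemma top_lines_sub: "top_lines A \<subseteq> {1..n}"
  using vertical_range by (auto simp: top_lines_def)

lemma finite_top_lines: "finite (top_lines A)"
  using top_lines_sub finite_subset by blast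

lemma hor_not_line:
  assumes "a \<in> hor 0 A" "i \<in> ends (down a)"
  shows "i \<notin> top_lines A"
proof
  assume "i \<in> top_lines A"
  then obtain b j where b: "b \<in> A" "ends b = {(0, i), (1, j)}" by (auto simp: top_lines_def)
  have a: "a \<in> A" "\<And>v. v \<in> ends a \<Longrightarrow> fst v = 0" using assms(1) by (simp_all add: hor_def)
  obtain v where v: "v \<in> ends a" "i = snd v" using assms(2) by auto
  have "v = (0, i)" using v a(2)[OF v(1)] by (simp add: prod_eq_iff)
  hence "a = b" using arc_unique[OF a(1) b(1) v(1)] b(2) by simp
  thus False using a(2)[of "(1, j)"] b(2) by simp
qed

text \<open>
  The frame positions of top vertices are their numbers, so the order relations between top
  horizontal arcs are inherited. A line is not enclosed by a top arc, since the vertical arc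
  behind it would cross that arc.
\<close>

lemma half_dangle:
  assumes G: "arcs G = A" "decorated_tangle m n G" "\<And>a. a \<in> A \<Longrightarrow> blobs a \<le> 1"
    "\<forall>(r, s)\<in>#cycles G. s \<le> 1" and b: "b \<le> 1" and m: "m \<ge> 1"
  shows "decorated_dangle m n (card (hor 0 A)) (half b G)"
proof -
  have arcs: "arcs (half b G) = down ` hor 0 A \<union> half_line b A ` top_lines A" by (simp add: half_def G(1))
  have half_cases [consumes 1, case_names down line]: thesis
    if "a \<in> arcs (half b G)" "\<And>x. x \<in> hor 0 A \<Longrightarrow> a = down x \<Longrightarrow> thesis"
      "\<And>i. i \<in> top_lines A \<Longrightarrow> a = half_line b A i \<Longrightarrow> thesis" for a thesis
    using that arcs by blast
  have line: "is_line (half_line b A i)" for i by (simp add: is_line_def)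
  have nl: "\<not> is_line (down x)" if h: "x \<in> hor 0 A" for x
  proof -
    obtain i j where "ends (down x) = {i, j}" "i < j" using hor_down[OF h] by metis
    thus ?thesis by (simp add: is_line_def)
  qed
  have lohi: "lo id (half_line b A i) = i" "hi id (half_line b A i) = i" for i by (simp_all add: lo_def hi_def)
  have c1: "ends a \<subseteq> {1..n}" "card (ends a) \<in> {1, 2}" if "a \<in> arcs (half b G)" for a
  proof -
    have "ends a \<subseteq> {1..n} \<and> card (ends a) \<in> {1, 2}"
      using that
    proof (cases rule: half_cases)
      case x: (down x)
      obtain i j where "ends (down x) = {i, j}" "i < j" "1 \<le> i" "j \<le> n" using hor_down[OF x(1)] by metis
      thus ?thesis using x(2) by simp
    next
      case (line i)
      thus ?thesis using top_lines_sub by auto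
    qed
    thus "ends a \<subseteq> {1..n}" "card (ends a) \<in> {1, 2}" by simp_all
  qed
  have c2: "\<exists>!a. a \<in> arcs (half b G) \<and> i \<in> ends a" if i: "i \<in> {1..n}" for i
  proof (cases "i \<in> top_lines A")
    case True
    show ?thesis
    proof (rule ex1I[of _ "half_line b A i"])
      show "half_line b A i \<in> arcs (half b G) \<and> i \<in> ends (half_line b A i)" using True arcs by simp
      fix a assume a: "a \<in> arcs (half b G) \<and> i \<in> ends a"
      hence "a \<in> arcs (half b G)" by simp
      thus "a = half_line b A i"
      proof (cases rule: half_cases)
        case (down x)
        thus ?thesis using hor_not_line[of _ i] True a by blast
      next
        case (line j)
        thus ?thesis using a by auto
      qed
    qed
  next
    case False
    have "(0, i) \<in> vertices n" using i by (simp add: vertices_iff)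
    then obtain x where x: "x \<in> A" "(0, i) \<in> ends x" using arc_exists by blast
    have "x \<notin> hor 1 A"
    proof
      assume "x \<in> hor 1 A"
      hence "\<forall>v\<in>ends x. fst v = 1" by (simp add: hor_def)
      from bspec[OF this x(2)] show False by simp
    qed
    have xh: "x \<in> hor 0 A"
    proof (rule ccontr)
      assume "x \<notin> hor 0 A"
      then obtain i' j where "ends x = {(0, i'), (1, j)}" using vertical_ends[OF x(1) _ \<open>x \<notin> hor 1 A\<close>] by metis
      thus False using False x by (auto simp: top_lines_def)
    qed
    show ?thesis
    proof (rule ex1I[of _ "down x"])
      have "i \<in> snd ` ends x" using x(2) by force
      thus "down x \<in> arcs (half b G) \<and> i \<in> ends (down x)" using xh arcs by simp
      fix a assume a: "a \<in> arcs (half b G) \<and> i \<in> ends a"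
      hence "a \<in> arcs (half b G)" by simp
      thus "a = down x"
      proof (cases rule: half_cases)
        case y: (down y)
        then obtain u where u: "u \<in> ends y" "i = snd u" using a by auto
        hence "u = (0, i)" using y(1) by (simp add: hor_def prod_eq_iff)
        hence "y = x" using arc_unique[of y x "(0, i)"] x u(1) y(1) by (simp add: hor_def)
        thus ?thesis using y(2) by simp
      next
        case (line j)
        thus ?thesis using a False by auto
      qed
    qed
  qed
  have c3: "card {a \<in> arcs (half b G). \<not> is_line a} = card (hor 0 A)"
  proof -
    have "{a \<in> arcs (half b G). \<not> is_line a} = down ` hor 0 A" using arcs line nl by blast
    thus ?thesis by (simp add: card_image[OF down_inj])
  qed
  have c4: "\<not> crosses id a c \<and> (is_line a \<longrightarrow> \<not> encloses id c a)"
    if a: "a \<in> arcs (half b G)" and c: "c \<in> arcs (half b G)" for a c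
    using a
  proof (cases rule: half_cases)
    case x: (down x)
    have nc: "\<not> crosses id a c"
      using c
    proof (cases rule: half_cases)
      case y: (down y)
      have "lo id a = lo pos x" "hi id a = hi pos x" using down_lo_hi[OF x(1)] x(2) by simp_all
      moreover have "lo id c = lo pos y" "hi id c = hi pos y" using down_lo_hi[OF y(1)] y(2) by simp_all
      moreover have "\<not> crosses pos x y" using not_crosses x y by (simp add: hor_def)
      ultimately show ?thesis by (simp add: crosses_def)
    next
      case (line i)
      thus ?thesis using lohi by (auto simp: crosses_def)
    qed
    thus ?thesis using nl x by simp
  next
    case i: (line i)
    have nc: "\<not> crosses id a c" using lohi i(2) by (simp add: crosses_def)
    have "\<not> encloses id c a"
      using c
    proof (cases rule: half_cases)
      case y: (down y)
      obtain p q where pq: "lo pos y = p" "hi pos y = q" "lo id c = p" "hi id c = q" "q \<le> n"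
        using down_lo_hi[OF y(1)] y(2) by simp
      obtain z j where z: "z \<in> A" "ends z = {(0, i), (1, j)}" using i(1) by (auto simp: top_lines_def)
      note vr = vertical_range[OF z]
      have "\<not> crosses pos y z" using not_crosses[of y z] y(1) z(1) by (simp add: hor_def)
      hence "\<not> (p < i \<and> i < q \<and> q < 2 * n + 1 - j)" unfolding crosses_def pq vr .
      moreover have "q < 2 * n + 1 - j" using pq vr by linarith
      ultimately show ?thesis using pq lohi i(2) by (auto simp: encloses_def)
    next
      case (line i')
      thus ?thesis using lohi i(2) by (auto simp: encloses_def)
    qed
    thus ?thesis using nc by simp
  qed
  have c5: "dots a < m \<and> (is_line a \<longrightarrow> dots a = 0)" if a: "a \<in> arcs (half b G)" for a
    using a arcs G(1,2) m nl by (auto simp: decorated_tangle_def hor_def)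
  have c6: "blobs a \<le> 1" if a: "a \<in> arcs (half b G)" for a
    using a arcs G(3) b by (auto simp: hor_def)
  have c7: "blob_position (half b G) a" if a: "a \<in> arcs (half b G)" and bl: "blobs a \<noteq> 0" for a
    using a
  proof (cases rule: half_cases)
    case x: (down x)
    obtain p q where pq: "lo pos x = p" "hi pos x = q" "lo id a = p" "hi id a = q" "q \<le> n"
      using down_lo_hi[OF x(1)] x(2) by simp
    have "exposed n G x" using G(1,2) x bl by (auto simp: decorated_tangle_def hor_def)
    hence ex: "\<not> encloses pos y x" if "y \<in> A" for y using that G(1) by (simp add: exposed_def)
    have n1: "\<not> encloses id c a" if c: "c \<in> arcs (half b G)" for c
      using c
    proof (cases rule: half_cases)
      case y: (down y)
      have "lo id c = lo pos y" "hi id c = hi pos y" using down_lo_hi[OF y(1)] y(2) by simp_all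
      thus ?thesis using ex[of y] y(1) pq by (simp add: encloses_def hor_def)
    next
      case i: (line i)
      have "p < q" using down_lo_hi(3)[OF x(1)] pq by simp
      thus ?thesis using lohi pq unfolding encloses_def i(2) by simp
    qed
    have n2: "\<not> lo id c < lo id a" if c: "c \<in> arcs (half b G)" "is_line c" for c
      using c(1)
    proof (cases rule: half_cases)
      case (down y)
      thus ?thesis using nl c(2) by blast
    next
      case i: (line i)
      obtain z j where z: "z \<in> A" "ends z = {(0, i), (1, j)}" using i(1) by (auto simp: top_lines_def)
      note vr = vertical_range[OF z]
      have "\<not> (i < p \<and> q < 2 * n + 1 - j)" using ex[OF z(1)] unfolding encloses_def vr pq .
      moreover have "q < 2 * n + 1 - j" using pq vr by linarith
      ultimately show ?thesis using i(2) lohi pq by simp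
    qed
    show ?thesis unfolding blob_position_def using n1 n2 by blast
  next
    case i: (line i)
    hence mn: "i = Min (top_lines A)" using bl by (simp split: if_splits)
    have "\<not> lo id c < lo id a" if c: "c \<in> arcs (half b G)" "is_line c" for c
      using c(1)
    proof (cases rule: half_cases)
      case (down y)
      thus ?thesis using nl c(2) by blast
    next
      case i': (line i')
      have "i \<le> i'" using mn Min_le[OF finite_top_lines i'(1)] by simp
      thus ?thesis using i(2) i'(2) lohi by simp
    qed
    moreover have "\<not> encloses id c a" if "c \<in> arcs (half b G)" for c
      using c4[OF a that] i(2) line by simp
    ultimately show ?thesis unfolding blob_position_def by blast
  qed
  have c8: "\<forall>(r, s)\<in>#cycles (half b G). r < m \<and> s \<le> 1"
    using G(2,4) by (auto simp: half_def decorated_tangle_def)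
  have "\<forall>a\<in>arcs (half b G). ends a \<subseteq> {1..n} \<and> card (ends a) \<in> {1, 2}" using c1 by simp
  moreover have "\<forall>i\<in>{1..n}. \<exists>!a. a \<in> arcs (half b G) \<and> i \<in> ends a" using c2 by simp
  moreover have "\<forall>a\<in>arcs (half b G). \<forall>c\<in>arcs (half b G). \<not> crosses id a c \<and> (is_line a \<longrightarrow> \<not> encloses id c a)"
    using c4 by simp
  moreover have "\<forall>a\<in>arcs (half b G). dots a < m \<and> (is_line a \<longrightarrow> dots a = 0)" using c5 by simp
  moreover have "\<forall>a\<in>arcs (half b G). blobs a \<le> 1 \<and> (\<not> blob_position (half b G) a \<longrightarrow> blobs a = 0)"
    using c6 c7 by metis
  ultimately show ?thesis unfolding decorated_dangle_def by (intro conjI c3 c8)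
qed

lemma half_parts:
  assumes G: "arcs G = A" and d: "dangle m n k (half b G)"
  shows "nonlines (half b G) = down ` hor 0 A" "lines (half b G) = sorted_list_of_set (top_lines A)"
    "j < length (lines (half b G)) \<Longrightarrow> line_blobs (half b G) j = (if j = 0 then b else 0)"
proof -
  interpret dangle m n k "half b G" by fact
  have arcs: "arcs (half b G) = down ` hor 0 A \<union> half_line b A ` top_lines A" by (simp add: half_def G(1))
  have line: "is_line (half_line b A i)" for i by (simp add: is_line_def)
  have nl: "\<not> is_line (down x)" if h: "x \<in> hor 0 A" for x
  proof -
    obtain i j where "ends (down x) = {i, j}" "i < j" using hor_down[OF h] by metis
    thus ?thesis by (simp add: is_line_def)
  qed
  show non: "nonlines (half b G) = down ` hor 0 A" unfolding nonlines_def arcs using line nl by blast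
  have lp: "line_positions = top_lines A"
  proof (intro equalityI subsetI)
    fix i assume "i \<in> line_positions"
    then obtain a where a: "a \<in> arcs (half b G)" "ends a = {i}" by (auto simp: line_positions_def)
    hence "is_line a" by (simp add: is_line_def)
    hence "a \<notin> down ` hor 0 A" using nl by blast
    then obtain i' where "i' \<in> top_lines A" "a = half_line b A i'" using a(1) unfolding arcs by blast
    thus "i \<in> top_lines A" using a(2) by simp
  next
    fix i assume "i \<in> top_lines A"
    hence "half_line b A i \<in> arcs (half b G)" "ends (half_line b A i) = {i}" using arcs by simp_all
    thus "i \<in> line_positions" unfolding line_positions_def by blast
  qed
  thus l: "lines (half b G) = sorted_list_of_set (top_lines A)" using lines_eq by simp
  assume j: "j < length (lines (half b G))"
  obtain a where a: "a \<in> arcs (half b G)" "ends a = {lines (half b G) ! j}" "line_blobs (half b G) j = blobs a" "is_line a"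
    using line_arc[OF j] .
  have "a \<notin> down ` hor 0 A" using nl a(4) by blast
  then obtain i where i: "i \<in> top_lines A" "a = half_line b A i" using a(1) unfolding arcs by blast
  hence ii: "i = lines (half b G) ! j" using a(2) by simp
  have ne: "top_lines A \<noteq> {}" using i(1) by blast
  have z: "lines (half b G) ! 0 = Min (top_lines A)"
    unfolding l sorted_list_of_set_nonempty[OF finite_top_lines ne] by simp
  have "i = Min (top_lines A) \<longleftrightarrow> j = 0"
  proof
    assume "i = Min (top_lines A)"
    hence "lines (half b G) ! j = lines (half b G) ! 0" using ii z by simp
    moreover have "0 < length (lines (half b G))" using j by linarith
    ultimately show "j = 0" using lines_inj[OF j] by blast
  qed (use ii z in simp)
  thus "line_blobs (half b G) j = (if j = 0 then b else 0)" using a(3) i(2) by simp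
qed

end

lemma top_lines_flip:
  assumes "planar_matching n A"
  shows "top_lines (flip_arc ` A) = {j. \<exists>i. \<exists>a\<in>A. ends a = {(0, i), (1, j)}}"
proof -
  interpret planar n A using assms by (simp add: planar_def)
  have "flip_vertex ` ends a = {(0, j), (1, i)} \<longleftrightarrow> ends a = {(0, i), (1, j)}" if a: "a \<in> A" for a i j
  proof
    assume h: "flip_vertex ` ends a = {(0, j), (1, i)}"
    have "flip_vertex ` flip_vertex ` ends a = ends a"
      using arg_cong[OF flip_arc_flip[OF a], of ends] by simp
    thus "ends a = {(0, i), (1, j)}" unfolding h by (simp add: flip_vertex_def insert_commute)
  next
    assume h: "ends a = {(0, i), (1, j)}"
    show "flip_vertex ` ends a = {(0, j), (1, i)}" unfolding h by (simp add: flip_vertex_def insert_commute)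
  qed
  hence "(\<exists>a\<in>A. flip_vertex ` ends a = {(0, j), (1, i)}) \<longleftrightarrow> (\<exists>a\<in>A. ends a = {(0, i), (1, j)})" for i j
    by (intro bex_cong refl)
  thus ?thesis by (simp add: top_lines_def)
qed

text \<open>
  Without crossings the vertical arcs join the lines of both halves in order. Vertical arcs other
  than the leftmost one are not exposed, so a blob number \<open>\<beta>\<close> for the leftmost
  one is enough, and it may be distributed over both halves in any way of the same parity.
\<close>

lemma glue_halves:
  assumes G: "decorated_tangle m n G" "\<And>a. a \<in> arcs G \<Longrightarrow> blobs a \<le> 1"
    "\<forall>(r, s)\<in>#cycles G. s \<le> 1" and m: "m \<ge> 1"
  defines "L \<equiv> sorted_list_of_set (top_lines (arcs G))"
  obtains e :: "nat \<Rightarrow>\<^sub>0 nat" and \<beta> :: nat where "keys e \<subseteq> {..<length L}" "\<beta> \<le> 1"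
    "\<forall>b b'. b \<le> 1 \<longrightarrow> b' \<le> 1 \<longrightarrow> (b + b') mod 2 = \<beta> \<longrightarrow>
      glue m (half b G) (half b' (flip G)) e = G"
    "\<forall>j < length L. \<exists>a\<in>arcs G. ends a = {(0, L ! j), (1, sorted_list_of_set (top_lines (arcs (flip G))) ! j)}
       \<and> dots a = lookup e j \<and> blobs a = (if j = 0 then \<beta> else 0)"
    "length (sorted_list_of_set (top_lines (arcs (flip G)))) = length L"
proof -
  have p: "planar_matching n (arcs G)" using decorated_planar[OF G(1)] .
  interpret planar n "arcs G" using p by (simp add: planar_def)
  have pf: "planar_matching n (arcs (flip G))" using planar_flip by simp
  interpret F: planar n "arcs (flip G)" using pf by (simp add: planar_def)
  let ?S = "top_lines (arcs G)"
  define L' where "L' = sorted_list_of_set (top_lines (arcs (flip G)))"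
  define va where "va i = (SOME a. a \<in> arcs G \<and> (\<exists>j. ends a = {(0, i), (1, j)}))" for i
  define f where "f i = (SOME j. ends (va i) = {(0, i), (1, j)})" for i
  have va: "va i \<in> arcs G \<and> ends (va i) = {(0, i), (1, f i)}" if "i \<in> ?S" for i
  proof -
    have "\<exists>a. a \<in> arcs G \<and> (\<exists>j. ends a = {(0, i), (1, j)})" using that by (auto simp: top_lines_def)
    hence s: "va i \<in> arcs G \<and> (\<exists>j. ends (va i) = {(0, i), (1, j)})" unfolding va_def by (rule someI_ex)
    have "ends (va i) = {(0, i), (1, f i)}" unfolding f_def
      by (rule someI_ex[of "\<lambda>j. ends (va i) = {(0, i), (1, j)}"]) (rule conjunct2[OF s])
    thus ?thesis using s by simp
  qed
  have va_eq: "a = va i \<and> j = f i" if "a \<in> arcs G" "ends a = {(0, i), (1, j)}" for a i j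
  proof -
    have i: "i \<in> ?S" using that by (auto simp: top_lines_def)
    have "a = va i" using arc_unique[of a "va i" "(0, i)"] that va[OF i] by simp
    thus ?thesis using that(2) va[OF i] by (auto simp: doubleton_eq_iff)
  qed
  have mono: "f i < f i'" if h: "i \<in> ?S" "i' \<in> ?S" "i < i'" for i i'
  proof -
    note v = va[OF h(1)] va[OF h(2)]
    note r = vertical_range[OF conjunct1[OF v(1)] conjunct2[OF v(1)]] vertical_range[OF conjunct1[OF v(2)] conjunct2[OF v(2)]]
    have "\<not> crosses pos (va i) (va i')" using not_crosses v by blast
    hence "f i \<le> f i'" using h(3) r unfolding crosses_def by linarith
    moreover have "f i \<noteq> f i'"
    proof
      assume "f i = f i'"
      hence "va i = va i'" using arc_unique[of "va i" "va i'" "(1, f i)"] v by simp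
      thus False using v h(3) by (auto simp: doubleton_eq_iff)
    qed
    ultimately show ?thesis by simp
  qed
  have img: "top_lines (arcs (flip G)) = f ` ?S"
  proof -
    have "top_lines (arcs (flip G)) = {j. \<exists>i. \<exists>a\<in>arcs G. ends a = {(0, i), (1, j)}}"
      using top_lines_flip[OF p] by simp
    also have "\<dots> = f ` ?S"
    proof (intro equalityI subsetI)
      fix j assume "j \<in> {j. \<exists>i. \<exists>a\<in>arcs G. ends a = {(0, i), (1, j)}}"
      then obtain i a where a: "a \<in> arcs G" "ends a = {(0, i), (1, j)}" by blast
      hence "i \<in> ?S" "j = f i" using va_eq by (auto simp: top_lines_def)
      thus "j \<in> f ` ?S" by blast
    next
      fix j assume "j \<in> f ` ?S"
      thus "j \<in> {j. \<exists>i. \<exists>a\<in>arcs G. ends a = {(0, i), (1, j)}}" using va by blast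
    qed
    finally show ?thesis .
  qed
  have L': "L' = map f L" unfolding L'_def L_def img
    by (rule sorted_list_of_set_image_mono[OF finite_top_lines mono])
  have LS: "L ! j \<in> ?S" if "j < length L" for j
    using nth_mem[OF that] finite_top_lines by (simp add: L_def)
  obtain e :: "nat \<Rightarrow>\<^sub>0 nat" where e: "\<And>j. j < length L \<Longrightarrow> lookup e j = dots (va (L ! j))"
    "keys e \<subseteq> {..<length L}" using finite_pm[of "length L" "\<lambda>j. dots (va (L ! j))"] by blast
  define \<beta> where "\<beta> = (if L = [] then 0 else blobs (va (L ! 0)))"
  have \<beta>1: "\<beta> \<le> 1" using G(2) va LS[of 0] by (simp add: \<beta>_def)
  have sorted: "L ! 0 < L ! j" if "0 < j" "j < length L" for j
    using that by (simp add: L_def sorted_wrt_nth_less)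
  have bl: "blobs (va (L ! j)) = (if j = 0 then \<beta> else 0)" if j: "j < length L" for j
  proof (cases "j = 0")
    case True
    thus ?thesis using j by (auto simp: \<beta>_def)
  next
    case False
    hence lt: "L ! 0 < L ! j" "0 < length L" using sorted j by (simp, linarith)
    note v = va[OF LS[OF lt(2)]] va[OF LS[OF j]]
    note r = vertical_range[OF conjunct1[OF v(1)] conjunct2[OF v(1)]] vertical_range[OF conjunct1[OF v(2)] conjunct2[OF v(2)]]
    have "f (L ! 0) < f (L ! j)" using mono[OF LS[OF lt(2)] LS[OF j] lt(1)] .
    hence "encloses pos (va (L ! 0)) (va (L ! j))" using lt r unfolding encloses_def by linarith
    hence "\<not> exposed n G (va (L ! j))" using v by (auto simp: exposed_def)
    thus ?thesis using G(1) v False by (simp add: decorated_tangle_def)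
  qed
  have dm: "dots a < m" if "a \<in> arcs G" for a using G(1) that by (simp add: decorated_tangle_def)
  have chk: "hor 0 (arcs (flip G)) = flip_arc ` hor 1 (arcs G)" using hor_flip(2)[OF p] by simp
  have g1: "glue m (half b G) (half b' (flip G)) e = G" if b: "b \<le> 1" "b' \<le> 1" "(b + b') mod 2 = \<beta>" for b b'
  proof -
    have d1: "decorated_dangle m n (card (hor 0 (arcs G))) (half b G)"
      by (rule half_dangle[OF refl G(1,2,3) b(1) m])
    have d2: "decorated_dangle m n (card (hor 0 (arcs (flip G)))) (half b' (flip G))"
      by (rule F.half_dangle[OF refl decorated_flip[OF G(1)] _ _ b(2) m]) (use G(2,3) in auto)
    have ceq: "card (hor 0 (arcs (flip G))) = card (hor 0 (arcs G))"
      unfolding chk using card_image[OF inj_on_subset[OF flip_arc_inj]] card_hor by (simp add: hor_def)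
    interpret dangle_pair m n "card (hor 0 (arcs G))" "half b G" "half b' (flip G)"
      using d1 d2 ceq by (simp add: dangle_pair_def dangle_def)
    note h1 = half_parts[OF refl v1.dangle_axioms] and h2 = F.half_parts[OF refl v2.dangle_axioms]
    have l1: "lines (half b G) = L" using h1(2) by (simp add: L_def)
    have l2: "lines (half b' (flip G)) = L'" using h2(2) by (simp add: L'_def)
    have t: "up 0 ` nonlines (half b G) = hor 0 (arcs G)"
    proof -
      have "up 0 ` down ` hor 0 (arcs G) = (\<lambda>a. a) ` hor 0 (arcs G)"
        unfolding image_image by (rule image_cong[OF refl]) (rule up_down)
      thus ?thesis using h1(1) by simp
    qed
    have u: "up 1 ` nonlines (half b' (flip G)) = hor 1 (arcs G)"
    proof -
      have "up 1 ` down ` flip_arc ` hor 1 (arcs G) = (\<lambda>a. a) ` hor 1 (arcs G)"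
        unfolding image_image by (rule image_cong[OF refl]) (rule up_down_flip)
      thus ?thesis using h2(1) chk by simp
    qed
    have v: "vertical_arc m (half b G) (half b' (flip G)) e j = va (L ! j)" if j: "j < length L" for j
    proof -
      have j': "j < length L'" using j L' by simp
      have vv: "va (L ! j) \<in> arcs G" "ends (va (L ! j)) = {(0, L ! j), (1, L' ! j)}"
        using va[OF LS[OF j]] L' j by simp_all
      have "(line_blobs (half b G) j + line_blobs (half b' (flip G)) j) mod 2 = blobs (va (L ! j))"
        using h1(3)[of j] h2(3)[of j] j j' l1 l2 bl[OF j] b(3) by simp
      thus ?thesis unfolding vertical_arc_def l1 l2
        using vv e(1)[OF j] dm[OF vv(1)] by (cases "va (L ! j)") simp
    qed
    have w: "vertical_arc m (half b G) (half b' (flip G)) e ` {..<length L} = arcs G - hor 0 (arcs G) - hor 1 (arcs G)"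
    proof (intro equalityI subsetI)
      fix a assume "a \<in> vertical_arc m (half b G) (half b' (flip G)) e ` {..<length L}"
      then obtain j where j: "j < length L" "a = va (L ! j)" using v by auto
      thus "a \<in> arcs G - hor 0 (arcs G) - hor 1 (arcs G)" using va[OF LS[OF j(1)]] by (simp add: hor_def)
    next
      fix a assume "a \<in> arcs G - hor 0 (arcs G) - hor 1 (arcs G)"
      hence a: "a \<in> arcs G" "a \<notin> hor 0 (arcs G)" "a \<notin> hor 1 (arcs G)" by simp_all
      obtain i j where ij: "ends a = {(0, i), (1, j)}" using vertical_ends[OF a] .
      have i: "i \<in> ?S" using a(1) ij by (auto simp: top_lines_def)
      hence "i \<in> set L" using finite_top_lines by (simp add: L_def)
      then obtain t where t: "t < length L" "L ! t = i" by (auto simp: in_set_conv_nth)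
      have "a = va (L ! t)" using va_eq[OF a(1) ij] t(2) by simp
      hence "a = vertical_arc m (half b G) (half b' (flip G)) e t" using v[OF t(1)] by simp
      thus "a \<in> vertical_arc m (half b G) (half b' (flip G)) e ` {..<length L}" using t(1) by blast
    qed
    have "arcs (glue m (half b G) (half b' (flip G)) e) = arcs G"
      unfolding glue_arcs l1 t u w by (auto simp: hor_def)
    moreover have "cycles (glue m (half b G) (half b' (flip G)) e) = cycles G" by (simp add: glue_def half_def)
    ultimately show ?thesis by (cases G; cases "glue m (half b G) (half b' (flip G)) e") simp
  qed
  have g2: "\<forall>j < length L. \<exists>a\<in>arcs G. ends a = {(0, L ! j), (1, L' ! j)} \<and> dots a = lookup e j
      \<and> blobs a = (if j = 0 then \<beta> else 0)"
  proof (intro allI impI)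
    fix j assume j: "j < length L"
    show "\<exists>a\<in>arcs G. ends a = {(0, L ! j), (1, L' ! j)} \<and> dots a = lookup e j
      \<and> blobs a = (if j = 0 then \<beta> else 0)"
      using va[OF LS[OF j]] L' j e(1)[OF j] bl[OF j] by (intro bexI[of _ "va (L ! j)"]) simp_all
  qed
  have g3: "length L' = length L" using L' by simp
  have g1': "\<forall>b b'. b \<le> 1 \<longrightarrow> b' \<le> 1 \<longrightarrow> (b + b') mod 2 = \<beta> \<longrightarrow> glue m (half b G) (half b' (flip G)) e = G"
    using g1 by simp
  show ?thesis by (rule that[OF e(2) \<beta>1 g1' g2[unfolded L'_def] g3[unfolded L'_def]])
qed

section \<open>The action on the upper half\<close>

context layered
begin

lemma strand_pair_rows:
  assumes L: "L = 2" and pq: "(0, a) \<in> P" "(1, b) \<in> P"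
    and row: "{v \<in> points (0, a). fst v = 1} = {v \<in> points (1, b). fst v = 1}" "{v \<in> points (0, a). fst v = 1} \<noteq> {}"
  shows "{(0, a), (1, b)} \<in> strands P"
proof -
  obtain v where v: "v \<in> points (0, a)" "v \<in> points (1, b)" using row by blast
  show ?thesis
  proof (rule strand_pairI[OF pq v])
    fix r w assume r: "r \<in> P" "w \<in> points r" "w \<in> points (0, a) \<or> w \<in> points (1, b)"
    note ra = points_rows[OF pq(1), of w] and rb = points_rows[OF pq(2), of w] and rr = points_rows[OF r(1,2)]
    have "fst r < 2" using r(1) L piece_iff by blast
    then consider "fst r = 0" | "fst r = 1" by linarith
    thus "r = (0, a) \<or> r = (1, b)"
    proof cases
      case 1
      have "w \<in> points (0, a)"
      proof (cases "w \<in> points (0, a)")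
        case False
        hence "w \<in> points (1, b)" using r(3) by simp
        hence "fst w = 1" using rb rr 1 by auto
        thus ?thesis using row(1) \<open>w \<in> points (1, b)\<close> by blast
      qed
      thus ?thesis using piece_unique[OF r(1) pq(1) _ r(2)] 1 by simp
    next
      case 2
      have "w \<in> points (1, b)"
      proof (cases "w \<in> points (1, b)")
        case False
        hence "w \<in> points (0, a)" using r(3) by simp
        hence "fst w = 1" using ra rr 2 by auto
        thus ?thesis using row(1) \<open>w \<in> points (0, a)\<close> by blast
      qed
      thus ?thesis using piece_unique[OF r(1) pq(2) _ r(2)] 2 by simp
    qed
  qed
qed

end

lemma up_row: "a \<in> up r ` N \<Longrightarrow> v \<in> ends a \<Longrightarrow> fst v = r"
  by (elim imageE) (simp add: up_def, elim imageE, simp)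

lemma dots_up: "a \<in> up r ` N \<Longrightarrow> (\<And>c. c \<in> N \<Longrightarrow> dots c < m) \<Longrightarrow> dots a < m"
  by (elim imageE) (simp add: up_def)

text \<open>
  If the lower half of \<open>G1\<close> mirrors the upper half of \<open>G2\<close> and this
  common part is plain, then horizontal arcs of the common part close up to \<open>k\<close> plain
  cycles and vertical arcs are joined one to one.
\<close>

lemma compose_through:
  assumes w: "dangle m n k w" and plain: "\<And>c. c \<in> nonlines w \<Longrightarrow> dots c = 0 \<and> blobs c = 0"
    and p: "planar_matching n (arcs G1)" "planar_matching n (arcs G2)" and m: "m \<ge> 1"
    and G1: "arcs G1 = T \<union> up 1 ` nonlines w \<union> (\<lambda>j. Arc {(0, l1 j), (1, lines w ! j)} (d1 j) (\<beta>1 j)) ` {..<length (lines w)}"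
    and T: "\<And>a v. a \<in> T \<Longrightarrow> v \<in> ends a \<Longrightarrow> fst v = 0" "\<And>a. a \<in> T \<Longrightarrow> dots a < m"
    and G2: "arcs G2 = up 0 ` nonlines w \<union> B \<union> (\<lambda>j. Arc {(0, lines w ! j), (1, l2 j)} (d2 j) (\<beta>2 j)) ` {..<length (lines w)}"
    and B: "\<And>a v. a \<in> B \<Longrightarrow> v \<in> ends a \<Longrightarrow> fst v = 1" "\<And>a. a \<in> B \<Longrightarrow> dots a < m"
  shows "compose m G1 G2 = Diagram
    (T \<union> B \<union> (\<lambda>j. Arc {(0, l1 j), (1, l2 j)} ((d1 j + d2 j) mod m) (\<beta>1 j + \<beta>2 j)) ` {..<length (lines w)})
    (cycles G1 + cycles G2 + replicate_mset k (0, 0))"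
proof -
  interpret w: dangle m n k w by fact
  interpret layered n 2 "two_layers G1 G2" by standard (use p in simp)
  let ?r = "length (lines w)"
  define V1 where "V1 j = Arc {(0::nat, l1 j), (1, lines w ! j)} (d1 j) (\<beta>1 j)" for j
  define V2 where "V2 j = Arc {(0::nat, lines w ! j), (1, l2 j)} (d2 j) (\<beta>2 j)" for j
  define XV where "XV j = {(0::nat, V1 j), (1, V2 j)}" for j
  define XC where "XC c = {(0::nat, up 1 c), (1, up 0 c)}" for c
  have A1: "arcs G1 = T \<union> up 1 ` nonlines w \<union> V1 ` {..<?r}" using G1 by (simp add: V1_def[abs_def])
  have A2: "arcs G2 = up 0 ` nonlines w \<union> B \<union> V2 ` {..<?r}" using G2 by (simp add: V2_def[abs_def])
  have P0: "(0, a) \<in> P \<longleftrightarrow> a \<in> arcs G1" and P1: "(1, a) \<in> P \<longleftrightarrow> a \<in> arcs G2" for a by (simp_all add: piece_iff)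
  have TS: "{(0, a)} \<in> strands P" "boundary 2 {(0, a)} \<noteq> {}" "strand_arc m 2 {(0, a)} = a" if "a \<in> T" for a
    using single_strand[OF refl _ T(1)[OF that] T(2)[OF that]] that P0 A1 by simp_all
  have BS: "{(1, a)} \<in> strands P" "boundary 2 {(1, a)} \<noteq> {}" "strand_arc m 2 {(1, a)} = a" if "a \<in> B" for a
    using single_strand[OF refl _ B(1)[OF that] B(2)[OF that]] that P1 A2 by simp_all
  have pC: "points (0, up 1 c) = Pair 1 ` ends c" "points (1, up 0 c) = Pair 1 ` ends c" for c
    by (simp_all add: points_shift shift_def image_image)
  have CP: "(0, up 1 c) \<in> P" "(1, up 0 c) \<in> P" if "c \<in> nonlines w" for c using that P0 P1 A1 A2 by simp_all
  have CS: "XC c \<in> strands P" "boundary 2 (XC c) = {}" "strand_weight (XC c) = 0" "strand_blobs (XC c) = 0"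
    if c: "c \<in> nonlines w" for c
  proof -
    have "ends c \<noteq> {}" using w.ends_card[of c] c by (auto simp: nonlines_def)
    thus "XC c \<in> strands P" unfolding XC_def
      by (intro strand_pair_rows[OF refl CP[OF c]]; unfold pC) auto
    show "boundary 2 (XC c) = {}" unfolding boundary_def XC_def pts_def image_insert image_empty Union_insert pC by auto
    show "strand_weight (XC c) = 0" "strand_blobs (XC c) = 0"
      using plain[OF c] by (simp_all add: strand_weight_def strand_blobs_def XC_def)
  qed
  have pV: "points (0, V1 j) = {(0, l1 j), (1, lines w ! j)}" "points (1, V2 j) = {(1, lines w ! j), (2, l2 j)}" for j
    by (simp_all add: points_shift shift_def V1_def V2_def numeral_2_eq_2)
  have VP: "(0, V1 j) \<in> P" "(1, V2 j) \<in> P" if "j < ?r" for j using that P0 P1 A1 A2 by simp_all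
  have VS: "XV j \<in> strands P" "boundary 2 (XV j) \<noteq> {}"
    "strand_arc m 2 (XV j) = Arc {(0, l1 j), (1, l2 j)} ((d1 j + d2 j) mod m) (\<beta>1 j + \<beta>2 j)"
    if j: "j < ?r" for j
  proof -
    show "XV j \<in> strands P" unfolding XV_def
      by (rule strand_pair_rows[OF refl VP[OF j]]; unfold pV) auto
    have pts: "pts (XV j) = {(0, l1 j), (1, lines w ! j), (2, l2 j)}"
      unfolding pts_def XV_def image_insert image_empty Union_insert pV by auto
    have bd: "boundary 2 (XV j) = {(0, l1 j), (2, l2 j)}" by (auto simp: boundary_def pts)
    thus "boundary 2 (XV j) \<noteq> {}" by simp
    have one: "dir (pts (XV j)) u = 1" if "u \<in> pts (XV j)" for u
      by (rule dir_leftmost) (use that in \<open>auto simp: pts\<close>)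
    have base: "base_point (points q) \<in> pts (XV j)" if "q \<in> XV j" "q \<in> P" for q
      using base_point_in[OF finite_points[OF that(2)] points_ne[OF that(2)]] that(1) by (auto simp: pts_def)
    have "strand_weight (XV j) = int (dots (V1 j)) + int (dots (V2 j))"
      using one[OF base[of "(0, V1 j)"]] one[OF base[of "(1, V2 j)"]] VP[OF j]
      by (simp add: strand_weight_def XV_def)
    hence "nat (strand_weight (XV j) mod int m) = (d1 j + d2 j) mod m"
      by (simp add: V1_def V2_def nat_mod_distrib flip: of_nat_add zmod_int)
    moreover have "strand_blobs (XV j) = \<beta>1 j + \<beta>2 j" by (simp add: strand_blobs_def XV_def V1_def V2_def)
    ultimately show "strand_arc m 2 (XV j) = Arc {(0, l1 j), (1, l2 j)} ((d1 j + d2 j) mod m) (\<beta>1 j + \<beta>2 j)"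
      unfolding strand_arc_def bd by (simp add: outer_def)
  qed
  define OP where "OP = (\<lambda>a. {(0::nat, a)}) ` T \<union> (\<lambda>a. {(1::nat, a)}) ` B \<union> XV ` {..<?r}"
  have S: "strands P = OP \<union> XC ` nonlines w"
  proof (rule strands_eqI)
    show "OP \<union> XC ` nonlines w \<subseteq> strands P" using TS(1) BS(1) CS(1) VS(1) by (auto simp: OP_def)
    show "P \<subseteq> \<Union> (OP \<union> XC ` nonlines w)"
    proof
      fix p assume p: "p \<in> P"
      show "p \<in> \<Union> (OP \<union> XC ` nonlines w)"
      proof (cases "fst p = 0")
        case True
        then obtain a where a: "p = (0, a)" by (cases p) simp
        hence "a \<in> T \<or> a \<in> up 1 ` nonlines w \<or> a \<in> V1 ` {..<?r}" using p P0 A1 by blast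
        thus ?thesis using a by (auto simp: OP_def XC_def XV_def)
      next
        case False
        hence "fst p = 1" using p by (simp add: piece_iff less_2_cases_iff)
        then obtain a where a: "p = (1, a)" by (cases p) simp
        hence "a \<in> B \<or> a \<in> up 0 ` nonlines w \<or> a \<in> V2 ` {..<?r}" using p P1 A2 by blast
        thus ?thesis using a by (auto simp: OP_def XC_def XV_def)
      qed
    qed
  qed
  have ob: "boundary 2 X \<noteq> {}" if "X \<in> OP" for X using that TS(2) BS(2) VS(2) by (auto simp: OP_def)
  have o: "{X \<in> strands P. boundary 2 X \<noteq> {}} = OP" and c: "{X \<in> strands P. boundary 2 X = {}} = XC ` nonlines w"
    unfolding S using ob CS(2) by blast+
  have arcs: "strand_arc m 2 ` OP = T \<union> B \<union> (\<lambda>j. Arc {(0, l1 j), (1, l2 j)} ((d1 j + d2 j) mod m) (\<beta>1 j + \<beta>2 j)) ` {..<?r}"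
    unfolding OP_def image_Un image_image using TS(3) BS(3) VS(3) by simp
  have inj: "inj_on XC (nonlines w)"
  proof (rule inj_onI)
    fix c c' assume "XC c = XC c'"
    hence "(0, up 1 c) \<in> XC c'" by (simp add: XC_def set_eq_iff) (metis insertI1)
    hence "up 1 c = up 1 c'" by (simp add: XC_def)
    thus "c = c'" using injD[OF up_inj] by blast
  qed
  have "image_mset (strand_cycle m) (mset_set (XC ` nonlines w)) =
    image_mset (\<lambda>c. (0, 0)) (mset_set (nonlines w))"
    unfolding image_mset_mset_set[OF inj, symmetric] multiset.map_comp
    by (rule image_mset_cong) (use w.finite_nonlines CS in simp)
  also have "\<dots> = replicate_mset k (0, 0)" using w.card_nonlines by (simp add: image_mset_const_eq)
  finally show ?thesis
    unfolding compose_two_layers[OF p m] compose_layers_def o c arcs by simp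
qed

text \<open>
  The plain part of a dangle. The blob of the leftmost line is kept because the even number of
  blobs in \<open>glue m v (skeleton v) 0\<close> then cancels on that arc.
\<close>

definition skeleton :: "dangle \<Rightarrow> dangle" where
  "skeleton v = Diagram ((\<lambda>a. Arc (ends a) 0 (if is_line a then blobs a else 0)) ` arcs v) {#}"

lemma skeleton_dangle:
  assumes v: "dangle m n k v" and m: "m \<ge> 1"
  shows "dangle m n k (skeleton v)" "lines (skeleton v) = lines v"
    "j < length (lines v) \<Longrightarrow> line_blobs (skeleton v) j = line_blobs v j"
    "c \<in> nonlines (skeleton v) \<Longrightarrow> dots c = 0 \<and> blobs c = 0"
proof -
  interpret dangle m n k v by fact
  let ?f = "\<lambda>a :: nat arc. Arc (ends a) 0 (if is_line a then blobs a else 0)"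
  have line: "is_line (?f a) = is_line a" for a by (simp add: is_line_def)
  have lohi: "lo id (?f a) = lo id a" "hi id (?f a) = hi id a" for a by (simp_all add: lo_def hi_def)
  have arcs: "arcs (skeleton v) = ?f ` arcs v" by (simp add: skeleton_def)
  have bp: "blob_position (skeleton v) (?f a) = blob_position v a" for a
    by (simp add: blob_position_def arcs encloses_def lohi line)
  have inj: "inj_on ?f (arcs v)"
    by (rule inj_onI) (use inj_onD[OF inj_ends] in simp)
  have e1: "\<forall>a\<in>arcs (skeleton v). ends a \<subseteq> {1..n} \<and> card (ends a) \<in> {1, 2}"
    using ends_sub ends_card arcs by simp
  have e2: "\<forall>i\<in>{1..n}. \<exists>!a. a \<in> arcs (skeleton v) \<and> i \<in> ends a"
  proof
    fix i assume "i \<in> {1..n}"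
    then obtain a where a: "a \<in> arcs v" "i \<in> ends a" using arc_exists by blast
    show "\<exists>!a. a \<in> arcs (skeleton v) \<and> i \<in> ends a"
    proof (rule ex1I[of _ "?f a"])
      show "?f a \<in> arcs (skeleton v) \<and> i \<in> ends (?f a)" using a arcs by simp
      fix b assume b: "b \<in> arcs (skeleton v) \<and> i \<in> ends b"
      then obtain c where c: "c \<in> arcs v" "b = ?f c" using arcs by blast
      hence "c = a" using arc_unique[OF c(1) a(1), of i] a b by simp
      thus "b = ?f a" using c by simp
    qed
  qed
  have nl: "nonlines (skeleton v) = ?f ` nonlines v"
    unfolding nonlines_def arcs by (rule filter_image) (simp add: line)
  have "card (nonlines (skeleton v)) = k"
    unfolding nl using card_image[OF inj_on_subset[OF inj], of "nonlines v"] card_nonlines by (simp add: nonlines_def)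
  hence e3: "card {a \<in> arcs (skeleton v). \<not> is_line a} = k" by (simp add: nonlines_def)
  have e4: "\<forall>a\<in>arcs (skeleton v). \<forall>b\<in>arcs (skeleton v). \<not> crosses id a b \<and> (is_line a \<longrightarrow> \<not> encloses id b a)"
  proof (intro ballI)
    fix a b assume a: "a \<in> arcs (skeleton v)" and b: "b \<in> arcs (skeleton v)"
    obtain a' where a': "a = ?f a'" "a' \<in> arcs v" by (rule imageE[OF a[unfolded arcs]])
    obtain b' where b': "b = ?f b'" "b' \<in> arcs v" by (rule imageE[OF b[unfolded arcs]])
    note ab = a'(2,1) b'(2,1)
    have "lo id a = lo id a'" "hi id a = hi id a'" "lo id b = lo id b'" "hi id b = hi id b'" "is_line a = is_line a'"
      unfolding ab(2,4) by (rule lohi line)+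
    thus "\<not> crosses id a b \<and> (is_line a \<longrightarrow> \<not> encloses id b a)"
      using not_crosses[OF ab(1,3)] line_not_enclosed[OF ab(1,3)] by (simp add: crosses_def encloses_def)
  qed
  have e5: "\<forall>a\<in>arcs (skeleton v). dots a < m \<and> (is_line a \<longrightarrow> dots a = 0)" using m arcs by auto
  have e6: "\<forall>a\<in>arcs (skeleton v). blobs a \<le> 1 \<and> (\<not> blob_position (skeleton v) a \<longrightarrow> blobs a = 0)"
    using blobs_le blobs_position by (simp add: arcs bp)
  have e7: "\<forall>(r, s)\<in>#cycles (skeleton v). r < m \<and> s \<le> 1" by (simp add: skeleton_def)
  show d: "dangle m n k (skeleton v)"
    unfolding dangle_def decorated_dangle_def by (intro conjI e1 e2 e3 e4 e5 e6 e7)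
  interpret w: dangle m n k "skeleton v" by fact
  have "w.line_positions = line_positions" by (simp add: w.line_positions_def line_positions_def arcs)
  thus l: "lines (skeleton v) = lines v" by (simp add: w.lines_eq lines_eq)
  show "line_blobs (skeleton v) j = line_blobs v j" if j: "j < length (lines v)"
  proof -
    obtain a where a: "a \<in> arcs v" "ends a = {lines v ! j}" "line_blobs v j = blobs a" "is_line a" using line_arc[OF j] .
    obtain b where b: "b \<in> arcs (skeleton v)" "ends b = {lines v ! j}" "line_blobs (skeleton v) j = blobs b"
      using w.line_arc[of j] j l by metis
    obtain c where c: "c \<in> arcs v" "b = ?f c" using b(1) arcs by blast
    hence "c = a" using inj_onD[OF inj_ends, of c a] a b(2) by simp
    thus ?thesis using a b(3) c by simp
  qed
  show "dots c = 0 \<and> blobs c = 0" if c: "c \<in> nonlines (skeleton v)"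
  proof -
    obtain a where a: "c = ?f a" "a \<in> nonlines v" by (rule imageE[OF c[unfolded nl]])
    have "\<not> is_line a" using a(2) by (simp add: nonlines_def)
    thus ?thesis unfolding a(1) by simp
  qed
qed

lemma compose_add_cycles:
  "compose m G (Diagram A (Z + R)) = Diagram (arcs (compose m G (Diagram A Z))) (cycles (compose m G (Diagram A Z)) + R)"
  by (simp add: compose_def stack_def)

context parameters
begin

lemma cycles_dangle: "dangle m n k v \<Longrightarrow> \<forall>(r, s)\<in>#cycles v. r < m"
  unfolding dangle_def decorated_dangle_def by fast

text \<open>
  Gluing factors through the skeleton, up to \<open>k\<close> plain cycles. By associativity the
  action of a tangle on \<open>glue m v1 v2 e\<close> is thus determined by its action on
  \<open>glue m v1 (skeleton v1) 0\<close>, which involves neither \<open>v2\<close> nor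
  \<open>e\<close>.
\<close>

lemma glue_skeleton:
  assumes v1: "dangle m n k v1" and v2: "dangle m n k v2"
  shows "compose m (glue m v1 (skeleton v1) 0) (glue m (skeleton v1) v2 e) =
    Diagram (arcs (glue m v1 v2 e)) (cycles (glue m v1 v2 e) + replicate_mset k (0, 0))"
proof -
  note sk = skeleton_dangle[OF v1 m]
  interpret p1: dangle_pair m n k v1 "skeleton v1" using v1 sk(1) by (simp add: dangle_pair_def)
  interpret p2: dangle_pair m n k "skeleton v1" v2 using v2 sk(1) by (simp add: dangle_pair_def)
  interpret p: dangle_pair m n k v1 v2 using v1 v2 by (simp add: dangle_pair_def)
  let ?r = "length (lines (skeleton v1))"
  have c: "compose m (glue m v1 (skeleton v1) 0) (glue m (skeleton v1) v2 e) = Diagram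
    (up 0 ` nonlines v1 \<union> up 1 ` nonlines v2 \<union>
      (\<lambda>j. Arc {(0, lines v1 ! j), (1, lines v2 ! j)} ((0 + lookup e j mod m) mod m)
        (0 + (line_blobs v1 j + line_blobs v2 j) mod 2)) ` {..<?r})
    (cycles (glue m v1 (skeleton v1) 0) + cycles (glue m (skeleton v1) v2 e) + replicate_mset k (0, 0))"
  proof (rule compose_through[OF sk(1) sk(4), OF _ p1.glue_planar p2.glue_planar m])
    show "arcs (glue m v1 (skeleton v1) 0) = up 0 ` nonlines v1 \<union> up 1 ` nonlines (skeleton v1) \<union>
      (\<lambda>j. Arc {(0, lines v1 ! j), (1, lines (skeleton v1) ! j)} 0 0) ` {..<?r}"
      unfolding p1.glue_arcs p1.length_eq vertical_arc_def[abs_def] using sk(2,3) m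
      by (intro arg_cong2[where f = "(\<union>)"] refl image_cong) simp_all
    show "arcs (glue m (skeleton v1) v2 e) = up 0 ` nonlines (skeleton v1) \<union> up 1 ` nonlines v2 \<union>
      (\<lambda>j. Arc {(0, lines (skeleton v1) ! j), (1, lines v2 ! j)} (lookup e j mod m)
        ((line_blobs v1 j + line_blobs v2 j) mod 2)) ` {..<?r}"
      unfolding p2.glue_arcs vertical_arc_def[abs_def] using sk(2,3)
      by (intro arg_cong2[where f = "(\<union>)"] refl image_cong) simp_all
  next
    show "fst v = 0" if "a \<in> up 0 ` nonlines v1" "v \<in> ends a" for a v using up_row[OF that] .
    show "fst v = 1" if "a \<in> up 1 ` nonlines v2" "v \<in> ends a" for a v using up_row[OF that] .
    show "dots a < m" if "a \<in> up 0 ` nonlines v1" for a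
      by (rule dots_up[OF that]) (rule p1.v1.dots_less, simp add: nonlines_def)
    show "dots a < m" if "a \<in> up 1 ` nonlines v2" for a
      by (rule dots_up[OF that]) (rule p2.v2.dots_less, simp add: nonlines_def)
  qed
  have arcs: "arcs (glue m v1 v2 e) = up 0 ` nonlines v1 \<union> up 1 ` nonlines v2 \<union>
      (\<lambda>j. Arc {(0, lines v1 ! j), (1, lines v2 ! j)} ((0 + lookup e j mod m) mod m)
        (0 + (line_blobs v1 j + line_blobs v2 j) mod 2)) ` {..<?r}"
    unfolding p.glue_arcs vertical_arc_def[abs_def] using sk(2) by simp
  show ?thesis unfolding c arcs by (simp add: glue_def skeleton_def)
qed

text \<open>
  Let \<open>X\<close> be the composition of \<open>G\<close> with \<open>glue m v1 (skeleton v1)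
  0\<close>. Its bottom horizontal arcs include those of the skeleton. If there are more, every
  product has more than \<open>k\<close> horizontal arcs on top. If not, \<open>X\<close> is glued
  from its upper half and the skeleton, and \<open>compose_through\<close> yields the product. The
  condition on blobs excludes the case where a cycle formed by \<open>G\<close> and
  \<open>v1\<close> absorbs blobs of \<open>v2\<close>.
\<close>

lemma tangle_action:
  assumes G: "decorated_tangle m n G" and v1: "dangle m n k v1"
  shows "(\<forall>v2 e. dangle m n k v2 \<longrightarrow> k < card (hor 0 (arcs (compose m G (glue m v1 v2 e))))) \<or>
    (\<exists>v1' d Z. dangle m n k v1' \<and> (\<forall>v2 e. dangle m n k v2 \<longrightarrow>
      cycles (compose m G (glue m v1 v2 e)) = Z \<and>
      (odd_cycles Z = 0 \<or> (\<forall>a\<in>arcs v2. blobs a = 0) \<longrightarrow>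
        reduced (compose m G (glue m v1 v2 e)) = glue m v1' v2 (d + e))))"
proof -
  note sk = skeleton_dangle[OF v1 m]
  let ?w = "skeleton v1"
  interpret w: dangle m n k ?w by (rule sk(1))
  interpret p1: dangle_pair m n k v1 ?w using v1 sk(1) by (simp add: dangle_pair_def)
  define X where "X = compose m G (glue m v1 ?w 0)"
  have dG1: "decorated_tangle m n (glue m v1 ?w 0)" using p1.glue_decorated[OF m cycles_dangle[OF v1]] .
  have dX: "decorated_tangle m n X" unfolding X_def using decorated_compose[OF G dG1 m] .
  have pX: "planar_matching n (arcs X)" using decorated_planar[OF dX] .
  interpret X: planar n "arcs X" using pX by (simp add: planar_def)
  have dotsX: "dots a < m" if "a \<in> arcs X" for a using dX that by (simp add: decorated_tangle_def)
  have via: "compose m X (glue m ?w v2 e) = Diagram (arcs (compose m G (glue m v1 v2 e)))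
      (cycles (compose m G (glue m v1 v2 e)) + replicate_mset k (0, 0))" if v2: "dangle m n k v2" for v2 e
  proof -
    interpret p2: dangle_pair m n k ?w v2 using v2 sk(1) by (simp add: dangle_pair_def)
    have "compose m X (glue m ?w v2 e) = compose m G (compose m (glue m v1 ?w 0) (glue m ?w v2 e))"
      unfolding X_def using compose_assoc[OF decorated_planar[OF G] p1.glue_planar p2.glue_planar m] .
    also have "\<dots> = compose m G (Diagram (arcs (glue m v1 v2 e)) (cycles (glue m v1 v2 e) + replicate_mset k (0, 0)))"
      unfolding glue_skeleton[OF v1 v2] ..
    finally show ?thesis unfolding compose_add_cycles by simp
  qed
  have bot: "up 1 ` nonlines ?w \<subseteq> hor 1 (arcs X)"
  proof
    fix a assume "a \<in> up 1 ` nonlines ?w"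
    hence h: "a \<in> hor 1 (arcs (glue m v1 ?w 0))" using p1.hor_glue(2)[of 0] by simp
    moreover have "dots a < m" using dG1 h by (simp add: decorated_tangle_def hor_def)
    ultimately show "a \<in> hor 1 (arcs X)"
      unfolding X_def using hor_compose_bottom[OF decorated_planar[OF G] p1.glue_planar m] by simp
  qed
  have finh: "finite (hor r (arcs X))" for r by (rule finite_subset[OF _ X.finite_arcs]) (auto simp: hor_def)
  have cw: "card (up 1 ` nonlines ?w) = k" using w.card_nonlines by (simp add: card_image inj_on_subset[OF up_inj])
  have "k \<le> card (hor 0 (arcs X))" using card_mono[OF finh bot] cw X.card_hor by simp
  then consider (more) "k < card (hor 0 (arcs X))" | (same) "card (hor 0 (arcs X)) = k" by linarith
  thus ?thesis
  proof cases
    case more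
    have "k < card (hor 0 (arcs (compose m G (glue m v1 v2 e))))" if v2: "dangle m n k v2" for v2 e
    proof -
      interpret p2: dangle_pair m n k ?w v2 using v2 sk(1) by (simp add: dangle_pair_def)
      have pc: "planar_matching n (arcs (compose m X (glue m ?w v2 e)))" using planar_compose[OF pX p2.glue_planar m] .
      have "hor 0 (arcs X) \<subseteq> hor 0 (arcs (compose m X (glue m ?w v2 e)))"
        using hor_compose_top[OF pX p2.glue_planar m] dotsX by (auto simp: hor_def)
      moreover have "finite (hor 0 (arcs (compose m X (glue m ?w v2 e))))"
        by (rule finite_subset[OF _ planar.finite_arcs[of n]]) (use pc in \<open>auto simp: hor_def planar_def\<close>)
      ultimately have "card (hor 0 (arcs X)) \<le> card (hor 0 (arcs (compose m X (glue m ?w v2 e))))" by (rule card_mono[rotated])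
      thus ?thesis using more unfolding via[OF v2] by simp
    qed
    thus ?thesis by blast
  next
    case same
    have h1: "hor 1 (arcs X) = up 1 ` nonlines ?w"
      using card_seteq[OF finh bot] cw X.card_hor same by simp
    define R where "R = reduced X"
    have dR: "decorated_tangle m n R" unfolding R_def using decorated_reduced[OF dX m] .
    have arcsR: "arcs R = reblob (reduced_blobs X) ` arcs X" by (simp add: R_def reduced_def)
    have bR: "blobs a \<le> 1" if "a \<in> arcs R" for a using that arcsR by (auto simp: reduced_blobs_def)
    have cR: "\<forall>(r, s)\<in>#cycles R. s \<le> 1" by (simp add: R_def reduced_def)
    have pR: "planar_matching n (arcs R)" using decorated_planar[OF dR] .
    interpret R: planar n "arcs R" using pR by (simp add: planar_def)
    interpret RF: planar n "arcs (flip R)" using R.planar_flip by (simp add: planar_def)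
    have horR: "hor r (arcs R) = reblob (reduced_blobs X) ` hor r (arcs X)" for r
      unfolding hor_def arcsR by (rule filter_image) simp
    have rinj: "inj_on (reblob h) (arcs X)" for h
      by (rule inj_onI) (use inj_onD[OF X.inj_ends] in \<open>simp add: reblob_def\<close>)
    have cardR: "card (hor 0 (arcs R)) = k"
      unfolding horR using card_image[OF inj_on_subset[OF rinj]] same by (simp add: hor_def)
    define L where "L = sorted_list_of_set (top_lines (arcs R))"
    obtain d :: "nat \<Rightarrow>\<^sub>0 nat" and \<beta> :: nat where \<beta>: "\<beta> \<le> 1"
      and ex: "\<forall>j < length L. \<exists>a\<in>arcs R. ends a = {(0, L ! j), (1, sorted_list_of_set (top_lines (arcs (flip R))) ! j)}
       \<and> dots a = lookup d j \<and> blobs a = (if j = 0 then \<beta> else 0)"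
      and len: "length (sorted_list_of_set (top_lines (arcs (flip R)))) = length L"
      by (rule glue_halves[OF dR bR cR m, folded L_def], assumption, rule that, assumption+)
    have half: "dangle m n k (half b R)" if "b \<le> 1" for b
      unfolding dangle_def using R.half_dangle[OF refl dR bR cR that m] cardR by simp
    have bRF: "blobs a \<le> 1" if "a \<in> arcs (flip R)" for a using that bR by auto
    have halfF: "dangle m n k (half 0 (flip R))"
    proof -
      have "card (hor 0 (arcs (flip R))) = k"
        using hor_flip(2)[OF pR] card_image[OF inj_on_subset[OF R.flip_arc_inj], of "hor 1 (arcs R)"] R.card_hor cardR
        by (simp add: hor_def)
      thus ?thesis unfolding dangle_def
        using RF.half_dangle[OF refl decorated_flip[OF dR] bRF _ _ m, of 0] cR by simp
    qed
    interpret hF: dangle m n k "half 0 (flip R)" by (rule halfF)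
    have L': "sorted_list_of_set (top_lines (arcs (flip R))) = lines ?w"
    proof -
      have n1: "nonlines (half 0 (flip R)) = down ` hor 0 (arcs (flip R))"
        and n2: "lines (half 0 (flip R)) = sorted_list_of_set (top_lines (arcs (flip R)))"
        using RF.half_parts[OF refl halfF] by simp_all
      have "ends ` nonlines (half 0 (flip R)) = ends ` nonlines ?w"
      proof -
        have "nonlines (half 0 (flip R)) = down ` flip_arc ` reblob (reduced_blobs X) ` up 1 ` nonlines ?w"
          unfolding n1 arcs_flip hor_flip(2)[OF pR, symmetric] horR h1 ..
        hence "ends ` nonlines (half 0 (flip R)) = (\<lambda>c. snd ` flip_vertex ` Pair 1 ` ends c) ` nonlines ?w"
          by (simp add: image_image)
        also have "\<dots> = ends ` nonlines ?w" by (simp add: image_image flip_vertex_def)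
        finally show ?thesis .
      qed
      moreover have "hF.line_positions = {1..n} - \<Union>(ends ` nonlines (half 0 (flip R)))"
        unfolding hF.nonline_union(1) using hF.nonline_union(2) by blast
      moreover have "w.line_positions = {1..n} - \<Union>(ends ` nonlines ?w)"
        unfolding w.nonline_union(1) using w.nonline_union(2) by blast
      ultimately have "hF.line_positions = w.line_positions" by simp
      thus ?thesis using n2 hF.lines_eq w.lines_eq by simp
    qed
    have lenw: "length (lines ?w) = length L" using len unfolding L' .
    have exX: "\<exists>a\<in>arcs X. ends a = {(0, L ! j), (1, lines ?w ! j)} \<and> dots a = lookup d j \<and>
        reduced_blobs X a = (if j = 0 then \<beta> else 0)" if j: "j < length L" for j
    proof -
      obtain a' where a': "a' \<in> arcs R" "ends a' = {(0, L ! j), (1, lines ?w ! j)}" "dots a' = lookup d j"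
        "blobs a' = (if j = 0 then \<beta> else 0)" using ex j unfolding L' by blast
      then obtain a where "a \<in> arcs X" "a' = reblob (reduced_blobs X) a" using arcsR by blast
      thus ?thesis using a' by (intro bexI[of _ a]) simp_all
    qed
    define va where "va j = (SOME a. a \<in> arcs X \<and> ends a = {(0, L ! j), (1, lines ?w ! j)} \<and>
       dots a = lookup d j \<and> reduced_blobs X a = (if j = 0 then \<beta> else 0))" for j
    have va: "va j \<in> arcs X \<and> ends (va j) = {(0, L ! j), (1, lines ?w ! j)} \<and> dots (va j) = lookup d j \<and>
        reduced_blobs X (va j) = (if j = 0 then \<beta> else 0)" if j: "j < length L" for j
      unfolding va_def by (rule someI_ex) (use exX[OF j] in blast)
    have vert: "arcs X = hor 0 (arcs X) \<union> up 1 ` nonlines ?w \<union> va ` {..<length L}"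
    proof -
      have "a \<in> va ` {..<length L}" if a: "a \<in> arcs X" "a \<notin> hor 0 (arcs X)" "a \<notin> hor 1 (arcs X)" for a
      proof -
        obtain i j where ij: "ends a = {(0, i), (1, j)}" using X.vertical_ends[OF a] .
        have "reblob (reduced_blobs X) a \<in> arcs R" using a(1) arcsR by simp
        moreover have "ends (reblob (reduced_blobs X) a) = {(0, i), (1, j)}" using ij by (simp add: reblob_def)
        ultimately have "i \<in> top_lines (arcs R)" unfolding top_lines_def by blast
        hence "i \<in> set L" using R.finite_top_lines by (simp add: L_def)
        then obtain t where t: "t < length L" "L ! t = i" by (auto simp: in_set_conv_nth)
        have "a = va t" using X.arc_unique[of a "va t" "(0, i)"] a(1) ij va[OF t(1)] t(2) by simp
        thus ?thesis using t(1) by blast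
      qed
      hence "arcs X \<subseteq> hor 0 (arcs X) \<union> hor 1 (arcs X) \<union> va ` {..<length L}" by blast
      moreover have "hor 0 (arcs X) \<union> hor 1 (arcs X) \<union> va ` {..<length L} \<subseteq> arcs X"
        using va unfolding hor_def by blast
      ultimately show ?thesis unfolding h1[symmetric] by (rule subset_antisym)
    qed
    have vform: "va ` {..<length L} = (\<lambda>j. Arc {(0, L ! j), (1, lines ?w ! j)} (lookup d j) (blobs (va j))) ` {..<length (lines ?w)}"
    proof -
      have "va j = Arc {(0, L ! j), (1, lines ?w ! j)} (lookup d j) (blobs (va j))" if "j < length L" for j
        using va[OF that] by (cases "va j") simp
      thus ?thesis unfolding lenw by (intro image_cong refl) simp
    qed
    \<comment> \<open>In \<open>X\<close> the blob on the leftmost line of \<open>v1\<close> is cancelled by that of the skeleton; it has to be restored.\<close>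
    define b where "b = (if odd_cycles (cycles X) = 0 then (\<beta> + line_blobs v1 0) mod 2 else 0)"
    have "(\<beta> + line_blobs v1 0) mod 2 \<le> 1" by linarith
    hence b1: "b \<le> 1" unfolding b_def by (simp split: if_splits)
    note hb = R.half_parts[OF refl half[OF b1]]
    have main: "cycles (compose m G (glue m v1 v2 e)) = cycles X \<and>
      (odd_cycles (cycles X) = 0 \<or> (\<forall>a\<in>arcs v2. blobs a = 0) \<longrightarrow>
        reduced (compose m G (glue m v1 v2 e)) = glue m (half b R) v2 (d + e))" if v2: "dangle m n k v2" for v2 e
    proof -
      interpret p2: dangle_pair m n k ?w v2 using v2 sk(1) by (simp add: dangle_pair_def)
      interpret p3: dangle_pair m n k "half b R" v2 using v2 half[OF b1] by (simp add: dangle_pair_def)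
      define W where "W = (\<lambda>j. Arc {(0::nat, L ! j), (1, lines v2 ! j)}
        ((lookup d j + lookup e j mod m) mod m)
        (blobs (va j) + (line_blobs v1 j + line_blobs v2 j) mod 2))"
      have c: "compose m X (glue m ?w v2 e) = Diagram (hor 0 (arcs X) \<union> up 1 ` nonlines v2 \<union>
        W ` {..<length (lines ?w)})
        (cycles X + cycles (glue m ?w v2 e) + replicate_mset k (0, 0))"
        unfolding W_def
      proof (rule compose_through[OF sk(1) sk(4), OF _ pX p2.glue_planar m])
        show "arcs X = hor 0 (arcs X) \<union> up 1 ` nonlines ?w \<union>
          (\<lambda>j. Arc {(0, L ! j), (1, lines ?w ! j)} (lookup d j) (blobs (va j))) ` {..<length (lines ?w)}"
          using vert unfolding vform .
        show "arcs (glue m ?w v2 e) = up 0 ` nonlines ?w \<union> up 1 ` nonlines v2 \<union>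
          (\<lambda>j. Arc {(0, lines ?w ! j), (1, lines v2 ! j)} (lookup e j mod m)
            ((line_blobs v1 j + line_blobs v2 j) mod 2)) ` {..<length (lines ?w)}"
          unfolding p2.glue_arcs vertical_arc_def[abs_def] using sk(2,3)
          by (intro arg_cong2[where f = "(\<union>)"] refl image_cong) simp_all
      next
        fix a assume a: "a \<in> hor 0 (arcs X)"
        thus "dots a < m" using dotsX by (simp add: hor_def)
        show "fst v = 0" if "v \<in> ends a" for v using a that unfolding hor_def by blast
      next
        fix a assume a: "a \<in> up 1 ` nonlines v2"
        show "fst v = 1" if "v \<in> ends a" for v using up_row[OF a that] .
        show "dots a < m" by (rule dots_up[OF a]) (rule p2.v2.dots_less, simp add: nonlines_def)
      qed
      have cyc: "cycles (compose m G (glue m v1 v2 e)) = cycles X"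
        using c unfolding via[OF v2] by (simp add: glue_def skeleton_def)
      have arcsC: "arcs (compose m G (glue m v1 v2 e)) = hor 0 (arcs X) \<union> up 1 ` nonlines v2 \<union>
        W ` {..<length (lines ?w)}"
        using c unfolding via[OF v2] by simp
      have "reduced (compose m G (glue m v1 v2 e)) = glue m (half b R) v2 (d + e)"
        if ok: "odd_cycles (cycles X) = 0 \<or> (\<forall>a\<in>arcs v2. blobs a = 0)"
      proof -
        let ?C = "compose m G (glue m v1 v2 e)"
        have lb: "lines (half b R) = L" using hb(2) by (simp add: L_def)
        have rb: "reduced_blobs ?C a = (if odd_cycles (cycles X) = 0 then blobs a mod 2 else 0)"
          "reduced_blobs X a = (if odd_cycles (cycles X) = 0 then blobs a mod 2 else 0)" for a
          by (simp_all add: reduced_blobs_def cyc)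
        have top: "reblob (reduced_blobs ?C) ` hor 0 (arcs X) = up 0 ` nonlines (half b R)"
        proof -
          have "up 0 ` nonlines (half b R) = (\<lambda>a. a) ` hor 0 (arcs R)"
            unfolding hb(1) image_image by (rule image_cong[OF refl]) (rule R.up_down)
          also have "\<dots> = reblob (reduced_blobs ?C) ` hor 0 (arcs X)"
            unfolding image_ident horR by (rule image_cong[OF refl]) (simp add: reblob_def rb)
          finally show ?thesis ..
        qed
        have bottom: "reblob (reduced_blobs ?C) ` up 1 ` nonlines v2 = up 1 ` nonlines v2"
        proof -
          have "reblob (reduced_blobs ?C) (up 1 a) = up 1 a" if "a \<in> nonlines v2" for a
          proof -
            have "blobs a \<le> 1" using p2.v2.blobs_le that by (simp add: nonlines_def)
            moreover have "odd_cycles (cycles X) \<noteq> 0 \<longrightarrow> blobs a = 0" using ok that by (auto simp: nonlines_def)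
            ultimately show ?thesis by (auto simp: reblob_def rb up_def)
          qed
          thus ?thesis unfolding image_image by simp
        qed
        have vert: "reblob (reduced_blobs ?C) (W j) = vertical_arc m (half b R) v2 (d + e) j"
          if j: "j < length L" for j
        proof -
          have j1: "j < length (lines v1)" "j < length (lines v2)" using j lenw sk(2) p2.length_eq by simp_all
          have hbj: "line_blobs (half b R) j = (if j = 0 then b else 0)" using hb(3)[of j] j lb by simp
          have "(if odd_cycles (cycles X) = 0 then (blobs (va j) + (line_blobs v1 j + line_blobs v2 j) mod 2) mod 2 else 0) =
            (line_blobs (half b R) j + line_blobs v2 j) mod 2"
          proof (cases "odd_cycles (cycles X) = 0")
            case True
            have vb: "blobs (va j) mod 2 = (if j = 0 then \<beta> else 0)" using va[OF j] True by (simp add: rb(2))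
            show ?thesis
            proof (cases "j = 0")
              case j0: True
              have "(blobs (va 0) + (line_blobs v1 0 + line_blobs v2 0) mod 2) mod 2 =
                (blobs (va 0) mod 2 + line_blobs v1 0 + line_blobs v2 0) mod 2"
                by (simp only: add.assoc mod_add_left_eq mod_add_right_eq)
              also have "\<dots> = (\<beta> + line_blobs v1 0 + line_blobs v2 0) mod 2" using vb j0 by simp
              also have "\<dots> = (b + line_blobs v2 0) mod 2"
                using True unfolding b_def by (simp only: simp_thms if_True mod_add_left_eq)
              finally show ?thesis using True hbj j0 by simp
            next
              case False
              thus ?thesis using True hbj vb p1.v1.line_blobs_zero[of j] p2.v2.line_blobs_zero[of j] j1 by simp
            qed
          next
            case False
            with ok have plain: "\<forall>a\<in>arcs v2. blobs a = 0" by (elim disjE) (erule notE, assumption, assumption)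
            have "line_blobs v2 j = 0" by (rule p2.v2.line_arc[OF j1(2)]) (use plain in simp)
            thus ?thesis using False hbj by (simp add: b_def)
          qed
          thus ?thesis
            unfolding W_def vertical_arc_def lb reblob_def rb arc.sel lookup_add mod_add_right_eq by (simp only:)
        qed
        have "arcs (reduced ?C) = arcs (glue m (half b R) v2 (d + e))"
          unfolding reduced_def arcsC p3.glue_arcs lb lenw diagram.sel image_Un top bottom
          unfolding image_image by (intro arg_cong2[where f = "(\<union>)"] refl image_cong) (simp only: lessThan_iff vert)
        moreover have "cycles (reduced ?C) = cycles (glue m (half b R) v2 (d + e))"
          unfolding reduced_def cyc by (simp add: glue_def half_def R_def reduced_def)
        ultimately show ?thesis by (cases "reduced ?C"; cases "glue m (half b R) v2 (d + e)") simp
      qed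
      thus ?thesis using cyc by blast
    qed
    thus ?thesis using half[OF b1] by blast
  qed
qed

end

section \<open>The group algebra\<close>

lemma glue_periodic:
  assumes "\<And>j. j < length (lines v1) \<Longrightarrow> lookup e j mod m = lookup e' j mod m"
  shows "glue m v1 v2 e = glue m v1 v2 e'"
proof -
  have "{Arc {(0, lines v1 ! j), (1, lines v2 ! j)} (lookup e j mod m) ((blobs a + blobs b) mod 2) | j a b.
         j < length (lines v1) \<and> a \<in> arcs v1 \<and> ends a = {lines v1 ! j} \<and> b \<in> arcs v2 \<and> ends b = {lines v2 ! j}} =
    {Arc {(0, lines v1 ! j), (1, lines v2 ! j)} (lookup e' j mod m) ((blobs a + blobs b) mod 2) | j a b.
         j < length (lines v1) \<and> a \<in> arcs v1 \<and> ends a = {lines v1 ! j} \<and> b \<in> arcs v2 \<and> ends b = {lines v2 ! j}}"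
    (is "{?f j a b | j a b. ?P j a b} = {?g j a b | j a b. ?P j a b}")
  proof -
    have "?f j a b = ?g j a b" if "?P j a b" for j a b
    proof -
      have "j < length (lines v1)" using that by blast
      thus ?thesis using assms[of j] by simp
    qed
    hence "x \<in> {?f j a b | j a b. ?P j a b} \<longleftrightarrow> x \<in> {?g j a b | j a b. ?P j a b}" for x
      unfolding mem_Collect_eq by metis
    thus ?thesis by (rule set_eqI)
  qed
  thus ?thesis unfolding glue_def by (rule arg_cong[where f = "\<lambda>V. Diagram (_ \<union> V) _"])
qed

context parameters
begin

abbreviation T :: "dangle \<Rightarrow> dangle \<Rightarrow> 'k gpoly \<Rightarrow> (tangle \<Rightarrow>\<^sub>0 'k)" where "T \<equiv> tensor m"

lemma tensor_expand:
  assumes "finite S" "keys w \<subseteq> S"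
  shows "T v1 v2 w = (\<Sum>e\<in>S. scale_pm (lookup w e) (E (glue m v1 v2 e)))"
proof -
  have "T v1 v2 w = (\<Sum>e\<in>keys w. scale_pm (lookup w e) (E (glue m v1 v2 e)))"
    by (simp add: tensor_def E_def scale_single)
  also have "\<dots> = (\<Sum>e\<in>S. scale_pm (lookup w e) (E (glue m v1 v2 e)))"
    by (rule sum.mono_neutral_left[OF assms]) (simp add: in_keys_iff)
  finally show ?thesis .
qed

lemma tensor_add: "T v1 v2 (w + w') = T v1 v2 w + T v1 v2 w'"
proof -
  let ?S = "keys w \<union> keys w'"
  have f: "finite ?S" by simp
  have k: "keys (w + w') \<subseteq> ?S" by (rule Poly_Mapping.keys_add)
  show ?thesis
    unfolding tensor_expand[OF f k] tensor_expand[OF f Un_upper1] tensor_expand[OF f Un_upper2]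
    by (simp add: lookup_add pm.scale_left_distrib sum.distrib)
qed

lemma tensor_0: "T v1 v2 0 = 0"
  by (simp add: tensor_def)

lemma tensor_diff: "T v1 v2 (w - w') = T v1 v2 w - T v1 v2 w'"
  using tensor_add[of v1 v2 "w - w'" w'] by simp

lemma tensor_sum: "T v1 v2 (\<Sum>x\<in>S. f x) = (\<Sum>x\<in>S. T v1 v2 (f x))"
  by (induction S rule: infinite_finite_induct) (simp_all add: tensor_0 tensor_add)

lemma tensor_single: "T v1 v2 (single e c) = scale_pm c (E (glue m v1 v2 e))"
  using tensor_expand[of "{e}" "single e c"] by simp

lemma tensor_single_mult:
  "T v1 v2 (single d c * w) =
    (\<Sum>e\<in>keys w. scale_pm (c * lookup w e) (E (glue m v1 v2 (d + e))))"
proof -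
  have "single d c * w =
      (\<Sum>e\<in>keys w. single d c * single e (lookup w e))"
    by (subst pm_expand[OF finite_keys subset_refl, of w]) (simp add: sum_distrib_left)
  thus ?thesis by (simp add: tensor_sum mult_single tensor_single)
qed

lemma tensor_const: "T v1 v2 (const c * w) = scale_pm c (T v1 v2 w)"
  unfolding const_def tensor_single_mult tensor_expand[OF finite_keys subset_refl, of v1 v2 w]
  by (simp add: pm.scale_sum_right)

lemma gen_power: "(gen j :: 'k gpoly) ^ k = single (single j k) 1"
  by (induction k) (simp_all add: gen_def mult_single single_add[symmetric])

text \<open>
  The relation \<open>T\<^sub>j\<^sup>m = 1\<close> of the group algebra holds after
  \<open>tensor\<close>, since \<open>glue\<close> takes exponents modulo \<open>m\<close>.
\<close>

lemma tensor_gen_power: "T v1 v2 ((gen j ^ m - 1) * w) = 0"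
proof -
  have "glue m v1 v2 (single j m + e) = glue m v1 v2 (0 + e)" for e
    by (rule glue_periodic) (simp add: lookup_add lookup_single when_def)
  hence "T v1 v2 (gen j ^ m * w) = T v1 v2 (single 0 1 * w)"
    unfolding gen_power tensor_single_mult by simp
  thus ?thesis by (simp add: left_diff_distrib tensor_diff)
qed

end

text \<open>
  Evaluation of a polynomial at a generator, a ring homomorphism that transports the factorisation
  of \<open>x\<^sup>m - 1\<close>.
\<close>

definition at_gen :: "nat \<Rightarrow> 'k::field poly \<Rightarrow> 'k gpoly" where
  "at_gen j p = poly (map_poly const p) (gen j)"

lemma const_simps: "const 0 = 0" "const 1 = 1" "const (a + b) = const a + const b" "const (a * b) = const a * const b"
  "const (- a) = - const a"
  by (simp_all add: const_def single_add mult_single single_uminus)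

lemma at_gen_pCons: "at_gen j (pCons a p) = const a + gen j * at_gen j p"
  by (simp add: at_gen_def map_poly_pCons const_simps)

lemma at_gen_0: "at_gen j 0 = 0"
  by (simp add: at_gen_def)

lemma at_gen_add: "at_gen j (p + q) = at_gen j p + at_gen j q"
  by (induction p q rule: poly_induct2) (simp_all add: at_gen_pCons at_gen_0 const_simps algebra_simps)

lemma at_gen_diff: "at_gen j (p - q) = at_gen j p - at_gen j q"
  using at_gen_add[of j "p - q" q] by simp

lemma at_gen_smult: "at_gen j (smult c p) = const c * at_gen j p"
  by (induction p) (simp_all add: at_gen_pCons at_gen_0 const_simps algebra_simps)

lemma at_gen_mult: "at_gen j (p * q) = at_gen j p * at_gen j q"
  by (induction p) (simp_all add: at_gen_pCons at_gen_0 at_gen_add at_gen_smult const_simps algebra_simps)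

lemma at_gen_1: "at_gen j 1 = 1"
  using at_gen_pCons[of j 1 0] by (simp add: at_gen_0 const_simps one_pCons)

lemma at_gen_prod: "at_gen j (\<Prod>x\<in>S. f x) = (\<Prod>x\<in>S. at_gen j (f x))"
  by (induction S rule: infinite_finite_induct) (simp_all add: at_gen_1 at_gen_mult)

lemma at_gen_monom: "at_gen j (monom 1 k) = gen j ^ k"
  by (induction k) (simp_all add: monom_0 monom_Suc at_gen_pCons at_gen_0 const_simps)

lemma prod_roots:
  assumes "monom 1 m - 1 = (\<Prod>j=1..m. [:- \<xi> j, 1:])"
  shows "(\<Prod>l\<in>{1..m}. gen j - const (\<xi> l)) = gen j ^ m - 1"
  using arg_cong[OF assms, of "at_gen j"]
  by (simp add: at_gen_diff at_gen_monom at_gen_1 at_gen_prod at_gen_pCons at_gen_0 const_simps)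

lemma C11_remove:
  assumes "j < length I"
  shows "C11 m \<xi> (I[j := i]) = (\<Prod>l\<in>{i + 1..m}. gen j - const (\<xi> l)) *
    (\<Prod>s\<in>{..<length I} - {j}. \<Prod>l\<in>{I ! s + 1..m}. gen s - const (\<xi> l))"
proof -
  have "(\<Prod>s\<in>{..<length I} - {j}. \<Prod>l\<in>{I[j := i] ! s + 1..m}. gen s - const (\<xi> l)) =
    (\<Prod>s\<in>{..<length I} - {j}. \<Prod>l\<in>{I ! s + 1..m}. gen s - const (\<xi> l))"
    by (rule prod.cong) simp_all
  thus ?thesis unfolding C11_def length_list_update
    using assms by (subst prod.remove[of _ j]) simp_all
qed

text \<open>
  Multiplying by \<open>T\<^sub>j - \<xi>\<^sub>i\<close> with \<open>i = I ! j\<close> adds the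
  next factor to the product over \<open>l > i\<close>.
\<close>

lemma gen_C11:
  assumes j: "j < length I" and i: "1 \<le> I ! j" "I ! j \<le> m"
  shows "gen j * C11 m \<xi> I = const (\<xi> (I ! j)) * C11 m \<xi> I + C11 m \<xi> (I[j := I ! j - 1])"
proof -
  let ?R = "\<Prod>s\<in>{..<length I} - {j}. \<Prod>l\<in>{I ! s + 1..m}. gen s - const (\<xi> l)"
  have "{I ! j - 1 + 1..m} = insert (I ! j) {I ! j + 1..m}" using i by auto
  hence "C11 m \<xi> (I[j := I ! j - 1]) =
      (gen j - const (\<xi> (I ! j))) * ((\<Prod>l\<in>{I ! j + 1..m}. gen j - const (\<xi> l)) * ?R)"
    unfolding C11_remove[OF j] by simp
  also have "\<dots> = (gen j - const (\<xi> (I ! j))) * C11 m \<xi> I"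
    using C11_remove[OF j, of m \<xi> "I ! j"] by simp
  finally show ?thesis by (simp add: algebra_simps)
qed

lemma C11_top: "C11 m \<xi> (replicate r m) = 1"
  by (simp add: C11_def)

lemma multi_indices_update:
  assumes "I \<in> multi_indices m r" "j < r" "1 \<le> i" "i \<le> m"
  shows "I[j := i] \<in> multi_indices m r"
  using assms set_update_subset_insert[of I j i] by (auto simp: multi_indices_def)

lemma multi_indices_nth: "I \<in> multi_indices m r \<Longrightarrow> j < r \<Longrightarrow> 1 \<le> I ! j \<and> I ! j \<le> m"
  unfolding multi_indices_def by (auto dest!: nth_mem subsetD)

locale splitting = parameters m n \<delta> for m n and \<delta> :: "nat \<Rightarrow> 'k::field" +
  fixes \<xi> :: "nat \<Rightarrow> 'k"
  assumes roots: "monom 1 m - 1 = (\<Prod>j=1..m. [:- \<xi> j, 1:])"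
begin

text \<open>
  If an entry is lowered to zero, the product runs over all roots and equals
  \<open>T\<^sub>j\<^sup>m - 1\<close>.
\<close>

lemma tensor_C11_zero:
  assumes "j < length I"
  shows "T v1 v2 (w * C11 m \<xi> (I[j := 0])) = 0"
proof -
  let ?R = "\<Prod>s\<in>{..<length I} - {j}. \<Prod>l\<in>{I ! s + 1..m}. gen s - const (\<xi> l)"
  have "C11 m \<xi> (I[j := 0]) = (gen j ^ m - 1) * ?R"
    using C11_remove[OF assms, of m \<xi> 0] prod_roots[OF roots, of j] by simp
  hence "w * C11 m \<xi> (I[j := 0]) = (gen j ^ m - 1) * (w * ?R)" by (simp only: ac_simps)
  thus ?thesis by (simp only: tensor_gen_power)
qed

definition below :: "dangle \<Rightarrow> dangle \<Rightarrow> nat list \<Rightarrow> (tangle \<Rightarrow>\<^sub>0 'k) set" where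
  "below v1 v2 I = {T v1 v2 (C11 m \<xi> I') | I'. I' \<in> multi_indices m (length I) \<and> list_all2 (\<le>) I' I \<and> I' \<noteq> I}"

text \<open>
  By induction on the degree: one generator is split off and applied to \<open>C\<^sub>I\<close>
  by \<open>gen_C11\<close>. The scalar does not depend on the two dangles.
\<close>

lemma monomial_action:
  assumes "keys d \<subseteq> {..<r}" "I \<in> multi_indices m r"
  shows "T v1 v2 (single d 1 * C11 m \<xi> I) -
    scale_pm (\<Prod>j<r. \<xi> (I ! j) ^ lookup d j) (T v1 v2 (C11 m \<xi> I)) \<in> pm.span (below v1 v2 I)"
  using assms
proof (induction "\<Sum>j<r. lookup d j" arbitrary: d I)
  case 0
  have "lookup d j = 0" for j
    using 0 by (cases "j < r") (auto simp: in_keys_iff)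
  hence "d = 0" by (intro poly_mapping_eqI) simp
  thus ?case by (simp add: pm.span_zero)
next
  case (Suc N)
  then obtain j where j: "j < r" "lookup d j \<noteq> 0"
    by (metis lessThan_iff nat.distinct(1) sum.neutral)
  define d' where "d' = d - single j 1"
  have dl: "lookup d' s = (if s = j then lookup d j - 1 else lookup d s)" for s
    by (simp add: d'_def lookup_minus lookup_single when_def)
  have d: "d = d' + single j 1"
    using j(2) by (intro poly_mapping_eqI) (auto simp: lookup_add lookup_single dl when_def)
  have k': "keys d' \<subseteq> {..<r}" using Suc.prems(1) j(1) dl by (auto simp: in_keys_iff subset_iff split: if_splits)
  have "(\<Sum>s<r. lookup d s) = (\<Sum>s<r. lookup d' s) + (\<Sum>s<r. if s = j then 1 else 0)"
    unfolding sum.distrib[symmetric] by (rule sum.cong) (use j(2) dl in auto)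
  hence N: "N = (\<Sum>s<r. lookup d' s)" using Suc.hyps(2) j(1) by simp
  have len: "length I = r" using Suc.prems(2) by (simp add: multi_indices_def)
  have i: "1 \<le> I ! j" "I ! j \<le> m" using multi_indices_nth[OF Suc.prems(2) j(1)] by simp_all
  let ?c = "\<lambda>d. \<Prod>s<r. \<xi> (I ! s) ^ lookup d s"
  have c: "?c d = \<xi> (I ! j) * ?c d'"
    unfolding prod.remove[OF finite_lessThan, of j r] using j
    by (subst (1 2) prod.remove[of _ j]) (simp_all add: dl power_eq_if ac_simps)
  have "single d 1 * C11 m \<xi> I = single d' 1 * (gen j * C11 m \<xi> I)"
    unfolding d gen_def by (simp add: mult.assoc[symmetric] mult_single)
  also have "\<dots> = const (\<xi> (I ! j)) * (single d' 1 * C11 m \<xi> I) +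
      single d' 1 * C11 m \<xi> (I[j := I ! j - 1])"
    using gen_C11[of j I m \<xi>] j(1) len i by (simp add: algebra_simps)
  finally have step: "T v1 v2 (single d 1 * C11 m \<xi> I) =
      scale_pm (\<xi> (I ! j)) (T v1 v2 (single d' 1 * C11 m \<xi> I)) +
      T v1 v2 (single d' 1 * C11 m \<xi> (I[j := I ! j - 1]))"
    by (simp add: tensor_add tensor_const)
  have rest: "T v1 v2 (single d' 1 * C11 m \<xi> (I[j := I ! j - 1])) \<in> pm.span (below v1 v2 I)"
  proof (cases "I ! j = 1")
    case True
    thus ?thesis using tensor_C11_zero[of j I] j(1) len by (simp add: pm.span_zero)
  next
    case False
    let ?I = "I[j := I ! j - 1]"
    have mi: "?I \<in> multi_indices m r" using multi_indices_update[OF Suc.prems(2) j(1)] i False by simp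
    have le: "list_all2 (\<le>) ?I I" using j(1) len by (auto simp: list_all2_conv_all_nth nth_list_update)
    have ne: "?I ! j < I ! j" using i j(1) len by simp
    have sub: "insert (T v1 v2 (C11 m \<xi> ?I)) (below v1 v2 ?I) \<subseteq> below v1 v2 I"
    proof -
      have "?I \<noteq> I" using ne by force
      hence "T v1 v2 (C11 m \<xi> ?I) \<in> below v1 v2 I" using mi le len unfolding below_def by blast
      moreover have "I' \<noteq> I" if "list_all2 (\<le>) I' ?I" for I'
        using list_all2_nthD2[OF that, of j] ne j(1) len by auto
      moreover have "list_all2 (\<le>) I' I" if "list_all2 (\<le>) I' ?I" for I'
        using list_all2_trans[OF order_trans that le] .
      ultimately show ?thesis unfolding below_def length_list_update by blast
    qed
    let ?x = "T v1 v2 (C11 m \<xi> ?I)" and ?y = "T v1 v2 (single d' 1 * C11 m \<xi> ?I)"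
    let ?a = "\<Prod>s<r. \<xi> (?I ! s) ^ lookup d' s"
    have "?y - scale_pm ?a ?x \<in> pm.span (below v1 v2 I)"
      using Suc.hyps(1)[OF N k' mi] pm.span_mono[of "below v1 v2 ?I" "below v1 v2 I"] sub by blast
    moreover have "scale_pm ?a ?x \<in> pm.span (below v1 v2 I)"
      using sub by (intro pm.span_scale pm.span_base) simp
    ultimately have "(?y - scale_pm ?a ?x) + scale_pm ?a ?x \<in> pm.span (below v1 v2 I)" by (rule pm.span_add)
    thus ?thesis by simp
  qed
  have "scale_pm (\<xi> (I ! j)) (T v1 v2 (single d' 1 * C11 m \<xi> I) -
      scale_pm (?c d') (T v1 v2 (C11 m \<xi> I))) \<in> pm.span (below v1 v2 I)"
    using Suc.hyps(1)[OF N k' Suc.prems(2)] by (rule pm.span_scale)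
  from pm.span_add[OF this rest] show ?case
    unfolding step c by (simp add: pm.scale_right_diff_distrib algebra_simps)
qed

end

section \<open>Dangles of a cell\<close>

fun label_plus :: "label \<Rightarrow> bool" where
  "label_plus (Plus k I) = True"
| "label_plus (Minus k I) = False"
| "label_plus (Half j) = False"

fun label_size :: "nat \<Rightarrow> label \<Rightarrow> nat" where
  "label_size n (Plus k I) = k"
| "label_size n (Minus k I) = k"
| "label_size n (Half j) = n div 2"

fun label_dangles :: "nat \<Rightarrow> nat \<Rightarrow> label \<Rightarrow> dangle set" where
  "label_dangles m n (Plus k I) = Dplus m n k"
| "label_dangles m n (Minus k I) = Dminus m n k"
| "label_dangles m n (Half j) = Dminus_half m n j"

fun with_index :: "label \<Rightarrow> nat list \<Rightarrow> label" where
  "with_index (Plus k I) J = Plus k J"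
| "with_index (Minus k I) J = Minus k J"
| "with_index (Half j) J = Half j"

lemma cell_index_eq: "cell_index m n l = (\<lambda>v. (v, label_index l)) ` label_dangles m n l"
  by (cases l) auto

lemma multi_indices_0: "multi_indices m 0 = {[]}"
  by (auto simp: multi_indices_def)

lemma labels_cases:
  assumes "l \<in> labels m n" "n \<ge> 1"
  obtains (plus) k I where "l = Plus k I" "1 \<le> k" "k \<le> n div 2" "I \<in> multi_indices m (n - 2 * k)"
    | (minus) k I where "l = Minus k I" "2 * k < n" "I \<in> multi_indices m (n - 2 * k)"
    | (half) j where "l = Half j" "even n" "j = 1 \<or> j = 2"
proof (cases l)
  case (Plus k I)
  thus ?thesis using assms plus by (auto simp: labels_def split: if_splits)
next
  case (Minus k I)
  have "2 * k < n"
  proof (cases "odd n")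
    case True
    hence "k \<le> n div 2" using assms Minus by (auto simp: labels_def)
    thus ?thesis using True by presburger
  next
    case False
    hence "k \<le> n div 2 - 1" using assms Minus by (auto simp: labels_def)
    thus ?thesis using False assms(2) by presburger
  qed
  moreover have "I \<in> multi_indices m (n - 2 * k)" using assms Minus by (auto simp: labels_def split: if_splits)
  ultimately show ?thesis using minus Minus by blast
next
  case (Half j)
  thus ?thesis using assms half by (auto simp: labels_def split: if_splits)
qed

lemma half_label: "Half j \<in> labels m n \<Longrightarrow> 2 * (n div 2) = n"
  by (auto simp: labels_def split: if_splits)

lemma labels_intros:
  "1 \<le> k \<Longrightarrow> k \<le> n div 2 \<Longrightarrow> I \<in> multi_indices m (n - 2 * k) \<Longrightarrow> Plus k I \<in> labels m n"
  "2 * k < n \<Longrightarrow> I \<in> multi_indices m (n - 2 * k) \<Longrightarrow> Minus k I \<in> labels m n"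
  "even n \<Longrightarrow> j = 1 \<or> j = 2 \<Longrightarrow> Half j \<in> labels m n"
proof -
  show "Plus k I \<in> labels m n" if "1 \<le> k" "k \<le> n div 2" "I \<in> multi_indices m (n - 2 * k)"
    using that by (auto simp: labels_def)
  show "Minus k I \<in> labels m n" if h: "2 * k < n" "I \<in> multi_indices m (n - 2 * k)"
  proof -
    have "k \<le> n div 2" "even n \<Longrightarrow> k \<le> n div 2 - 1" using h(1) by presburger+
    thus ?thesis using h(2) by (auto simp: labels_def)
  qed
  show "Half j \<in> labels m n" if "even n" "j = 1 \<or> j = 2" using that by (auto simp: labels_def)
qed

lemma with_index:
  assumes "l \<in> labels m n" "n \<ge> 1" "J \<in> multi_indices m (n - 2 * label_size n l)"
  shows "with_index l J \<in> labels m n" "label_index (with_index l J) = J"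
    "label_dangles m n (with_index l J) = label_dangles m n l"
    "label_size n (with_index l J) = label_size n l" "label_plus (with_index l J) = label_plus l"
proof -
  show "with_index l J \<in> labels m n" using assms(1,2)
    by (cases rule: labels_cases) (use assms(3) labels_intros in auto)
  show "label_index (with_index l J) = J" using assms(1,2)
    by (cases rule: labels_cases) (use assms(3) in \<open>auto simp: multi_indices_0\<close>)
qed (cases l; simp)+

lemma label_index:
  assumes "l \<in> labels m n" "n \<ge> 1"
  shows "label_index l \<in> multi_indices m (n - 2 * label_size n l)"
  using assms by (cases rule: labels_cases) (auto simp: multi_indices_0)

lemma with_index_less:
  assumes l: "l \<in> labels m n" "n \<ge> 1" and J: "J \<in> multi_indices m (n - 2 * label_size n l)"
    and le: "list_all2 (\<le>) J (label_index l)" "J \<noteq> label_index l"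
  shows "label_le (with_index l J) l" "with_index l J \<noteq> l"
proof -
  show "with_index l J \<noteq> l" using with_index(2)[OF l J] le(2) by metis
  show "label_le (with_index l J) l" using l
    by (cases rule: labels_cases) (use le in auto)
qed

lemma label_lower:
  assumes l: "l \<in> labels m n" "l' \<in> labels m n" "n \<ge> 1"
    and lower: "label_plus l' = label_plus l \<and> label_size n l < label_size n l' \<or> label_plus l' \<and> \<not> label_plus l"
  shows "label_le l' l" "l' \<noteq> l"
proof -
  have "label_le l' l \<and> l' \<noteq> l" using l(1,3)
  proof (cases rule: labels_cases)
    case (plus k I)
    show ?thesis using l(2,3) by (cases rule: labels_cases) (use plus lower in auto)
  next
    case (minus k I)
    show ?thesis using l(2,3) by (cases rule: labels_cases) (use minus lower in auto)
  next
    case (half j)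
    show ?thesis using l(2,3) by (cases rule: labels_cases) (use half lower in auto)
  qed
  thus "label_le l' l" "l' \<noteq> l" by auto
qed

lemma finite_multi_indices: "finite (multi_indices m r)"
  using finite_lists_length_eq[of "{1..m}" r] by (simp add: multi_indices_def conj_commute)

lemma finite_labels:
  assumes "n \<ge> 1"
  shows "finite (labels m n)"
proof -
  let ?I = "\<Union>k\<in>{..n}. multi_indices m (n - 2 * k)"
  have "labels m n \<subseteq> (\<lambda>(k, I). Plus k I) ` ({..n} \<times> ?I) \<union> (\<lambda>(k, I). Minus k I) ` ({..n} \<times> ?I) \<union> {Half 1, Half 2}"
  proof
    fix l assume "l \<in> labels m n"
    thus "l \<in> (\<lambda>(k, I). Plus k I) ` ({..n} \<times> ?I) \<union> (\<lambda>(k, I). Minus k I) ` ({..n} \<times> ?I) \<union> {Half 1, Half 2}"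
      using assms
    proof (cases rule: labels_cases)
      case (plus k I)
      hence "(k, I) \<in> {..n} \<times> ?I" by auto
      thus ?thesis unfolding plus(1) by force
    next
      case (minus k I)
      hence "(k, I) \<in> {..n} \<times> ?I" by auto
      thus ?thesis unfolding minus(1) by force
    qed auto
  qed
  thus ?thesis by (rule finite_subset) (simp add: finite_multi_indices)
qed

lemma labels_poset:
  assumes "n \<ge> 1"
  shows "partial_order_on (labels m n) {(l, l'). l \<in> labels m n \<and> l' \<in> labels m n \<and> label_le l l'}"
proof -
  have refl: "label_le l l" for l by (cases l) (simp_all add: list_all2_refl)
  have trans: "label_le a c" if "label_le a b" "label_le b c" for a b c
    using that by (cases a; cases b; cases c) (auto intro: list_all2_trans[OF order_trans])
  have anti: "a = b" if "label_le a b" "label_le b a" for a b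
  proof -
    have "I = J" if "list_all2 (\<le>) I J" "list_all2 (\<le>) J I" for I J :: "nat list"
      by (rule list_all2_antisym[OF _ that]) (rule order_antisym)
    thus ?thesis using that by (cases a; cases b) auto
  qed
  show ?thesis
    unfolding partial_order_on_def preorder_on_def refl_on_def trans_def antisym_def
    using refl trans anti by blast
qed

abbreviation even_blobs :: "'v diagram \<Rightarrow> bool" where
  "even_blobs v \<equiv> even (\<Sum>a\<in>arcs v. blobs a)"

lemma label_dangles_plus:
  "label_plus l \<Longrightarrow> v \<in> label_dangles m n l \<longleftrightarrow> decorated_dangle m n (label_size n l) v \<and> cycles v = {#(0, 1)#} \<and>
     (\<forall>a\<in>arcs v. blobs a = 0) \<and> nonlines v \<noteq> {}"
  by (cases l) (auto simp: Dplus_def nonlines_def)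

text \<open>
  For type II labels the parity of blobs is a function of the label, which treats the two half
  labels uniformly with the others.
\<close>

lemma label_dangles_minus:
  assumes "l \<in> labels m n" "n \<ge> 1" "\<not> label_plus l"
  shows "v \<in> label_dangles m n l \<longleftrightarrow> decorated_dangle m n (label_size n l) v \<and> cycles v = {#} \<and>
     (even_blobs v \<longleftrightarrow> l \<noteq> Half 2)"
  using assms(1,2)
proof (cases rule: labels_cases)
  case (plus k I)
  thus ?thesis using assms(3) by simp
next
  case (minus k I)
  thus ?thesis by (simp add: Dminus_def)
next
  case (half j)
  hence "2 * (n div 2) = n" by simp
  thus ?thesis using half by (auto simp: Dminus_half_def Dminus_def)
qed

lemma label_dangles_dangle:
  assumes "l \<in> labels m n" "n \<ge> 1" "v \<in> label_dangles m n l"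
  shows "dangle m n (label_size n l) v"
  using label_dangles_plus[of l v m n] label_dangles_minus[OF assms(1,2), of v] assms(3)
  unfolding dangle_def by blast

lemma label_dangles_cycles:
  assumes "l \<in> labels m n" "n \<ge> 1" "v \<in> label_dangles m n l"
  shows "cycles v = (if label_plus l then {#(0, 1)#} else {#})"
  using label_dangles_plus[of l v m n] label_dangles_minus[OF assms(1,2), of v] assms(3) by auto

lemma label_dangles_even:
  assumes "l \<in> labels m n" "n \<ge> 1" "v \<in> label_dangles m n l"
  shows "even_blobs v \<longleftrightarrow> l \<noteq> Half 2"
proof (cases "label_plus l")
  case True
  hence "\<forall>a\<in>arcs v. blobs a = 0" using label_dangles_plus assms(3) by blast
  thus ?thesis using True by auto
next
  case False
  thus ?thesis using label_dangles_minus[OF assms(1,2)] assms(3) by blast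
qed

lemma (in dangle) line_blobs_plain:
  assumes "\<forall>a\<in>arcs v. blobs a = 0" "j < length (lines v)"
  shows "line_blobs v j = 0"
  by (rule line_arc[OF assms(2)]) (use assms(1) in simp)

lemma (in dangle_pair) glue_plain:
  assumes "\<forall>a\<in>arcs v1. blobs a = 0" "\<forall>a\<in>arcs v2. blobs a = 0"
  shows "\<forall>a\<in>arcs (glue m v1 v2 e). blobs a = 0"
proof
  fix a assume "a \<in> arcs (glue m v1 v2 e)"
  thus "blobs a = 0"
  proof (cases rule: glue_cases)
    case (vert j)
    thus ?thesis using v1.line_blobs_plain[OF assms(1)] v2.line_blobs_plain[OF assms(2)] length_eq
      by (simp add: vertical_arc_def)
  qed (use assms in \<open>simp_all add: nonlines_def\<close>)
qed

locale cells = splitting m n \<delta> \<xi> for m n and \<delta> \<xi> :: "nat \<Rightarrow> 'k::field" +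
  assumes n: "n \<ge> 1"
begin

abbreviation D :: "label \<Rightarrow> dangle set" where "D \<equiv> label_dangles m n"

lemma label_pair:
  assumes "l \<in> labels m n" "v1 \<in> D l" "v2 \<in> D l"
  shows "dangle_pair m n (label_size n l) v1 v2"
  using label_dangles_dangle[OF assms(1) n] assms(2,3) by (simp add: dangle_pair_def)

lemma glue_Adm:
  assumes l: "l \<in> labels m n" and v: "v1 \<in> D l" "v2 \<in> D l"
  shows "glue m v1 v2 e \<in> Adm"
proof -
  interpret dangle_pair m n "label_size n l" v1 v2 using label_pair[OF l v] .
  note c = label_dangles_cycles[OF l n v(1)]
  have dec: "decorated_tangle m n (glue m v1 v2 e)" using glue_decorated[OF m cycles_dangle[OF v1.dangle_axioms]] .
  have cyc: "cycles (glue m v1 v2 e) = cycles v1" by (simp add: glue_def)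
  have "type_I (glue m v1 v2 e) \<or> type_II (glue m v1 v2 e)"
  proof (cases "label_plus l")
    case True
    have p: "\<forall>a\<in>arcs v1. blobs a = 0" "\<forall>a\<in>arcs v2. blobs a = 0" "nonlines v1 \<noteq> {}"
      using label_dangles_plus[OF True] v by blast+
    obtain a where "a \<in> nonlines v1" using p(3) by blast
    hence "up 0 a \<in> hor 0 (arcs (glue m v1 v2 e))" unfolding hor_glue by (rule imageI)
    hence "\<exists>a\<in>arcs (glue m v1 v2 e). horizontal a" using hor_horizontal unfolding hor_def by blast
    thus ?thesis using glue_plain[OF p(1,2)] cyc c True by (simp add: type_I_def)
  next
    case False
    have "even_blobs (glue m v1 v2 e)"
      using glue_parity[of e] label_dangles_even[OF l n v(1)] label_dangles_even[OF l n v(2)] by simp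
    thus ?thesis using cyc c False by (simp add: type_II_def)
  qed
  thus ?thesis using dec glue_blobs_le cyc c unfolding Adm_def admissible_def by (auto split: if_splits)
qed

text \<open>
  Cut the diagram by \<open>glue_halves\<close>. In type II with vertical arcs, the parity of the
  blobs of each half is made even by the choice of the blob on its leftmost line; both choices are
  consistent because the total is even. Without vertical arcs there is no choice, and the common
  parity of the halves selects one of the two half labels.
\<close>

lemma Adm_glue:
  assumes H: "H \<in> Adm"
  obtains l v1 v2 e where "l \<in> labels m n" "v1 \<in> D l" "v2 \<in> D l"
    "keys e \<subseteq> {..<n - 2 * label_size n l}" "H = glue m v1 v2 e"
    "label_plus l \<longleftrightarrow> cycles H \<noteq> {#}" "label_size n l = card (hor 0 (arcs H))"
proof -
  have H': "admissible m n H" using H by (simp add: Adm_def)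
  have dec: "decorated_tangle m n H" and bl: "\<And>a. a \<in> arcs H \<Longrightarrow> blobs a \<le> 1"
    and cy: "\<forall>(r, s)\<in>#cycles H. s \<le> 1" and type: "type_I H \<or> type_II H"
    using H' by (auto simp: admissible_def)
  have p: "planar_matching n (arcs H)" using decorated_planar[OF dec] .
  interpret H: planar n "arcs H" using p by (simp add: planar_def)
  interpret F: planar n "arcs (flip H)" using H.planar_flip by (simp add: planar_def)
  define L where "L = sorted_list_of_set (top_lines (arcs H))"
  obtain e :: "nat \<Rightarrow>\<^sub>0 nat" and \<beta> :: nat where e: "keys e \<subseteq> {..<length L}" and \<beta>: "\<beta> \<le> 1"
    and gl: "\<forall>b b'. b \<le> 1 \<longrightarrow> b' \<le> 1 \<longrightarrow> (b + b') mod 2 = \<beta> \<longrightarrow> glue m (half b H) (half b' (flip H)) e = H"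
    and ex: "\<forall>j < length L. \<exists>a\<in>arcs H. ends a = {(0, L ! j), (1, sorted_list_of_set (top_lines (arcs (flip H))) ! j)}
       \<and> dots a = lookup e j \<and> blobs a = (if j = 0 then \<beta> else 0)"
    by (rule glue_halves[OF dec bl cy m, folded L_def], assumption, rule that, assumption+)
  define k where "k = card (hor 0 (arcs H))"
  have half: "dangle m n k (half b H)" if "b \<le> 1" for b
    unfolding dangle_def k_def by (rule H.half_dangle[OF refl dec bl cy that m])
  have blF: "blobs a \<le> 1" if "a \<in> arcs (flip H)" for a using that bl by auto
  have kF: "card (hor 0 (arcs (flip H))) = k"
    using hor_flip(2)[OF p] card_image[OF inj_on_subset[OF H.flip_arc_inj], of "hor 1 (arcs H)"] H.card_hor
    by (simp add: hor_def k_def)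
  have halfF: "dangle m n k (half b (flip H))" if "b \<le> 1" for b
    using F.half_dangle[OF refl decorated_flip[OF dec] blF _ that m] cy kF unfolding dangle_def by simp
  define q where "q = (\<Sum>a\<in>down ` hor 0 (arcs H). blobs a)"
  define b where "b = q mod 2"
  \<comment> \<open>\<open>b\<close> makes the upper half even if there is a line; then \<open>b'\<close> is forced by \<open>glue_halves\<close>.\<close>
  define b' where "b' = (b + \<beta>) mod 2"
  have b1: "b \<le> 1" "b' \<le> 1" unfolding b_def b'_def by linarith+
  have bb: "(b + b') mod 2 = \<beta>" using \<beta> b1(1) unfolding b'_def by (auto simp: le_Suc_eq)
  have H_eq: "H = glue m (half b H) (half b' (flip H)) e" using gl b1 bb by simp
  interpret dangle_pair m n k "half b H" "half b' (flip H)"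
    using half[OF b1(1)] halfF[OF b1(2)] by (simp add: dangle_pair_def)
  have len: "lines (half b H) = L" using H.half_parts(2)[OF refl half[OF b1(1)]] by (simp add: L_def)
  have nk: "n = 2 * k + length L" using v1.length_lines len by simp
  have sum: "(\<Sum>a\<in>arcs (half b H). blobs a) = q + (if L = [] then 0 else b)"
  proof -
    have "line_blobs (half b H) 0 = b" if "L \<noteq> []"
      using H.half_parts(3)[OF refl half[OF b1(1)], of 0] that unfolding len by simp
    thus ?thesis unfolding v1.sum_blobs len H.half_parts(1)[OF refl half[OF b1(1)]] q_def by simp
  qed
  have cyc: "cycles (half b H) = cycles H" "cycles (half b' (flip H)) = cycles H" by (simp_all add: half_def)
  have key: "keys e \<subseteq> {..<n - 2 * k}" using e nk by simp
  show ?thesis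
  proof (cases "type_I H")
    case True
    have plain: "\<forall>a\<in>arcs H. blobs a = 0" and c: "cycles H = {#(0, 1)#}" and hz: "\<exists>a\<in>arcs H. horizontal a"
      using True by (auto simp: type_I_def)
    have q0: "q = 0" unfolding q_def by (rule sum.neutral) (use plain in \<open>auto simp: hor_def\<close>)
    have \<beta>0: "\<beta> = 0" if "L \<noteq> []" using ex plain that by fastforce
    have h1: "\<forall>a\<in>arcs (half b H). blobs a = 0"
      using plain q0 by (auto simp: half_def b_def hor_def)
    have h2: "\<forall>a\<in>arcs (half b' (flip H)). blobs a = 0"
    proof
      fix a assume a: "a \<in> arcs (half b' (flip H))"
      show "blobs a = 0"
      proof (cases "a \<in> nonlines (half b' (flip H))")
        case True
        hence "a \<in> down ` hor 0 (arcs (flip H))" using F.half_parts(1)[OF refl halfF[OF b1(2)]] by simp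
        thus ?thesis using plain by (auto simp: hor_def)
      next
        case False
        then obtain i where i: "ends a = {i}" using a v2.line_iff[of a] by (auto simp: nonlines_def)
        hence "i \<in> set (lines (half b' (flip H)))" using a v2.set_lines v2.line_positions_def by auto
        hence "L \<noteq> []" using length_eq len by auto
        hence "b' = 0" using \<beta>0 q0 by (simp add: b'_def b_def)
        thus ?thesis using a F.half_parts(1)[OF refl halfF[OF b1(2)]] False by (auto simp: half_def)
      qed
    qed
    have hne: "hor 0 (arcs H) \<noteq> {}" using hz H.horizontal_hor H.hor_nonempty by blast
    hence k1: "1 \<le> k" unfolding k_def
      using finite_subset[OF _ H.finite_arcs, of "hor 0 (arcs H)"] by (simp add: hor_def Suc_le_eq card_gt_0_iff)
    let ?l = "Plus k (replicate (n - 2 * k) m)"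
    have l: "?l \<in> labels m n" using nk k1 m by (intro labels_intros) (auto simp: multi_indices_def)
    have ne: "nonlines (half b H) \<noteq> {}" "nonlines (half b' (flip H)) \<noteq> {}"
      using v1.card_nonlines v2.card_nonlines k1 by auto
    show ?thesis
      by (rule that[of ?l "half b H" "half b' (flip H)" e])
        (use l h1 h2 ne cyc c key H_eq v1.dangle v2.dangle in \<open>simp_all add: label_dangles_plus k_def[symmetric] del: label_dangles.simps\<close>)
  next
    case False
    hence c: "cycles H = {#}" and ev: "even_blobs H" using type by (auto simp: type_II_def)
    define l where "l = (if L \<noteq> [] then Minus k (replicate (n - 2 * k) m) else if even q then Half 1 else Half 2)"
    have l: "l \<in> labels m n" unfolding l_def using nk m by (auto intro!: labels_intros simp: multi_indices_def)
    have lp: "\<not> label_plus l" and ls: "label_size n l = k" using nk by (auto simp: l_def)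
    have e1: "even_blobs (half b H) \<longleftrightarrow> l \<noteq> Half 2"
      unfolding sum by (auto simp: l_def b_def)
    have e2: "even_blobs (half b' (flip H)) \<longleftrightarrow> even_blobs (half b H)"
      using glue_parity[of e] ev H_eq by simp
    show ?thesis
      by (rule that[of l "half b H" "half b' (flip H)" e])
        (use l lp ls e1 e2 cyc c key H_eq v1.dangle v2.dangle in \<open>simp_all add: label_dangles_minus[OF l n lp] k_def[symmetric]\<close>)
  qed
qed

text \<open>
  The dangles are recovered from the horizontal arcs, the cycles and the parity of blobs, and the
  exponents from the vertical arcs. Labels are recovered except for their index, which
  \<open>glue\<close> does not involve.
\<close>

lemma glue_injective:
  assumes l: "l \<in> labels m n" "l' \<in> labels m n" and v: "v1 \<in> D l" "v2 \<in> D l" "v1' \<in> D l'" "v2' \<in> D l'"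
    and eq: "glue m v1 v2 e = glue m v1' v2' e'"
  shows "v1 = v1'" "v2 = v2'" "label_plus l = label_plus l'" "label_size n l = label_size n l'"
    "\<And>j. j < n - 2 * label_size n l \<Longrightarrow> lookup e j mod m = lookup e' j mod m"
    "label_index l = label_index l' \<Longrightarrow> l = l'"
proof -
  interpret a: dangle_pair m n "label_size n l" v1 v2 using label_pair[OF l(1) v(1,2)] .
  interpret b: dangle_pair m n "label_size n l'" v1' v2' using label_pair[OF l(2) v(3,4)] .
  have "cycles v1 = cycles v1'" using arg_cong[OF eq, of cycles] by (simp add: glue_def)
  thus pl: "label_plus l = label_plus l'"
    using label_dangles_cycles[OF l(1) n v(1)] label_dangles_cycles[OF l(2) n v(3)] by (simp split: if_splits)
  have c: "cycles v1 = cycles v1'" "cycles v2 = cycles v2'"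
    using label_dangles_cycles[OF l(1) n] label_dangles_cycles[OF l(2) n] v pl by simp_all
  have "up 0 ` nonlines v1 = up 0 ` nonlines v1'" "up 1 ` nonlines v2 = up 1 ` nonlines v2'"
    using a.hor_glue[of e] b.hor_glue[of e'] eq by simp_all
  hence nl: "nonlines v1 = nonlines v1'" "nonlines v2 = nonlines v2'"
    by (simp_all only: inj_image_eq_iff[OF up_inj])
  thus sz: "label_size n l = label_size n l'" using a.v1.card_nonlines b.v1.card_nonlines by simp
  have par: "even_blobs v \<longleftrightarrow> even_blobs w"
    if h: "v \<in> D l" "w \<in> D l'" "nonlines v = nonlines w" for v w
  proof -
    interpret p: dangle m n "label_size n l" v using label_dangles_dangle[OF l(1) n h(1)] .
    interpret q: dangle m n "label_size n l'" w using label_dangles_dangle[OF l(2) n h(2)] .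
    show ?thesis
    proof (cases "lines v = []")
      case True
      hence "lines w = []" using p.length_lines q.length_lines sz by simp
      thus ?thesis using p.sum_blobs q.sum_blobs True h(3) by simp
    next
      case False
      hence "length (lines v) \<noteq> 0" by simp
      hence "2 * label_size n l \<noteq> n" using p.length_lines by linarith
      hence "l \<noteq> Half 2" "l' \<noteq> Half 2" using sz half_label l by fastforce+
      thus ?thesis using label_dangles_even[OF l(1) n h(1)] label_dangles_even[OF l(2) n h(2)] by simp
    qed
  qed
  show eq1: "v1 = v1'" by (rule dangle_eqI[OF a.v1.dangle_axioms b.v1.dangle_axioms nl(1) c(1) par[OF v(1,3) nl(1)]])
  show eq2: "v2 = v2'" by (rule dangle_eqI[OF a.v2.dangle_axioms b.v2.dangle_axioms nl(2) c(2) par[OF v(2,4) nl(2)]])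
  show "lookup e j mod m = lookup e' j mod m" if j: "j < n - 2 * label_size n l" for j
  proof -
    have j': "j < length (lines v1)" using j a.v1.length_lines by simp
    have m1: "vertical_arc m v1 v2 e j \<in> arcs (glue m v1 v2 e)" unfolding a.glue_arcs using j' by simp
    have "vertical_arc m v1' v2' e' j \<in> arcs (glue m v1' v2' e')"
      unfolding b.glue_arcs using j' eq1 by simp
    hence m2: "vertical_arc m v1 v2 e' j \<in> arcs (glue m v1 v2 e)" unfolding eq unfolding eq1 eq2 .
    interpret planar n "arcs (glue m v1 v2 e)" using a.glue_planar by (simp add: planar_def)
    have "vertical_arc m v1 v2 e j = vertical_arc m v1 v2 e' j"
      by (rule arc_unique[OF m1 m2, of "(0, lines v1 ! j)"]) (simp_all add: vertical_arc_def)
    thus ?thesis by (simp add: vertical_arc_def)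
  qed
  show "l = l'" if idx: "label_index l = label_index l'"
  proof -
    have ev: "l \<noteq> Half 2 \<longleftrightarrow> l' \<noteq> Half 2"
      using label_dangles_even[OF l(1) n v(1)] label_dangles_even[OF l(2) n v(3)] eq1 by simp
    show ?thesis using l(1) n
    proof (cases rule: labels_cases)
      case (plus k I)
      thus ?thesis using pl sz idx by (cases l') auto
    next
      case (minus k I)
      show ?thesis using l(2) n by (cases rule: labels_cases) (use minus pl sz idx in auto)
    next
      case (half j)
      show ?thesis using l(2) n by (cases rule: labels_cases) (use half pl sz ev in auto)
    qed
  qed
qed

text \<open>Dangles embed into the finite set of diagrams by gluing a dangle to itself.\<close>

lemma finite_D:
  assumes l: "l \<in> labels m n"
  shows "finite (D l)"
proof (rule finite_imageD)
  show "finite ((\<lambda>v. glue m v v 0) ` D l)"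
    by (rule finite_subset[OF _ finite_Adm]) (intro image_subsetI glue_Adm[OF l])
  show "inj_on (\<lambda>v. glue m v v 0) (D l)"
    by (rule inj_onI) (rule glue_injective(1)[OF l l])
qed

end

section \<open>The cellular basis\<close>

lemma (in planar) card_hor_reduced:
  assumes "arcs G = A"
  shows "card (hor r (arcs (reduced G))) = card (hor r (arcs G))"
proof -
  have "hor r (arcs (reduced G)) = reblob (reduced_blobs G) ` hor r (arcs G)"
    unfolding hor_def reduced_def diagram.sel by (rule filter_image) simp
  moreover have "inj_on (reblob (reduced_blobs G)) (hor r (arcs G))"
    by (rule inj_onI) (use inj_onD[OF inj_ends] assms in \<open>simp add: reblob_def hor_def\<close>)
  ultimately show ?thesis by (simp add: card_image)
qed

lemma flip_glue:
  assumes "dangle_pair m n k v1 v2" "cycles v1 = cycles v2"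
  shows "flip (glue m v1 v2 e) = glue m v2 v1 e"
  using dangle_pair.glue_swap[OF assms(1), of e] assms(2)
  by (cases "glue m v2 v1 e") (simp add: flip_eq glue_def)

context parameters
begin

lemma additive_sum:
  assumes "finite S" "\<And>x. x \<in> S \<Longrightarrow> g x \<in> A"
    and F: "\<And>x y. x \<in> A \<Longrightarrow> y \<in> A \<Longrightarrow> F (x + y) = F x + F y" "\<And>c x. x \<in> A \<Longrightarrow> F (scale_pm c x) = scale_pm c (F x)"
  shows "F (\<Sum>x\<in>S. scale_pm (c x) (g x)) = (\<Sum>x\<in>S. scale_pm (c x) (F (g x)))"
  using assms(1,2)
proof (induction S rule: finite_induct)
  case empty
  show ?case using F(2)[OF zero_A, of 0] by simp
next
  case (insert y S)
  have "(\<Sum>x\<in>S. scale_pm (c x) (g x)) \<in> A"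
    using insert by (intro pm.subspace_sum[OF subspace_A] pm.subspace_scale[OF subspace_A]) simp
  thus ?case using insert F pm.subspace_scale[OF subspace_A] by simp
qed

lemma E_inj: "inj E"
proof (rule injI)
  fix G H assume "E G = E H"
  hence "keys (E G) = keys (E H)" by simp
  thus "G = H" by (simp add: E_def)
qed

lemma E_independent: "pm.independent (E ` Adm)"
proof (rule notI)
  assume "pm.dependent (E ` Adm)"
  then obtain u where u: "\<exists>x\<in>E ` Adm. u x \<noteq> 0" "(\<Sum>x\<in>E ` Adm. scale_pm (u x) x) = 0"
    using finite_Adm by (auto simp: pm.dependent_finite)
  obtain H where H: "H \<in> Adm" "u (E H) \<noteq> 0" using u(1) by blast
  have "(\<Sum>G\<in>Adm. scale_pm (u (E G)) (E G)) = 0"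
    using u(2) by (simp add: sum.reindex inj_on_subset[OF E_inj])
  hence "(\<Sum>G\<in>Adm. lookup (scale_pm (u (E G)) (E G)) H) = 0"
    using lookup_sum[of "\<lambda>G. scale_pm (u (E G)) (E G)" Adm H] by simp
  moreover have "lookup (scale_pm (u (E G)) (E G)) H = (if G = H then u (E H) else 0)" for G
    by (simp add: E_def lookup_single when_def)
  ultimately show False using H finite_Adm by simp
qed

lemma E_span: "pm.span (E ` Adm) = A"
proof
  show "pm.span (E ` Adm) \<subseteq> A" using E_in by (intro pm.span_minimal subspace_A) blast
  show "A \<subseteq> pm.span (E ` Adm)"
  proof
    fix f assume "f \<in> A"
    thus "f \<in> pm.span (E ` Adm)"
      by (subst A_expand, assumption) (rule pm.span_sum, rule pm.span_scale, rule pm.span_base, rule imageI)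
  qed
qed

lemma dim_A: "pm.dim A = card Adm"
proof -
  have "pm.dim A = card (E ` Adm)" using E_span by (intro pm.dim_eq_card[OF _ E_independent]) (metis pm.span_span)
  thus ?thesis by (simp add: card_image inj_on_subset[OF E_inj])
qed

text \<open>
  A spanning family with at most as many members as the dimension contains a basis, which can
  leave out or identify no member.
\<close>

lemma spanning_family_basis:
  assumes X: "finite X" "card X \<le> card Adm" and span: "pm.span (f ` X) = A"
  shows "inj_on f X" "pm.independent (f ` X)"
proof -
  obtain B where B: "B \<subseteq> f ` X" "pm.independent B" "f ` X \<subseteq> pm.span B"
    using pm.maximal_independent_subset[of "f ` X"] by blast
  have "pm.span B = pm.span (f ` X)"
    using B(1,3) by (metis pm.span_mono pm.span_minimal pm.subspace_span subset_antisym)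
  hence "pm.span B = pm.span A" using span by (metis pm.span_span)
  hence cB: "card B = card Adm" using pm.dim_eq_card[OF _ B(2)] dim_A by metis
  have fin: "finite (f ` X)" using X(1) by simp
  have le: "card B \<le> card (f ` X)" "card (f ` X) \<le> card X" using card_mono[OF fin B(1)] card_image_le[OF X(1)] by blast+
  hence "card (f ` X) = card X" "card B = card (f ` X)" using X(2) cB by linarith+
  thus "inj_on f X" "pm.independent (f ` X)"
    using eq_card_imp_inj_on[OF X(1)] card_subset_eq[OF fin B(1)] B(2) by auto
qed

end

context cells
begin

abbreviation C where "C \<equiv> cell_basis m \<xi>"
abbreviation M where "M \<equiv> cell_index m n"

lemma tensor_expand_keys:
  "T v1 v2 w = (\<Sum>e\<in>keys w. scale_pm (lookup w e) (E (glue m v1 v2 e)))"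
  by (rule tensor_expand) simp_all

lemma tensor_in:
  assumes "l \<in> labels m n" "v1 \<in> D l" "v2 \<in> D l"
  shows "T v1 v2 w \<in> A"
  unfolding tensor_expand_keys
  by (intro pm.subspace_sum[OF subspace_A] pm.subspace_scale[OF subspace_A] E_in glue_Adm[OF assms])

lemma inv_tensor:
  assumes l: "l \<in> labels m n" and v: "v1 \<in> D l" "v2 \<in> D l"
  shows "inv (T v1 v2 w) = T v2 v1 w"
proof -
  have "cycles v1 = cycles v2" using label_dangles_cycles[OF l n] v by simp
  note fl = flip_glue[OF label_pair[OF l v] this]
  have "inv (T v1 v2 w) = (\<Sum>e\<in>keys w. scale_pm (lookup w e) (inv (E (glue m v1 v2 e))))"
    unfolding tensor_expand_keys
    by (rule additive_sum[OF finite_keys E_in[OF glue_Adm[OF l v]] inv_add inv_scale])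
  thus ?thesis by (simp add: inv_E fl tensor_expand_keys)
qed

lemma mult_tensor:
  assumes G: "G \<in> Adm" and l: "l \<in> labels m n" and v: "v1 \<in> D l" "v2 \<in> D l"
  shows "mult (E G) (T v1 v2 w) = (\<Sum>e\<in>keys w. scale_pm (lookup w e)
    (scale_pm (prod_coeff G (glue m v1 v2 e)) (E (prod_tangle G (glue m v1 v2 e)))))"
proof -
  have "mult (E G) (T v1 v2 w) = (\<Sum>e\<in>keys w. scale_pm (lookup w e) (mult (E G) (E (glue m v1 v2 e))))"
    unfolding tensor_expand_keys
    by (rule additive_sum[OF finite_keys E_in[OF glue_Adm[OF l v]] mult_add_right[OF _ _ E_in[OF G]] mult_scale_right[OF E_in[OF G]]])
  thus ?thesis by (simp add: mult_E[OF G glue_Adm[OF l v]])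
qed

definition cells_with :: "(label \<Rightarrow> bool) \<Rightarrow> (tangle \<Rightarrow>\<^sub>0 'k) set" where
  "cells_with Q = {C l U V | l U V. l \<in> labels m n \<and> Q l \<and> U \<in> M l \<and> V \<in> M l}"

lemma cells_with_mono: "(\<And>l. l \<in> labels m n \<Longrightarrow> Q l \<Longrightarrow> Q' l) \<Longrightarrow> cells_with Q \<subseteq> cells_with Q'"
  unfolding cells_with_def by blast

lemma tensor_cell:
  assumes l: "l \<in> labels m n" and v: "v1 \<in> D l" "v2 \<in> D l" and J: "J \<in> multi_indices m (n - 2 * label_size n l)"
  shows "T v1 v2 (C11 m \<xi> J) = C (with_index l J) (v1, J) (v2, J)"
    "(v1, J) \<in> M (with_index l J)" "(v2, J) \<in> M (with_index l J)"
  using with_index(2,3)[OF l n J] v by (simp_all add: cell_basis_def cell_index_eq)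

text \<open>
  The index \<open>(m, \<dots>, m)\<close> has \<open>C\<^sub>I = 1\<close>, so
  \<open>monomial_action\<close> expresses the diagram with exponents \<open>e\<close> by cell
  elements of the same two dangles.
\<close>

lemma Adm_span:
  assumes H: "H \<in> Adm"
  shows "E H \<in> pm.span (cells_with (\<lambda>l. (label_plus l \<longleftrightarrow> cycles H \<noteq> {#}) \<and> label_size n l = card (hor 0 (arcs H))))"
    (is "_ \<in> pm.span (cells_with ?Q)")
proof -
  obtain l v1 v2 e where l: "l \<in> labels m n" "?Q l" and v: "v1 \<in> D l" "v2 \<in> D l"
    and e: "keys e \<subseteq> {..<n - 2 * label_size n l}" and H_eq: "H = glue m v1 v2 e"
    by (rule Adm_glue[OF H]) blast
  let ?r = "n - 2 * label_size n l"
  let ?I = "replicate ?r m"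
  have I: "?I \<in> multi_indices m ?r" using m by (auto simp: multi_indices_def)
  have mem: "T v1 v2 (C11 m \<xi> J) \<in> cells_with ?Q" if J: "J \<in> multi_indices m ?r" for J
  proof -
    note t = tensor_cell[OF l(1) v J]
    show ?thesis unfolding t(1) cells_with_def
      using with_index[OF l(1) n J] l(2) t(2,3) by (intro CollectI exI[of _ "with_index l J"] exI[of _ "(v1, J)"] exI[of _ "(v2, J)"] conjI refl) simp_all
  qed
  have "below v1 v2 ?I \<subseteq> cells_with ?Q" using mem unfolding below_def by auto
  hence a: "T v1 v2 (single e 1 * C11 m \<xi> ?I) -
      scale_pm (\<Prod>j<?r. \<xi> (?I ! j) ^ lookup e j) (T v1 v2 (C11 m \<xi> ?I)) \<in> pm.span (cells_with ?Q)"
    using monomial_action[OF e I] pm.span_mono by blast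
  have b: "scale_pm (\<Prod>j<?r. \<xi> (?I ! j) ^ lookup e j) (T v1 v2 (C11 m \<xi> ?I)) \<in> pm.span (cells_with ?Q)"
    by (intro pm.span_scale pm.span_base mem I)
  have "T v1 v2 (single e 1 * C11 m \<xi> ?I) \<in> pm.span (cells_with ?Q)"
    using pm.span_add[OF a b] by simp
  thus ?thesis unfolding H_eq C11_top by (simp add: tensor_single)
qed

definition lower :: "label \<Rightarrow> (tangle \<Rightarrow>\<^sub>0 'k) set" where
  "lower l = cells_with (\<lambda>l'. label_le l' l \<and> l' \<noteq> l)"

text \<open>
  More horizontal arcs lead to lower cells of the same type, and a closed cycle with a blob leads
  from type II to type I.
\<close>

lemma Adm_lower:
  assumes l: "l \<in> labels m n" and H: "H \<in> Adm"
    and low: "(cycles H \<noteq> {#} \<longleftrightarrow> label_plus l) \<and> label_size n l < card (hor 0 (arcs H)) \<or> cycles H \<noteq> {#} \<and> \<not> label_plus l"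
  shows "E H \<in> pm.span (lower l)"
proof -
  have "cells_with (\<lambda>l'. (label_plus l' \<longleftrightarrow> cycles H \<noteq> {#}) \<and> label_size n l' = card (hor 0 (arcs H))) \<subseteq> lower l"
    unfolding lower_def
  proof (rule cells_with_mono)
    fix l' assume l': "l' \<in> labels m n" "(label_plus l' \<longleftrightarrow> cycles H \<noteq> {#}) \<and> label_size n l' = card (hor 0 (arcs H))"
    hence "label_plus l' = label_plus l \<and> label_size n l < label_size n l' \<or> label_plus l' \<and> \<not> label_plus l"
      using low by auto
    from label_lower[OF l l'(1) n this] show "label_le l' l \<and> l' \<noteq> l" by blast
  qed
  from pm.span_mono[OF this] Adm_span[OF H] show ?thesis by blast
qed

text \<open>
  Membership of the new upper half can be read off from one glued diagram, since the blobs of the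
  other half are known.
\<close>

lemma glue_memD:
  assumes l: "l \<in> labels m n" and v2: "v2 \<in> D l" and v: "dangle m n (label_size n l) v"
    and H: "glue m v v2 e \<in> Adm" and cyc: "cycles v = (if label_plus l then {#(0, 1)#} else {#})"
  shows "v \<in> D l"
proof -
  interpret dangle_pair m n "label_size n l" v v2
    using v label_dangles_dangle[OF l n v2] by (simp add: dangle_pair_def)
  have H': "admissible m n (glue m v v2 e)" using H by (simp add: Adm_def)
  have gc: "cycles (glue m v v2 e) = cycles v" by (simp add: glue_def)
  show ?thesis
  proof (cases "label_plus l")
    case True
    have "type_I (glue m v v2 e)" using H' gc cyc True by (auto simp: admissible_def type_II_def)
    hence plain: "\<forall>a\<in>arcs (glue m v v2 e). blobs a = 0" by (simp add: type_I_def)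
    have p2: "\<forall>a\<in>arcs v2. blobs a = 0" using v2 label_dangles_plus[OF True] by blast
    have "blobs a = 0" if a: "a \<in> arcs v" for a
    proof (cases "is_line a")
      case True
      then obtain i where i: "ends a = {i}" using v1.line_iff[of a] by blast
      hence "i \<in> set (lines v)" using a v1.set_lines v1.line_positions_def by auto
      then obtain j where j: "j < length (lines v)" "lines v ! j = i" by (auto simp: in_set_conv_nth)
      obtain b where b: "b \<in> arcs v" "ends b = {lines v ! j}" "line_blobs v j = blobs b" using v1.line_arc[OF j(1)] .
      have "a = b" using inj_onD[OF v1.inj_ends, of a b] a b i j by simp
      have "vertical_arc m v v2 e j \<in> arcs (glue m v v2 e)" unfolding glue_arcs using j by simp
      hence "(line_blobs v j + line_blobs v2 j) mod 2 = 0" using plain by (auto simp: vertical_arc_def)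
      moreover have "line_blobs v2 j = 0" using v2.line_blobs_plain[OF p2, of j] j length_eq by simp
      moreover have "line_blobs v j \<le> 1" using v1.line_blobs_le[OF j(1)] .
      ultimately show ?thesis using b(3) \<open>a = b\<close> by simp
    next
      case False
      hence "up 0 a \<in> arcs (glue m v v2 e)" unfolding glue_arcs using a by (simp add: nonlines_def)
      hence "blobs (up 0 a) = 0" using plain by blast
      thus ?thesis by simp
    qed
    moreover have "label_size n l \<ge> 1" using l n by (cases rule: labels_cases) (use True in auto)
    hence "nonlines v \<noteq> {}" using v1.card_nonlines by auto
    ultimately show ?thesis using cyc True v1.dangle unfolding label_dangles_plus[OF True] by simp
  next
    case False
    have "type_II (glue m v v2 e)" using H' gc cyc False by (auto simp: admissible_def type_I_def)
    hence "even_blobs v \<longleftrightarrow> even_blobs v2" using glue_parity[of e] by (simp add: type_II_def)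
    thus ?thesis
      using cyc False v1.dangle label_dangles_even[OF l n v2] unfolding label_dangles_minus[OF l n False] by simp
  qed
qed

text \<open>
  If the action increases the number of horizontal arcs, or produces a closed cycle with a blob
  from type II, then all products lie in lower cells. Otherwise the product is the value of the
  cycles times the action of a monomial on \<open>C\<^sub>I\<close> with a new upper dangle that
  does not depend on the lower one.
\<close>

lemma cell_action:
  assumes G: "G \<in> Adm" and l: "l \<in> labels m n" and v1: "v1 \<in> D l"
  defines "I \<equiv> label_index l"
  shows "\<exists>r. \<forall>v2\<in>D l. mult (E G) (C l (v1, I) (v2, I)) - (\<Sum>U\<in>M l. scale_pm (r U) (C l U (v2, I))) \<in> pm.span (lower l)"
proof -
  let ?k = "label_size n l"
  have dG: "decorated_tangle m n G" using G admissible_decorated by (simp add: Adm_def)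
  have d1: "dangle m n ?k v1" using label_dangles_dangle[OF l n v1] .
  have I: "I \<in> multi_indices m (n - 2 * ?k)" unfolding I_def using label_index[OF l n] .
  have C: "C l (v, I) (w, I) = T v w (C11 m \<xi> I)" for v w by (simp add: cell_basis_def I_def)
  have H: "prod_tangle G (glue m v1 v2 e) \<in> Adm" if "v2 \<in> D l" for v2 e
    using prod_Adm[OF G glue_Adm[OF l v1 that]] .
  have cH: "cycles (prod_tangle G H) = (if odd_cycles (cycles (compose m G H)) = 0 then {#} else {#(0, 1)#})" for H
    by (simp add: reduced_def)
  have odd: "odd_cycles (cycles (compose m G (glue m v1 v2 e))) \<noteq> 0" if "label_plus l" "v2 \<in> D l" for v2 e
    using label_dangles_cycles[OF l n v1] that(1) by (simp add: compose_def glue_def)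
  have all_low: ?thesis
    if low: "\<And>v2 e. v2 \<in> D l \<Longrightarrow> E (prod_tangle G (glue m v1 v2 e)) \<in> pm.span (lower l)"
  proof (intro exI[of _ "\<lambda>U. 0"] ballI)
    fix v2 assume v2: "v2 \<in> D l"
    show "mult (E G) (C l (v1, I) (v2, I)) - (\<Sum>U\<in>M l. scale_pm 0 (C l U (v2, I))) \<in> pm.span (lower l)"
      unfolding C mult_tensor[OF G l v1 v2] by (simp, intro pm.span_sum pm.span_scale low v2)
  qed
  show ?thesis
    using tangle_action[OF dG d1]
  proof (elim disjE exE conjE)
    assume more: "\<forall>v2 e. dangle m n ?k v2 \<longrightarrow> ?k < card (hor 0 (arcs (compose m G (glue m v1 v2 e))))"
    show ?thesis
    proof (rule all_low)
      fix v2 e assume v2: "v2 \<in> D l"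
      have "planar_matching n (arcs (compose m G (glue m v1 v2 e)))"
        using planar_compose[OF decorated_planar[OF dG] dangle_pair.glue_planar[OF label_pair[OF l v1 v2]] m] .
      then interpret planar n "arcs (compose m G (glue m v1 v2 e))" by (simp add: planar_def)
      have "?k < card (hor 0 (arcs (prod_tangle G (glue m v1 v2 e))))"
        unfolding card_hor_reduced[OF refl] using more label_dangles_dangle[OF l n v2] by blast
      thus "E (prod_tangle G (glue m v1 v2 e)) \<in> pm.span (lower l)"
        using odd[OF _ v2, of e] cH[of "glue m v1 v2 e"] by (intro Adm_lower[OF l H[OF v2]]) (auto split: if_splits)
    qed
  next
    fix v1' d Z
    assume d1': "dangle m n ?k v1'" and act: "\<forall>v2 e. dangle m n ?k v2 \<longrightarrow>
      cycles (compose m G (glue m v1 v2 e)) = Z \<and> (odd_cycles Z = 0 \<or> (\<forall>a\<in>arcs v2. blobs a = 0) \<longrightarrow>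
        prod_tangle G (glue m v1 v2 e) = glue m v1' v2 (d + e))"
    have Z: "cycles (compose m G (glue m v1 v2 e)) = Z" if "v2 \<in> D l" for v2 e
      using act label_dangles_dangle[OF l n that] by blast
    show ?thesis
    proof (cases "odd_cycles Z \<noteq> 0 \<and> \<not> label_plus l")
      case True
      show ?thesis
        by (rule all_low, rule Adm_lower[OF l H], assumption) (use cH Z True in simp)
    next
      case False
      have prod: "prod_tangle G (glue m v1 v2 e) = glue m v1' v2 (d + e)" if v2: "v2 \<in> D l" for v2 e
      proof -
        have "odd_cycles Z = 0 \<or> (\<forall>a\<in>arcs v2. blobs a = 0)" using False v2 label_dangles_plus by blast
        thus ?thesis using act label_dangles_dangle[OF l n v2] by blast
      qed
      have v1': "v1' \<in> D l"
      proof (rule glue_memD[OF l v1 d1'])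
        show "glue m v1' v1 (d + 0) \<in> Adm" using H[OF v1, of 0] unfolding prod[OF v1] .
        have "cycles v1' = cycles (prod_tangle G (glue m v1 v1 0))" unfolding prod[OF v1] by (simp add: glue_def)
        thus "cycles v1' = (if label_plus l then {#(0, 1)#} else {#})"
          using cH[of "glue m v1 v1 0"] odd[OF _ v1, of 0] False Z[OF v1, of 0] by auto
      qed
      interpret v1': dangle m n ?k v1' by fact
      let ?r = "n - 2 * ?k"
      obtain d' :: "nat \<Rightarrow>\<^sub>0 nat" where d': "\<forall>j<?r. lookup d' j = lookup d j" "keys d' \<subseteq> {..<?r}"
        using finite_pm[of ?r "lookup d"] by blast
      have dd: "glue m v1' v2 (d + e) = glue m v1' v2 (d' + e)" for v2 e
        by (rule glue_periodic) (use d' v1'.length_lines in \<open>simp add: lookup_add\<close>)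
      define \<kappa> where "\<kappa> = cycle_value \<delta> Z"
      define c where "c = (\<Prod>j<?r. \<xi> (I ! j) ^ lookup d' j)"
      define r where "r U = (if U = (v1', I) then \<kappa> * c else 0)" for U
      have "mult (E G) (C l (v1, I) (v2, I)) - (\<Sum>U\<in>M l. scale_pm (r U) (C l U (v2, I))) \<in> pm.span (lower l)"
        if v2: "v2 \<in> D l" for v2
      proof -
        have "mult (E G) (C l (v1, I) (v2, I)) = scale_pm \<kappa> (T v1' v2 (single d' 1 * C11 m \<xi> I))"
          unfolding C mult_tensor[OF G l v1 v2] tensor_single_mult prod[OF v2] dd Z[OF v2] \<kappa>_def[symmetric]
          by (simp add: pm.scale_sum_right ac_simps)
        moreover have "(\<Sum>U\<in>M l. scale_pm (r U) (C l U (v2, I))) = scale_pm (\<kappa> * c) (T v1' v2 (C11 m \<xi> I))"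
        proof -
          have "(v1', I) \<in> M l" using v1' by (simp add: cell_index_eq I_def)
          moreover have "finite (M l)" using finite_D[OF l] by (simp add: cell_index_eq)
          moreover have "scale_pm (r U) (C l U (v2, I)) = (if U = (v1', I) then scale_pm (\<kappa> * c) (C l (v1', I) (v2, I)) else 0)" for U
            by (simp add: r_def)
          ultimately show ?thesis by (simp add: C)
        qed
        moreover have "T v1' v2 (single d' 1 * C11 m \<xi> I) - scale_pm c (T v1' v2 (C11 m \<xi> I)) \<in> pm.span (lower l)"
        proof -
          have "below v1' v2 I \<subseteq> lower l"
          proof
            fix x assume "x \<in> below v1' v2 I"
            then obtain J where J: "x = T v1' v2 (C11 m \<xi> J)" "J \<in> multi_indices m ?r" "list_all2 (\<le>) J I" "J \<noteq> I"
              using I unfolding below_def multi_indices_def by auto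
            note t = tensor_cell[OF l v1' v2 J(2)]
            show "x \<in> lower l" unfolding J(1) t(1) lower_def cells_with_def
              using with_index(1)[OF l n J(2)] with_index_less[OF l n J(2)] J(3,4) t(2,3) unfolding I_def by blast
          qed
          thus ?thesis unfolding c_def using monomial_action[OF d'(2) I] pm.span_mono by blast
        qed
        from pm.span_scale[OF this, of \<kappa>]
        have "scale_pm \<kappa> (T v1' v2 (single d' 1 * C11 m \<xi> I)) - scale_pm (\<kappa> * c) (T v1' v2 (C11 m \<xi> I)) \<in> pm.span (lower l)"
          by (simp add: pm.scale_right_diff_distrib)
        ultimately show ?thesis by simp
      qed
      thus ?thesis by blast
    qed
  qed
qed

lemma finite_M: "l \<in> labels m n \<Longrightarrow> finite (M l)"
  using finite_D by (simp add: cell_index_eq)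

lemma cell_mult:
  assumes a: "a \<in> A" and l: "l \<in> labels m n"
  shows "\<exists>r. \<forall>S\<in>M l. \<forall>U\<in>M l. mult a (C l S U) - (\<Sum>V\<in>M l. scale_pm (r V S) (C l V U)) \<in> pm.span (lower l)"
proof -
  have "\<exists>r. \<forall>U\<in>M l. mult (E G) (C l S U) - (\<Sum>V\<in>M l. scale_pm (r V) (C l V U)) \<in> pm.span (lower l)"
    if "G \<in> Adm" "S \<in> M l" for G S
    using cell_action[OF that(1) l] that(2) unfolding cell_index_eq by fastforce
  note action = this
  define r where "r G S = (SOME r. \<forall>U\<in>M l. mult (E G) (C l S U) - (\<Sum>V\<in>M l. scale_pm (r V) (C l V U)) \<in> pm.span (lower l))" for G S
  have r: "mult (E G) (C l S U) - (\<Sum>V\<in>M l. scale_pm (r G S V) (C l V U)) \<in> pm.span (lower l)"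
    if "G \<in> Adm" "S \<in> M l" "U \<in> M l" for G S U
    using someI_ex[OF action[OF that(1,2)]] that(3) unfolding r_def by (rule bspec)
  define R where "R V S = (\<Sum>G\<in>Adm. lookup a G * r G S V)" for V S
  have "mult a (C l S U) - (\<Sum>V\<in>M l. scale_pm (R V S) (C l V U)) \<in> pm.span (lower l)" if S: "S \<in> M l" "U \<in> M l" for S U
  proof -
    have CA: "C l S U \<in> A" using S tensor_in[OF l] by (auto simp: cell_basis_def cell_index_eq)
    have "mult a (C l S U) = (\<Sum>G\<in>Adm. scale_pm (lookup a G) (mult (E G) (C l S U)))"
      by (subst A_expand[OF a], rule additive_sum[OF finite_Adm E_in mult_add_left[OF _ _ CA] mult_scale_left[OF _ CA]])
    moreover have "(\<Sum>V\<in>M l. scale_pm (R V S) (C l V U)) =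
      (\<Sum>G\<in>Adm. scale_pm (lookup a G) (\<Sum>V\<in>M l. scale_pm (r G S V) (C l V U)))"
      unfolding R_def pm.scale_sum_left pm.scale_sum_right by (subst sum.swap) simp
    ultimately have eq: "mult a (C l S U) - (\<Sum>V\<in>M l. scale_pm (R V S) (C l V U)) =
      (\<Sum>G\<in>Adm. scale_pm (lookup a G) (mult (E G) (C l S U) - (\<Sum>V\<in>M l. scale_pm (r G S V) (C l V U))))"
      by (simp add: pm.scale_right_diff_distrib sum_subtractf)
    show ?thesis unfolding eq by (intro pm.span_sum pm.span_scale r S)
  qed
  thus ?thesis by blast
qed

abbreviation cell_pairs where "cell_pairs \<equiv> SIGMA l:labels m n. M l \<times> M l"

text \<open>
  The cell elements are counted by the diagrams with \<open>m - I ! j\<close> dots on the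
  \<open>j\<close>-th vertical arc. As the entries of \<open>I\<close> range over \<open>1,
  \<dots>, m\<close>, these numbers range over \<open>0, \<dots>, m - 1\<close>.
\<close>

lemma card_cell_pairs: "finite cell_pairs" "card cell_pairs \<le> card Adm"
proof -
  show fin: "finite cell_pairs" using finite_labels[OF n] finite_M by simp
  have "\<exists>e :: nat \<Rightarrow>\<^sub>0 nat. \<forall>j<length (label_index l). lookup e j = m - label_index l ! j" for l
    using finite_pm[of "length (label_index l)" "\<lambda>j. m - label_index l ! j"] by (elim exE conjE) (rule exI)
  then obtain \<epsilon> :: "label \<Rightarrow> nat \<Rightarrow>\<^sub>0 nat"
    where \<epsilon>: "lookup (\<epsilon> l) j = m - label_index l ! j" if "j < length (label_index l)" for l j by metis
  define \<psi> where "\<psi> x = glue m (fst (fst (snd x))) (fst (snd (snd x))) (\<epsilon> (fst x))" for x :: "label \<times> (dangle \<times> nat list) \<times> dangle \<times> nat list"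
  have "inj_on \<psi> cell_pairs"
  proof (rule inj_onI)
    fix x y assume x: "x \<in> cell_pairs" and y: "y \<in> cell_pairs" and eq: "\<psi> x = \<psi> y"
    obtain l v1 v2 where x': "x = (l, (v1, label_index l), (v2, label_index l))" "l \<in> labels m n" "v1 \<in> D l" "v2 \<in> D l"
      using x by (auto simp: cell_index_eq)
    obtain l' w1 w2 where y': "y = (l', (w1, label_index l'), (w2, label_index l'))" "l' \<in> labels m n" "w1 \<in> D l'" "w2 \<in> D l'"
      using y by (auto simp: cell_index_eq)
    have eq': "glue m v1 v2 (\<epsilon> l) = glue m w1 w2 (\<epsilon> l')" using eq by (simp add: \<psi>_def x'(1) y'(1))
    note g = glue_injective[OF x'(2) y'(2) x'(3,4) y'(3,4) eq']
    let ?r = "n - 2 * label_size n l"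
    have I: "label_index l \<in> multi_indices m ?r" "label_index l' \<in> multi_indices m ?r"
      using label_index[OF x'(2) n] label_index[OF y'(2) n] g(4) by simp_all
    hence len: "length (label_index l) = ?r" "length (label_index l') = ?r" by (simp_all add: multi_indices_def)
    have "label_index l = label_index l'"
    proof (rule nth_equalityI)
      fix j assume "j < length (label_index l)"
      hence j: "j < ?r" using len by simp
      have b: "1 \<le> label_index l ! j" "label_index l ! j \<le> m" "1 \<le> label_index l' ! j" "label_index l' ! j \<le> m"
        using multi_indices_nth[OF I(1) j] multi_indices_nth[OF I(2) j] by simp_all
      have "(m - label_index l ! j) mod m = (m - label_index l' ! j) mod m" using g(5)[OF j] \<epsilon> j len by simp
      thus "label_index l ! j = label_index l' ! j" using b by simp
    qed (simp add: len)
    thus "x = y" using g(1,2,6) x'(1) y'(1) by simp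
  qed
  moreover have "\<psi> ` cell_pairs \<subseteq> Adm"
    unfolding \<psi>_def using glue_Adm by (auto simp: cell_index_eq)
  ultimately show "card cell_pairs \<le> card Adm" by (rule card_inj_on_le[OF _ _ finite_Adm])
qed

lemma cells_span: "pm.span ((\<lambda>(l, S, U). C l S U) ` cell_pairs) = A"
proof
  show "pm.span ((\<lambda>(l, S, U). C l S U) ` cell_pairs) \<subseteq> A"
    by (intro pm.span_minimal subspace_A) (auto simp: cell_basis_def cell_index_eq intro!: tensor_in)
  have all: "cells_with Q \<subseteq> (\<lambda>(l, S, U). C l S U) ` cell_pairs" for Q
  proof
    fix x assume "x \<in> cells_with Q"
    then obtain l S U where "x = C l S U" "l \<in> labels m n" "S \<in> M l" "U \<in> M l" unfolding cells_with_def by blast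
    thus "x \<in> (\<lambda>(l, S, U). C l S U) ` cell_pairs" by (intro image_eqI[of _ _ "(l, S, U)"]) simp_all
  qed
  have "E ` Adm \<subseteq> pm.span ((\<lambda>(l, S, U). C l S U) ` cell_pairs)"
    using Adm_span pm.span_mono[OF all] by blast
  thus "A \<subseteq> pm.span ((\<lambda>(l, S, U). C l S U) ` cell_pairs)"
    using pm.span_minimal[OF _ pm.subspace_span] E_span by blast
qed

lemma cellular: "cellular_algebra scale_pm A mult (labels m n) label_le M C inv"
proof (intro cellular_algebra.intro associative cellular_algebra_axioms.intro)
  show "inv (C l S U) = C l U S" if "l \<in> labels m n" "S \<in> M l" "U \<in> M l" for l S U
    using inv_tensor[OF that(1)] that(2,3) by (auto simp: cell_basis_def cell_index_eq)
  show "\<exists>r. \<forall>S\<in>M l. \<forall>U\<in>M l. mult a (C l S U) - (\<Sum>V\<in>M l. scale_pm (r V S) (C l V U))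
      \<in> pm.span {C l' U V | l' U V. l' \<in> labels m n \<and> label_le l' l \<and> l' \<noteq> l \<and> U \<in> M l' \<and> V \<in> M l'}"
    if "a \<in> A" "l \<in> labels m n" for a l
    using cell_mult[OF that] unfolding lower_def cells_with_def by (simp only: conj_assoc)
qed (use finite_labels labels_poset n finite_M spanning_family_basis[OF card_cell_pairs cells_span] cells_span
      inv_closed inv_add inv_scale inv_mult inv_inv in simp_all)

end

theorem theorem4p8:
  fixes m n :: nat and \<delta> \<xi> :: "nat \<Rightarrow> 'k::field"
  assumes "n \<ge> 4" and "m \<ge> 1"
    and "\<And>i. 1 \<le> i \<Longrightarrow> i \<le> m - 1 \<Longrightarrow> \<delta> i * \<delta> 0 = \<delta> i"
    and "monom 1 m - 1 = (\<Prod>j=1..m. [:- \<xi> j, 1:])"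
  shows "cellular_algebra scale_pm (CTL m n) (CTL_mult m n \<delta>)
    (labels m n) label_le (cell_index m n) (cell_basis m \<xi>) CTL_inv"
proof -
  interpret cells m n \<delta> \<xi> by unfold_locales (use assms in simp_all)
  show ?thesis by (rule cellular)
qed

end
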